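(* Assume $\gamma_1\neq\gamma_2$. Then for every $\lambda\in(2\max_{[p_0,0]}\Gamma,\infty)$ the bounded linear operator $(L,T):X\to Y\times Z$ defined in the context is a Fredholm operator of index zero.
   Context: Setting: - $\mathbb S=\mathbb R/2\pi\mathbb Z$, and $g>0$, $\sigma>0$. - $p_0<p_1<0$, and $\gamma_1,\gamma_2$ are real constants. - $\gamma=\gamma_1$ on $(p_0,p_1)$, $\gamma=\gamma_2$ on $(p_1,0)$, and $\Gamma(p)=\int_0^p\gamma(s)ds$. - $\Omega_1=\mathbb S\times(p_0,p_1)$ and $\Omega_2=\mathbb S\times(p_1,0)$. - Fix $\alpha\in(0,1)$. - For $\lambda>2\max_{[p_0,0]}\Gamma$ set $a(p):=\sqrt{\lambda-2\Gamma(p)}$. Banach spaces: - $X:=\{(v,V)\in C^{2+\alpha}(\overline{\Omega_1})\times C^{2+\alpha}(\overline{\Omega_2}):\ v=V,\ v_p=V_p\text{ on }p=p_1,\ v=0\text{ on }p=p_0\}$; - $Y:=C^\alpha(\overline{\Omega_1})\times C^\alpha(\overline{\Omega_2})$; - $Z:=C^\alpha(\mathbb S)$, with $\mathbb S$ identified with $\{p=0\}$. The operator is $(L,T)(v,V):=((L_1v,L_2V),TV)$, where - $L_1v:=v_{pp}+a^{-2}v_{qq}-3\gamma_1a^{-2}v_p$; - $L_2V:=V_{pp}+a^{-2}V_{qq}-3\gamma_2a^{-2}V_p$; - $TV:=\frac2\lambda\big[gV-\lambda^{3/2}V_p-\sigma V_{qq}\big]\big|_{p=0}$. (This operator is the Fréchet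 derivative at $(v,V)=0$ of the nonlinear water-wave operator linearized around the laminar flow.) *)

theory Defs
  imports "HOL-Analysis.Analysis"
begin

text \<open>A function on the closed cylinder  S x [a,b]  is represented as a function
  u :: real * real => real  of  z = (q,p), which is 2pi-periodic in q and which is
  (by convention) 0 for p outside [a,b], so that distinct elements of the function
  spaces are distinct HOL functions.  A function on S = {p = 0} is a 2pi-periodic
  function real => real.\<close>

definition strip :: "real \<Rightarrow> real \<Rightarrow> (real \<times> real) set" where
  "strip a b = UNIV \<times> {a..b}"

definition dq :: "(real \<times> real \<Rightarrow> real) \<Rightarrow> real \<times> real \<Rightarrow> real" where
  "dq u z = vector_derivative (\<lambda>t. u (t, snd z)) (at (fst z))"

definition dp :: "real \<Rightarrow> real \<Rightarrow> (real \<times> real \<Rightarrow> real) \<Rightarrow> real \<times> real \<Rightarrow> real" where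
  "dp a b u z = vector_derivative (\<lambda>t. u (fst z, t)) (at (snd z) within {a..b})"

definition C1_strip :: "real \<Rightarrow> real \<Rightarrow> (real \<times> real \<Rightarrow> real) \<Rightarrow> bool" where
  "C1_strip a b u \<longleftrightarrow>
     continuous_on (strip a b) u \<and>
     (\<forall>z\<in>strip a b. (\<lambda>t. u (t, snd z)) differentiable (at (fst z))) \<and>
     (\<forall>z\<in>strip a b. (\<lambda>t. u (fst z, t)) differentiable (at (snd z) within {a..b})) \<and>
     continuous_on (strip a b) (dq u) \<and> continuous_on (strip a b) (dp a b u)"

definition C2_strip :: "real \<Rightarrow> real \<Rightarrow> (real \<times> real \<Rightarrow> real) \<Rightarrow> bool" where
  "C2_strip a b u \<longleftrightarrow> C1_strip a b u \<and> C1_strip a b (dq u) \<and> C1_strip a b (dp a b u)"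

definition holder_on :: "'a::metric_space set \<Rightarrow> real \<Rightarrow> ('a \<Rightarrow> real) \<Rightarrow> bool" where
  "holder_on S \<alpha> f \<longleftrightarrow> (\<exists>C. \<forall>z\<in>S. \<forall>w\<in>S. \<bar>f z - f w\<bar> \<le> C * dist z w powr \<alpha>)"

definition cyl_fun :: "real \<Rightarrow> real \<Rightarrow> (real \<times> real \<Rightarrow> real) \<Rightarrow> bool" where
  "cyl_fun a b u \<longleftrightarrow> (\<forall>z. snd z \<notin> {a..b} \<longrightarrow> u z = 0) \<and> (\<forall>q p. u (q + 2*pi, p) = u (q, p))"

definition C_alpha :: "real \<Rightarrow> real \<Rightarrow> real \<Rightarrow> (real \<times> real \<Rightarrow> real) set" where
  "C_alpha \<alpha> a b = {u. cyl_fun a b u \<and> bounded (u ` strip a b) \<and> holder_on (strip a b) \<alpha> u}"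

definition C2_alpha :: "real \<Rightarrow> real \<Rightarrow> real \<Rightarrow> (real \<times> real \<Rightarrow> real) set" where
  "C2_alpha \<alpha> a b = {u. cyl_fun a b u \<and> C2_strip a b u \<and>
     (\<forall>w\<in>{u, dq u, dp a b u, dq (dq u), dp a b (dq u), dq (dp a b u), dp a b (dp a b u)}.
         bounded (w ` strip a b)) \<and>
     (\<forall>w\<in>{dq (dq u), dp a b (dq u), dq (dp a b u), dp a b (dp a b u)}.
         holder_on (strip a b) \<alpha> w)}"

definition C_alpha_S :: "real \<Rightarrow> (real \<Rightarrow> real) set" where
  "C_alpha_S \<alpha> = {h. (\<forall>q. h (q + 2*pi) = h q) \<and> bounded (range h) \<and> holder_on UNIV \<alpha> h}"

definition sup_norm :: "'a set \<Rightarrow> ('a \<Rightarrow> real) \<Rightarrow> real" where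
  "sup_norm S f = (SUP z\<in>S. \<bar>f z\<bar>)"

definition holder_semi :: "'a::metric_space set \<Rightarrow> real \<Rightarrow> ('a \<Rightarrow> real) \<Rightarrow> real" where
  "holder_semi S \<alpha> f =
     (SUP zw\<in>{(z, w). z \<in> S \<and> w \<in> S \<and> z \<noteq> w}. \<bar>f (fst zw) - f (snd zw)\<bar> / dist (fst zw) (snd zw) powr \<alpha>)"

definition gam :: "real \<Rightarrow> real \<Rightarrow> real \<Rightarrow> real \<Rightarrow> real" where
  "gam \<gamma>1 \<gamma>2 p1 p = (if p < p1 then \<gamma>1 else \<gamma>2)"

definition Gam :: "real \<Rightarrow> real \<Rightarrow> real \<Rightarrow> real \<Rightarrow> real" where
  "Gam \<gamma>1 \<gamma>2 p1 p =
     (if 0 \<le> p then integral {0..p} (gam \<gamma>1 \<gamma>2 p1) else - integral {p..0} (gam \<gamma>1 \<gamma>2 p1))"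

definition aa :: "real \<Rightarrow> real \<Rightarrow> real \<Rightarrow> real \<Rightarrow> real \<Rightarrow> real" where
  "aa \<gamma>1 \<gamma>2 p1 lam p = sqrt (lam - 2 * Gam \<gamma>1 \<gamma>2 p1 p)"

type_synonym xelt = "(real \<times> real \<Rightarrow> real) \<times> (real \<times> real \<Rightarrow> real)"
type_synonym yzelt = "(real \<times> real \<Rightarrow> real) \<times> (real \<times> real \<Rightarrow> real) \<times> (real \<Rightarrow> real)"

definition Xsp :: "real \<Rightarrow> real \<Rightarrow> real \<Rightarrow> xelt set" where
  "Xsp \<alpha> p0 p1 = {(v, V). v \<in> C2_alpha \<alpha> p0 p1 \<and> V \<in> C2_alpha \<alpha> p1 0 \<and>
      (\<forall>q. v (q, p1) = V (q, p1)) \<and>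
      (\<forall>q. dp p0 p1 v (q, p1) = dp p1 0 V (q, p1)) \<and>
      (\<forall>q. v (q, p0) = 0)}"

definition YZsp :: "real \<Rightarrow> real \<Rightarrow> real \<Rightarrow> yzelt set" where
  "YZsp \<alpha> p0 p1 = C_alpha \<alpha> p0 p1 \<times> C_alpha \<alpha> p1 0 \<times> C_alpha_S \<alpha>"

definition YZnorm :: "real \<Rightarrow> real \<Rightarrow> real \<Rightarrow> yzelt \<Rightarrow> real" where
  "YZnorm \<alpha> p0 p1 y =
     (case y of (f1, f2, h) \<Rightarrow>
        sup_norm (strip p0 p1) f1 + holder_semi (strip p0 p1) \<alpha> f1 +
        sup_norm (strip p1 0) f2 + holder_semi (strip p1 0) \<alpha> f2 +
        sup_norm UNIV h + holder_semi UNIV \<alpha> h)"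

definition Lop :: "real \<Rightarrow> real \<Rightarrow> real \<Rightarrow> real \<Rightarrow> real \<Rightarrow> real \<Rightarrow> real \<Rightarrow>
    (real \<times> real \<Rightarrow> real) \<Rightarrow> real \<times> real \<Rightarrow> real" where
  "Lop \<gamma>i \<gamma>1 \<gamma>2 p1 lam a b v z =
     (if snd z \<in> {a..b} then
        dp a b (dp a b v) z + dq (dq v) z / (aa \<gamma>1 \<gamma>2 p1 lam (snd z))\<^sup>2
        - 3 * \<gamma>i * dp a b v z / (aa \<gamma>1 \<gamma>2 p1 lam (snd z))\<^sup>2
      else 0)"

definition Top :: "real \<Rightarrow> real \<Rightarrow> real \<Rightarrow> real \<Rightarrow> (real \<times> real \<Rightarrow> real) \<Rightarrow> real \<Rightarrow> real" where
  "Top g \<sigma> p1 lam V q =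
     (2 / lam) * (g * V (q, 0) - lam powr (3/2) * dp p1 0 V (q, 0) - \<sigma> * dq (dq V) (q, 0))"

definition LTop :: "real \<Rightarrow> real \<Rightarrow> real \<Rightarrow> real \<Rightarrow> real \<Rightarrow> real \<Rightarrow> real \<Rightarrow> xelt \<Rightarrow> yzelt" where
  "LTop g \<sigma> p0 p1 \<gamma>1 \<gamma>2 lam x =
     (case x of (v, V) \<Rightarrow>
       (Lop \<gamma>1 \<gamma>1 \<gamma>2 p1 lam p0 p1 v, Lop \<gamma>2 \<gamma>1 \<gamma>2 p1 lam p1 0 V, Top g \<sigma> p1 lam V))"

definition xzero :: xelt where "xzero = (\<lambda>_. 0, \<lambda>_. 0)"
definition yzzero :: yzelt where "yzzero = (\<lambda>_. 0, \<lambda>_. 0, \<lambda>_. 0)"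

definition xcomb :: "nat \<Rightarrow> (nat \<Rightarrow> real) \<Rightarrow> (nat \<Rightarrow> xelt) \<Rightarrow> xelt" where
  "xcomb n c ks = (\<lambda>z. \<Sum>i<n. c i * fst (ks i) z, \<lambda>z. \<Sum>i<n. c i * snd (ks i) z)"

definition yzcomb :: "nat \<Rightarrow> (nat \<Rightarrow> real) \<Rightarrow> (nat \<Rightarrow> yzelt) \<Rightarrow> yzelt" where
  "yzcomb n c ys = (\<lambda>z. \<Sum>i<n. c i * fst (ys i) z, \<lambda>z. \<Sum>i<n. c i * fst (snd (ys i)) z,
                    \<lambda>t. \<Sum>i<n. c i * snd (snd (ys i)) t)"

definition yzadd :: "yzelt \<Rightarrow> yzelt \<Rightarrow> yzelt" where
  "yzadd y y' = (\<lambda>z. fst y z + fst y' z, \<lambda>z. fst (snd y) z + fst (snd y') z,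
                 \<lambda>t. snd (snd y) t + snd (snd y') t)"

definition yzdiff :: "yzelt \<Rightarrow> yzelt \<Rightarrow> yzelt" where
  "yzdiff y y' = (\<lambda>z. fst y z - fst y' z, \<lambda>z. fst (snd y) z - fst (snd y') z,
                  \<lambda>t. snd (snd y) t - snd (snd y') t)"

definition kernel_dim :: "xelt set \<Rightarrow> (xelt \<Rightarrow> yzelt) \<Rightarrow> nat \<Rightarrow> bool" where
  "kernel_dim X A n \<longleftrightarrow>
     (\<exists>ks. (\<forall>i<n. ks i \<in> X \<and> A (ks i) = yzzero) \<and>
           (\<forall>x\<in>X. A x = yzzero \<longrightarrow> (\<exists>!c. (\<forall>i\<ge>n. c i = 0) \<and> x = xcomb n c ks)))"

definition range_codim :: "xelt set \<Rightarrow> yzelt set \<Rightarrow> (xelt \<Rightarrow> yzelt) \<Rightarrow> nat \<Rightarrow> bool" where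
  "range_codim X YZ A n \<longleftrightarrow>
     (\<exists>ys. (\<forall>i<n. ys i \<in> YZ) \<and>
           (\<forall>y\<in>YZ. \<exists>!rc. fst rc \<in> A ` X \<and> (\<forall>i\<ge>n. snd rc i = 0) \<and>
                            y = yzadd (fst rc) (yzcomb n (snd rc) ys)))"

definition closed_range :: "xelt set \<Rightarrow> yzelt set \<Rightarrow> (yzelt \<Rightarrow> real) \<Rightarrow> (xelt \<Rightarrow> yzelt) \<Rightarrow> bool" where
  "closed_range X YZ N A \<longleftrightarrow>
     (\<forall>xs y. (\<forall>k. xs k \<in> X) \<and> y \<in> YZ \<and> (\<lambda>k. N (yzdiff (A (xs k)) y)) \<longlonglongrightarrow> 0
        \<longrightarrow> y \<in> A ` X)"

definition fredholm_index_zero ::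
    "xelt set \<Rightarrow> yzelt set \<Rightarrow> (yzelt \<Rightarrow> real) \<Rightarrow> (xelt \<Rightarrow> yzelt) \<Rightarrow> bool" where
  "fredholm_index_zero X YZ N A \<longleftrightarrow>
     A ` X \<subseteq> YZ \<and> closed_range X YZ N A \<and>
     (\<exists>n. kernel_dim X A n \<and> range_codim X YZ A n)"

end

theory Submission
  imports Defs "HOL-Complex_Analysis.Complex_Analysis" "HOL-Library.Function_Algebras"
begin

text \<open>Split the operator as \<open>PP + Kop \<circ> \<partial>\<^sub>p\<close>, where \<open>PP u\<close> consists of
  \<open>u\<^sub>p\<^sub>p + a\<^sup>-\<^sup>2 u\<^sub>q\<^sub>q - \<gamma> a\<^sup>-\<^sup>2 u\<^sub>p\<close> on the layers and \<open>(2/\<lambda>)(g u - \<sigma> u\<^sub>q\<^sub>q)\<close> on top. In the variable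
  \<open>s = \<integral> dp / a\<close> the interior part of \<open>PP\<close> is \<open>a\<^sup>-\<^sup>2\<close> times the Laplacian, for both layers at once, and the
  transmission conditions say that \<open>u\<close> is \<open>C\<^sup>1\<close>. Hence \<open>PP\<close> is inverted explicitly: the top condition is a periodic
  ODE for the boundary values, and the remaining Dirichlet problem is solved by the potential of the oddly reflected
  data, with Hoelder estimates in each layer; uniqueness is a maximum principle.
  The map \<open>\<partial>\<^sub>p \<circ> PP\<inverse>\<close> sends bounded data to Hoelder functions, so interpolation with a fine partition of unity
  replaces \<open>\<partial>\<^sub>p\<close> by a finite-rank map up to an error that a Neumann series absorbs. Thus the operator is a
  finite-rank perturbation of an isomorphism, and its index and range are read off from linear algebra on the
  finite-dimensional span of the partition.\<close>

section \<open>The Poisson kernel of the half-cylinder\<close>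

text \<open>The share - \<gamma> a^-2 u_p stays in \<open>PP\<close> because the change of variable
  produces it: a' = - \<gamma> / a on each layer, hence u_pp = a^-2 u_ss + \<gamma> a^-2 u_p. The
  rest, - 2 \<gamma> a^-2 u_p inside and the u_p term on top, is of lower order and forms
  \<open>Kop\<close>. The obstacle is that the data of the two layers need not agree at the
  interface: the glued source is only measurable in s, and u_ss jumps. The source is, however,
  Hoelder continuous in q uniformly in s, which is enough for u_qq and u_qs to be Hoelder continuous
  across the interface; u_ss is then read off from the equation, layer by layer. To exploit this,
  the potential is an integral over t of holomorphic functions of |s - t| + i q: Cauchy estimates
  supply the bounds on derivatives of the kernel, and one scaling integral yields all Hoelder
  exponents. Interpolation is accurate on Hoelder functions only, so the error operator
  \<open>E\<close> need not be small in the sup norm; its square is, because \<open>E\<close>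
  smooths.\<close>

text \<open>On \<open>Re z > 0\<close>, with \<open>z = s + \<i> q\<close>, the function \<open>1 / (2\<pi>) + Re (kap z)\<close> is the \<open>2\<pi>\<close>-periodic Poisson kernel;
  hence \<open>W h\<close> below is holomorphic and \<open>Re (W h) + mean h\<close> is the harmonic extension of \<open>h\<close>.\<close>

definition kap :: "complex \<Rightarrow> complex" where
  "kap z = 1 / (of_real pi * (exp z - 1))"

definition dkap :: "complex \<Rightarrow> complex" where
  "dkap z = - exp z / (of_real pi * (exp z - 1)\<^sup>2)"

lemma exp_neq_1_Re_pos: "Re z > 0 \<Longrightarrow> exp z \<noteq> 1"
  by (metis exp_eq_1 less_irrefl)

lemma has_field_derivative_kap:
  assumes "Re z > 0" shows "(kap has_field_derivative dkap z) (at z within S)"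
proof -
  have "((\<lambda>z. (1 / of_real pi) * inverse (exp z - 1)) has_field_derivative
      (1 / of_real pi) * (- (exp z * inverse ((exp z - 1)\<^sup>2)))) (at z within S)"
    using exp_neq_1_Re_pos[OF assms]
    by (auto intro!: derivative_eq_intros simp: power2_eq_square)
  moreover have "(\<lambda>z. (1 / of_real pi) * inverse (exp z - 1)) = kap"
    by (simp add: fun_eq_iff kap_def divide_inverse)
  moreover have "(1 / of_real pi) * (- (exp z * inverse ((exp z - 1)\<^sup>2))) = dkap z"
    by (simp add: dkap_def divide_inverse)
  ultimately show ?thesis by simp
qed

lemma kap_add_2pi: "kap (z + \<i> * (2 * of_real pi)) = kap z" "dkap (z + \<i> * (2 * of_real pi)) = dkap z"
proof -
  have "exp (\<i> * (2 * of_real pi)) = (1::complex)" using exp_two_pi_i by (simp add: mult_ac)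
  thus "kap (z + \<i> * (2 * of_real pi)) = kap z" "dkap (z + \<i> * (2 * of_real pi)) = dkap z"
    by (simp_all add: kap_def dkap_def exp_add)
qed

text \<open>Maclaurin expansion with cubic remainder |x|^3 / 6, where x^2 <= 4. It is applied to
  halves of angles in [-pi, pi], which are at most pi / 2 < 2.\<close>

lemma abs_sin_ge_third:
  fixes x :: real assumes "\<bar>x\<bar> \<le> 2" shows "\<bar>x\<bar> / 3 \<le> \<bar>sin x\<bar>"
proof -
  have "\<bar>sin x - (\<Sum>m<3. sin_coeff m * x ^ m)\<bar> \<le> inverse (fact 3) * \<bar>x\<bar> ^ 3"
    by (rule Maclaurin_sin_bound)
  hence "\<bar>sin x - x\<bar> \<le> \<bar>x\<bar>^3 / 6"
    by (simp add: sin_coeff_def lessThan_Suc numeral_3_eq_3 field_simps fact_numeral)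
  moreover have "\<bar>x\<bar>^3 / 6 \<le> \<bar>x\<bar> * 4 / 6"
  proof -
    have "\<bar>x\<bar>\<^sup>2 \<le> 2\<^sup>2" using assms by (intro power_mono) auto
    hence "\<bar>x\<bar> * \<bar>x\<bar>\<^sup>2 \<le> \<bar>x\<bar> * 4" by (intro mult_left_mono) auto
    thus ?thesis by (simp add: power3_eq_cube power2_eq_square)
  qed
  ultimately show ?thesis by linarith
qed

text \<open>This is |2 sinh (z/2)|^2 after the factor exp (z/2) has been pulled out of exp z -
  1.\<close>

lemma norm_exp_minus_1_sq:
  "(cmod (exp z - 1))\<^sup>2 = exp (Re z) * ((exp (Re z / 2) - exp (- Re z / 2))\<^sup>2 + 4 * (sin (Im z / 2))\<^sup>2)"
proof -
  define E where "E = exp (Re z / 2)"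
  have E: "E > 0" "exp (Re z) = E\<^sup>2" "exp (- Re z / 2) = 1 / E"
    by (simp_all add: E_def power2_eq_square mult_exp_exp exp_minus field_simps)
  have c: "4 * (sin (Im z / 2))\<^sup>2 = 2 * (1 - cos (Im z))"
    using cos_double_sin[of "Im z / 2"] by simp
  have "(cmod (exp z - 1))\<^sup>2 = (E\<^sup>2 * cos (Im z) - 1)\<^sup>2 + (E\<^sup>2 * sin (Im z))\<^sup>2"
    by (simp add: cmod_power2 Re_exp Im_exp E)
  also have "\<dots> = E^4 * ((sin (Im z))\<^sup>2 + (cos (Im z))\<^sup>2) - 2 * E\<^sup>2 * cos (Im z) + 1"
    by algebra
  also have "\<dots> = E\<^sup>2 * ((E - 1/E)\<^sup>2 + 2 * (1 - cos (Im z)))"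
    using E(1) by (simp add: field_simps power2_eq_square power4_eq_xxxx)
  finally show ?thesis using E c by (simp add: E_def)
qed

text \<open>In the strip |Im z| <= pi the only zero of exp z - 1 is 0, so a multiple of the distance
  to 0 is the natural lower bound; the exponential factor records the growth for large
  \<open>Re z\<close>. Both terms of \<open>norm_exp_minus_1_sq\<close> are bounded below by their
  arguments.\<close>

lemma norm_exp_minus_1_ge:
  assumes "Re z > 0" "\<bar>Im z\<bar> \<le> pi"
  shows "exp (Re z / 2) * (Re z + \<bar>Im z\<bar>) / 5 \<le> cmod (exp z - 1)"
proof -
  have "(Re z + \<bar>Im z\<bar>)\<^sup>2 / 25 \<le> (Re z)\<^sup>2 + (Im z)\<^sup>2 / 9"
  proof -
    have "(Re z + \<bar>Im z\<bar>)\<^sup>2 + (Re z - \<bar>Im z\<bar>)\<^sup>2 = 2 * (Re z)\<^sup>2 + 2 * (Im z)\<^sup>2"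
      by (simp add: power2_eq_square algebra_simps)
    hence "(Re z + \<bar>Im z\<bar>)\<^sup>2 \<le> 2 * (Re z)\<^sup>2 + 2 * (Im z)\<^sup>2"
      by (smt (verit) zero_le_power2)
    thus ?thesis using zero_le_power2[of "Re z"] zero_le_power2[of "Im z"] by argo
  qed
  also have "(Re z)\<^sup>2 + (Im z)\<^sup>2 / 9 \<le> (exp (Re z / 2) - exp (- Re z / 2))\<^sup>2 + 4 * (sin (Im z / 2))\<^sup>2"
  proof (rule add_mono)
    have "Re z \<le> exp (Re z / 2) - exp (- Re z / 2)"
      using exp_ge_add_one_self[of "Re z / 2"] 
    proof -
      \<comment> \<open>Mean value theorem for 2 sinh (x/2), whose derivative cosh (x/2) is at least
        1.\<close>
      have "\<exists>c>0. c < Re z \<and> exp (Re z / 2) - exp (- Re z / 2) - (exp (0 / 2) - exp (- 0 / 2)) = 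
         (Re z - 0) * (exp (c/2) / 2 + exp (-c/2) / 2)"
        by (rule MVT2[OF assms(1)]) (auto intro!: derivative_eq_intros)
      then obtain c where c: "exp (Re z / 2) - exp (- Re z / 2) = Re z * (exp (c/2) / 2 + exp (-c/2) / 2)"
        by auto
      have "1 \<le> cosh (c/2)" by (rule cosh_real_ge_1)
      hence "1 \<le> exp (c/2) / 2 + exp (-c/2) / 2" by (simp add: cosh_def field_simps)
      thus ?thesis using c assms(1) mult_left_mono[of 1 "exp (c/2) / 2 + exp (-c/2) / 2" "Re z"] by simp
    qed
    thus "(Re z)\<^sup>2 \<le> (exp (Re z / 2) - exp (- Re z / 2))\<^sup>2"
      using assms by (intro power_mono) auto
    have "\<bar>Im z / 2\<bar> / 3 \<le> \<bar>sin (Im z / 2)\<bar>"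
      using assms pi_less_4 by (intro abs_sin_ge_third) auto
    hence "(\<bar>Im z / 2\<bar> / 3)\<^sup>2 \<le> \<bar>sin (Im z / 2)\<bar>\<^sup>2" by (intro power_mono) auto
    thus "(Im z)\<^sup>2 / 9 \<le> 4 * (sin (Im z / 2))\<^sup>2" by (simp add: power2_eq_square)
  qed
  finally have "exp (Re z) * ((Re z + \<bar>Im z\<bar>)\<^sup>2 / 25) \<le> (cmod (exp z - 1))\<^sup>2"
    unfolding norm_exp_minus_1_sq by (intro mult_left_mono) auto
  moreover have "exp (Re z) = (exp (Re z / 2))\<^sup>2" by (simp add: power2_eq_square mult_exp_exp)
  ultimately have "(exp (Re z / 2) * (Re z + \<bar>Im z\<bar>) / 5)\<^sup>2 \<le> (cmod (exp z - 1))\<^sup>2"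
    by (simp add: power_mult_distrib power_divide)
  thus ?thesis by (rule power2_le_imp_le) simp
qed

lemma norm_kap_le:
  assumes "Re z > 0" "\<bar>Im z\<bar> \<le> pi"
  shows "cmod (kap z) \<le> 2 / (exp (Re z / 2) * (Re z + \<bar>Im z\<bar>))"
proof -
  have p: "0 < exp (Re z / 2) * (Re z + \<bar>Im z\<bar>)" using assms by (simp add: add_pos_nonneg)
  have "cmod (kap z) = 1 / (pi * cmod (exp z - 1))" by (simp add: kap_def norm_divide norm_mult)
  also have "\<dots> \<le> 1 / (2.5 * (exp (Re z / 2) * (Re z + \<bar>Im z\<bar>) / 5))"
    using norm_exp_minus_1_ge[OF assms] p pi_gt3 by (intro divide_left_mono mult_mono mult_pos_pos) auto
  also have "\<dots> = 2 / (exp (Re z / 2) * (Re z + \<bar>Im z\<bar>))" by simp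
  finally show ?thesis .
qed

lemma norm_exp_minus_1_sq_ge:
  assumes "Re z > 0" "\<bar>Im z\<bar> \<le> pi"
  shows "exp (Re z) * (Re z + \<bar>Im z\<bar>)\<^sup>2 / 25 \<le> (cmod (exp z - 1))\<^sup>2"
proof -
  have "(exp (Re z / 2) * (Re z + \<bar>Im z\<bar>) / 5)\<^sup>2 \<le> (cmod (exp z - 1))\<^sup>2"
    using norm_exp_minus_1_ge[OF assms] assms by (intro power_mono) auto
  moreover have "exp (Re z) = (exp (Re z / 2))\<^sup>2" by (simp add: power2_eq_square mult_exp_exp)
  ultimately show ?thesis by (simp add: power_mult_distrib power_divide)
qed

text \<open>The numerator exp z uses up the exponential factor of the denominator; the square that
  remains still decays fast enough for large \<open>Re z\<close>.\<close>

lemma norm_dkap_le: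
  assumes "Re z > 0" "\<bar>Im z\<bar> \<le> pi"
  shows "cmod (dkap z) \<le> 9 / (Re z + \<bar>Im z\<bar>)\<^sup>2"
proof -
  have p: "0 < Re z + \<bar>Im z\<bar>" using assms by (simp add: add_pos_nonneg)
  have "cmod (dkap z) = exp (Re z) / (pi * (cmod (exp z - 1))\<^sup>2)"
    by (simp add: dkap_def norm_divide norm_mult norm_power)
  also have "\<dots> \<le> exp (Re z) / (3 * (exp (Re z) * (Re z + \<bar>Im z\<bar>)\<^sup>2 / 25))"
    using norm_exp_minus_1_sq_ge[OF assms] p pi_gt3 exp_neq_1_Re_pos[OF assms(1)]
    by (intro divide_left_mono mult_mono mult_pos_pos) auto
  also have "\<dots> = (25/3) / (Re z + \<bar>Im z\<bar>)\<^sup>2" by simp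
  also have "\<dots> \<le> 9 / (Re z + \<bar>Im z\<bar>)\<^sup>2" by (intro divide_right_mono) auto
  finally show ?thesis .
qed

text \<open>After multiplication by the conjugate, adding 1 / (2 pi) cancels the part of the
  numerator that is not small: what remains is positive and vanishes linearly with
  \<open>Re z\<close>.\<close>

lemma Re_kap: 
  assumes "Re z > 0"
  shows "Re (kap z) + 1 / (2 * pi) = (exp (2 * Re z) - 1) / (2 * pi * (cmod (exp z - 1))\<^sup>2)"
proof -
  have n: "cmod (exp z - 1) \<noteq> 0" using exp_neq_1_Re_pos[OF assms] by simp
  have "kap z = cnj (exp z - 1) / (of_real pi * of_real ((cmod (exp z - 1))\<^sup>2))"
  proof -
    have "of_real ((cmod (exp z - 1))\<^sup>2) = (exp z - 1) * cnj (exp z - 1)"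
      by (rule complex_norm_square[of "exp z - 1", simplified of_real_power[symmetric]])
    thus ?thesis using n unfolding kap_def by simp
  qed
  hence A: "Re (kap z) = (Re (exp z) - 1) / (pi * (cmod (exp z - 1))\<^sup>2)"
    by (simp flip: of_real_mult)
  have B: "(cmod (exp z - 1))\<^sup>2 = exp (2 * Re z) - 2 * Re (exp z) + 1"
  proof -
    have "(cmod (exp z - 1))\<^sup>2 = (cmod (exp z))\<^sup>2 - 2 * Re (exp z) + 1"
      unfolding cmod_power2 by (simp add: power2_eq_square algebra_simps)
    thus ?thesis by (simp add: power2_eq_square mult_exp_exp)
  qed
  have "(R - 1) / (pi * N) + 1 / (2 * pi) = (E - 1) / (2 * pi * N)"
    if "N = E - 2 * R + 1" "N \<noteq> 0" for R N E :: real
    unfolding that(1)[symmetric] using that by (simp add: divide_simps)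
  from this[OF B] show ?thesis unfolding A using n by simp
qed

text \<open>The numerator in \<open>Re_kap\<close> gains a factor \<open>Re z\<close> over
  \<open>norm_kap_le\<close>, which is what an approximate identity needs: as \<open>Re z\<close>
  tends to 0 the kernel concentrates at \<open>Im z = 0\<close>.\<close>

lemma abs_Re_kap_le:
  assumes "Re z > 0" "Re z \<le> 1" "\<bar>Im z\<bar> \<le> pi"
  shows "\<bar>Re (kap z) + 1 / (2 * pi)\<bar> \<le> 30 * Re z / (Re z + \<bar>Im z\<bar>)\<^sup>2"
proof -
  have p: "0 < Re z + \<bar>Im z\<bar>" using assms by (simp add: add_pos_nonneg)
  have e: "exp (2 * Re z) - 1 \<le> exp (Re z) * (6 * Re z)"
  proof -
    have 1: "exp (Re z) \<le> 1 + Re z + (Re z)\<^sup>2" using assms by (intro exp_bound) auto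
    have 2: "(Re z)\<^sup>2 \<le> Re z" using assms by (simp add: power2_eq_square mult_left_le)
    have 3: "1 - Re z \<le> exp (- Re z)" using exp_ge_add_one_self[of "- Re z"] by simp
    have "exp (2 * Re z) - 1 = exp (Re z) * (exp (Re z) - exp (- Re z))"
      by (simp add: algebra_simps mult_exp_exp)
    also have "\<dots> \<le> exp (Re z) * (6 * Re z)" using 1 2 3 assms by (intro mult_left_mono) auto
    finally show ?thesis .
  qed
  have "\<bar>Re (kap z) + 1 / (2 * pi)\<bar> = (exp (2 * Re z) - 1) / (2 * pi * (cmod (exp z - 1))\<^sup>2)"
    using assms by (simp add: Re_kap)
  also have "\<dots> \<le> (exp (Re z) * (6 * Re z)) / (2 * 3 * (exp (Re z) * (Re z + \<bar>Im z\<bar>)\<^sup>2 / 25))"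
    using norm_exp_minus_1_sq_ge[OF assms(1,3)] p pi_gt3 e assms
    by (intro frac_le mult_mono mult_pos_pos) auto
  also have "\<dots> = 25 * Re z / (Re z + \<bar>Im z\<bar>)\<^sup>2" by simp
  also have "\<dots> \<le> 30 * Re z / (Re z + \<bar>Im z\<bar>)\<^sup>2" using assms by (intro divide_right_mono) auto
  finally show ?thesis .
qed

lemma has_vector_derivative_vertical:
  assumes "(f has_field_derivative D) (at (Complex \<tau> y))"
  shows "((\<lambda>y. f (Complex \<tau> y)) has_vector_derivative \<i> * D) (at y within S)"
proof -
  have g: "((\<lambda>y. Complex \<tau> y) has_vector_derivative \<i>) (at y within S)"
    unfolding Complex_eq by (auto intro!: derivative_eq_intros)
  show ?thesis using field_vector_diff_chain_within[OF g DERIV_subset[OF assms subset_UNIV]] by (simp add: o_def)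
qed

lemma has_vector_derivative_horizontal:
  assumes "(f has_field_derivative D) (at (Complex \<tau> y))"
  shows "((\<lambda>\<tau>. f (Complex \<tau> y)) has_vector_derivative D) (at \<tau> within S)"
proof -
  have g: "((\<lambda>\<tau>. Complex \<tau> y) has_vector_derivative 1) (at \<tau> within S)"
    unfolding Complex_eq by (auto intro!: derivative_eq_intros)
  show ?thesis using field_vector_diff_chain_within[OF g DERIV_subset[OF assms subset_UNIV]] by (simp add: o_def)
qed

text \<open>On a vertical line \<open>f'\<close> is, up to the factor i, the derivative of a
  function with equal values at both ends of the period.\<close>

lemma has_integral_period_zero:
  assumes "\<And>z. Re z > 0 \<Longrightarrow> (f has_field_derivative f' z) (at z)"
    and "\<And>z. f (z + \<i> * (2 * of_real pi)) = f z" and "\<tau> > 0"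
  shows "((\<lambda>y. f' (Complex \<tau> y)) has_integral 0) {-pi..pi}"
proof -
  have "((\<lambda>y. \<i> * f' (Complex \<tau> y)) has_integral f (Complex \<tau> pi) - f (Complex \<tau> (-pi))) {-pi..pi}"
    by (rule fundamental_theorem_of_calculus, simp, rule has_vector_derivative_vertical, rule assms) (use assms in simp)
  moreover have "Complex \<tau> pi = Complex \<tau> (-pi) + \<i> * (2 * of_real pi)" by (simp add: complex_eq_iff)
  ultimately have "((\<lambda>y. \<i> * f' (Complex \<tau> y)) has_integral 0) {-pi..pi}" by (simp add: assms(2))
  from has_integral_mult_right[OF this, of "-\<i>"] show ?thesis by (simp add: mult.assoc[symmetric])
qed

lemma has_integral_dkap: "\<tau> > 0 \<Longrightarrow> ((\<lambda>y. dkap (Complex \<tau> y)) has_integral 0) {-pi..pi}"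
  by (rule has_integral_period_zero[of kap]) (auto intro: has_field_derivative_kap kap_add_2pi)

lemma has_integral_kap: "\<tau> > 0 \<Longrightarrow> ((\<lambda>y. kap (Complex \<tau> y)) has_integral 0) {-pi..pi}"
\<comment> \<open>A primitive of \<open>kap\<close>. The logarithm is holomorphic on the half-plane
  because 1 - exp (-z) has positive real part there.\<close>
proof (rule has_integral_period_zero[of "\<lambda>z. (1 / of_real pi) * Ln (1 - exp (- z))"])
  fix z :: complex assume that: "Re z > 0"
  have "cmod (exp (-z)) < 1" using that by simp
  hence "Re (1 - exp (-z)) > 0" by (smt (verit) complex_Re_le_cmod minus_complex.simps(1) one_complex.simps(1))
  hence nl: "1 - exp (- z) \<notin> \<real>\<^sub>\<le>\<^sub>0" by (auto simp: complex_nonpos_Reals_iff)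
  have e: "exp z - 1 \<noteq> 0" "exp z \<noteq> 0" using exp_neq_1_Re_pos[OF that] by auto
  have "exp (- z) / (1 - exp (- z)) = 1 / (exp z - 1)"
    using e by (simp add: exp_minus divide_simps)
  hence "(1 / of_real pi) * (exp (- z) / (1 - exp (- z))) = kap z"
    by (simp add: kap_def)
  moreover have "((\<lambda>z. (1 / of_real pi) * Ln (1 - exp (- z))) has_field_derivative (1 / of_real pi) * (exp (- z) / (1 - exp (- z)))) (at z)"
    by (rule DERIV_cmult) (use nl in \<open>auto intro!: derivative_eq_intros simp: divide_inverse mult.commute\<close>)
  ultimately show "((\<lambda>z. (1 / of_real pi) * Ln (1 - exp (- z))) has_field_derivative kap z) (at z)" by simp
next
  fix z :: complex
  have "exp (\<i> * (2 * of_real pi)) = (1::complex)" using exp_two_pi_i by (simp add: mult_ac)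
  thus "(1 / of_real pi) * Ln (1 - exp (- (z + \<i> * (2 * of_real pi)))) = (1 / of_real pi) * Ln (1 - exp (- z))"
    by (simp add: exp_add exp_minus exp_diff)
qed

lemma integral_periodic_shift:
  fixes f :: "real \<Rightarrow> 'a::euclidean_space"
  assumes c: "continuous_on UNIV f" and per: "\<And>x. f (x + 2 * pi) = f x"
  shows "integral {-pi..pi} (\<lambda>y. f (q - y)) = integral {-pi..pi} f"
proof -
  have int: "f integrable_on {a..b}" for a b
    using c by (intro integrable_continuous_interval continuous_on_subset[OF c]) auto
  have refl: "integral {-pi..pi} (\<lambda>y. f (q - y)) = integral {q - pi..q + pi} f"
  proof -
    have "integral {-pi..pi} (\<lambda>x. f (q + x)) = integral {-pi..pi} (\<lambda>x. f (q + - x))"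
      using Henstock_Kurzweil_Integration.integral_reflect_real[of pi "-pi" "\<lambda>x. f (q + x)"] by (simp del: Henstock_Kurzweil_Integration.integral_reflect_real)
    moreover have "integral {-pi..pi} (\<lambda>x. f (q + x)) = integral {q - pi..q + pi} f"
      using integral_shift_Icc_real[of "-pi" pi f q] by (simp add: add.commute o_def)
    ultimately show ?thesis by simp
  qed
  \<comment> \<open>The piece of the window beyond pi is moved back by one period, where it fills
    the gap at the left end.\<close>
  have main: "integral {r - pi..r + pi} f = integral {-pi..pi} f" if r: "0 \<le> r" "r \<le> 2 * pi" for r
  proof -
    have "integral {r - pi..r + pi} f = integral {r - pi..pi} f + integral {pi..r + pi} f"
      by (rule Henstock_Kurzweil_Integration.integral_combine[symmetric]) (use r int in auto)
    also have "integral {pi..r + pi} f = integral {-pi..r - pi} (\<lambda>x. f (x + 2 * pi))"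
      using integral_shift_Icc_real[of "-pi" "r-pi" f "2*pi"] by (simp add: o_def add.commute)
    also have "\<dots> = integral {-pi..r - pi} f" by (simp add: per)
    also have "integral {r - pi..pi} f + integral {-pi..r - pi} f = integral {-pi..pi} f"
      by (subst add.commute, rule Henstock_Kurzweil_Integration.integral_combine) (use r int in auto)
    finally show ?thesis .
  qed
  have pern: "f (x + of_int n * (2 * pi)) = f x" for x and n :: int
  proof -
    have 1: "f (x + real n * (2 * pi)) = f x" for x n
    proof (induction n)
      case (Suc n) show ?case using per[of "x + real n * (2 * pi)"] Suc by (simp add: algebra_simps)
    qed simp
    show ?thesis
      using 1[of x "nat n"] 1[of "x + of_int n * (2 * pi)" "nat (- n)"] by (cases "n \<ge> 0") auto
  qed
  define n where "n = \<lfloor>q / (2 * pi)\<rfloor>"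
  define r where "r = q - of_int n * (2 * pi)"
  have r: "0 \<le> r" "r \<le> 2 * pi"
    using floor_divide_lower[of "2 * pi" q] floor_divide_upper[of "2 * pi" q]
    by (auto simp: r_def n_def algebra_simps)
  have "integral {q - pi..q + pi} f = integral {r - pi..r + pi} (\<lambda>x. f (x + of_int n * (2 * pi)))"
    using integral_shift_Icc_real[of "r-pi" "r+pi" f "of_int n * (2 * pi)"]
    by (simp add: o_def r_def algebra_simps)
  thus ?thesis using main[OF r] refl by (simp add: pern)
qed


definition W :: "(real \<Rightarrow> real) \<Rightarrow> complex \<Rightarrow> complex" where
  "W h z = integral {-pi..pi} (\<lambda>y. kap (z - \<i> * of_real y) * of_real (h y))"

definition dW :: "(real \<Rightarrow> real) \<Rightarrow> complex \<Rightarrow> complex" where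
  "dW h z = integral {-pi..pi} (\<lambda>y. dkap (z - \<i> * of_real y) * of_real (h y))"

text \<open>The size of a kernel at height \<tau>. The power \<open>\<tau> powr (-b)\<close> is
  integrable at 0 for b < 1, and the extra 1 / \<tau> beyond \<tau> = 1 makes it integrable at
  infinity for b > 0.\<close>

definition mb :: "real \<Rightarrow> real \<Rightarrow> real" where
  "mb b \<tau> = \<tau> powr (-b) * min 1 (1 / \<tau>)"

lemma continuous_on_kap:
  assumes "continuous_on S f" "\<And>x. x \<in> S \<Longrightarrow> Re (f x) > 0"
  shows "continuous_on S (\<lambda>x. kap (f x))" "continuous_on S (\<lambda>x. dkap (f x))"
proof -
  have "exp (f x) \<noteq> 1" if "x \<in> S" for x using exp_neq_1_Re_pos assms(2)[OF that] by blast
  thus "continuous_on S (\<lambda>x. kap (f x))" "continuous_on S (\<lambda>x. dkap (f x))"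
    unfolding kap_def dkap_def using assms by (auto intro!: continuous_intros)
qed

lemma continuous_on_kap_Complex:
  assumes "\<tau> > 0"
  shows "continuous_on S (\<lambda>y. kap (Complex \<tau> y))" "continuous_on S (\<lambda>y. dkap (Complex \<tau> y))"
  by (rule continuous_on_kap; use assms in \<open>auto simp: Complex_eq intro!: continuous_intros\<close>)+

lemma has_field_derivative_dkap:
  assumes "Re z > 0"
  shows "(dkap has_field_derivative deriv dkap z) (at z)"
proof -
  have "dkap field_differentiable at z"
    unfolding dkap_def using exp_neq_1_Re_pos[OF assms]
    by (auto intro!: derivative_intros field_differentiable_divide field_differentiable_within_exp
        field_differentiable_mult field_differentiable_power field_differentiable_minus)
  thus ?thesis by (simp add: field_differentiable_derivI)
qed

context
  fixes h :: "real \<Rightarrow> real"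
  assumes cont: "continuous_on UNIV h" and per: "\<And>x. h (x + 2 * pi) = h x"
begin

lemma continuous_on_h: "continuous_on S h"
  by (rule continuous_on_subset[OF cont]) simp

lemma continuous_on_h_comp: "continuous_on S f \<Longrightarrow> continuous_on S (\<lambda>x. h (f x))"
  by (rule continuous_on_compose2[OF cont]) auto

lemma per_minus: "h (x - 2 * pi) = h x"
  using per[of "x - 2 * pi"] by simp

lemma conv_shift:
  assumes k: "continuous_on UNIV (\<lambda>y. k (Complex \<tau> y))"
    and kp: "\<And>z. k (z + \<i> * (2 * of_real pi)) = (k z :: complex)"
  shows "integral {-pi..pi} (\<lambda>y. k (Complex \<tau> q - \<i> * of_real y) * of_real (h y)) =
     integral {-pi..pi} (\<lambda>y. k (Complex \<tau> y) * of_real (h (q - y)))"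
proof -
  define f where "f = (\<lambda>x. k (Complex \<tau> x) * of_real (h (q - x)))"
  have "integral {-pi..pi} (\<lambda>y. f (q - y)) = integral {-pi..pi} f"
  proof (rule integral_periodic_shift)
    show "continuous_on UNIV f"
      unfolding f_def by (intro continuous_intros k continuous_on_h_comp)
    fix x
    have "Complex \<tau> (x + 2 * pi) = Complex \<tau> x + \<i> * (2 * of_real pi)" by (simp add: complex_eq_iff)
    moreover have "h (q - (x + 2 * pi)) = h (q - x)" using per_minus[of "q - x"] by (simp add: algebra_simps)
    ultimately show "f (x + 2 * pi) = f x" by (simp add: f_def kp)
  qed
  moreover have "Complex \<tau> q - \<i> * of_real y = Complex \<tau> (q - y)" for y by (simp add: complex_eq_iff)
  ultimately show ?thesis by (simp add: f_def)
qed

lemma W_shift: "\<tau> > 0 \<Longrightarrow> W h (Complex \<tau> q) = integral {-pi..pi} (\<lambda>y. kap (Complex \<tau> y) * of_real (h (q - y)))"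
  unfolding W_def by (rule conv_shift) (auto intro: continuous_on_kap_Complex kap_add_2pi)

lemma dW_shift: "\<tau> > 0 \<Longrightarrow> dW h (Complex \<tau> q) = integral {-pi..pi} (\<lambda>y. dkap (Complex \<tau> y) * of_real (h (q - y)))"
  unfolding dW_def by (rule conv_shift) (auto intro: continuous_on_kap_Complex kap_add_2pi)

lemma has_field_derivative_conv:
  assumes k: "\<And>z. Re z > 0 \<Longrightarrow> (k has_field_derivative dk z) (at z)"
    and ck: "continuous_on {z. Re z > 0} dk" and "Re z > 0"
  shows "((\<lambda>z. integral {-pi..pi} (\<lambda>y. k (z - \<i> * of_real y) * of_real (h y))) has_field_derivative
     integral {-pi..pi} (\<lambda>y. dk (z - \<i> * of_real y) * of_real (h y))) (at z)"
proof -
  define U where "U = {z. Re z > 0}"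
  have ckk: "continuous_on U k" unfolding U_def
    by (rule continuous_at_imp_continuous_on) (auto intro: DERIV_isCont k)
  have "((\<lambda>z. integral (cbox (-pi) pi) (\<lambda>y. k (z - \<i> * of_real y) * of_real (h y))) has_field_derivative
     integral (cbox (-pi) pi) (\<lambda>y. dk (z - \<i> * of_real y) * of_real (h y))) (at z within U)"
  proof (rule leibniz_rule_field_derivative)
    fix x t assume "x \<in> U" "t \<in> cbox (-pi) pi"
    thus "((\<lambda>x. k (x - \<i> * of_real t) * of_real (h t)) has_field_derivative
         dk (x - \<i> * of_real t) * of_real (h t)) (at x within U)"
      unfolding U_def
      by (auto intro!: derivative_eq_intros DERIV_chain2[where f=k, OF k] simp: U_def)
  next
    fix x assume "x \<in> U"
    thus "(\<lambda>y. k (x - \<i> * of_real y) * of_real (h y)) integrable_on cbox (-pi) pi"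
      by (intro integrable_continuous continuous_intros continuous_on_compose2[OF ckk] continuous_on_h)
        (auto simp: U_def)
  next
    show "continuous_on (U \<times> cbox (-pi) pi) (\<lambda>(x, t). dk (x - \<i> * of_real t) * of_real (h t))"
      unfolding split_beta
      by (intro continuous_intros continuous_on_compose2[OF ck] continuous_on_h_comp) (auto simp: U_def)
  qed (use assms in \<open>auto simp: U_def convex_halfspace_Re_gt\<close>)
  moreover have "at z within U = at z"
    using assms(3) by (intro at_within_open) (auto simp: U_def open_halfspace_Re_gt)
  ultimately show ?thesis by simp
qed

lemma has_field_derivative_W: "Re z > 0 \<Longrightarrow> (W h has_field_derivative dW h z) (at z)"
  unfolding W_def[abs_def] dW_def
  by (rule has_field_derivative_conv) (auto intro: has_field_derivative_kap continuous_on_kap)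

lemma dW_field_differentiable: "Re z > 0 \<Longrightarrow> dW h field_differentiable at z"
  unfolding dW_def[abs_def] field_differentiable_def
  apply (rule exI)
  apply (rule has_field_derivative_conv[where dk = "deriv dkap"])
    apply (auto intro!: has_field_derivative_dkap holomorphic_on_imp_continuous_on holomorphic_deriv
       simp: open_halfspace_Re_gt holomorphic_on_def)
  using has_field_derivative_dkap field_differentiable_at_within field_differentiable_def by blast

end

lemma has_integral_powr_abs:
  fixes \<tau> c :: real assumes "\<tau> > 0" "c \<noteq> 0"
  shows "((\<lambda>y. (\<tau> + \<bar>y\<bar>) powr (c - 1)) has_integral 2 * ((\<tau> + pi) powr c - \<tau> powr c) / c) {-pi..pi}"
proof -
  have 1: "((\<lambda>y. (\<tau> + \<bar>y\<bar>) powr (c - 1)) has_integral ((\<tau> + pi) powr c / c - (\<tau> + 0) powr c / c)) {0..pi}"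
    by (rule fundamental_theorem_of_calculus)
      (use assms in \<open>auto intro!: derivative_eq_intros simp flip: has_real_derivative_iff_has_vector_derivative\<close>)
  have 2: "((\<lambda>y. (\<tau> + \<bar>y\<bar>) powr (c - 1)) has_integral (- ((\<tau> - 0) powr c / c) - (- ((\<tau> - (-pi)) powr c / c)))) {-pi..0}"
    by (rule fundamental_theorem_of_calculus)
      (use assms in \<open>auto intro!: derivative_eq_intros simp flip: has_real_derivative_iff_has_vector_derivative\<close>)
  have eq: "(- ((\<tau> - 0) powr c / c) - (- ((\<tau> - (-pi)) powr c / c))) + ((\<tau> + pi) powr c / c - (\<tau> + 0) powr c / c)
     = 2 * ((\<tau> + pi) powr c - \<tau> powr c) / c"
    using assms by (simp add: diff_divide_distrib)
  from has_integral_combine[OF _ _ 2 1] show ?thesis unfolding eq by simp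
qed

lemma mb_nonneg: "\<tau> > 0 \<Longrightarrow> mb b \<tau> \<ge> 0"
  by (simp add: mb_def)

lemma mb_le1: "\<tau> > 0 \<Longrightarrow> \<tau> \<le> 1 \<Longrightarrow> mb b \<tau> = \<tau> powr (-b)"
  by (simp add: mb_def min_def field_simps)

lemma mb_ge1: "\<tau> \<ge> 1 \<Longrightarrow> b \<le> 1 \<Longrightarrow> 1 / \<tau>\<^sup>2 \<le> mb b \<tau>"
proof -
  assume *: "\<tau> \<ge> 1" "b \<le> 1"
  have "1 / \<tau>\<^sup>2 = \<tau> powr (-1) * (1 / \<tau>)"
    using * by (simp add: powr_minus power2_eq_square field_simps)
  also have "\<dots> \<le> \<tau> powr (-b) * (1 / \<tau>)" using * by (intro mult_right_mono powr_mono) auto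
  also have "\<dots> = mb b \<tau>" using * by (simp add: mb_def min_def)
  finally show ?thesis .
qed

lemma norm_integral_period_le:
  fixes f :: "real \<Rightarrow> 'a::euclidean_space"
  assumes "continuous_on {-pi..pi} f" "\<And>y. y \<in> {-pi..pi} \<Longrightarrow> norm (f y) \<le> B"
  shows "norm (integral {-pi..pi} f) \<le> B * (2 * pi)"
  using integral_bound[of "-pi" pi f B] assms by simp

text \<open>The kernel bound 1 / (\<tau> + |y|) has an integral that diverges logarithmically as
  \<tau> tends to 0. Giving away a factor \<open>\<tau> powr (-b)\<close> leaves the integrable
  power b - 1 at the price of a constant 1 / b.\<close>

lemma norm_W_le:
  assumes cont: "continuous_on UNIV h" and per: "\<And>x. h (x + 2 * pi) = h x"
    and M: "\<And>x. \<bar>h x\<bar> \<le> M" and b: "0 < b" "b < 1" and z: "Re z > 0"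
  shows "cmod (W h z) \<le> 32 / b * M * mb b (Re z)"
proof -
  define \<tau> q where "\<tau> = Re z" and "q = Im z"
  have z': "z = Complex \<tau> q" "\<tau> > 0" using z by (simp_all add: \<tau>_def q_def)
  have M0: "M \<ge> 0" using M[of 0] by linarith
  let ?f = "\<lambda>y. kap (Complex \<tau> y) * of_real (h (q - y))"
  have cf: "continuous_on {-pi..pi} ?f"
    using z' by (intro continuous_intros continuous_on_kap_Complex continuous_on_compose2[OF cont]) auto
  have W: "W h z = integral {-pi..pi} ?f" using W_shift[OF cont per z'(2)] z' by simp
  have f: "cmod (?f y) \<le> 2 / (exp (\<tau> / 2) * (\<tau> + \<bar>y\<bar>)) * M" if "y \<in> {-pi..pi}" for y
  proof -
    have "cmod (?f y) = cmod (kap (Complex \<tau> y)) * \<bar>h (q - y)\<bar>" by (simp add: norm_mult)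
    also have "\<dots> \<le> 2 / (exp (\<tau> / 2) * (\<tau> + \<bar>y\<bar>)) * M"
      using norm_kap_le[of "Complex \<tau> y"] that z' M by (intro mult_mono) auto
    finally show ?thesis .
  qed
  show ?thesis
  proof (cases "\<tau> \<le> 1")
    case True
    have "cmod (integral {-pi..pi} ?f) \<le> integral {-pi..pi} (\<lambda>y. 2 * M * \<tau> powr (-b) * (\<tau> + \<bar>y\<bar>) powr (b - 1))"
    proof (rule integral_norm_bound_integral)
      show "?f integrable_on {-pi..pi}" using cf by (rule integrable_continuous_interval)
      show "(\<lambda>y. 2 * M * \<tau> powr (-b) * (\<tau> + \<bar>y\<bar>) powr (b - 1)) integrable_on {-pi..pi}"
        using has_integral_mult_right[OF has_integral_powr_abs[OF z'(2), of b]] b by (auto simp: integrable_on_def)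
      fix y assume y: "y \<in> {-pi..pi}"
      have "cmod (?f y) \<le> 2 / (exp (\<tau> / 2) * (\<tau> + \<bar>y\<bar>)) * M" by (rule f[OF y])
      also have "\<dots> \<le> 2 / (1 * (\<tau> + \<bar>y\<bar>)) * M"
        using z' M0 by (intro mult_right_mono divide_left_mono mult_right_mono mult_pos_pos) auto
      also have "\<dots> = 2 * M * ((\<tau> + \<bar>y\<bar>) powr (-b) * (\<tau> + \<bar>y\<bar>) powr (b-1))"
      proof -
        have "(\<tau> + \<bar>y\<bar>) powr (-b) * (\<tau> + \<bar>y\<bar>) powr (b-1) = (\<tau> + \<bar>y\<bar>) powr (-1)"
          unfolding powr_add[symmetric] by simp
        also have "\<dots> = 1 / (\<tau> + \<bar>y\<bar>)" using z' by (simp add: powr_minus_divide)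
        finally show ?thesis by simp
      qed
      also have "\<dots> \<le> 2 * M * (\<tau> powr (-b) * (\<tau> + \<bar>y\<bar>) powr (b-1))"
        using z' b M0 by (intro mult_left_mono mult_right_mono powr_mono2') auto
      finally show "cmod (?f y) \<le> 2 * M * \<tau> powr (-b) * (\<tau> + \<bar>y\<bar>) powr (b - 1)" by simp
    qed
    also have "\<dots> = 2 * M * \<tau> powr (-b) * (2 * ((\<tau> + pi) powr b - \<tau> powr b) / b)"
      by (subst integral_mult_right, subst integral_unique[OF has_integral_powr_abs[OF z'(2)]]) (use b in auto)
    also have "\<dots> \<le> 2 * M * \<tau> powr (-b) * (2 * 5 / b)"
    proof -
      have "(\<tau> + pi) powr b \<le> (\<tau> + pi) powr 1" using z' b pi_gt3 by (intro powr_mono) auto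
      hence "(\<tau> + pi) powr b - \<tau> powr b \<le> 5"
        using True z' pi_less_4 powr_ge_zero[of \<tau> b] by (simp del: powr_ge_zero)
      thus ?thesis using M0 b by (intro mult_left_mono divide_right_mono) auto
    qed
    also have "\<dots> \<le> 32 / b * M * mb b \<tau>"
      using M0 b z' True by (simp add: mb_le1 field_simps mult_left_mono)
    finally show ?thesis using W by (simp add: \<tau>_def)
  next
    case False
    have "cmod (integral {-pi..pi} ?f) \<le> 4 / \<tau>\<^sup>2 * M * (2 * pi)"
    proof (rule norm_integral_period_le[OF cf])
      fix y assume y: "y \<in> {-pi..pi}"
      \<comment> \<open>For \<tau> > 1 the exponential factor of \<open>norm_kap_le\<close> supplies
        the second power of 1 / \<tau>, so that \<open>mb_ge1\<close> applies.\<close>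
      have "\<tau> / 2 \<le> exp (\<tau> / 2)" using exp_ge_add_one_self[of "\<tau>/2"] by linarith
      hence "\<tau> / 2 * \<tau> \<le> exp (\<tau> / 2) * (\<tau> + \<bar>y\<bar>)" using z' by (intro mult_mono) auto
      hence "2 / (exp (\<tau> / 2) * (\<tau> + \<bar>y\<bar>)) \<le> 2 / (\<tau> / 2 * \<tau>)"
        using z' by (intro divide_left_mono) (auto intro!: mult_pos_pos)
      hence "2 / (exp (\<tau> / 2) * (\<tau> + \<bar>y\<bar>)) * M \<le> 2 / (\<tau> / 2 * \<tau>) * M" using M0 by (rule mult_right_mono)
      with f[OF y] show "cmod (?f y) \<le> 4 / \<tau>\<^sup>2 * M" by (simp add: power2_eq_square)
    qed
    also have "\<dots> \<le> 4 / \<tau>\<^sup>2 * M * 8" using M0 pi_less_4 by (intro mult_left_mono) auto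
    also have "\<dots> = 32 * M * (1 / \<tau>\<^sup>2)" by simp
    also have "\<dots> \<le> 32 / b * M * mb b \<tau>"
      using M0 b False mb_ge1[of \<tau> b] by (intro mult_mono) (auto simp: field_simps)
    finally show ?thesis using W by (simp add: \<tau>_def)
  qed
qed

lemma integral_holder_weight:
  assumes "\<tau> > 0" "0 < \<alpha>" "\<alpha> < 1"
  shows "(\<lambda>y. C * (\<tau> + \<bar>y\<bar>) powr (\<alpha> - 2)) integrable_on {-pi..pi}"
    and "C \<ge> 0 \<Longrightarrow> integral {-pi..pi} (\<lambda>y. C * (\<tau> + \<bar>y\<bar>) powr (\<alpha> - 2)) \<le> 2 * C * \<tau> powr (\<alpha> - 1) / (1 - \<alpha>)"
proof -
  have 1: "((\<lambda>y. (\<tau> + \<bar>y\<bar>) powr (\<alpha> - 2)) has_integral 2 * ((\<tau> + pi) powr (\<alpha> - 1) - \<tau> powr (\<alpha> - 1)) / (\<alpha> - 1)) {-pi..pi}"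
    using has_integral_powr_abs[OF assms(1), of "\<alpha> - 1"] assms by simp
  from has_integral_mult_right[OF this, of C]
  show "(\<lambda>y. C * (\<tau> + \<bar>y\<bar>) powr (\<alpha> - 2)) integrable_on {-pi..pi}" by (auto simp: integrable_on_def)
  assume C: "C \<ge> 0"
  have "2 * ((\<tau> + pi) powr (\<alpha> - 1) - \<tau> powr (\<alpha> - 1)) / (\<alpha> - 1) = 2 * (\<tau> powr (\<alpha> - 1) - (\<tau> + pi) powr (\<alpha> - 1)) / (1 - \<alpha>)"
    using assms by (simp add: field_simps)
  also have "\<dots> \<le> 2 * \<tau> powr (\<alpha> - 1) / (1 - \<alpha>)"
    using assms by (intro divide_right_mono) auto
  finally have "C * (2 * ((\<tau> + pi) powr (\<alpha> - 1) - \<tau> powr (\<alpha> - 1)) / (\<alpha> - 1)) \<le> C * (2 * \<tau> powr (\<alpha> - 1) / (1 - \<alpha>))"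
    using C by (rule mult_left_mono)
  thus "integral {-pi..pi} (\<lambda>y. C * (\<tau> + \<bar>y\<bar>) powr (\<alpha> - 2)) \<le> 2 * C * \<tau> powr (\<alpha> - 1) / (1 - \<alpha>)"
    using integral_unique[OF has_integral_mult_right[OF 1, of C]] by (simp add: mult.left_commute mult.assoc)
qed

lemma holder_weight_le:
  fixes \<tau> y :: real assumes "\<tau> > 0" "0 < \<alpha>"
  shows "\<bar>y\<bar> powr \<alpha> / (\<tau> + \<bar>y\<bar>)\<^sup>2 \<le> (\<tau> + \<bar>y\<bar>) powr (\<alpha> - 2)"
proof -
  have "\<bar>y\<bar> powr \<alpha> / (\<tau> + \<bar>y\<bar>)\<^sup>2 \<le> (\<tau> + \<bar>y\<bar>) powr \<alpha> / (\<tau> + \<bar>y\<bar>)\<^sup>2"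
    using assms by (intro divide_right_mono powr_mono2) auto
  also have "\<dots> = (\<tau> + \<bar>y\<bar>) powr (\<alpha> - 2)"
  proof -
    have "(\<tau> + \<bar>y\<bar>) powr 2 = (\<tau> + \<bar>y\<bar>)\<^sup>2" using assms by (intro powr_numeral) auto
    thus ?thesis by (simp add: powr_diff)
  qed
  finally show ?thesis .
qed

context
  fixes h :: "real \<Rightarrow> real" and \<alpha> H :: real
  assumes cont: "continuous_on UNIV h" and per: "\<And>x. h (x + 2 * pi) = h x"
    and H: "\<And>x y. \<bar>h x - h y\<bar> \<le> H * \<bar>x - y\<bar> powr \<alpha>" and \<alpha>: "0 < \<alpha>" "\<alpha> < 1"
begin

lemma H0: "H \<ge> 0"
  using H[of 1 0] by simp

text \<open>The integral of \<open>dkap\<close> over a period is zero, so \<open>h q\<close> may be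
  subtracted from the density. The Hoelder bound then lowers the singularity to the power \<alpha> -
  2 of \<tau> + |y|, whose integral is of order \<open>\<tau> powr (\<alpha> - 1)\<close>.\<close>

lemma norm_dW_le:
  assumes z: "Re z > 0"
  shows "cmod (dW h z) \<le> 288 / (1 - \<alpha>) * H * mb (1 - \<alpha>) (Re z)"
proof -
  define \<tau> q where "\<tau> = Re z" and "q = Im z"
  have z': "z = Complex \<tau> q" "\<tau> > 0" using z by (simp_all add: \<tau>_def q_def)
  let ?f = "\<lambda>y. dkap (Complex \<tau> y) * of_real (h (q - y) - h q)"
  have cf: "continuous_on {-pi..pi} ?f"
    using z' by (intro continuous_intros continuous_on_kap_Complex continuous_on_compose2[OF cont]) auto
  have "((\<lambda>y. dkap (Complex \<tau> y) * of_real (h (q - y)) - dkap (Complex \<tau> y) * of_real (h q)) has_integral dW h z - 0 * of_real (h q)) {-pi..pi}"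
  proof (intro has_integral_diff has_integral_mult_left has_integral_dkap z')
    have "(\<lambda>y. dkap (Complex \<tau> y) * of_real (h (q - y))) integrable_on {-pi..pi}"
      using z' by (intro integrable_continuous_interval continuous_intros continuous_on_kap_Complex continuous_on_compose2[OF cont]) auto
    thus "((\<lambda>y. dkap (Complex \<tau> y) * of_real (h (q - y))) has_integral dW h z) {-pi..pi}"
      using dW_shift[OF cont per z'(2)] z' by (simp add: has_integral_iff)
  qed
  hence W: "dW h z = integral {-pi..pi} ?f" by (simp add: integral_unique algebra_simps)
  have f: "cmod (?f y) \<le> 9 * H * (\<bar>y\<bar> powr \<alpha> / (\<tau> + \<bar>y\<bar>)\<^sup>2)" if "y \<in> {-pi..pi}" for y
  proof -
    have "cmod (?f y) = cmod (dkap (Complex \<tau> y)) * \<bar>h (q - y) - h q\<bar>" by (simp add: norm_mult flip: of_real_diff)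
    also have "\<dots> \<le> 9 / (\<tau> + \<bar>y\<bar>)\<^sup>2 * (H * \<bar>y\<bar> powr \<alpha>)"
      using norm_dkap_le[of "Complex \<tau> y"] that z' H[of "q - y" q] by (intro mult_mono) auto
    finally show ?thesis by simp
  qed
  show ?thesis
  proof (cases "\<tau> \<le> 1")
    case True
    have "cmod (integral {-pi..pi} ?f) \<le> integral {-pi..pi} (\<lambda>y. 9 * H * (\<tau> + \<bar>y\<bar>) powr (\<alpha> - 2))"
    proof (rule integral_norm_bound_integral)
      show "?f integrable_on {-pi..pi}" using cf by (rule integrable_continuous_interval)
      show "(\<lambda>y. 9 * H * (\<tau> + \<bar>y\<bar>) powr (\<alpha> - 2)) integrable_on {-pi..pi}"
        by (rule integral_holder_weight[OF z'(2) \<alpha>])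
      fix y assume "y \<in> {-pi..pi}"
      from f[OF this] show "cmod (?f y) \<le> 9 * H * (\<tau> + \<bar>y\<bar>) powr (\<alpha> - 2)"
        using mult_left_mono[OF holder_weight_le[OF z'(2) \<alpha>(1), of y], of "9 * H"] H0 by linarith
    qed
    also have "\<dots> \<le> 2 * (9 * H) * \<tau> powr (\<alpha> - 1) / (1 - \<alpha>)"
      by (rule integral_holder_weight[OF z'(2) \<alpha>]) (use H0 in auto)
    also have "\<dots> = 18 / (1 - \<alpha>) * H * mb (1 - \<alpha>) \<tau>" using True z' by (simp add: mb_le1)
    also have "\<dots> \<le> 288 / (1 - \<alpha>) * H * mb (1 - \<alpha>) \<tau>"
      using H0 \<alpha> mb_nonneg[OF z'(2)] by (intro mult_right_mono divide_right_mono) auto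
    finally show ?thesis using W by (simp add: \<tau>_def)
  next
    case False
    have "cmod (integral {-pi..pi} ?f) \<le> 36 * H / \<tau>\<^sup>2 * (2 * pi)"
    proof (rule norm_integral_period_le[OF cf])
      fix y assume y: "y \<in> {-pi..pi}"
      have "\<bar>y\<bar> powr \<alpha> \<le> 4 powr \<alpha>" using y pi_less_4 \<alpha> by (intro powr_mono2) auto
      also have "\<dots> \<le> 4 powr 1" using \<alpha> by (intro powr_mono) auto
      finally have "\<bar>y\<bar> powr \<alpha> \<le> 4" by simp
      hence "\<bar>y\<bar> powr \<alpha> / (\<tau> + \<bar>y\<bar>)\<^sup>2 \<le> 4 / \<tau>\<^sup>2"
        using z' by (intro frac_le power_mono) auto
      hence "9 * H * (\<bar>y\<bar> powr \<alpha> / (\<tau> + \<bar>y\<bar>)\<^sup>2) \<le> 9 * H * (4 / \<tau>\<^sup>2)" using H0 by (intro mult_left_mono) auto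
      with f[OF y] show "cmod (?f y) \<le> 36 * H / \<tau>\<^sup>2" by simp
    qed
    also have "\<dots> \<le> 36 * H / \<tau>\<^sup>2 * 8" using H0 pi_less_4 by (intro mult_left_mono) auto
    also have "\<dots> = 288 * H * (1 / \<tau>\<^sup>2)" by simp
    also have "\<dots> \<le> 288 / (1 - \<alpha>) * H * mb (1 - \<alpha>) \<tau>"
      using H0 \<alpha> False mb_ge1[of \<tau> "1 - \<alpha>"] by (intro mult_mono) (auto simp: field_simps)
    finally show ?thesis using W by (simp add: \<tau>_def)
  qed
qed

text \<open>Over a period \<open>kap\<close> has integral 0, so its real part plus 1 / (2 pi) has
  integral 1; the added constant accounts for the mean of \<open>h\<close>. The error is then the
  average of \<open>h (q - y) - h q\<close> against this kernel.\<close>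

lemma Re_W_approx:
  assumes \<tau>: "0 < \<tau>" "\<tau> \<le> 1"
  shows "\<bar>Re (W h (Complex \<tau> q)) - (h q - integral {-pi..pi} h / (2 * pi))\<bar> \<le> 60 * H / (1 - \<alpha>) * \<tau> powr \<alpha>"
proof -
  let ?P = "\<lambda>y. Re (kap (Complex \<tau> y)) + 1 / (2 * pi)"
  have ck: "continuous_on S (\<lambda>y. kap (Complex \<tau> y) * of_real (h (q - y)))"
     "continuous_on S (\<lambda>y. h (q - y))" for S
    using \<tau> by (intro continuous_intros continuous_on_kap_Complex continuous_on_compose2[OF cont]; auto)+
  have "((\<lambda>y. kap (Complex \<tau> y) * of_real (h (q - y))) has_integral W h (Complex \<tau> q)) {-pi..pi}"
    using W_shift[OF cont per \<tau>(1)] ck by (simp add: has_integral_iff integrable_continuous_interval)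
  from has_integral_linear[OF this bounded_linear_Re]
  have 1: "((\<lambda>y. Re (kap (Complex \<tau> y)) * h (q - y)) has_integral Re (W h (Complex \<tau> q))) {-pi..pi}"
    by (simp add: o_def)
  from has_integral_linear[OF has_integral_kap[OF \<tau>(1)] bounded_linear_Re]
  have 2: "((\<lambda>y. Re (kap (Complex \<tau> y))) has_integral 0) {-pi..pi}" by (simp add: o_def)
  have 3: "((\<lambda>y. h (q - y)) has_integral integral {-pi..pi} h) {-pi..pi}"
    using integral_periodic_shift[OF cont per, of q] ck(2) by (simp add: has_integral_iff integrable_continuous_interval)
  have 4: "((\<lambda>y. 1 / (2 * pi)) has_integral 1) {-pi..pi}"
    using has_integral_const_real[of "1 / (2 * pi)" "-pi" pi] by simp
  have "((\<lambda>y. (Re (kap (Complex \<tau> y)) * h (q - y) - Re (kap (Complex \<tau> y)) * h q) + (h (q - y) * (1 / (2 * pi)) - 1 / (2 * pi) * h q))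
    has_integral (Re (W h (Complex \<tau> q)) - 0 * h q) + (integral {-pi..pi} h * (1 / (2 * pi)) - 1 * h q)) {-pi..pi}"
    by (intro has_integral_add has_integral_diff has_integral_mult_left 1 2 3 4)
  hence 5: "((\<lambda>y. ?P y * (h (q - y) - h q)) has_integral (Re (W h (Complex \<tau> q)) - (h q - integral {-pi..pi} h / (2 * pi)))) {-pi..pi}"
    by (rule has_integral_eq_rhs[OF has_integral_eq[rotated]]) (simp_all add: field_simps)
  have "norm (integral {-pi..pi} (\<lambda>y. ?P y * (h (q - y) - h q))) \<le> integral {-pi..pi} (\<lambda>y. 30 * \<tau> * H * (\<tau> + \<bar>y\<bar>) powr (\<alpha> - 2))"
  proof (rule integral_norm_bound_integral)
    show "(\<lambda>y. ?P y * (h (q - y) - h q)) integrable_on {-pi..pi}" using 5 by blast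
    show "(\<lambda>y. 30 * \<tau> * H * (\<tau> + \<bar>y\<bar>) powr (\<alpha> - 2)) integrable_on {-pi..pi}"
      by (rule integral_holder_weight[OF \<tau>(1) \<alpha>])
    fix y assume y: "y \<in> {-pi..pi}"
    have "norm (?P y * (h (q - y) - h q)) = \<bar>?P y\<bar> * \<bar>h (q - y) - h q\<bar>" by (simp add: abs_mult)
    also have "\<dots> \<le> 30 * \<tau> / (\<tau> + \<bar>y\<bar>)\<^sup>2 * (H * \<bar>y\<bar> powr \<alpha>)"
      using abs_Re_kap_le[of "Complex \<tau> y"] y \<tau> H[of "q - y" q] by (intro mult_mono) auto
    also have "\<dots> = 30 * \<tau> * H * (\<bar>y\<bar> powr \<alpha> / (\<tau> + \<bar>y\<bar>)\<^sup>2)" by simp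
    also have "\<dots> \<le> 30 * \<tau> * H * (\<tau> + \<bar>y\<bar>) powr (\<alpha> - 2)"
      using holder_weight_le[OF \<tau>(1) \<alpha>(1), of y] H0 \<tau> by (intro mult_left_mono) auto
    finally show "norm (?P y * (h (q - y) - h q)) \<le> 30 * \<tau> * H * (\<tau> + \<bar>y\<bar>) powr (\<alpha> - 2)" .
  qed
  also have "\<dots> \<le> 2 * (30 * \<tau> * H) * \<tau> powr (\<alpha> - 1) / (1 - \<alpha>)"
    by (rule integral_holder_weight[OF \<tau>(1) \<alpha>]) (use H0 \<tau> in auto)
  also have "\<dots> = 60 * H / (1 - \<alpha>) * \<tau> powr \<alpha>"
    using \<tau> by (simp add: powr_diff)
  finally show ?thesis using integral_unique[OF 5] by simp
qed

end

section \<open>Potentials of layer densities\<close>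

text \<open>An integrable majorant for increments of a kernel of size
  \<open>\<tau> powr (-b)\<close> under a shift of length d: the kernel itself for \<tau> < d, and d
  times its derivative for \<tau> > d.\<close>

definition md :: "real \<Rightarrow> real \<Rightarrow> real \<Rightarrow> real" where
  "md b d \<tau> = \<tau> powr (-b) * min 1 (d / \<tau>)"

lemma mb_eq_md: "mb b = md b 1"
  by (simp add: fun_eq_iff mb_def md_def)

lemma md_scale: "d > 0 \<Longrightarrow> \<tau> \<ge> 0 \<Longrightarrow> md b d \<tau> = d powr (-b) * mb b (\<tau> / d)"
  by (simp add: md_def mb_def powr_divide)

lemma md_nonneg: "\<tau> \<ge> 0 \<Longrightarrow> d \<ge> 0 \<Longrightarrow> md b d \<tau> \<ge> 0"
  by (simp add: md_def)

lemma md_le_powr: "\<tau> > 0 \<Longrightarrow> md b d \<tau> \<le> \<tau> powr (-b)"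
  unfolding md_def by (rule mult_left_le) auto

lemma md_eq_powr: "\<tau> > 0 \<Longrightarrow> \<tau> \<le> d \<Longrightarrow> md b d \<tau> = \<tau> powr (-b)"
  by (simp add: md_def min_def field_simps)

lemma md_measurable [measurable]: "md b d \<in> borel_measurable borel"
  unfolding md_def[abs_def] by measurable

lemma integrable_mb:
  assumes b: "0 < b" "b < 1"
  shows "integrable lborel (\<lambda>t. mb b \<bar>t\<bar>)"
proof -
  define g where "g = (\<lambda>t::real. indicator {0..1} t * t powr (-b) + indicator {1..} t * t powr (-b-1))"
  have 1: "set_integrable lebesgue {0..1} (\<lambda>t::real. t powr (-b))"
    by (rule nonnegative_absolutely_integrable_1) (use b in \<open>auto intro!: integrable_on_powr_from_0\<close>)
  have 2: "set_integrable lebesgue {1..} (\<lambda>t::real. t powr (-b-1))"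
    by (rule nonnegative_absolutely_integrable_1)
      (use b has_integral_powr_to_inf[of "-b-1" 1] in \<open>auto simp: integrable_on_def\<close>)
  have "integrable lebesgue g"
    using 1 2 unfolding g_def set_integrable_def by simp
  hence g: "integrable lborel g"
    by (subst (asm) integrable_completion) (auto simp: g_def)
  have g': "integrable lborel (\<lambda>t. g (- t))"
    using lborel_integrable_real_affine[OF g, of "-1" 0] by simp
  show ?thesis
  proof (rule Bochner_Integration.integrable_bound[OF Bochner_Integration.integrable_add[OF g g']])
    show "(\<lambda>t. mb b \<bar>t\<bar>) \<in> borel_measurable lborel" unfolding mb_eq_md by measurable
    have "mb b \<bar>t\<bar> \<le> g t + g (-t)" for t
    proof -
      have g0: "g t \<ge> 0" "g (-t) \<ge> 0" by (auto simp: g_def)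
      have "mb b \<tau> \<le> g \<tau>" if "\<tau> \<ge> 0" for \<tau>
      proof (cases "\<tau> \<le> 1")
        case True
        thus ?thesis using that by (cases "\<tau> = 0") (auto simp: mb_def g_def mb_le1[unfolded mb_def])
      next
        case False
        thus ?thesis using that by (auto simp: mb_def g_def min_def powr_diff)
      qed
      from this[of "\<bar>t\<bar>"] show ?thesis using g0 by (cases "t \<ge> 0") auto
    qed
    thus "AE t in lborel. norm (mb b \<bar>t\<bar>) \<le> norm (g t + g (- t))"
      by (auto simp: mb_eq_md md_nonneg intro!: order_trans[OF _ abs_ge_self])
  qed
qed

definition Cb :: "real \<Rightarrow> real" where
  "Cb b = (LINT t|lborel. mb b \<bar>t\<bar>)"

lemma Cb_nonneg: "Cb b \<ge> 0"
  unfolding Cb_def by (intro Bochner_Integration.integral_nonneg) (simp add: mb_eq_md md_nonneg)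

text \<open>Scaling by d reduces the weight to \<open>mb\<close>. The power 1 - b of d found here is
  the Hoelder exponent in all later estimates of potentials.\<close>

lemma integrable_md:
  assumes b: "0 < b" "b < 1" and d: "d > 0"
  shows "integrable lborel (\<lambda>t. md b d \<bar>s - t\<bar>)" "(LINT t|lborel. md b d \<bar>s - t\<bar>) = d powr (1 - b) * Cb b"
proof -
  have eq: "mb b \<bar>s / d + (-1 / d) * t\<bar> = d powr b * md b d \<bar>s - t\<bar>" for t
  proof -
    have "\<bar>s / d + (-1 / d) * t\<bar> = \<bar>s - t\<bar> / d" using d by (simp add: diff_divide_distrib[symmetric] abs_divide)
    thus ?thesis using d by (simp add: md_scale mult.assoc[symmetric] powr_add[symmetric])
  qed
  have "integrable lborel (\<lambda>t. d powr b * md b d \<bar>s - t\<bar>)"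
    using lborel_integrable_real_affine[OF integrable_mb[OF b], of "-1/d" "s/d"] d unfolding eq by simp
  hence "integrable lborel (\<lambda>t. d powr (-b) * (d powr b * md b d \<bar>s - t\<bar>))" by (rule integrable_mult_right)
  thus i: "integrable lborel (\<lambda>t. md b d \<bar>s - t\<bar>)"
    using d by (simp add: mult.assoc[symmetric] powr_add[symmetric])
  have "Cb b = \<bar>-1/d\<bar> *\<^sub>R (LINT t|lborel. mb b \<bar>s / d + (-1 / d) * t\<bar>)"
    unfolding Cb_def by (rule lborel_integral_real_affine) (use d in auto)
  also have "\<dots> = (1/d) * (d powr b * (LINT t|lborel. md b d \<bar>s - t\<bar>))"
    unfolding eq using d by simp
  finally show "(LINT t|lborel. md b d \<bar>s - t\<bar>) = d powr (1 - b) * Cb b"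
    using d by (simp add: powr_diff)
qed

text \<open>A superposition of functions on the two half-cylinders that meet at height t; their
  half-plane variable is |s - t| + i q. The factor \<open>e\<close> is constant for a kernel even in
  s - t and \<open>sgn\<close> for an odd one, and differentiation in s exchanges the two.\<close>

definition JJ :: "(real \<Rightarrow> real) \<Rightarrow> (complex \<Rightarrow> real \<Rightarrow> complex) \<Rightarrow> real \<Rightarrow> real \<Rightarrow> complex" where
  "JJ e G q s = (LINT t|lborel. e (s - t) *\<^sub>R G (Complex \<bar>s - t\<bar> q) t)"

lemma measurable_Complex [measurable (raw)]:
  assumes "f \<in> borel_measurable M" "g \<in> borel_measurable M"
  shows "(\<lambda>x. Complex (f x) (g x)) \<in> borel_measurable M"
proof -
  have "(\<lambda>x. Complex (fst x) (snd x)) \<in> borel_measurable borel"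
    unfolding Complex_eq by (intro borel_measurable_continuous_onI continuous_intros)
  from measurable_compose[OF borel_measurable_Pair[OF assms] this] show ?thesis by simp
qed

lemma LINT_norm_bound_AE:
  fixes f :: "'a \<Rightarrow> 'b::{banach, second_countable_topology}"
  assumes "integrable M f" "integrable M g" "AE x in M. norm (f x) \<le> g x"
  shows "norm (integral\<^sup>L M f) \<le> integral\<^sup>L M g"
proof -
  have "norm (integral\<^sup>L M f) \<le> (LINT x|M. norm (f x))" by (rule integral_norm_bound)
  also have "\<dots> \<le> integral\<^sup>L M g" using assms by (intro integral_mono_AE) auto
  finally show ?thesis .
qed

lemma has_bochner_integral_norm_bound:
  fixes f :: "'a \<Rightarrow> 'b::{banach, second_countable_topology}"
  assumes "has_bochner_integral M f x" "integrable M g" "AE x in M. norm (f x) \<le> g x"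
  shows "norm x \<le> integral\<^sup>L M g"
  using LINT_norm_bound_AE[of M f g] assms by (auto simp: has_bochner_integral_iff)

text \<open>The common frame for \<open>W\<close> and \<open>dW\<close>, which differ in constant
  and exponent. Holomorphy together with the size bound yields all control of increments.\<close>

locale half_kernel =
  fixes G :: "complex \<Rightarrow> real \<Rightarrow> complex" and C b :: real
  assumes meas: "(\<lambda>x. G (fst x) (snd x)) \<in> borel_measurable borel"
    and bound: "\<And>z t. Re z > 0 \<Longrightarrow> cmod (G z t) \<le> C * mb b (Re z)"
    and diff: "\<And>z t. Re z > 0 \<Longrightarrow> (\<lambda>z. G z t) field_differentiable at z"
    and b: "0 < b" "b < 1"
begin

lemma C_nonneg: "C \<ge> 0"
  using bound[of 1 0] by (simp add: mb_def) (metis norm_ge_zero order_trans)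

lemma bound_powr: "Re z > 0 \<Longrightarrow> cmod (G z t) \<le> C * Re z powr (-b)"
  using bound[of z t] mult_left_mono[OF md_le_powr[of "Re z" b 1] C_nonneg] by (simp add: mb_eq_md)

lemma holo: "(\<lambda>z. G z t) holomorphic_on {z. Re z > 0}"
  unfolding holomorphic_on_def by (auto intro: field_differentiable_at_within diff)

text \<open>Cauchy's inequality on the disc of radius \<open>Re z / 2\<close>, where real parts stay
  above \<open>Re z / 2\<close>; the factor 4 bounds 2 to the power b + 1.\<close>

lemma deriv_bound:
  assumes "Re z > 0"
  shows "cmod (deriv (\<lambda>z. G z t) z) \<le> 4 * C * Re z powr (-b-1)"
proof -
  define r where "r = Re z / 2"
  have r: "r > 0" using assms by (simp add: r_def)
  have sub: "cball z r \<subseteq> {w. Re w > 0}" 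
  proof
    fix w assume "w \<in> cball z r"
    hence "\<bar>Re (z - w)\<bar> \<le> r" by (smt (verit) abs_Re_le_cmod dist_norm mem_cball)
    hence "Re w > 0" using r by (simp add: r_def abs_if split: if_splits)
    thus "w \<in> {w. Re w > 0}" by simp
  qed
  have "norm ((deriv ^^ 1) (\<lambda>z. G z t) z) \<le> fact 1 * (C * r powr (-b)) / r ^ 1"
  proof (rule Cauchy_inequality)
    show "(\<lambda>z. G z t) holomorphic_on ball z r"
      by (rule holomorphic_on_subset[OF holo]) (use sub ball_subset_cball in blast)
    show "continuous_on (cball z r) (\<lambda>z. G z t)"
      by (rule continuous_on_subset[OF holomorphic_on_imp_continuous_on[OF holo] sub])
    fix x assume x: "norm (z - x) = r"
    hence "\<bar>Re (z - x)\<bar> \<le> r" by (metis abs_Re_le_cmod)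
    hence "Re x \<ge> r" by (simp add: r_def abs_if split: if_splits)
    hence "cmod (G x t) \<le> C * Re x powr (-b)" using r by (intro bound_powr) auto
    also have "\<dots> \<le> C * r powr (-b)"
      using \<open>Re x \<ge> r\<close> r b C_nonneg by (intro mult_left_mono powr_mono2') auto
    finally show "cmod (G x t) \<le> C * r powr (-b)" .
  qed (fact r)
  hence "cmod (deriv (\<lambda>z. G z t) z) \<le> C * (r powr (-b) / r)" by simp
  also have "r powr (-b) / r = r powr (-b-1)" using r by (simp add: powr_diff)
  also have "r powr (-b-1) = (1/2) powr (-b-1) * Re z powr (-b-1)"
    using assms by (simp add: r_def powr_divide powr_mult[symmetric])
  also have "(1/2::real) powr (-b-1) \<le> (1/2) powr (-2)" using b by (intro powr_mono') auto
  also have "(1/2::real) powr (-2) = 4" by (simp add: powr_minus powr_numeral power2_eq_square)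
  finally show ?thesis using C_nonneg by (simp add: mult_left_mono mult_right_mono mult.assoc mult.left_commute)
qed

text \<open>For d <= \<tau> this is the mean value inequality with \<open>deriv_bound\<close> on a
  convex half-plane; for d > \<tau> it is the triangle inequality, as \<open>md b d \<tau>\<close>
  is then the bare power.\<close>

lemma diff_bound:
  assumes z: "Re z \<ge> \<tau>" "Re w \<ge> \<tau>" and \<tau>: "\<tau> > 0" and d: "cmod (z - w) \<le> d"
  shows "cmod (G z t - G w t) \<le> 4 * C * md b d \<tau>"
proof (cases "d \<le> \<tau>")
  case True
  have "cmod (G z t - G w t) \<le> (4 * C * \<tau> powr (-b-1)) * cmod (z - w)"
  proof (rule field_differentiable_bound[where S = "{z. Re z \<ge> \<tau>}"])
    fix x assume x: "x \<in> {z. Re z \<ge> \<tau>}"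
    hence x0: "Re x > 0" using \<tau> by simp
    show "((\<lambda>z. G z t) has_field_derivative deriv (\<lambda>z. G z t) x) (at x within {z. Re z \<ge> \<tau>})"
      using diff[OF x0] by (intro DERIV_subset[OF field_differentiable_derivI]) auto
    have "cmod (deriv (\<lambda>z. G z t) x) \<le> 4 * C * Re x powr (-b-1)" by (rule deriv_bound[OF x0])
    also have "\<dots> \<le> 4 * C * \<tau> powr (-b-1)"
      using x \<tau> b C_nonneg by (intro mult_left_mono powr_mono2') auto
    finally show "cmod (deriv (\<lambda>z. G z t) x) \<le> 4 * C * \<tau> powr (-b-1)" .
  qed (use z in \<open>auto simp: convex_halfspace_Re_ge\<close>)
  also have "\<dots> \<le> (4 * C * \<tau> powr (-b-1)) * d" using d C_nonneg by (intro mult_left_mono) auto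
  also have "\<dots> = 4 * C * md b d \<tau>" using True \<tau> by (simp add: md_def min_def powr_diff field_simps)
  finally show ?thesis .
next
  case False
  have "cmod (G x t) \<le> C * \<tau> powr (-b)" if "Re x \<ge> \<tau>" for x
  proof -
    have "cmod (G x t) \<le> C * Re x powr (-b)" using that \<tau> by (intro bound_powr) auto
    also have "\<dots> \<le> C * \<tau> powr (-b)" using that \<tau> b C_nonneg by (intro mult_left_mono powr_mono2') auto
    finally show ?thesis .
  qed
  from this[OF z(1)] this[OF z(2)] have "cmod (G z t - G w t) \<le> 2 * (C * \<tau> powr (-b))"
    using norm_triangle_ineq4[of "G z t" "G w t"] by linarith
  also have "\<dots> \<le> 4 * C * md b d \<tau>" using False \<tau> C_nonneg by (simp add: md_eq_powr)
  finally show ?thesis .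
qed

lemma measurable_G [measurable (raw)]:
  "f \<in> borel_measurable M \<Longrightarrow> g \<in> borel_measurable M \<Longrightarrow> (\<lambda>x. G (f x) (g x)) \<in> borel_measurable M"
  using measurable_compose[OF borel_measurable_Pair meas, of f M g] by simp

end

section \<open>Bounds and Hoelder continuity of superposed kernels\<close>

context half_kernel begin

context
  fixes e :: "real \<Rightarrow> real"
  assumes e: "e = (\<lambda>_. 1) \<or> e = sgn"
begin

lemma e_abs: "\<bar>e x\<bar> \<le> 1"
  using e by (auto simp: sgn_if)

lemma e_meas [measurable]: "e \<in> borel_measurable borel"
  using e by auto

text \<open>The sign can differ only for t between s and s', end points included.\<close>

lemma e_neq: "e (s - t) \<noteq> e (s' - t) \<Longrightarrow> \<bar>s - t\<bar> \<le> \<bar>s - s'\<bar> \<and> \<bar>s' - t\<bar> \<le> \<bar>s - s'\<bar>"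
  using e by (auto simp: sgn_if split: if_splits)

lemma J_integrand_bound:
  "AE t in lborel. norm (e (s - t) *\<^sub>R G (Complex \<bar>s - t\<bar> q) t) \<le> C * mb b \<bar>s - t\<bar>"
  using AE_lborel_singleton[of s]
proof eventually_elim
  fix t assume "t \<noteq> s"
  hence *: "cmod (G (Complex \<bar>s - t\<bar> q) t) \<le> C * mb b \<bar>s - t\<bar>" using bound[of "Complex \<bar>s - t\<bar> q" t] by simp
  show "norm (e (s - t) *\<^sub>R G (Complex \<bar>s - t\<bar> q) t) \<le> C * mb b \<bar>s - t\<bar>"
    using mult_mono[OF e_abs[of "s-t"] *] by simp
qed

lemma J_integrable: "integrable lborel (\<lambda>t. e (s - t) *\<^sub>R G (Complex \<bar>s - t\<bar> q) t)"
proof (rule Bochner_Integration.integrable_bound)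
  show "integrable lborel (\<lambda>t. C * mb b \<bar>s - t\<bar>)"
    using integrable_md(1)[OF b, of 1 s] by (simp add: mb_eq_md)
  show "AE t in lborel. norm (e (s - t) *\<^sub>R G (Complex \<bar>s - t\<bar> q) t) \<le> norm (C * mb b \<bar>s - t\<bar>)"
    using J_integrand_bound by eventually_elim (auto intro: order_trans[OF _ abs_ge_self])
qed measurable

lemma J_bound: "cmod (JJ e G q s) \<le> C * Cb b"
proof -
  have "norm (JJ e G q s) \<le> (LINT t|lborel. C * mb b \<bar>s - t\<bar>)"
    unfolding JJ_def
    by (rule LINT_norm_bound_AE[OF J_integrable _ J_integrand_bound])
      (use integrable_md(1)[OF b, of 1 s] in \<open>simp add: mb_eq_md\<close>)
  also have "\<dots> = C * Cb b" using integrable_md(2)[OF b, of 1 s] by (simp add: mb_eq_md)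
  finally show ?thesis .
qed

text \<open>Far from the singularity the Cauchy estimate controls increments of the kernel; near it, and
  where the sign factor jumps, both terms are small separately.\<close>

lemma J_integrand_diff:
  assumes "t \<noteq> s" "t \<noteq> s'" and d: "\<bar>q - q'\<bar> + \<bar>s - s'\<bar> \<le> d"
  shows "norm (e (s - t) *\<^sub>R G (Complex \<bar>s - t\<bar> q) t - e (s' - t) *\<^sub>R G (Complex \<bar>s' - t\<bar> q') t)
     \<le> 4 * C * (md b d \<bar>s - t\<bar> + md b d \<bar>s' - t\<bar>)"
proof -
  have d0: "d \<ge> 0" using d by linarith
  define \<tau> where "\<tau> = min \<bar>s - t\<bar> \<bar>s' - t\<bar>"
  have \<tau>: "\<tau> > 0" using assms by (simp add: \<tau>_def)
  have mdnn: "md b d \<bar>s - t\<bar> \<ge> 0" "md b d \<bar>s' - t\<bar> \<ge> 0" using d0 by (auto intro: md_nonneg)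
  let ?z = "Complex \<bar>s - t\<bar> q" and ?w = "Complex \<bar>s' - t\<bar> q'"
  show ?thesis
  proof (cases "e (s - t) = e (s' - t)")
    case True
    have "cmod (?z - ?w) \<le> \<bar>Re (?z - ?w)\<bar> + \<bar>Im (?z - ?w)\<bar>" by (rule cmod_le)
    also have "\<dots> \<le> d" using d by simp
    finally have "cmod (G ?z t - G ?w t) \<le> 4 * C * md b d \<tau>"
      by (intro diff_bound \<tau>) (auto simp: \<tau>_def)
    also have "\<dots> \<le> 4 * C * (md b d \<bar>s - t\<bar> + md b d \<bar>s' - t\<bar>)"
      using C_nonneg mdnn by (intro mult_left_mono) (auto simp: \<tau>_def min_def)
    finally have *: "cmod (G ?z t - G ?w t) \<le> 4 * C * (md b d \<bar>s - t\<bar> + md b d \<bar>s' - t\<bar>)" .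
    have "norm (e (s - t) *\<^sub>R G ?z t - e (s' - t) *\<^sub>R G ?w t) = \<bar>e (s - t)\<bar> * cmod (G ?z t - G ?w t)"
      unfolding True scaleR_diff_right[symmetric] by simp
    also have "\<dots> \<le> 1 * cmod (G ?z t - G ?w t)" using e_abs by (intro mult_right_mono) auto
    finally show ?thesis using * by simp
  next
    case False
    from e_neq[OF this] d have le: "\<bar>s - t\<bar> \<le> d" "\<bar>s' - t\<bar> \<le> d" by auto
    have *: "norm (e x *\<^sub>R G (Complex r y) t) \<le> C * md b d r" if "0 < r" "r \<le> d" for x y r
    proof -
      have "norm (e x *\<^sub>R G (Complex r y) t) \<le> 1 * (C * r powr (-b))"
        using mult_mono[OF e_abs[of x] bound_powr[of "Complex r y" t]] that by simp
      thus ?thesis using that by (simp add: md_eq_powr)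
    qed
    have "norm (e (s - t) *\<^sub>R G ?z t - e (s' - t) *\<^sub>R G ?w t) \<le> C * md b d \<bar>s - t\<bar> + C * md b d \<bar>s' - t\<bar>"
      using assms le by (intro order_trans[OF norm_triangle_ineq4] add_mono *) auto
    also have "\<dots> \<le> 4 * C * (md b d \<bar>s - t\<bar> + md b d \<bar>s' - t\<bar>)"
      using mult_nonneg_nonneg[OF C_nonneg mdnn(1)] mult_nonneg_nonneg[OF C_nonneg mdnn(2)]
      unfolding distrib_left by linarith
    finally show ?thesis .
  qed
qed

text \<open>\<open>J_integrand_diff\<close> is integrated: each of its two weights contributes
  \<open>d powr (1 - b) * Cb b\<close>.\<close>

lemma J_holder:
  assumes d: "\<bar>q - q'\<bar> + \<bar>s - s'\<bar> \<le> d" "d > 0"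
  shows "cmod (JJ e G q s - JJ e G q' s') \<le> 8 * C * Cb b * d powr (1 - b)"
proof -
  have "norm (JJ e G q s - JJ e G q' s') \<le> (LINT t|lborel. 4 * C * (md b d \<bar>s - t\<bar> + md b d \<bar>s' - t\<bar>))"
  proof (rule has_bochner_integral_norm_bound)
    show "has_bochner_integral lborel
      (\<lambda>t. e (s - t) *\<^sub>R G (Complex \<bar>s - t\<bar> q) t - e (s' - t) *\<^sub>R G (Complex \<bar>s' - t\<bar> q') t) (JJ e G q s - JJ e G q' s')"
      unfolding JJ_def by (intro has_bochner_integral_diff has_bochner_integral_integrable J_integrable)
    show "AE t in lborel. norm (e (s - t) *\<^sub>R G (Complex \<bar>s - t\<bar> q) t - e (s' - t) *\<^sub>R G (Complex \<bar>s' - t\<bar> q') t)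
       \<le> 4 * C * (md b d \<bar>s - t\<bar> + md b d \<bar>s' - t\<bar>)"
      using AE_lborel_singleton[of s] AE_lborel_singleton[of s']
      by eventually_elim (rule J_integrand_diff[OF _ _ d(1)])
    show "integrable lborel (\<lambda>t. 4 * C * (md b d \<bar>s - t\<bar> + md b d \<bar>s' - t\<bar>))"
      using integrable_md(1)[OF b d(2)] by (intro integrable_mult_right Bochner_Integration.integrable_add)
  qed
  also have "\<dots> = 8 * C * Cb b * d powr (1 - b)"
    using integrable_md[OF b d(2)] by simp
  finally show ?thesis .
qed

end

end

text \<open>Since the exponent of \<open>dG\<close> is also below 1, the differentiated kernel is
  integrable and no principal values arise.\<close>

locale half_kernel_deriv = half_kernel G C b + D: half_kernel dG C' b'
  for G C b dG C' b' +
  assumes deriv: "\<And>z t. Re z > 0 \<Longrightarrow> ((\<lambda>z. G z t) has_field_derivative dG z t) (at z)"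
begin

text \<open>The mean value inequality is applied to \<open>G\<close> minus its linear part at z,
  whose derivative is an increment of \<open>dG\<close> and thus controlled by
  \<open>diff_bound\<close>.\<close>

lemma taylor:
  assumes "Re z \<ge> \<tau>" "Re w \<ge> \<tau>" "\<tau> > 0" "cmod (z - w) \<le> d"
  shows "cmod (G w t - G z t - (w - z) * dG z t) \<le> d * (4 * C' * md b' d \<tau>)"
proof -
  have "cmod ((G w t - dG z t * w) - (G z t - dG z t * z)) \<le> (4 * C' * md b' d \<tau>) * cmod (w - z)"
  proof (rule field_differentiable_bound[where S = "closed_segment z w" and f = "\<lambda>x. G x t - dG z t * x" and f' = "\<lambda>x. dG x t - dG z t"])
    fix x assume x: "x \<in> closed_segment z w"
    hence "x \<in> {x. Re x \<ge> \<tau>}"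
      using closed_segment_subset[OF _ _ convex_halfspace_Re_ge[of \<tau>], of z w] assms by auto
    hence rx: "Re x \<ge> \<tau>" by simp
    show "((\<lambda>x. G x t - dG z t * x) has_field_derivative (dG x t - dG z t)) (at x within closed_segment z w)"
      using rx assms by (auto intro!: derivative_eq_intros DERIV_subset[OF deriv])
    have "cmod (x - z) \<le> d" using segment_bound(1)[OF x] assms(4) by (simp add: norm_minus_commute)
    thus "cmod (dG x t - dG z t) \<le> 4 * C' * md b' d \<tau>"
      using assms rx by (intro D.diff_bound) auto
  qed auto
  also have "\<dots> \<le> (4 * C' * md b' d \<tau>) * d"
    using assms D.C_nonneg order_trans[OF norm_ge_zero assms(4)] 
    by (intro mult_left_mono) (auto simp: norm_minus_commute intro!: mult_nonneg_nonneg md_nonneg)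
  finally show ?thesis by (simp add: algebra_simps)
qed

text \<open>The bound on \<open>dG\<close> is integrated between the two heights and the lower limit
  dropped. It serves for t between s and the displaced height, where the two kernel arguments are
  not a Taylor increment of each other.\<close>

lemma powr_increment:
  assumes "0 < \<tau>" "0 < \<tau>'" "\<tau> \<le> d" "\<tau>' \<le> d"
  shows "cmod (G (Complex \<tau> q) t - G (Complex \<tau>' q) t) \<le> C' / (1 - b') * d powr (1 - b')"
proof -
  have *: "cmod (G (Complex \<tau>' q) t - G (Complex \<tau> q) t) \<le> C' / (1 - b') * d powr (1 - b')"
    if "0 < \<tau>" "\<tau> < \<tau>'" "\<tau>' \<le> d" for \<tau> \<tau>'
  proof -
    have "cmod (G (Complex \<tau>' q) t - G (Complex \<tau> q) t) \<le>
        C' / (1 - b') * \<tau>' powr (1 - b') - C' / (1 - b') * \<tau> powr (1 - b')"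
    proof (rule differentiable_bound_general[OF that(2), where f' = "\<lambda>x. dG (Complex x q) t" and \<phi>' = "\<lambda>x. C' * x powr (-b')"])
      show "continuous_on {\<tau>..\<tau>'} (\<lambda>x. G (Complex x q) t)"
      proof (rule continuous_on_vector_derivative)
        fix x assume "x \<in> {\<tau>..\<tau>'}"
        thus "((\<lambda>x. G (Complex x q) t) has_vector_derivative dG (Complex x q) t) (at x within {\<tau>..\<tau>'})"
          using that by (intro has_vector_derivative_horizontal deriv) auto
      qed
      show "continuous_on {\<tau>..\<tau>'} (\<lambda>x. C' / (1 - b') * x powr (1 - b'))"
        using that by (intro continuous_intros) auto
      fix x assume x: "\<tau> < x" "x < \<tau>'"
      show "((\<lambda>x. G (Complex x q) t) has_vector_derivative dG (Complex x q) t) (at x)"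
        using x that by (intro has_vector_derivative_horizontal deriv) auto
      show "((\<lambda>x. C' / (1 - b') * x powr (1 - b')) has_vector_derivative C' * x powr (- b')) (at x)"
        using x that D.b unfolding has_real_derivative_iff_has_vector_derivative[symmetric]
        by (auto intro!: derivative_eq_intros)
      show "norm (dG (Complex x q) t) \<le> C' * x powr (- b')"
        using x that D.bound_powr[of "Complex x q" t] by simp
    qed
    also have "\<dots> \<le> C' / (1 - b') * \<tau>' powr (1 - b')" using D.C_nonneg D.b by simp
    also have "\<dots> \<le> C' / (1 - b') * d powr (1 - b')"
      using D.C_nonneg D.b that by (intro mult_left_mono powr_mono2) auto
    finally show ?thesis .
  qed
  show ?thesis
    using *[of \<tau> \<tau>'] *[of \<tau>' \<tau>] assms D.C_nonneg D.b
    by (cases \<tau> \<tau>' rule: linorder_cases) (auto simp: norm_minus_commute)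
qed

lemma powr_le_md: "0 < \<tau> \<Longrightarrow> \<tau> \<le> d \<Longrightarrow> d powr (1 - b') \<le> d * md b' d \<tau>"
proof -
  assume *: "0 < \<tau>" "\<tau> \<le> d"
  have "d powr (1 - b') = d * d powr (-b')" using * by (simp add: powr_diff powr_minus_divide)
  also have "\<dots> \<le> d * \<tau> powr (-b')" using * D.b by (intro mult_left_mono powr_mono2') auto
  finally show ?thesis using * by (simp add: md_eq_powr)
qed

end

text \<open>The integrated remainders below are of order |y - x| to the power 1 + \<theta>, a form
  that \<open>integrable_md\<close> produces directly.\<close>

lemma has_vector_derivative_remainder:
  fixes f :: "real \<Rightarrow> 'a::real_normed_vector"
  assumes "\<And>y. y \<noteq> x \<Longrightarrow> \<bar>y - x\<bar> \<le> 1 \<Longrightarrow> norm (f y - f x - (y - x) *\<^sub>R D) \<le> K * \<bar>y - x\<bar> * \<bar>y - x\<bar> powr \<theta>" and \<theta>: "\<theta> > 0"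
  shows "(f has_vector_derivative D) (at x within S)"
proof -
  have "((\<lambda>y. norm (f y - f x - (y - x) *\<^sub>R D) / norm (y - x)) \<longlongrightarrow> 0) (at x)"
  proof (rule tendsto_sandwich[OF _ _ tendsto_const])
    have "((\<lambda>y. K * \<bar>y - x\<bar> powr \<theta>) \<longlongrightarrow> K * \<bar>x - x\<bar> powr \<theta>) (at x)"
      using \<theta> by (intro tendsto_intros tendsto_powr') auto
    thus "((\<lambda>y. K * \<bar>y - x\<bar> powr \<theta>) \<longlongrightarrow> 0) (at x)" by simp
    show "\<forall>\<^sub>F y in at x. norm (f y - f x - (y - x) *\<^sub>R D) / norm (y - x) \<le> K * \<bar>y - x\<bar> powr \<theta>"
    proof -
      have "\<forall>\<^sub>F y in at x. y \<in> ball x 1" by (rule eventually_at_in_open') auto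
      moreover have "\<forall>\<^sub>F y in at x. y \<noteq> x" by (simp add: eventually_at_filter)
      ultimately show ?thesis
      proof eventually_elim
        fix y assume y: "y \<in> ball x 1" "y \<noteq> x"
        have "norm (f y - f x - (y - x) *\<^sub>R D) \<le> K * \<bar>y - x\<bar> * \<bar>y - x\<bar> powr \<theta>"
          using assms(1)[OF y(2)] y(1) by (simp add: dist_real_def abs_minus_commute)
        thus "norm (f y - f x - (y - x) *\<^sub>R D) / norm (y - x) \<le> K * \<bar>y - x\<bar> powr \<theta>"
          using y(2) by (simp add: divide_le_eq mult_ac)
      qed
    qed
  qed auto
  hence "(f has_vector_derivative D) (at x)"
    unfolding has_vector_derivative_def has_derivative_iff_norm by (auto intro!: bounded_linear_intros)
  thus ?thesis by (rule has_vector_derivative_at_within)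
qed

text \<open>The contribution of the mean values of the density; \<open>sgn t\<close> makes the integrand compactly supported.\<close>

definition Sg :: "(real \<Rightarrow> real) \<Rightarrow> real \<Rightarrow> real" where
  "Sg R s = (LINT t|lborel. (sgn (s - t) + sgn t) * R t)"

lemma Sg_integrable:
  fixes R :: "real \<Rightarrow> real" and B :: real
  assumes [measurable]: "R \<in> borel_measurable borel" and B: "\<And>t. \<bar>R t\<bar> \<le> B"
  shows "integrable lborel (\<lambda>t. (sgn (s - t) + sgn t) * R t)"
proof (rule Bochner_Integration.integrable_bound)
  show "integrable lborel (\<lambda>t. 2 * B * indicator {- \<bar>s\<bar>..\<bar>s\<bar>} t)" by simp
  have B0: "B \<ge> 0" using B[of 0] by linarith
  show "AE t in lborel. norm ((sgn (s - t) + sgn t) * R t) \<le> norm (2 * B * indicator {- \<bar>s\<bar>..\<bar>s\<bar>} t)"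
  proof (rule AE_I2)
    fix t
    have "\<bar>sgn (s - t) + sgn t\<bar> \<le> 2 * indicator {- \<bar>s\<bar>..\<bar>s\<bar>} t"
      by (auto simp: sgn_if indicator_def)
    hence "\<bar>sgn (s - t) + sgn t\<bar> * \<bar>R t\<bar> \<le> 2 * indicator {- \<bar>s\<bar>..\<bar>s\<bar>} t * B"
      using B by (intro mult_mono) auto
    thus "norm ((sgn (s - t) + sgn t) * R t) \<le> norm (2 * B * indicator {- \<bar>s\<bar>..\<bar>s\<bar>} t)"
      using B0 by (simp add: abs_mult mult_ac)
  qed
qed measurable

lemma Sg_diff:
  fixes R :: "real \<Rightarrow> real" and B :: real
  assumes "R \<in> borel_measurable borel" "\<And>t. \<bar>R t\<bar> \<le> B"
  shows "has_bochner_integral lborel (\<lambda>t. (sgn (y - t) - sgn (s - t)) * R t) (Sg R y - Sg R s)"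
  using has_bochner_integral_diff[OF has_bochner_integral_integrable[OF Sg_integrable[OF assms, of y]]
     has_bochner_integral_integrable[OF Sg_integrable[OF assms, of s]]]
  by (simp add: Sg_def algebra_simps)

context half_kernel_deriv begin

text \<open>A change of q moves the kernel argument in the imaginary direction, whence the factor i;
  the sign factor stays the same.\<close>

lemma J_deriv_q:
  assumes e: "e = (\<lambda>_. 1) \<or> e = sgn"
  shows "((\<lambda>q. JJ e G q s) has_vector_derivative \<i> * JJ e dG q s) (at q within S)"
proof (rule has_vector_derivative_remainder)
  fix y assume y: "y \<noteq> q"
  define d where "d = \<bar>y - q\<bar>"
  have d: "d > 0" using y by (simp add: d_def)
  have "norm (JJ e G y s - JJ e G q s - (y - q) *\<^sub>R (\<i> * JJ e dG q s)) \<le> (LINT t|lborel. 4 * C' * d * md b' d \<bar>s - t\<bar>)"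
  proof (rule has_bochner_integral_norm_bound)
    show "has_bochner_integral lborel
      (\<lambda>t. e (s - t) *\<^sub>R G (Complex \<bar>s - t\<bar> y) t - e (s - t) *\<^sub>R G (Complex \<bar>s - t\<bar> q) t
       - (y - q) *\<^sub>R (\<i> * (e (s - t) *\<^sub>R dG (Complex \<bar>s - t\<bar> q) t))) (JJ e G y s - JJ e G q s - (y - q) *\<^sub>R (\<i> * JJ e dG q s))"
      unfolding JJ_def by (intro has_bochner_integral_diff has_bochner_integral_scaleR_right has_bochner_integral_mult_right
          has_bochner_integral_integrable J_integrable[OF e] D.J_integrable[OF e])
    show "integrable lborel (\<lambda>t. 4 * C' * d * md b' d \<bar>s - t\<bar>)"
      by (intro integrable_mult_right integrable_md D.b d)
    show "AE t in lborel. norm (e (s - t) *\<^sub>R G (Complex \<bar>s - t\<bar> y) t - e (s - t) *\<^sub>R G (Complex \<bar>s - t\<bar> q) t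
       - (y - q) *\<^sub>R (\<i> * (e (s - t) *\<^sub>R dG (Complex \<bar>s - t\<bar> q) t))) \<le> 4 * C' * d * md b' d \<bar>s - t\<bar>"
      using AE_lborel_singleton[of s]
    proof eventually_elim
      fix t assume "t \<noteq> s"
      define z w where "z = Complex \<bar>s - t\<bar> q" and "w = Complex \<bar>s - t\<bar> y"
      have wz: "w - z = (y - q) *\<^sub>R \<i>" by (simp add: w_def z_def complex_eq_iff)
      have "cmod (z - w) = d" using arg_cong[OF wz, of cmod] by (simp add: d_def norm_minus_commute)
      hence "norm (G w t - G z t - (w - z) * dG z t) \<le> d * (4 * C' * md b' d \<bar>s - t\<bar>)"
        using \<open>t \<noteq> s\<close> by (intro taylor) (auto simp: z_def w_def)
      hence "\<bar>e (s - t)\<bar> * norm (G w t - G z t - (w - z) * dG z t) \<le> 1 * (d * (4 * C' * md b' d \<bar>s - t\<bar>))"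
        using e_abs[OF e] by (intro mult_mono) auto
      thus "norm (e (s - t) *\<^sub>R G (Complex \<bar>s - t\<bar> y) t - e (s - t) *\<^sub>R G (Complex \<bar>s - t\<bar> q) t
       - (y - q) *\<^sub>R (\<i> * (e (s - t) *\<^sub>R dG (Complex \<bar>s - t\<bar> q) t))) \<le> 4 * C' * d * md b' d \<bar>s - t\<bar>"
        unfolding norm_scaleR[symmetric] wz by (simp add: z_def w_def algebra_simps)
    qed
  qed
  also have "\<dots> = 4 * C' * Cb b' * d * d powr (1 - b')" using integrable_md[OF D.b d] by simp
  finally show "norm (JJ e G y s - JJ e G q s - (y - q) *\<^sub>R (\<i> * JJ e dG q s)) \<le> (4 * C' * Cb b') * \<bar>y - q\<bar> * \<bar>y - q\<bar> powr (1 - b')"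
    by (simp add: d_def)
qed (use D.b in auto)

text \<open>When t is not between s and y, the distance to t changes by exactly
  \<open>(y - s) * sgn (s - t)\<close>.\<close>

lemma taylor_same_side:
  assumes "t \<noteq> s" "t \<noteq> y" "sgn (s - t) = sgn (y - t)"
  shows "cmod (G (Complex \<bar>y - t\<bar> q) t - G (Complex \<bar>s - t\<bar> q) t - ((y - s) * sgn (s - t)) *\<^sub>R dG (Complex \<bar>s - t\<bar> q) t)
     \<le> 4 * C' * \<bar>y - s\<bar> * (md b' \<bar>y - s\<bar> \<bar>s - t\<bar> + md b' \<bar>y - s\<bar> \<bar>y - t\<bar>)"
proof -
  define d where "d = \<bar>y - s\<bar>"
  define z w where "z = Complex \<bar>s - t\<bar> q" and "w = Complex \<bar>y - t\<bar> q"
  define \<tau> where "\<tau> = min \<bar>s - t\<bar> \<bar>y - t\<bar>"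
  have nn: "md b' d \<bar>s - t\<bar> \<ge> 0" "md b' d \<bar>y - t\<bar> \<ge> 0" by (auto intro!: md_nonneg simp: d_def)
  have wz: "w - z = of_real ((y - s) * sgn (s - t))"
    using assms by (auto simp: w_def z_def complex_eq_iff sgn_if abs_if split: if_splits)
  have "cmod (z - w) = \<bar>(y - s) * sgn (s - t)\<bar>"
    unfolding norm_minus_commute[of z w] wz by (rule norm_of_real)
  hence "cmod (z - w) = d" using assms by (simp add: d_def abs_mult abs_sgn_eq)
  hence "norm (G w t - G z t - (w - z) * dG z t) \<le> d * (4 * C' * md b' d \<tau>)"
    using assms by (intro taylor) (auto simp: z_def w_def \<tau>_def)
  also have "\<dots> \<le> d * (4 * C' * (md b' d \<bar>s - t\<bar> + md b' d \<bar>y - t\<bar>))"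
    using D.C_nonneg nn by (intro mult_left_mono) (auto simp: \<tau>_def min_def d_def)
  finally show ?thesis unfolding wz by (simp add: z_def w_def d_def mult_ac scaleR_conv_of_real)
qed

lemma dG_near:
  assumes "t \<noteq> s" "\<bar>s - t\<bar> \<le> d"
  shows "cmod ((d * r) *\<^sub>R dG (Complex \<bar>s - t\<bar> q) t) \<le> \<bar>r\<bar> * (C' * (d * md b' d \<bar>s - t\<bar>))"
proof -
  have d: "d > 0" using assms by linarith
  have "cmod (dG (Complex \<bar>s - t\<bar> q) t) \<le> C' * md b' d \<bar>s - t\<bar>"
    using D.bound_powr[of "Complex \<bar>s - t\<bar> q" t] assms by (simp add: md_eq_powr)
  hence "(\<bar>r\<bar> * d) * cmod (dG (Complex \<bar>s - t\<bar> q) t) \<le> (\<bar>r\<bar> * d) * (C' * md b' d \<bar>s - t\<bar>)"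
    using d by (intro mult_left_mono) auto
  thus ?thesis using d by (simp add: abs_mult mult_ac)
qed

text \<open>Differentiating |s - t| produces the sign factor. The kernel is even in s - t, so no
  boundary term appears at t = s: for t between s and y the increment of \<open>G\<close> is small
  by \<open>powr_increment\<close>.\<close>

lemma J_deriv_s:
  "((\<lambda>s. JJ (\<lambda>_. 1) G q s) has_vector_derivative JJ sgn dG q s) (at s within S)"
proof (rule has_vector_derivative_remainder)
  fix y assume y: "y \<noteq> s"
  define d where "d = \<bar>y - s\<bar>"
  have d: "d > 0" using y by (simp add: d_def)
  \<comment> \<open>Large enough for both cases below: 4 C' from the Taylor estimate, and C' / (1 -
    b') + C' for t between s and y.\<close>
  define K where "K = C' * (5 + 1 / (1 - b'))"
  have K: "4 * C' \<le> K" "C' / (1 - b') + C' \<le> K" 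
  proof -
    have "0 \<le> C' * (1 / (1 - b'))" using D.C_nonneg D.b by (intro mult_nonneg_nonneg) auto
    thus "4 * C' \<le> K" "C' / (1 - b') + C' \<le> K" using D.C_nonneg unfolding K_def distrib_left by auto
  qed
  let ?g = "\<lambda>t. 1 *\<^sub>R G (Complex \<bar>y - t\<bar> q) t - 1 *\<^sub>R G (Complex \<bar>s - t\<bar> q) t - (y - s) *\<^sub>R (sgn (s - t) *\<^sub>R dG (Complex \<bar>s - t\<bar> q) t)"
  have "norm (JJ (\<lambda>_. 1) G q y - JJ (\<lambda>_. 1) G q s - (y - s) *\<^sub>R JJ sgn dG q s)
    \<le> (LINT t|lborel. K * d * (md b' d \<bar>s - t\<bar> + md b' d \<bar>y - t\<bar>))"
  proof (rule has_bochner_integral_norm_bound)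
    show "has_bochner_integral lborel ?g (JJ (\<lambda>_. 1) G q y - JJ (\<lambda>_. 1) G q s - (y - s) *\<^sub>R JJ sgn dG q s)"
      unfolding JJ_def
      by (intro has_bochner_integral_diff has_bochner_integral_scaleR_right has_bochner_integral_integrable
          J_integrable[of "\<lambda>_. 1", OF disjI1] D.J_integrable[OF disjI2] refl)
    show "integrable lborel (\<lambda>t. K * d * (md b' d \<bar>s - t\<bar> + md b' d \<bar>y - t\<bar>))"
      by (intro integrable_mult_right Bochner_Integration.integrable_add integrable_md D.b d)
    show "AE t in lborel. norm (?g t) \<le> K * d * (md b' d \<bar>s - t\<bar> + md b' d \<bar>y - t\<bar>)"
      using AE_lborel_singleton[of s] AE_lborel_singleton[of y]
    proof eventually_elim
      fix t assume t: "t \<noteq> s" "t \<noteq> y"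
      have nn: "md b' d \<bar>s - t\<bar> \<ge> 0" "md b' d \<bar>y - t\<bar> \<ge> 0" using d by (auto intro!: md_nonneg)
      show "norm (?g t) \<le> K * d * (md b' d \<bar>s - t\<bar> + md b' d \<bar>y - t\<bar>)"
      proof (cases "sgn (s - t) = sgn (y - t)")
        case True
        have "norm (?g t) \<le> 4 * C' * d * (md b' d \<bar>s - t\<bar> + md b' d \<bar>y - t\<bar>)"
          using taylor_same_side[OF t True, of q] by (simp add: d_def)
        also have "\<dots> \<le> K * d * (md b' d \<bar>s - t\<bar> + md b' d \<bar>y - t\<bar>)"
          using K d nn by (intro mult_right_mono) auto
        finally show ?thesis .
      next
        case False
        have le: "\<bar>s - t\<bar> \<le> d" "\<bar>y - t\<bar> \<le> d" using e_neq[of sgn, OF disjI2[OF refl] False] by (auto simp: d_def)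
        have 1: "norm (1 *\<^sub>R G (Complex \<bar>y - t\<bar> q) t - 1 *\<^sub>R G (Complex \<bar>s - t\<bar> q) t) \<le> C' / (1 - b') * (d * md b' d \<bar>s - t\<bar>)"
        proof -
          have "C' / (1 - b') * d powr (1 - b') \<le> C' / (1 - b') * (d * md b' d \<bar>s - t\<bar>)"
            using le t D.C_nonneg D.b by (intro mult_left_mono powr_le_md) auto
          thus ?thesis using powr_increment[of "\<bar>y - t\<bar>" "\<bar>s - t\<bar>" d q t] le t by simp
        qed
        have "(y - s) * sgn (s - t) = d * (sgn (y - s) * sgn (s - t))" by (simp add: d_def abs_sgn_eq mult_sgn_abs)
          (simp add: sgn_if)
        hence 2: "norm ((y - s) *\<^sub>R (sgn (s - t) *\<^sub>R dG (Complex \<bar>s - t\<bar> q) t)) \<le> 1 * (C' * (d * md b' d \<bar>s - t\<bar>))"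
          using dG_near[OF t(1) le(1), of "sgn (y - s) * sgn (s - t)" q] t y unfolding scaleR_scaleR
          by (simp only: abs_mult abs_sgn_eq) (simp add: d_def)
        have "norm (?g t) \<le> (C' / (1 - b') + C') * (d * md b' d \<bar>s - t\<bar>)"
          using norm_triangle_ineq4[of "1 *\<^sub>R G (Complex \<bar>y - t\<bar> q) t - 1 *\<^sub>R G (Complex \<bar>s - t\<bar> q) t"] 1 2
          unfolding distrib_right by (smt (verit, best))
        also have "\<dots> \<le> K * (d * (md b' d \<bar>s - t\<bar> + md b' d \<bar>y - t\<bar>))"
          using K nn d order_trans[OF _ K(1)] D.C_nonneg by (intro mult_mono) auto
        finally show ?thesis by (simp add: mult.assoc)
      qed
    qed
  qed
  also have "\<dots> = 2 * K * Cb b' * d * d powr (1 - b')" using integrable_md[OF D.b d] by simp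
  finally show "norm (JJ (\<lambda>_. 1) G q y - JJ (\<lambda>_. 1) G q s - (y - s) *\<^sub>R JJ sgn dG q s) \<le> (2 * K * Cb b') * \<bar>y - s\<bar> * \<bar>y - s\<bar> powr (1 - b')"
    by (simp add: d_def)
qed (use D.b in auto)

text \<open>The sign factor jumps at t = s, so the derivative formally contains the boundary term 2
  R(s), where \<open>R\<close> is the limit of \<open>Re G\<close> at height 0. \<open>Sg R\<close>
  has the same formal derivative. For a merely measurable \<open>R\<close> the two terms may fail to
  be differentiable separately, but their difference is differentiable.\<close>

lemma Re_J_deriv_s:
  fixes R :: "real \<Rightarrow> real" and B K0 :: real
  assumes Rm: "R \<in> borel_measurable borel" and RB: "\<And>t. \<bar>R t\<bar> \<le> B"
    and lim: "\<And>\<tau> t. 0 < \<tau> \<Longrightarrow> \<tau> \<le> 1 \<Longrightarrow> \<bar>Re (G (Complex \<tau> q) t) - R t\<bar> \<le> K0 * \<tau> powr (1 - b')"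
  shows "((\<lambda>s. Re (JJ sgn G q s) - Sg R s) has_vector_derivative Re (JJ (\<lambda>_. 1) dG q s)) (at s within S)"
proof (rule has_vector_derivative_remainder)
  fix y assume y: "y \<noteq> s" "\<bar>y - s\<bar> \<le> 1"
  define d where "d = \<bar>y - s\<bar>"
  have d: "d > 0" "d \<le> 1" using y by (auto simp: d_def)
  have K0: "K0 \<ge> 0" using lim[of 1 0] by (simp add: order_trans[OF abs_ge_zero])
  define K where "K = 4 * C' + K0"
  have K: "4 * C' \<le> K" "K0 + C' \<le> K" using D.C_nonneg K0 by (auto simp: K_def)
  let ?g = "\<lambda>t. Re (sgn (y - t) *\<^sub>R G (Complex \<bar>y - t\<bar> q) t) - Re (sgn (s - t) *\<^sub>R G (Complex \<bar>s - t\<bar> q) t)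
      - (sgn (y - t) - sgn (s - t)) * R t - (y - s) * Re (1 *\<^sub>R dG (Complex \<bar>s - t\<bar> q) t)"
  let ?x = "Re (JJ sgn G q y) - Re (JJ sgn G q s) - (Sg R y - Sg R s) - (y - s) * Re (JJ (\<lambda>_. 1) dG q s)"
  have "norm ?x \<le> (LINT t|lborel. K * d * (md b' d \<bar>s - t\<bar> + md b' d \<bar>y - t\<bar>))"
  proof (rule has_bochner_integral_norm_bound)
    show "has_bochner_integral lborel ?g ?x"
      unfolding JJ_def
      by (intro has_bochner_integral_diff has_bochner_integral_mult_right Sg_diff[OF Rm RB]
          has_bochner_integral_bounded_linear[OF bounded_linear_Re] has_bochner_integral_integrable
          J_integrable[OF disjI2] D.J_integrable[of "\<lambda>_. 1", OF disjI1] refl)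
    show "integrable lborel (\<lambda>t. K * d * (md b' d \<bar>s - t\<bar> + md b' d \<bar>y - t\<bar>))"
      by (intro integrable_mult_right Bochner_Integration.integrable_add integrable_md D.b d)
    show "AE t in lborel. norm (?g t) \<le> K * d * (md b' d \<bar>s - t\<bar> + md b' d \<bar>y - t\<bar>)"
      using AE_lborel_singleton[of s] AE_lborel_singleton[of y]
    proof eventually_elim
      fix t assume t: "t \<noteq> s" "t \<noteq> y"
      have nn: "md b' d \<bar>s - t\<bar> \<ge> 0" "md b' d \<bar>y - t\<bar> \<ge> 0" using d by (auto intro!: md_nonneg)
      show "norm (?g t) \<le> K * d * (md b' d \<bar>s - t\<bar> + md b' d \<bar>y - t\<bar>)"
      proof (cases "sgn (s - t) = sgn (y - t)")
        case True
        let ?T = "G (Complex \<bar>y - t\<bar> q) t - G (Complex \<bar>s - t\<bar> q) t - ((y - s) * sgn (s - t)) *\<^sub>R dG (Complex \<bar>s - t\<bar> q) t"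
        have ss: "sgn (s - t) * sgn (s - t) = 1" using t by (simp add: sgn_if)
        have "?g t = sgn (s - t) * Re ?T"
          unfolding True[symmetric] right_diff_distrib minus_complex.sel scaleR_complex.sel
          using ss by (simp add: algebra_simps)
        hence "norm (?g t) = \<bar>Re ?T\<bar>" using t by (simp add: abs_mult abs_sgn_eq)
        also have "\<dots> \<le> cmod ?T" by (rule abs_Re_le_cmod)
        also have "\<dots> \<le> 4 * C' * d * (md b' d \<bar>s - t\<bar> + md b' d \<bar>y - t\<bar>)"
          using taylor_same_side[OF t True, of q] by (simp add: d_def)
        also have "\<dots> \<le> K * d * (md b' d \<bar>s - t\<bar> + md b' d \<bar>y - t\<bar>)"
          using K d nn by (intro mult_right_mono) auto
        finally show ?thesis .
      next
        case False
        have le: "\<bar>s - t\<bar> \<le> d" "\<bar>y - t\<bar> \<le> d" using e_neq[of sgn, OF disjI2[OF refl] False] by (auto simp: d_def)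
        \<comment> \<open>Close to the jump \<open>Re G\<close> is compared with its limit
          \<open>R\<close>; the \<open>R\<close> terms cancel against the increment of
          \<open>Sg R\<close>.\<close>
        have 1: "\<bar>Re (G (Complex r q) t) - R t\<bar> \<le> K0 * (d * md b' d r)" if "0 < r" "r \<le> d" for r
        proof -
          have "\<bar>Re (G (Complex r q) t) - R t\<bar> \<le> K0 * r powr (1 - b')" using lim[of r t] that d by simp
          also have "\<dots> \<le> K0 * d powr (1 - b')" using that K0 D.b by (intro mult_left_mono powr_mono2) auto
          also have "\<dots> \<le> K0 * (d * md b' d r)" using powr_le_md[OF that] K0 by (intro mult_left_mono)
          finally show ?thesis .
        qed
        have "\<bar>Re (G (Complex \<bar>y - t\<bar> q) t) - R t\<bar> \<le> K0 * (d * md b' d \<bar>y - t\<bar>)"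
             "\<bar>Re (G (Complex \<bar>s - t\<bar> q) t) - R t\<bar> \<le> K0 * (d * md b' d \<bar>s - t\<bar>)"
          using le t by (auto intro!: 1)
        hence 2: "\<bar>sgn (y - t) * (Re (G (Complex \<bar>y - t\<bar> q) t) - R t)\<bar> \<le> K0 * (d * md b' d \<bar>y - t\<bar>)"
             "\<bar>sgn (s - t) * (Re (G (Complex \<bar>s - t\<bar> q) t) - R t)\<bar> \<le> K0 * (d * md b' d \<bar>s - t\<bar>)"
          using t by (auto simp: abs_mult abs_sgn_eq)
        have "cmod ((d * sgn (y - s)) *\<^sub>R dG (Complex \<bar>s - t\<bar> q) t) \<le> C' * (d * md b' d \<bar>s - t\<bar>)"
          using dG_near[OF t(1) le(1), of "sgn (y - s)" q] y by (simp add: abs_sgn_eq)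
        moreover have "d * sgn (y - s) = y - s" by (simp add: d_def sgn_if)
        ultimately have 3: "\<bar>(y - s) * Re (1 *\<^sub>R dG (Complex \<bar>s - t\<bar> q) t)\<bar> \<le> C' * (d * md b' d \<bar>s - t\<bar>)"
          using abs_Re_le_cmod[of "(y - s) *\<^sub>R dG (Complex \<bar>s - t\<bar> q) t"] by simp
        have "?g t = sgn (y - t) * (Re (G (Complex \<bar>y - t\<bar> q) t) - R t) - sgn (s - t) * (Re (G (Complex \<bar>s - t\<bar> q) t) - R t)
            - (y - s) * Re (1 *\<^sub>R dG (Complex \<bar>s - t\<bar> q) t)"
          by (simp add: algebra_simps)
        hence "norm (?g t) \<le> K0 * (d * md b' d \<bar>y - t\<bar>) + K0 * (d * md b' d \<bar>s - t\<bar>) + C' * (d * md b' d \<bar>s - t\<bar>)"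
          using 2 3 by (simp only: real_norm_def) linarith
        also have "\<dots> \<le> K * (d * md b' d \<bar>y - t\<bar>) + K * (d * md b' d \<bar>s - t\<bar>)"
        proof -
          have "K0 * (d * md b' d \<bar>y - t\<bar>) \<le> K * (d * md b' d \<bar>y - t\<bar>)"
            using K nn d D.C_nonneg by (intro mult_right_mono) auto
          moreover have "(K0 + C') * (d * md b' d \<bar>s - t\<bar>) \<le> K * (d * md b' d \<bar>s - t\<bar>)"
            using K nn d by (intro mult_right_mono) auto
          ultimately show ?thesis unfolding distrib_right by linarith
        qed
        finally show ?thesis by (simp add: algebra_simps)
      qed
    qed
  qed
  also have "\<dots> = 2 * K * Cb b' * d * d powr (1 - b')" using integrable_md[OF D.b d(1)] by simp
  finally show "norm (Re (JJ sgn G q y) - Sg R y - (Re (JJ sgn G q s) - Sg R s) - (y - s) *\<^sub>R Re (JJ (\<lambda>_. 1) dG q s))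
      \<le> (2 * K * Cb b') * \<bar>y - s\<bar> * \<bar>y - s\<bar> powr (1 - b')"
    by (simp add: d_def algebra_simps)
qed (use D.b in auto)

end

section \<open>The potential of a periodic source\<close>

lemma kap_measurable [measurable]: "kap \<in> borel_measurable borel" "dkap \<in> borel_measurable borel"
  unfolding kap_def[abs_def] dkap_def[abs_def]
  by (intro borel_measurable_divide borel_measurable_times borel_measurable_diff borel_measurable_power borel_measurable_uminus
      borel_measurable_continuous_onI continuous_intros)+

text \<open>Set to 0 outside the half-plane on which the kernel is used, so that joint measurability
  can be stated on the whole plane.\<close>

definition GW :: "(real \<Rightarrow> real \<Rightarrow> real) \<Rightarrow> complex \<Rightarrow> real \<Rightarrow> complex" where
  "GW F z t = (if Re z > 0 then W (F t) z else 0)"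

definition dGW :: "(real \<Rightarrow> real \<Rightarrow> real) \<Rightarrow> complex \<Rightarrow> real \<Rightarrow> complex" where
  "dGW F z t = (if Re z > 0 then dW (F t) z else 0)"

text \<open>\<open>kap\<close> integrates to zero over a period, so the kernel integrals do not see
  the zeroth Fourier mode of the source; this mode is carried separately through
  \<open>Sg\<close>.\<close>

definition mean :: "(real \<Rightarrow> real) \<Rightarrow> real" where
  "mean h = integral {-pi..pi} h / (2 * pi)"

lemma Sg_lipschitz:
  fixes R :: "real \<Rightarrow> real" and B :: real
  assumes [measurable]: "R \<in> borel_measurable borel" and "\<And>t. \<bar>R t\<bar> \<le> B"
  shows "\<bar>Sg R y - Sg R s\<bar> \<le> 2 * B * \<bar>y - s\<bar>"
proof -
  have B0: "B \<ge> 0" using assms(2)[of 0] by linarith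
  have "norm (Sg R y - Sg R s) \<le> (LINT t|lborel. 2 * B * indicator {min s y..max s y} t)"
  proof (rule has_bochner_integral_norm_bound[OF Sg_diff[OF assms]])
    show "AE t in lborel. norm ((sgn (y - t) - sgn (s - t)) * R t) \<le> 2 * B * indicator {min s y..max s y} t"
    proof (rule AE_I2)
      fix t
      have "\<bar>sgn (y - t) - sgn (s - t)\<bar> \<le> 2 * indicator {min s y..max s y} t"
        by (auto simp: sgn_if indicator_def)
      hence "\<bar>sgn (y - t) - sgn (s - t)\<bar> * \<bar>R t\<bar> \<le> 2 * indicator {min s y..max s y} t * B"
        using assms by (intro mult_mono) auto
      thus "norm ((sgn (y - t) - sgn (s - t)) * R t) \<le> 2 * B * indicator {min s y..max s y} t"
        by (simp add: abs_mult mult_ac)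
    qed
  qed simp
  also have "\<dots> = 2 * B * \<bar>y - s\<bar>" by (simp add: min_def max_def)
  finally show ?thesis by simp
qed

lemma Sg_0: "Sg R 0 = 0"
  by (simp add: Sg_def)

text \<open>Continuity is demanded along the period only. In t the source is merely measurable,
  because the data of the two layers do not match at the interface.\<close>

locale source =
  fixes F :: "real \<Rightarrow> real \<Rightarrow> real" and M :: real
  assumes Fm: "(\<lambda>x. F (fst x) (snd x)) \<in> borel_measurable borel"
    and Fc: "\<And>t. continuous_on UNIV (F t)"
    and Fper: "\<And>t y. F t (y + 2 * pi) = F t y"
    and Fb: "\<And>t y. \<bar>F t y\<bar> \<le> M"
begin

lemma M_nonneg: "M \<ge> 0"
  using Fb[of 0 0] by linarith

lemma measurable_F [measurable (raw)]:
  "f \<in> borel_measurable N \<Longrightarrow> g \<in> borel_measurable N \<Longrightarrow> (\<lambda>x. F (f x) (g x)) \<in> borel_measurable N"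
  using measurable_compose[OF borel_measurable_Pair Fm, of f N g] by simp

text \<open>Measurability in the parameters is that of a Lebesgue integral of a jointly measurable
  function, so the gauge integral is first rewritten as one.\<close>

lemma measurable_kernel_integral:
  fixes k :: "complex \<Rightarrow> complex"
  assumes [measurable]: "k \<in> borel_measurable borel"
    and k: "\<And>\<tau> S. \<tau> > 0 \<Longrightarrow> continuous_on S (\<lambda>y. k (Complex \<tau> y))"
  shows "(\<lambda>x. if Re (fst x) > 0 then integral {-pi..pi} (\<lambda>y. k (fst x - \<i> * of_real y) * of_real (F (snd x) y)) else 0)
     \<in> borel_measurable (borel :: (complex \<times> real) measure)"
proof -
  have eq: "integral {-pi..pi} (\<lambda>y. k (z - \<i> * of_real y) * of_real (F t y)) =
     (LINT y|lborel. indicator {-pi..pi} y *\<^sub>R (k (z - \<i> * of_real y) * of_real (F t y)))" if "Re z > 0" for z t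
  proof -
    have "z - \<i> * of_real y = Complex (Re z) (Im z - y)" for y by (simp add: complex_eq_iff)
    hence "continuous_on {-pi..pi} (\<lambda>y. k (z - \<i> * of_real y) * of_real (F t y))"
      using that by (auto intro!: continuous_intros continuous_on_compose2[OF k[OF that, of UNIV]] continuous_on_subset[OF Fc])
    from set_borel_integral_eq_integral(2)[OF borel_integrable_atLeastAtMost'[OF this]]
    show ?thesis by (simp add: set_lebesgue_integral_def)
  qed
  have "(\<lambda>x. if Re (fst x) > 0 then (LINT y|lborel. indicator {-pi..pi} y *\<^sub>R (k (fst x - \<i> * of_real y) * of_real (F (snd x) y))) else 0)
     \<in> borel_measurable (borel :: (complex \<times> real) measure)"
  proof -
    have [measurable]: "fst \<in> borel_measurable (borel :: (complex \<times> real) measure)" "snd \<in> borel_measurable (borel :: (complex \<times> real) measure)"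
      by (intro borel_measurable_continuous_onI continuous_intros)+
    show ?thesis by measurable
  qed
  thus ?thesis by (rule measurable_cong[THEN iffD1, rotated]) (simp add: eq)
qed

lemma half_kernel_GW:
  assumes b: "0 < b" "b < 1"
  shows "half_kernel (GW F) (32 / b * M) b"
proof
  show "(\<lambda>x. GW F (fst x) (snd x)) \<in> borel_measurable borel"
    unfolding GW_def W_def by (rule measurable_kernel_integral) (auto intro: continuous_on_kap_Complex)
  fix z t assume z: "Re z > 0"
  show "cmod (GW F z t) \<le> 32 / b * M * mb b (Re z)"
    using norm_W_le[OF Fc Fper Fb b z] z by (simp add: GW_def)
  have "(W (F t) has_field_derivative dW (F t) z) (at z)" by (rule has_field_derivative_W[OF Fc Fper z])
  hence "((\<lambda>z. GW F z t) has_field_derivative dW (F t) z) (at z)"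
    by (rule has_field_derivative_transform_within_open[OF _ open_halfspace_Re_gt[of 0]]) (use z in \<open>auto simp: GW_def\<close>)
  thus "(\<lambda>z. GW F z t) field_differentiable at z" unfolding field_differentiable_def by blast
qed (use b in auto)

lemma mean_eq: "mean (F t) = (LINT y|lborel. indicator {-pi..pi} y *\<^sub>R F t y) / (2 * pi)"
  using set_borel_integral_eq_integral(2)[OF borel_integrable_atLeastAtMost'[OF continuous_on_subset[OF Fc[of t]], of "-pi" pi]]
  by (simp add: mean_def set_lebesgue_integral_def)

lemma measurable_mean [measurable]: "(\<lambda>t. mean (F t)) \<in> borel_measurable borel"
  unfolding mean_eq by measurable

lemma abs_mean_le: "\<bar>mean (F t)\<bar> \<le> M"
proof -
  have "norm (integral {-pi..pi} (F t)) \<le> M * (2 * pi)"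
    by (rule norm_integral_period_le) (use Fb in \<open>auto intro: continuous_on_subset[OF Fc]\<close>)
  thus ?thesis by (simp add: mean_def abs_divide divide_le_eq)
qed

text \<open>The derivatives \<open>u\<^sub>q\<close>, \<open>u\<^sub>s\<close>, \<open>u\<^sub>q\<^sub>s\<close>, \<open>u\<^sub>q\<^sub>q\<close> of the potential \<open>u\<close> of \<open>F\<close>; \<open>u\<close> itself is recovered by integration in \<open>s\<close>.\<close>

definition pV :: "real \<Rightarrow> real \<Rightarrow> real" where
  "pV q s = - Im (JJ (\<lambda>_. 1) (GW F) q s) / 2"

definition pW :: "real \<Rightarrow> real \<Rightarrow> real" where
  "pW q s = Re (JJ sgn (GW F) q s) / 2 + Sg (\<lambda>t. mean (F t)) s / 2"

definition pA :: "real \<Rightarrow> real \<Rightarrow> real" where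
  "pA q s = - Im (JJ sgn (dGW F) q s) / 2"

definition pB :: "real \<Rightarrow> real \<Rightarrow> real" where
  "pB q s = - Re (JJ (\<lambda>_. 1) (dGW F) q s) / 2"

lemma pW_bound: 
  assumes b: "0 < b" "b < 1"
  shows "\<bar>pW q s\<bar> \<le> (32 / b * Cb b + \<bar>s\<bar>) * M"
proof -
  interpret half_kernel "GW F" "32 / b * M" b by (rule half_kernel_GW[OF b])
  have "\<bar>Re (JJ sgn (GW F) q s)\<bar> \<le> 32 / b * M * Cb b"
    using J_bound[of sgn q s] by (intro order_trans[OF abs_Re_le_cmod]) auto
  moreover have "\<bar>Sg (\<lambda>t. mean (F t)) s\<bar> \<le> 2 * M * \<bar>s\<bar>"
    using Sg_lipschitz[OF measurable_mean abs_mean_le, of s 0] by (simp add: Sg_0)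
  moreover have "0 \<le> 32 / b * M * Cb b" using b M_nonneg Cb_nonneg by (intro mult_nonneg_nonneg) auto
  ultimately show ?thesis by (simp add: pW_def algebra_simps abs_le_iff)
qed

text \<open>The constant involves the sup bound \<open>M\<close> alone: the s-derivative of the
  potential of a bounded source is Hoelder continuous with any exponent below 1. This is the
  smoothing on which the interpolation relies.\<close>

lemma pW_holder:
  assumes b: "0 < b" "b < 1" and d: "\<bar>q - q'\<bar> + \<bar>s - s'\<bar> \<le> d" "0 < d" "d \<le> 1"
  shows "\<bar>pW q s - pW q' s'\<bar> \<le> (128 / b * Cb b + 1) * M * d powr (1 - b)"
proof -
  interpret half_kernel "GW F" "32 / b * M" b by (rule half_kernel_GW[OF b])
  have 1: "\<bar>Re (JJ sgn (GW F) q s - JJ sgn (GW F) q' s')\<bar> \<le> 8 * (32 / b * M) * Cb b * d powr (1 - b)"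
    by (intro order_trans[OF abs_Re_le_cmod J_holder]) (use d in auto)
  have "\<bar>Sg (\<lambda>t. mean (F t)) s - Sg (\<lambda>t. mean (F t)) s'\<bar> \<le> 2 * M * \<bar>s - s'\<bar>"
    by (rule Sg_lipschitz[OF measurable_mean abs_mean_le])
  also have "\<dots> \<le> 2 * M * d powr (1 - b)"
  proof -
    have "d powr 1 \<le> d powr (1 - b)" using d b by (intro powr_mono') auto
    thus ?thesis using d M_nonneg by (intro mult_left_mono) auto
  qed
  finally have 2: "\<bar>Sg (\<lambda>t. mean (F t)) s - Sg (\<lambda>t. mean (F t)) s'\<bar> \<le> 2 * M * d powr (1 - b)" .
  have "(128 / b * Cb b + 1) * M * d powr (1 - b) = (8 * (32 / b * M) * Cb b * d powr (1 - b)) / 2 + (2 * M * d powr (1 - b)) / 2"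
    by (simp add: algebra_simps)
  moreover have "\<bar>(a / 2 + m / 2) - (a' / 2 + m' / 2)\<bar> \<le> X / 2 + Y / 2"
    if "\<bar>a - a'\<bar> \<le> X" "\<bar>m - m'\<bar> \<le> Y" for a a' m m' X Y :: real using that by linarith
  from this[OF 1[unfolded minus_complex.sel] 2]
  have "\<bar>pW q s - pW q' s'\<bar> \<le> (8 * (32 / b * M) * Cb b * d powr (1 - b)) / 2 + (2 * M * d powr (1 - b)) / 2"
    unfolding pW_def .
  ultimately show ?thesis by (simp only:)
qed

lemma pW_per: "pW (q + 2 * pi) s = pW q s"
proof -
  have "GW F (Complex r (q + 2 * pi)) t = GW F (Complex r q) t" for r t
  proof -
    have eq: "Complex r (q + 2 * pi) - \<i> * of_real y = Complex r q - \<i> * of_real y + \<i> * (2 * of_real pi)" for y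
      by (simp add: complex_eq_iff)
    show ?thesis unfolding GW_def W_def eq kap_add_2pi by simp
  qed
  thus ?thesis by (simp add: pW_def JJ_def)
qed

end

text \<open>Hoelder continuity along the period, uniform in t, is what \<open>norm_dW_le\<close>
  asks for; it makes u_qq and u_qs Hoelder continuous in both variables.\<close>

locale holder_source = source F M for F M +
  fixes H \<alpha> :: real
  assumes FH: "\<And>t x y. \<bar>F t x - F t y\<bar> \<le> H * \<bar>x - y\<bar> powr \<alpha>" and \<alpha>: "0 < \<alpha>" "\<alpha> < 1"
begin

sublocale hk: half_kernel_deriv "GW F" "32 / (1 - \<alpha>) * M" "1 - \<alpha>" "dGW F" "288 / (1 - \<alpha>) * H" "1 - \<alpha>"
proof (intro half_kernel_deriv.intro half_kernel_deriv_axioms.intro half_kernel_GW)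
  show "half_kernel (dGW F) (288 / (1 - \<alpha>) * H) (1 - \<alpha>)"
  proof
    show "(\<lambda>x. dGW F (fst x) (snd x)) \<in> borel_measurable borel"
      unfolding dGW_def dW_def by (rule measurable_kernel_integral) (auto intro: continuous_on_kap_Complex)
    fix z t assume z: "Re z > 0"
    show "cmod (dGW F z t) \<le> 288 / (1 - \<alpha>) * H * mb (1 - \<alpha>) (Re z)"
      using norm_dW_le[OF Fc Fper FH \<alpha> z] z by (simp add: dGW_def)
    obtain D where "(dW (F t) has_field_derivative D) (at z)"
      using dW_field_differentiable[OF Fc Fper z] unfolding field_differentiable_def by blast
    hence "((\<lambda>z. dGW F z t) has_field_derivative D) (at z)"
      by (rule has_field_derivative_transform_within_open[OF _ open_halfspace_Re_gt[of 0]]) (use z in \<open>auto simp: dGW_def\<close>)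
    thus "(\<lambda>z. dGW F z t) field_differentiable at z" unfolding field_differentiable_def by blast
  qed (use \<alpha> in auto)
  fix z t assume z: "Re z > 0"
  have "(W (F t) has_field_derivative dW (F t) z) (at z)" by (rule has_field_derivative_W[OF Fc Fper z])
  hence "(W (F t) has_field_derivative dGW F z t) (at z)" using z by (simp add: dGW_def)
  thus "((\<lambda>z. GW F z t) has_field_derivative dGW F z t) (at z)"
    by (rule has_field_derivative_transform_within_open[OF _ open_halfspace_Re_gt[of 0]]) (use z in \<open>auto simp: GW_def\<close>)
qed (use \<alpha> in auto)

lemma Re_vd: "(f has_vector_derivative D) G \<Longrightarrow> ((\<lambda>x. Re (f x)) has_vector_derivative Re D) G"
  by (rule bounded_linear.has_vector_derivative[OF bounded_linear_Re])

lemma Im_vd: "(f has_vector_derivative D) G \<Longrightarrow> ((\<lambda>x. Im (f x)) has_vector_derivative Im D) G"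
  by (rule bounded_linear.has_vector_derivative[OF bounded_linear_Im])

lemma pV_q: "((\<lambda>q. pV q s) has_vector_derivative pB q s) (at q within S)"
  using has_vector_derivative_divide[OF has_vector_derivative_minus[OF Im_vd[OF hk.J_deriv_q[of "\<lambda>_. 1" s q S]]], of 2]
  by (simp add: pV_def[abs_def] pB_def)

lemma pV_s: "((\<lambda>s. pV q s) has_vector_derivative pA q s) (at s within S)"
  using has_vector_derivative_divide[OF has_vector_derivative_minus[OF Im_vd[OF hk.J_deriv_s[of q s S]]], of 2]
  by (simp add: pV_def[abs_def] pA_def)

lemma pW_q: "((\<lambda>q. pW q s) has_vector_derivative pA q s) (at q within S)"
  using has_vector_derivative_add_const[of "\<lambda>q. Re (JJ sgn (GW F) q s) / 2" "Sg (\<lambda>t. mean (F t)) s / 2"]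
    has_vector_derivative_divide[OF Re_vd[OF hk.J_deriv_q[of sgn s q S]], of 2]
  by (simp add: pW_def[abs_def] pA_def)

lemma abs_diff_mean_le: "\<bar>F t q - mean (F t)\<bar> \<le> 2 * M"
  using Fb[of t q] abs_mean_le[of t] by linarith

lemma measurable_F_q: "(\<lambda>t. F t q) \<in> borel_measurable borel"
  by measurable

text \<open>Formally u_ss - F = - u_qq, with the possibly discontinuous F integrated once into
  \<open>Sg\<close>. By \<open>Re_W_approx\<close> the boundary value of the kernel is
  \<open>F t q - mean (F t)\<close>; the missing mean is the second term of
  \<open>pW\<close>.\<close>

lemma pW_s: "((\<lambda>s. pW q s - Sg (\<lambda>t. F t q) s / 2) has_vector_derivative - pB q s) (at s within S)"
proof -
  have "((\<lambda>s. Re (JJ sgn (GW F) q s) - Sg (\<lambda>t. F t q - mean (F t)) s) has_vector_derivative Re (JJ (\<lambda>_. 1) (dGW F) q s)) (at s within S)"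
  proof (rule hk.Re_J_deriv_s)
    show "(\<lambda>t. F t q - mean (F t)) \<in> borel_measurable borel" by measurable
    show "\<bar>F t q - mean (F t)\<bar> \<le> 2 * M" for t by (rule abs_diff_mean_le)
    fix \<tau> t :: real assume \<tau>: "0 < \<tau>" "\<tau> \<le> 1"
    show "\<bar>Re (GW F (Complex \<tau> q) t) - (F t q - mean (F t))\<bar> \<le> 60 * H / (1 - \<alpha>) * \<tau> powr (1 - (1 - \<alpha>))"
      using Re_W_approx[OF Fc Fper FH \<alpha> \<tau>, of t q] \<tau> by (simp add: GW_def mean_def)
  qed
  moreover have "Sg (\<lambda>t. F t q - mean (F t)) s = Sg (\<lambda>t. F t q) s - Sg (\<lambda>t. mean (F t)) s" for s
    unfolding Sg_def right_diff_distrib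
    by (intro Bochner_Integration.integral_diff Sg_integrable[OF measurable_F_q Fb] Sg_integrable[OF measurable_mean abs_mean_le])
  ultimately have "((\<lambda>s. Re (JJ sgn (GW F) q s) - (Sg (\<lambda>t. F t q) s - Sg (\<lambda>t. mean (F t)) s)) has_vector_derivative Re (JJ (\<lambda>_. 1) (dGW F) q s)) (at s within S)"
    by simp
  from has_vector_derivative_divide[OF this, of 2] show ?thesis
    by (simp add: pW_def[abs_def] pB_def diff_divide_distrib add_divide_distrib algebra_simps)
qed

lemma pAB_holder:
  assumes d: "\<bar>q - q'\<bar> + \<bar>s - s'\<bar> \<le> d" "d > 0"
  shows "\<bar>pA q s - pA q' s'\<bar> \<le> 4 * (288 / (1 - \<alpha>) * H) * Cb (1 - \<alpha>) * d powr \<alpha>"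
    and "\<bar>pB q s - pB q' s'\<bar> \<le> 4 * (288 / (1 - \<alpha>) * H) * Cb (1 - \<alpha>) * d powr \<alpha>"
    and "\<bar>pV q s - pV q' s'\<bar> \<le> 4 * (32 / (1 - \<alpha>) * M) * Cb (1 - \<alpha>) * d powr \<alpha>"
proof -
  have "\<bar>Im (JJ sgn (dGW F) q s - JJ sgn (dGW F) q' s')\<bar> \<le> 8 * (288 / (1 - \<alpha>) * H) * Cb (1 - \<alpha>) * d powr (1 - (1 - \<alpha>))"
    by (intro order_trans[OF abs_Im_le_cmod hk.D.J_holder] d) auto
  thus "\<bar>pA q s - pA q' s'\<bar> \<le> 4 * (288 / (1 - \<alpha>) * H) * Cb (1 - \<alpha>) * d powr \<alpha>"
    unfolding pA_def by (simp add: abs_le_iff)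
  have "\<bar>Re (JJ (\<lambda>_. 1) (dGW F) q s - JJ (\<lambda>_. 1) (dGW F) q' s')\<bar> \<le> 8 * (288 / (1 - \<alpha>) * H) * Cb (1 - \<alpha>) * d powr (1 - (1 - \<alpha>))"
    by (intro order_trans[OF abs_Re_le_cmod hk.D.J_holder] d) auto
  thus "\<bar>pB q s - pB q' s'\<bar> \<le> 4 * (288 / (1 - \<alpha>) * H) * Cb (1 - \<alpha>) * d powr \<alpha>"
    unfolding pB_def by (simp add: abs_le_iff)
  have "\<bar>Im (JJ (\<lambda>_. 1) (GW F) q s - JJ (\<lambda>_. 1) (GW F) q' s')\<bar> \<le> 8 * (32 / (1 - \<alpha>) * M) * Cb (1 - \<alpha>) * d powr (1 - (1 - \<alpha>))"
    by (intro order_trans[OF abs_Im_le_cmod hk.J_holder] d) auto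
  thus "\<bar>pV q s - pV q' s'\<bar> \<le> 4 * (32 / (1 - \<alpha>) * M) * Cb (1 - \<alpha>) * d powr \<alpha>"
    unfolding pV_def by (simp add: abs_le_iff)
qed

end

text \<open>Passes from increments d <= 1 of |q| + |p| to \<open>dist\<close>. Points more than 1/2
  apart are covered by the bound \<open>N\<close>.\<close>

lemma holder_on_bounded_intro:
  fixes f :: "real \<times> real \<Rightarrow> real"
  assumes K: "\<And>z w d. z \<in> S \<Longrightarrow> w \<in> S \<Longrightarrow> \<bar>fst z - fst w\<bar> + \<bar>snd z - snd w\<bar> \<le> d \<Longrightarrow> 0 < d \<Longrightarrow> d \<le> 1 \<Longrightarrow>
       \<bar>f z - f w\<bar> \<le> K * d powr \<theta>"
    and N: "\<And>z. z \<in> S \<Longrightarrow> \<bar>f z\<bar> \<le> N" and \<theta>: "0 < \<theta>" "\<theta> \<le> 1" and K0: "K \<ge> 0"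
    and zw: "z \<in> S" "w \<in> S"
  shows "\<bar>f z - f w\<bar> \<le> (2 * K + 4 * N) * dist z w powr \<theta>"
proof -
  have N0: "N \<ge> 0" using N[OF zw(1)] by linarith
  have two: "(2::real) powr \<theta> \<le> 2" using powr_mono[of \<theta> 1 "2::real"] \<theta> by simp
  have le: "\<bar>fst z - fst w\<bar> + \<bar>snd z - snd w\<bar> \<le> 2 * dist z w"
    using dist_fst_le[of z w] dist_snd_le[of z w] by (simp add: dist_real_def)
  consider "z = w" | "z \<noteq> w" "2 * dist z w \<le> 1" | "2 * dist z w > 1" by linarith
  thus ?thesis
  proof cases
    case 2
    have "\<bar>f z - f w\<bar> \<le> K * (2 * dist z w) powr \<theta>" using 2 by (intro K zw le) auto
    also have "\<dots> = K * (2 powr \<theta> * dist z w powr \<theta>)" by (simp add: powr_mult)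
    also have "\<dots> \<le> K * (2 * dist z w powr \<theta>)" using two K0 by (intro mult_left_mono mult_right_mono) auto
    also have "\<dots> \<le> (2 * K + 4 * N) * dist z w powr \<theta>" using N0 by (simp add: algebra_simps)
    finally show ?thesis .
  next
    case 3
    have "1 \<le> (2 * dist z w) powr \<theta>" using 3 \<theta> by (intro ge_one_powr_ge_zero) auto
    also have "\<dots> \<le> 2 * dist z w powr \<theta>" using two by (simp add: powr_mult mult_right_mono)
    finally have "2 * N * 1 \<le> 2 * N * (2 * dist z w powr \<theta>)" using N0 by (intro mult_left_mono) auto
    moreover have "\<bar>f z - f w\<bar> \<le> 2 * N" using N[OF zw(1)] N[OF zw(2)] by linarith
    ultimately have "\<bar>f z - f w\<bar> \<le> 4 * N * dist z w powr \<theta>" by linarith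
    also have "\<dots> \<le> (2 * K + 4 * N) * dist z w powr \<theta>" using K0 by (simp add: algebra_simps)
    finally show ?thesis .
  qed simp
qed

lemma holder_imp_continuous_on:
  fixes f :: "'a::metric_space \<Rightarrow> real"
  assumes "holder_on S \<theta> f" "\<theta> > 0"
  shows "continuous_on S f"
proof -
  obtain C where C: "\<And>z w. z \<in> S \<Longrightarrow> w \<in> S \<Longrightarrow> \<bar>f z - f w\<bar> \<le> C * dist z w powr \<theta>"
    using assms(1) unfolding holder_on_def by blast
  show ?thesis
    unfolding continuous_on_def
  proof
    fix x assume x: "x \<in> S"
    have "((\<lambda>y. \<bar>f y - f x\<bar>) \<longlongrightarrow> 0) (at x within S)"
    proof (rule tendsto_sandwich[OF _ _ tendsto_const])
      show "\<forall>\<^sub>F y in at x within S. \<bar>f y - f x\<bar> \<le> C * dist y x powr \<theta>"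
        unfolding eventually_at_filter using C x by (auto intro!: always_eventually)
      have "((\<lambda>y. C * dist y x powr \<theta>) \<longlongrightarrow> C * dist x x powr \<theta>) (at x within S)"
        using assms(2) by (intro tendsto_intros tendsto_powr') auto
      thus "((\<lambda>y. C * dist y x powr \<theta>) \<longlongrightarrow> 0) (at x within S)" by simp
    qed auto
    thus "(f \<longlongrightarrow> f x) (at x within S)"
      by (simp add: tendsto_rabs_zero_iff LIM_zero_iff)
  qed
qed

context source begin

text \<open>\<open>pW_bound\<close> grows linearly in s, so Hoelder continuity is established on
  unit balls; the exponent 1/2 is an arbitrary choice.\<close>

lemma pW_continuous: "continuous_on UNIV (\<lambda>z. pW (fst z) (snd z))"
proof -
  have "continuous_on (ball z 1) (\<lambda>z. pW (fst z) (snd z))" for z :: "real \<times> real"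
  proof (rule holder_imp_continuous_on)
    show "holder_on (ball z 1) (1/2) (\<lambda>z. pW (fst z) (snd z))"
      unfolding holder_on_def
    proof (intro exI ballI)
      fix x y assume xy: "x \<in> ball z 1" "y \<in> ball z 1"
      show "\<bar>pW (fst x) (snd x) - pW (fst y) (snd y)\<bar>
        \<le> (2 * ((128 / (1/2) * Cb (1/2) + 1) * M) + 4 * ((32 / (1/2) * Cb (1/2) + (\<bar>snd z\<bar> + 1)) * M)) * dist x y powr (1/2)"
      proof (rule holder_on_bounded_intro[OF _ _ _ _ _ xy, where f = "\<lambda>z. pW (fst z) (snd z)"])
        fix x y :: "real \<times> real" and d :: real
        assume "\<bar>fst x - fst y\<bar> + \<bar>snd x - snd y\<bar> \<le> d" "0 < d" "d \<le> 1"
        from pW_holder[OF _ _ this, of "1/2"]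
        show "\<bar>pW (fst x) (snd x) - pW (fst y) (snd y)\<bar> \<le> (128 / (1/2) * Cb (1/2) + 1) * M * d powr (1/2)" by simp
      next
        fix x assume "x \<in> ball z 1"
        hence "\<bar>snd x\<bar> \<le> \<bar>snd z\<bar> + 1" using dist_snd_le[of z x] by (simp add: dist_real_def)
        hence "(32 / (1/2) * Cb (1/2) + \<bar>snd x\<bar>) * M \<le> (32 / (1/2) * Cb (1/2) + (\<bar>snd z\<bar> + 1)) * M"
          using M_nonneg by (intro mult_right_mono) auto
        thus "\<bar>pW (fst x) (snd x)\<bar> \<le> (32 / (1/2) * Cb (1/2) + (\<bar>snd z\<bar> + 1)) * M"
          using pW_bound[of "1/2" "fst x" "snd x"] by simp
      qed (use M_nonneg Cb_nonneg in auto)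
    qed
  qed simp
  hence "continuous_on (\<Union>z. ball z 1) (\<lambda>z. pW (fst z) (snd z))"
    by (intro continuous_on_open_UN) auto
  moreover have "(\<Union>z::real \<times> real. ball z 1) = UNIV" by force
  ultimately show ?thesis by simp
qed

lemma pW_continuous_s: "continuous_on S (pW q)"
proof -
  have "continuous_on S (\<lambda>s. (q, s))" by (intro continuous_intros)
  from continuous_on_compose2[OF pW_continuous this] show ?thesis by simp
qed

text \<open>\<open>R\<close> is compared with a continuous function inside the interval only, so its
  one-sided limits may be used at a jump. In this way each layer can be treated up to its
  boundary.\<close>

lemma Sg_interval:
  fixes R :: "real \<Rightarrow> real" and K :: real
  assumes R: "R \<in> borel_measurable borel" "\<And>t. \<bar>R t\<bar> \<le> K"
    and f: "continuous_on {a..b} f" "\<And>t. a < t \<Longrightarrow> t < b \<Longrightarrow> R t = f t" and s: "a \<le> s" "s \<le> b"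
  shows "Sg R s = Sg R a + 2 * integral {a..s} f"
proof -
  have "has_bochner_integral lborel (\<lambda>t. 2 *\<^sub>R (indicator {a..s} t *\<^sub>R f t)) (2 *\<^sub>R integral {a..s} f)"
  proof (rule has_bochner_integral_scaleR_right)
    have "set_integrable lborel {a..s} f"
      by (rule borel_integrable_atLeastAtMost', rule continuous_on_subset[OF f(1)]) (use s in auto)
    thus "has_bochner_integral lborel (\<lambda>t. indicator {a..s} t *\<^sub>R f t) (integral {a..s} f)"
      using set_borel_integral_eq_integral(2)[of "{a..s}" f]
      by (simp add: has_bochner_integral_iff set_integrable_def set_lebesgue_integral_def)
  qed
  moreover have "AE t in lborel. 2 *\<^sub>R (indicator {a..s} t *\<^sub>R f t) = (sgn (s - t) - sgn (a - t)) * R t"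
    using AE_lborel_singleton[of a] AE_lborel_singleton[of s] AE_lborel_singleton[of b]
    by eventually_elim (use s f(2) in \<open>auto simp: indicator_def sgn_if\<close>)
  moreover have Rd: "has_bochner_integral lborel (\<lambda>t. (sgn (s - t) - sgn (a - t)) * R t) (Sg R s - Sg R a)" by (rule Sg_diff[OF R])
  ultimately have "2 *\<^sub>R integral {a..s} f = Sg R s - Sg R a"
    using integral_cong_AE[of "\<lambda>t. 2 *\<^sub>R (indicator {a..s} t *\<^sub>R f t)" lborel "\<lambda>t. (sgn (s - t) - sgn (a - t)) * R t"]
    by (auto simp: has_bochner_integral_iff borel_measurable_integrable)
  thus ?thesis by simp
qed

end

context holder_source begin

lemma pAB_continuous:
  "continuous_on UNIV (\<lambda>z. pA (fst z) (snd z))"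
proof -
  have "holder_on UNIV \<alpha> (\<lambda>z. pA (fst z) (snd z))"
    unfolding holder_on_def
  proof (intro exI ballI)
    fix z w :: "real \<times> real"
    define K where "K = 4 * (288 / (1 - \<alpha>) * H) * Cb (1 - \<alpha>)"
    have K: "K \<ge> 0" unfolding K_def using H0[OF Fc Fper FH \<alpha>] \<alpha> Cb_nonneg by (intro mult_nonneg_nonneg) auto
    show "\<bar>pA (fst z) (snd z) - pA (fst w) (snd w)\<bar> \<le> (K * 2 powr \<alpha>) * dist z w powr \<alpha>"
    proof (cases "z = w")
      case False
      have "\<bar>fst z - fst w\<bar> + \<bar>snd z - snd w\<bar> \<le> 2 * dist z w"
        using dist_fst_le[of z w] dist_snd_le[of z w] by (simp add: dist_real_def)
      from pAB_holder(1)[OF this] False show ?thesis by (simp add: K_def powr_mult mult.assoc)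
    qed simp
  qed
  thus ?thesis using \<alpha> by (intro holder_imp_continuous_on)
qed

end

text \<open>Oddness about \<open>s = 0\<close> and \<open>s = l\<close> makes the potential vanish on both walls up to a linear function of \<open>s\<close>, which \<open>c0\<close> removes.\<close>

locale odd_source = source F M for F M +
  fixes l :: real
  assumes l: "l > 0" and odd0: "\<And>t y. F (- t) y = - F t y" and oddl: "\<And>t y. F (2 * l - t) y = - F t y"
begin

lemma GW_odd: "(\<And>y. F t' y = - F t y) \<Longrightarrow> GW F z t' = - GW F z t"
  by (simp add: GW_def W_def)

text \<open>The substitution of 2 x - t for t keeps |x - t| and changes the sign of the source, so
  the integral equals its negative.\<close>

lemma pV_reflection:
  assumes "\<And>t y. F (2 * x - t) y = - F t y"
  shows "pV q x = 0"
proof -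
  define f where "f = (\<lambda>t. GW F (Complex \<bar>x - t\<bar> q) t)"
  have "f (2 * x + (-1) * t) = - f t" for t
  proof -
    have "\<bar>x - (2 * x - t)\<bar> = \<bar>x - t\<bar>" by simp
    thus ?thesis using GW_odd[OF assms] by (simp add: f_def)
  qed
  hence "integral\<^sup>L lborel f = - integral\<^sup>L lborel f"
    using lborel_integral_real_affine[of "-1" f "2 * x"] by simp
  thus ?thesis by (simp add: pV_def JJ_def f_def)
qed

lemma pV_0: "pV q 0 = 0" and pV_l: "pV q l = 0"
  using pV_reflection[of 0] pV_reflection[of l] odd0 oddl by simp_all

definition c0 :: real where "c0 = integral {0..l} (pW 0) / l"

definition Ws :: "real \<Rightarrow> real \<Rightarrow> real" where "Ws q s = pW q s - c0"

definition U :: "real \<Rightarrow> real \<Rightarrow> real" where "U q s = integral {0..s} (Ws q)"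

lemma c0_bound: "0 < b \<Longrightarrow> b < 1 \<Longrightarrow> \<bar>c0\<bar> \<le> (32 / b * Cb b + l) * M"
proof -
  assume b: "0 < b" "b < 1"
  have "norm (integral {0..l} (pW 0)) \<le> (32 / b * Cb b + l) * M * (l - 0)"
  proof (rule integral_bound)
    show "continuous_on {0..l} (pW 0)" by (rule pW_continuous_s)
    fix t assume t: "t \<in> {0..l}"
    have "\<bar>pW 0 t\<bar> \<le> (32 / b * Cb b + \<bar>t\<bar>) * M" by (rule pW_bound[OF b])
    also have "\<dots> \<le> (32 / b * Cb b + l) * M" using t M_nonneg by (intro mult_right_mono) auto
    finally show "norm (pW 0 t) \<le> (32 / b * Cb b + l) * M" by simp
  qed (use l in auto)
  thus ?thesis using l by (simp add: c0_def abs_divide divide_le_eq)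
qed

lemma Ws_continuous_s: "continuous_on S (Ws q)"
  unfolding Ws_def by (intro continuous_intros pW_continuous_s)

lemma U_0: "U q 0 = 0"
  by (simp add: U_def)

lemma U_s:
  assumes "s \<in> {0..l}"
  shows "(U q has_vector_derivative Ws q s) (at s within {0..l})"
  unfolding U_def by (rule integral_has_vector_derivative[OF Ws_continuous_s assms])

lemma Ws_bound:
  assumes b: "0 < b" "b < 1" and s: "s \<in> {0..l}"
  shows "\<bar>Ws q s\<bar> \<le> 2 * (32 / b * Cb b + l) * M"
proof -
  have "\<bar>pW q s\<bar> \<le> (32 / b * Cb b + \<bar>s\<bar>) * M" by (rule pW_bound[OF b])
  also have "\<dots> \<le> (32 / b * Cb b + l) * M" using s M_nonneg by (intro mult_right_mono) auto
  finally have "\<bar>pW q s\<bar> \<le> (32 / b * Cb b + l) * M" .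
  thus ?thesis using c0_bound[OF b] unfolding Ws_def by linarith
qed

lemma Ws_holder:
  assumes "0 < b" "b < 1" "\<bar>q - q'\<bar> + \<bar>s - s'\<bar> \<le> d" "0 < d" "d \<le> 1"
  shows "\<bar>Ws q s - Ws q' s'\<bar> \<le> (128 / b * Cb b + 1) * M * d powr (1 - b)"
  using pW_holder[OF assms] by (simp add: Ws_def)

lemma Ws_per: "Ws (q + 2 * pi) s = Ws q s"
  by (simp add: Ws_def pW_per)

lemma U_per: "U (q + 2 * pi) s = U q s"
  by (simp add: U_def Ws_per[abs_def])

end

locale odd_holder_source = odd_source F M l + holder_source F M H \<alpha> for F M l H \<alpha>
begin

lemma Ws_q: "((\<lambda>q. Ws q s) has_vector_derivative pA q s) (at q within S)"
  unfolding Ws_def using has_vector_derivative_diff[OF pW_q has_vector_derivative_const[of c0]] by simp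

text \<open>Under the integral the q-derivative of \<open>Ws\<close> is \<open>pA\<close>, which is
  also the s-derivative of \<open>pV\<close>; and \<open>pV\<close> vanishes at s = 0.\<close>

lemma U_q:
  assumes s: "s \<in> {0..l}"
  shows "((\<lambda>q. U q s) has_vector_derivative pV q s) (at q)"
proof -
  have "((\<lambda>q. integral (cbox 0 s) (Ws q)) has_vector_derivative integral (cbox 0 s) (pA q)) (at q within UNIV)"
  proof (rule leibniz_rule_vector_derivative)
    show "((\<lambda>x. Ws x t) has_vector_derivative pA x t) (at x within UNIV)" for x t by (rule Ws_q)
    show "Ws x integrable_on cbox 0 s" for x
      by (rule integrable_continuous) (rule Ws_continuous_s)
    show "continuous_on (UNIV \<times> cbox 0 s) (\<lambda>(x, t). pA x t)"
      unfolding split_beta by (rule continuous_on_subset[OF pAB_continuous]) simp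
  qed auto
  moreover have "(pA q has_integral (pV q s - pV q 0)) {0..s}"
    by (rule fundamental_theorem_of_calculus) (use s pV_s in auto)
  hence "integral {0..s} (pA q) = pV q s" by (simp add: pV_0 integral_unique)
  ultimately show ?thesis by (simp add: U_def[abs_def])
qed

text \<open>The q-derivative on this wall is \<open>pV q l = 0\<close>, so the value does not depend
  on q; \<open>c0\<close> was chosen to make it vanish at q = 0.\<close>

lemma U_l: "U q l = 0"
proof -
  have "((\<lambda>q. U q l) has_vector_derivative 0) (at q)" for q
    using U_q[of l q] l by (simp add: pV_l)
  hence "U q l = U 0 l"
    using has_vector_derivative_zero_constant[of UNIV "\<lambda>q. U q l"] by (metis UNIV_I convex_UNIV)
  also have "\<dots> = 0"
  proof -
    have "U 0 l = integral {0..l} (pW 0) - integral {0..l} (\<lambda>_. c0)"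
      unfolding U_def Ws_def
      by (rule Henstock_Kurzweil_Integration.integral_diff) (auto intro!: integrable_continuous_interval pW_continuous_s)
    thus ?thesis using l by (simp add: c0_def)
  qed
  finally show ?thesis .
qed

text \<open>On an interval where the source is continuous, \<open>Sg_interval\<close> turns the term
  subtracted in \<open>pW_s\<close> into a primitive, which can be differentiated up to the end
  points.\<close>

lemma Ws_s:
  assumes f: "continuous_on {a..b} f" "\<And>t. a < t \<Longrightarrow> t < b \<Longrightarrow> F t q = f t" and s: "s \<in> {a..b}"
  shows "((\<lambda>s. Ws q s) has_vector_derivative f s - pB q s) (at s within {a..b})"
proof -
  have "((\<lambda>s. integral {a..s} f) has_vector_derivative f s) (at s within {a..b})"
    by (rule integral_has_vector_derivative[OF f(1) s])
  from has_vector_derivative_add[OF has_vector_derivative_add[OF has_vector_derivative_diff[OF pW_s has_vector_derivative_const[of c0]] this] has_vector_derivative_const[of "Sg (\<lambda>t. F t q) a / 2"]]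
  have "((\<lambda>s. pW q s - Sg (\<lambda>t. F t q) s / 2 - c0 + integral {a..s} f + Sg (\<lambda>t. F t q) a / 2) has_vector_derivative (- pB q s - 0 + f s + 0)) (at s within {a..b})" .
  moreover have "Ws q s = pW q s - Sg (\<lambda>t. F t q) s / 2 - c0 + integral {a..s} f + Sg (\<lambda>t. F t q) a / 2" if "s \<in> {a..b}" for s
    using Sg_interval[OF measurable_F_q Fb f, of s] that by (simp add: Ws_def add_divide_distrib)
  ultimately show ?thesis
    by (intro has_vector_derivative_transform[OF s, of "Ws q"]) auto
qed

end

section \<open>Finite-rank perturbations of isomorphisms\<close>

text \<open>With pointwise operations the spaces of the theorem become subspaces of a real vector
  space, to which spans, bases and dimension apply.\<close>

instantiation "fun" :: (type, real_vector) real_vector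
begin
definition scaleR_fun :: "real \<Rightarrow> ('a \<Rightarrow> 'b) \<Rightarrow> 'a \<Rightarrow> 'b" where
  "scaleR_fun c f = (\<lambda>x. c *\<^sub>R f x)"
instance
  by standard (auto simp: scaleR_fun_def fun_eq_iff algebra_simps)
end

text \<open>Relative to a set, because derivative operators respect sums only on differentiable
  functions.\<close>

definition linear_on' :: "'a::real_vector set \<Rightarrow> ('a \<Rightarrow> 'b::real_vector) \<Rightarrow> bool" where
  "linear_on' X f \<longleftrightarrow> (\<forall>x\<in>X. \<forall>y\<in>X. \<forall>a b. f (a *\<^sub>R x + b *\<^sub>R y) = a *\<^sub>R f x + b *\<^sub>R f y)"

lemma linear_on'D:
  assumes "linear_on' X f" "x \<in> X" "y \<in> X"
  shows "f (x + y) = f x + f y" "f (x - y) = f x - f y" "f (c *\<^sub>R x) = c *\<^sub>R f x" "f 0 = 0" "f (- x) = - f x"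
proof -
  have *: "f (a *\<^sub>R x + b *\<^sub>R y) = a *\<^sub>R f x + b *\<^sub>R f y" for a b
    using assms unfolding linear_on'_def by blast
  show "f (x + y) = f x + f y" "f (x - y) = f x - f y" "f (c *\<^sub>R x) = c *\<^sub>R f x" "f 0 = 0" "f (- x) = - f x"
    using *[of 1 1] *[of 1 "-1"] *[of c 0] *[of 0 0] *[of "-1" 0] by simp_all
qed

lemma subspace_lincomb: "subspace X \<Longrightarrow> (\<And>i. i < n \<Longrightarrow> x i \<in> X) \<Longrightarrow> (\<Sum>i<n. c i *\<^sub>R x i) \<in> X" for n :: nat
  by (rule subspace_sum) (auto intro: subspace_scale)

lemma linear_on'_sum:
  fixes n :: nat
  assumes "linear_on' X f" "subspace X" "\<And>i. i < n \<Longrightarrow> x i \<in> X"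
  shows "f (\<Sum>i<n. c i *\<^sub>R x i) = (\<Sum>i<n. c i *\<^sub>R f (x i))"
  using assms(3)
proof (induction n)
  case 0
  show ?case using linear_on'D(4)[OF assms(1)] subspace_0[OF assms(2)] by auto
next
  case (Suc n)
  have "f ((\<Sum>i<n. c i *\<^sub>R x i) + c n *\<^sub>R x n) = f (\<Sum>i<n. c i *\<^sub>R x i) + f (c n *\<^sub>R x n)"
    by (rule linear_on'D(1)[OF assms(1)])
      (auto intro!: subspace_scale[OF assms(2)] subspace_lincomb[OF assms(2)] Suc.prems)
  thus ?case using Suc linear_on'D(3)[OF assms(1) Suc.prems[of n] Suc.prems[of n], of "c n"] by simp
qed

lemma span_enum:
  fixes f :: "nat \<Rightarrow> 'a::real_vector"
  assumes "bij_betw f {..<n} B" "x \<in> span B"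
  shows "\<exists>c. (\<forall>i\<ge>n. c i = 0) \<and> x = (\<Sum>i<n. c i *\<^sub>R f i)"
proof -
  have "finite B" using assms(1) bij_betw_finite by blast
  then obtain u where u: "x = (\<Sum>v\<in>B. u v *\<^sub>R v)" using assms(2) by (auto simp: span_finite)
  have "(\<Sum>v\<in>B. u v *\<^sub>R v) = (\<Sum>i<n. u (f i) *\<^sub>R f i)"
    by (rule sum.reindex_bij_betw[OF assms(1), symmetric])
  thus ?thesis using u by (intro exI[of _ "\<lambda>i. if i < n then u (f i) else 0"]) auto
qed

text \<open>Independence modulo the span of a part \<open>Bz\<close> of the basis: the combination
  over \<open>Bz\<close> is moved to the other side, and the independence of the whole of
  \<open>B\<close> applies.\<close>

lemma independent_enum:
  fixes f :: "nat \<Rightarrow> 'a::real_vector"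
  assumes bij: "bij_betw f {..<n} (B - Bz)" and ind: "independent B" and fin: "finite B" and Bz: "Bz \<subseteq> B"
    and s: "(\<Sum>i<n. c i *\<^sub>R f i) \<in> span Bz" and i: "i < n"
  shows "c i = 0"
proof -
  define u where "u = (\<lambda>v. c (inv_into {..<n} f v))"
  have inv: "inv_into {..<n} f (f j) = j" if "j < n" for j
    using bij that by (simp add: bij_betw_def inv_into_f_f)
  have "finite Bz" using fin Bz finite_subset by blast
  then obtain w where w: "(\<Sum>i<n. c i *\<^sub>R f i) = (\<Sum>v\<in>Bz. w v *\<^sub>R v)" using s by (auto simp: span_finite)
  have "(\<Sum>v\<in>B - Bz. u v *\<^sub>R v) = (\<Sum>i<n. u (f i) *\<^sub>R f i)"
    by (rule sum.reindex_bij_betw[OF bij, symmetric])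
  also have "\<dots> = (\<Sum>i<n. c i *\<^sub>R f i)" by (rule sum.cong) (auto simp: u_def inv)
  finally have e: "(\<Sum>v\<in>B - Bz. u v *\<^sub>R v) = (\<Sum>v\<in>Bz. w v *\<^sub>R v)" using w by simp
  define g where "g = (\<lambda>v. if v \<in> Bz then - w v else u v)"
  have "(\<Sum>v\<in>B. g v *\<^sub>R v) = (\<Sum>v\<in>B - Bz. g v *\<^sub>R v) + (\<Sum>v\<in>Bz. g v *\<^sub>R v)"
    by (rule sum.subset_diff[OF Bz fin])
  also have "(\<Sum>v\<in>B - Bz. g v *\<^sub>R v) = (\<Sum>v\<in>B - Bz. u v *\<^sub>R v)" by (rule sum.cong) (auto simp: g_def)
  also have "(\<Sum>v\<in>Bz. g v *\<^sub>R v) = - (\<Sum>v\<in>Bz. w v *\<^sub>R v)" by (simp add: g_def sum_negf)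
  finally have z: "(\<Sum>v\<in>B. g v *\<^sub>R v) = 0" using e by simp
  have fi: "f i \<in> B - Bz" using bij i by (auto simp: bij_betw_def)
  hence "g (f i) = 0" using independentD[OF ind fin subset_refl z] by blast
  thus ?thesis using fi i by (simp add: g_def u_def inv)
qed

text \<open>With \<open>G\<close> the inverse of \<open>A - K \<circ> \<pi>\<close>, both the kernel and
  the cokernel of \<open>A\<close> are those of the endomorphism \<open>t + \<pi> (G (K t))\<close> of the finite-dimensional space \<open>Th\<close>.\<close>

locale finite_rank_perturbation =
  fixes X :: "'x::real_vector set" and Y :: "'y::real_vector set" and Th :: "'b::real_vector set"
    and A :: "'x \<Rightarrow> 'y" and G :: "'y \<Rightarrow> 'x" and \<pi> :: "'x \<Rightarrow> 'b" and K :: "'b \<Rightarrow> 'y" and S :: "'b set"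
  assumes X: "subspace X" and Y: "subspace Y" and Th: "subspace Th" and S: "finite S" "Th \<subseteq> span S"
    and A: "linear_on' X A" "\<And>x. x \<in> X \<Longrightarrow> A x \<in> Y"
    and G: "linear_on' Y G" "\<And>y. y \<in> Y \<Longrightarrow> G y \<in> X"
    and \<pi>: "linear_on' X \<pi>" "\<And>x. x \<in> X \<Longrightarrow> \<pi> x \<in> Th"
    and K: "linear_on' Th K" "\<And>t. t \<in> Th \<Longrightarrow> K t \<in> Y"
    and GB: "\<And>x. x \<in> X \<Longrightarrow> G (A x - K (\<pi> x)) = x"
    and BG: "\<And>y. y \<in> Y \<Longrightarrow> A (G y) - K (\<pi> (G y)) = y"
begin

definition Q :: "'b \<Rightarrow> 'b" where "Q t = \<pi> (G (K t))"
definition T :: "'b \<Rightarrow> 'b" where "T t = t + Q t"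

lemma Q_in: "t \<in> Th \<Longrightarrow> Q t \<in> Th"
  unfolding Q_def by (intro \<pi> G K)

lemma T_in: "t \<in> Th \<Longrightarrow> T t \<in> Th"
  unfolding T_def by (intro subspace_add[OF Th] Q_in)

lemma Q_lin: "linear_on' Th Q"
  unfolding linear_on'_def Q_def
proof (intro ballI allI)
  fix x y a b assume xy: "x \<in> Th" "y \<in> Th"
  have "K (a *\<^sub>R x + b *\<^sub>R y) = a *\<^sub>R K x + b *\<^sub>R K y" using K(1) xy unfolding linear_on'_def by blast
  moreover have "G (a *\<^sub>R K x + b *\<^sub>R K y) = a *\<^sub>R G (K x) + b *\<^sub>R G (K y)"
    using G(1) K(2)[OF xy(1)] K(2)[OF xy(2)] unfolding linear_on'_def by blast
  moreover have "\<pi> (a *\<^sub>R G (K x) + b *\<^sub>R G (K y)) = a *\<^sub>R \<pi> (G (K x)) + b *\<^sub>R \<pi> (G (K y))"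
    using \<pi>(1) G(2)[OF K(2)[OF xy(1)]] G(2)[OF K(2)[OF xy(2)]] unfolding linear_on'_def by blast
  ultimately show "\<pi> (G (K (a *\<^sub>R x + b *\<^sub>R y))) = a *\<^sub>R \<pi> (G (K x)) + b *\<^sub>R \<pi> (G (K y))" by simp
qed

lemma T_lin: "linear_on' Th T"
  using Q_lin unfolding linear_on'_def T_def by (auto simp: algebra_simps)

lemma AG: "y \<in> Y \<Longrightarrow> A (G y) = y + K (\<pi> (G y))"
  using BG[of y] by (simp add: algebra_simps)

lemma A_GK: "t \<in> Th \<Longrightarrow> A (G (K t)) = K (T t)"
  using AG[OF K(2)] linear_on'D(1)[OF K(1) _ Q_in, of t t] by (simp add: T_def Q_def)

lemma x_eq: "x \<in> X \<Longrightarrow> x = G (A x) - G (K (\<pi> x))"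
  using GB[of x] linear_on'D(2)[OF G(1) A(2) K(2)[OF \<pi>(2)], of x x] by simp

text \<open>If \<open>y = A x\<close>, then \<open>x = G y - G (K (\<pi> x))\<close>, and applying
  \<open>\<pi>\<close> gives \<open>\<pi> (G y) = T (\<pi> x)\<close>. Conversely, if
  \<open>\<pi> (G y) = T t\<close>, then \<open>A\<close> maps \<open>G y - G (K t)\<close> to
  y.\<close>

lemma range_iff: "y \<in> Y \<Longrightarrow> y \<in> A ` X \<longleftrightarrow> \<pi> (G y) \<in> T ` Th"
proof
  assume y: "y \<in> Y" "y \<in> A ` X"
  then obtain x where x: "x \<in> X" "y = A x" by blast
  have "\<pi> x = \<pi> (G y) - Q (\<pi> x)"
    using x_eq[OF x(1)] linear_on'D(2)[OF \<pi>(1) G(2)[OF y(1)] G(2)[OF K(2)[OF \<pi>(2)[OF x(1)]]]] x(2)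
    unfolding Q_def by metis
  hence "\<pi> (G y) = T (\<pi> x)" unfolding T_def by (metis add.commute diff_add_cancel)
  thus "\<pi> (G y) \<in> T ` Th" using \<pi>(2)[OF x(1)] by blast
next
  assume y: "y \<in> Y" "\<pi> (G y) \<in> T ` Th"
  then obtain t where t: "t \<in> Th" "\<pi> (G y) = T t" by blast
  have "A (G y - G (K t)) = A (G y) - A (G (K t))"
    by (rule linear_on'D(2)[OF A(1)]) (auto intro: G K y t)
  also have "\<dots> = y" using AG[OF y(1)] A_GK[OF t(1)] t by simp
  finally show "y \<in> A ` X" using subspace_diff[OF X G(2)[OF y(1)] G(2)[OF K(2)[OF t(1)]]] by force
qed

lemma T_image_subspace: "subspace (T ` Th)"
  unfolding subspace_def
proof (intro conjI ballI allI)
  show "0 \<in> T ` Th"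
    using linear_on'D(4)[OF T_lin subspace_0[OF Th] subspace_0[OF Th]] subspace_0[OF Th] by force
  fix x y assume "x \<in> T ` Th" "y \<in> T ` Th"
  then obtain a b where ab: "a \<in> Th" "b \<in> Th" "x = T a" "y = T b" by blast
  show "x + y \<in> T ` Th" using linear_on'D(1)[OF T_lin ab(1,2)] ab subspace_add[OF Th ab(1,2)] by force
next
  fix c x assume "x \<in> T ` Th"
  then obtain a where a: "a \<in> Th" "x = T a" by blast
  have "c *\<^sub>R x = T (c *\<^sub>R a)" using linear_on'D(3)[OF T_lin a(1) a(1)] a by simp
  thus "c *\<^sub>R x \<in> T ` Th" using subspace_scale[OF Th a(1)] by blast
qed

text \<open>Rank and nullity for \<open>T\<close>: a complement of its image has as many basis
  vectors as its kernel. The complement is wanted in the form \<open>Q d\<close>, since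
  \<open>K d\<close> then spans a complement of the range of \<open>A\<close>; such vectors suffice
  because \<open>t = T t - Q t\<close>.\<close>

lemma index_bases:
  "\<exists>(n::nat) t d BN R0 R1. bij_betw t {..<n} BN \<and> independent BN \<and> finite BN \<and> BN \<subseteq> Th \<and> (\<forall>x\<in>Th. T x = 0 \<longleftrightarrow> x \<in> span BN) \<and>
     finite R1 \<and> independent R1 \<and> R0 \<subseteq> R1 \<and> span R1 = Th \<and> span R0 = T ` Th \<and>
     (\<forall>i<n. d i \<in> Th) \<and> bij_betw (\<lambda>i. Q (d i)) {..<n} (R1 - R0)"
proof -
  define N where "N = {x \<in> Th. T x = 0}"
  obtain BN where BN: "BN \<subseteq> N" "independent BN" "N \<subseteq> span BN"
    using maximal_independent_subset[of N] by blast
  have BNTh: "BN \<subseteq> Th" using BN(1) by (auto simp: N_def)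
  obtain BT where BT: "BN \<subseteq> BT" "BT \<subseteq> Th" "independent BT" "Th \<subseteq> span BT"
    using maximal_independent_subset_extend[OF BNTh BN(2)] by blast
  have finI: "finite C" if "independent C" "C \<subseteq> Th" for C
    using independent_span_bound[OF S(1) that(1)] that(2) S(2) by blast
  have fin: "finite BT" "finite BN" using finI BT BN(2) BNTh by auto
  have spanBT: "span BT = Th" using BT(2,4) span_minimal[OF BT(2) Th] by blast
  have subN: "subspace N"
    unfolding subspace_def N_def
    using subspace_0[OF Th] subspace_add[OF Th] subspace_scale[OF Th] linear_on'D[OF T_lin] by auto
  have spanBN: "span BN = N" using BN span_minimal[OF BN(1) subN] by blast
  define R0 where "R0 = T ` (BT - BN)"
  have Tsum: "T (\<Sum>v\<in>C. u v *\<^sub>R v) = (\<Sum>v\<in>C. u v *\<^sub>R T v)" if "finite C" "C \<subseteq> Th" for C u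
    using that
  proof (induction C rule: finite_induct)
    case empty
    show ?case using linear_on'D(4)[OF T_lin subspace_0[OF Th] subspace_0[OF Th]] by simp
  next
    case (insert x C)
    have "T (u x *\<^sub>R x + (\<Sum>v\<in>C. u v *\<^sub>R v)) = T (u x *\<^sub>R x) + T (\<Sum>v\<in>C. u v *\<^sub>R v)"
      by (rule linear_on'D(1)[OF T_lin]) (use insert.prems in \<open>auto intro!: subspace_scale[OF Th] subspace_sum[OF Th]\<close>)
    thus ?case using insert linear_on'D(3)[OF T_lin, of x x "u x"] by simp
  qed
  \<comment> \<open>A relation among these images is a vector in the kernel of \<open>T\<close>,
    hence in the span of \<open>BN\<close>; independence of \<open>BT\<close> kills its
    coefficients.\<close>
  have key: "(\<Sum>v\<in>BT - BN. u v *\<^sub>R T v) = 0 \<Longrightarrow> v \<in> BT - BN \<Longrightarrow> u v = 0" for u v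
  proof -
    assume z: "(\<Sum>v\<in>BT - BN. u v *\<^sub>R T v) = 0" and v: "v \<in> BT - BN"
    have "T (\<Sum>v\<in>BT - BN. u v *\<^sub>R v) = 0"
      using Tsum[of "BT - BN" u] z fin BT(2) by auto
    moreover have "(\<Sum>v\<in>BT - BN. u v *\<^sub>R v) \<in> Th"
      using BT(2) by (intro subspace_sum[OF Th] subspace_scale[OF Th]) auto
    ultimately have s: "(\<Sum>v\<in>BT - BN. u v *\<^sub>R v) \<in> span BN" by (simp add: spanBN N_def)
    have "finite (BT - BN)" using fin by simp
    then obtain f where f: "bij_betw f {..<card (BT - BN)} (BT - BN)"
      using ex_bij_betw_nat_finite by (metis atLeast0LessThan)
    have "(\<Sum>i<card (BT - BN). u (f i) *\<^sub>R f i) \<in> span BN"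
      using sum.reindex_bij_betw[OF f, of "\<lambda>v. u v *\<^sub>R v"] s by simp
    hence z: "u (f i) = 0" if "i < card (BT - BN)" for i
      using independent_enum[OF f BT(3) fin(1) BT(1), of "\<lambda>i. u (f i)"] that by blast
    obtain i where "i < card (BT - BN)" "v = f i" using f v by (auto simp: bij_betw_def)
    thus ?thesis using z by simp
  qed
  \<comment> \<open>Two equal images would give a relation with coefficients 1 and -1.\<close>
  have inj: "inj_on T (BT - BN)"
  proof
    fix v w assume vw: "v \<in> BT - BN" "w \<in> BT - BN" "T v = T w"
    show "v = w"
    proof (rule ccontr)
      assume ne: "v \<noteq> w"
      have "(\<Sum>x\<in>BT - BN. ((if x = v then 1 else 0) - (if x = w then 1 else (0::real))) *\<^sub>R T x) = T v - T w"
        using fin vw by (simp add: scaleR_diff_left sum_subtractf if_distrib[of "\<lambda>c. c *\<^sub>R _"] cong: if_cong)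
      with key[of "\<lambda>x. (if x = v then 1 else 0) - (if x = w then 1 else (0::real))" v] vw ne show False by simp
    qed
  qed
  have indR0: "independent R0"
    unfolding R0_def
  proof (rule independent_if_scalars_zero)
    fix u x assume z: "(\<Sum>x\<in>T ` (BT - BN). u x *\<^sub>R x) = 0" and x: "x \<in> T ` (BT - BN)"
    have "(\<Sum>v\<in>BT - BN. u (T v) *\<^sub>R T v) = 0" using z by (simp add: sum.reindex[OF inj])
    thus "u x = 0" using key[of "\<lambda>v. u (T v)"] x by auto
  qed (use fin in auto)
  have spanR0: "span R0 = T ` Th"
  proof
    show "span R0 \<subseteq> T ` Th" unfolding R0_def
      by (rule span_minimal[OF _ T_image_subspace]) (use BT(2) in auto)
    show "T ` Th \<subseteq> span R0"
    proof clarify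
      fix x assume "x \<in> Th"
      then obtain u where u: "x = (\<Sum>v\<in>BT. u v *\<^sub>R v)" using spanBT span_finite[OF fin(1)] by auto
      have "T x = (\<Sum>v\<in>BT. u v *\<^sub>R T v)" unfolding u by (rule Tsum[OF fin(1) BT(2)])
      also have "\<dots> = (\<Sum>v\<in>BT - BN. u v *\<^sub>R T v)"
        by (rule sum.mono_neutral_right) (use fin BN(1) in \<open>auto simp: N_def\<close>)
      also have "\<dots> \<in> span R0" unfolding R0_def by (intro span_sum span_scale span_base) auto
      finally show "T x \<in> span R0" .
    qed
  qed
  \<comment> \<open>Extending within the union of \<open>R0\<close> and the image of
    \<open>Q\<close>, and not within all of \<open>Th\<close>, forces the new vectors into the image
    of \<open>Q\<close>.\<close>
  obtain R1 where R1: "R0 \<subseteq> R1" "R1 \<subseteq> R0 \<union> Q ` Th" "independent R1" "R0 \<union> Q ` Th \<subseteq> span R1"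
    using maximal_independent_subset_extend[of R0 "R0 \<union> Q ` Th"] indR0 by blast
  have R1Th: "R1 \<subseteq> Th" using R1(2) Q_in T_in BT(2) by (auto simp: R0_def)
  have spanR1: "span R1 = Th"
  proof
    show "span R1 \<subseteq> Th" by (rule span_minimal[OF R1Th Th])
    show "Th \<subseteq> span R1"
    proof
      fix x assume x: "x \<in> Th"
      have "T x \<in> span R1" using spanR0 span_mono[OF R1(1)] x by blast
      moreover have "Q x \<in> span R1" using R1(4) x by blast
      ultimately have "T x - Q x \<in> span R1" by (rule span_diff)
      thus "x \<in> span R1" by (simp add: T_def)
    qed
  qed
  have finR1: "finite R1" by (rule finI[OF R1(3) R1Th])
  have cardR1: "card R1 = card BT"
    using dim_span_eq_card_independent[OF R1(3)] dim_span_eq_card_independent[OF BT(3)] by (simp add: spanBT spanR1)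
  have "card (R1 - R0) = card BN"
  proof -
    have "card R0 = card BT - card BN"
      unfolding R0_def card_image[OF inj] by (rule card_Diff_subset[OF fin(2) BT(1)])
    moreover have "card (R1 - R0) = card R1 - card R0"
      by (rule card_Diff_subset[OF finite_subset[OF R1(1) finR1] R1(1)])
    moreover have "card BN \<le> card BT" by (rule card_mono[OF fin(1) BT(1)])
    ultimately show ?thesis using cardR1 by simp
  qed
  then obtain e where e: "bij_betw e {..<card BN} (R1 - R0)"
    using ex_bij_betw_nat_finite[of "R1 - R0"] finR1 by (metis atLeast0LessThan finite_Diff)
  have "\<exists>d. d \<in> Th \<and> e i = Q d" if "i < card BN" for i
    using e that R1(2) by (auto simp: bij_betw_def)
  then obtain d where d: "\<And>i. i < card BN \<Longrightarrow> d i \<in> Th \<and> e i = Q (d i)" by metis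
  have "bij_betw (\<lambda>i. Q (d i)) {..<card BN} (R1 - R0)"
    using e bij_betw_cong[of "{..<card BN}" e "\<lambda>i. Q (d i)" "R1 - R0"] d by simp
  moreover obtain t where "bij_betw t {..<card BN} BN"
    using ex_bij_betw_nat_finite[OF fin(2)] by (metis atLeast0LessThan)
  moreover have "\<forall>x\<in>Th. T x = 0 \<longleftrightarrow> x \<in> span BN" by (simp add: spanBN N_def)
  moreover have "\<forall>i<card BN. d i \<in> Th" using d by blast
  ultimately show ?thesis
    using BN(2) fin(2) BNTh finR1 R1(1,3) spanR1 spanR0
    by (intro exI[of _ "card BN"] exI[of _ t] exI[of _ d] exI[of _ BN] exI[of _ R0] exI[of _ R1] conjI)
qed

text \<open>In the bases of \<open>index_bases\<close> the kernel of \<open>A\<close> is spanned by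
  \<open>G (K (t i))\<close>, which \<open>\<pi>\<close> maps to \<open>- t i\<close>, and the range
  is complemented by \<open>K (d i)\<close>, which \<open>\<pi> \<circ> G\<close> maps to the
  complement \<open>Q (d i)\<close> of the image of \<open>T\<close>. Both families have the same
  length.\<close>

lemma index_zero:
  "\<exists>n::nat. (\<exists>ks. (\<forall>i<n. ks i \<in> X \<and> A (ks i) = 0) \<and>
           (\<forall>x\<in>X. A x = 0 \<longrightarrow> (\<exists>!c. (\<forall>i\<ge>n. c i = 0) \<and> x = (\<Sum>i<n. c i *\<^sub>R ks i)))) \<and>
       (\<exists>ys. (\<forall>i<n. ys i \<in> Y) \<and>
           (\<forall>y\<in>Y. \<exists>!rc. fst rc \<in> A ` X \<and> (\<forall>i\<ge>n. snd rc i = 0) \<and>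
                            y = fst rc + (\<Sum>i<n. snd rc i *\<^sub>R ys i)))"
proof -
  obtain n :: nat and t d BN R0 R1 where t: "bij_betw t {..<n} BN" and BN: "independent BN" "finite BN" "BN \<subseteq> Th"
    and N: "\<And>x. x \<in> Th \<Longrightarrow> T x = 0 \<longleftrightarrow> x \<in> span BN"
    and R1: "finite R1" "independent R1" "R0 \<subseteq> R1" "span R1 = Th" "span R0 = T ` Th"
    and d: "\<And>i. i < n \<Longrightarrow> d i \<in> Th" and dq: "bij_betw (\<lambda>i. Q (d i)) {..<n} (R1 - R0)"
    using index_bases by (elim exE conjE) (rule that; simp)
  have tBN: "t i \<in> BN" if "i < n" for i using t that by (auto simp: bij_betw_def)
  hence tTh: "t i \<in> Th" if "i < n" for i using BN(3) that by blast
  have Tt: "T (t i) = 0" if "i < n" for i using N[OF tTh[OF that]] tBN[OF that] by (simp add: span_base)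
  have ker: "(\<forall>i<n. G (K (t i)) \<in> X \<and> A (G (K (t i))) = 0) \<and>
      (\<forall>x\<in>X. A x = 0 \<longrightarrow> (\<exists>!c. (\<forall>i\<ge>n. c i = 0) \<and> x = (\<Sum>i<n. c i *\<^sub>R G (K (t i)))))"
  proof (intro conjI allI impI ballI)
    fix i assume i: "i < n"
    show "G (K (t i)) \<in> X" using tTh[OF i] by (intro G K)
    show "A (G (K (t i))) = 0"
      using A_GK[OF tTh[OF i]] Tt[OF i] linear_on'D(4)[OF K(1) tTh[OF i] tTh[OF i]] by simp
  next
    fix x assume x: "x \<in> X" "A x = 0"
    have G0: "G 0 = 0" using linear_on'D(4)[OF G(1) subspace_0[OF Y] subspace_0[OF Y]] .
    have xe: "x = - G (K (\<pi> x))" using x_eq[OF x(1)] x(2) G0 by simp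
    have pin: "G (K (t i)) \<in> X" if "i < n" for i using tTh[OF that] by (intro G K)
    have pix: "\<pi> x = - Q (\<pi> x)"
      using arg_cong[OF xe, of \<pi>] linear_on'D(5)[OF \<pi>(1) G(2)[OF K(2)[OF \<pi>(2)[OF x(1)]]] x(1)] by (simp add: Q_def)
    hence "T (\<pi> x) = 0" unfolding T_def by (metis add.left_inverse)
    hence "\<pi> x \<in> span BN" using N[OF \<pi>(2)[OF x(1)]] by simp
    from span_enum[OF t this] obtain c where c: "\<forall>i\<ge>n. c i = 0" "\<pi> x = (\<Sum>i<n. c i *\<^sub>R t i)" by blast
    have "G (K (\<pi> x)) = (\<Sum>i<n. c i *\<^sub>R G (K (t i)))"
    proof -
      have "K (\<pi> x) = (\<Sum>i<n. c i *\<^sub>R K (t i))"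
        unfolding c(2) by (rule linear_on'_sum[OF K(1) Th]) (rule tTh)
      also have "G \<dots> = (\<Sum>i<n. c i *\<^sub>R G (K (t i)))"
        by (rule linear_on'_sum[OF G(1) Y]) (auto intro: K tTh)
      finally show ?thesis .
    qed
    hence ex: "x = (\<Sum>i<n. (- c i) *\<^sub>R G (K (t i)))" using xe by (simp add: sum_negf)
    show "\<exists>!c. (\<forall>i\<ge>n. c i = 0) \<and> x = (\<Sum>i<n. c i *\<^sub>R G (K (t i)))"
    proof (rule ex1I[of _ "\<lambda>i. - c i"])
      show "(\<forall>i\<ge>n. - c i = 0) \<and> x = (\<Sum>i<n. - c i *\<^sub>R G (K (t i)))" using c ex by simp
      fix c' assume c': "(\<forall>i\<ge>n. c' i = 0) \<and> x = (\<Sum>i<n. c' i *\<^sub>R G (K (t i)))"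
      \<comment> \<open>On the kernel of \<open>T\<close> the map \<open>Q\<close> is minus the
        identity, so \<open>\<pi>\<close> recovers the coefficients from x.\<close>
      have Qt: "Q (t i) = - t i" if "i < n" for i using Tt[OF that] by (simp add: T_def eq_neg_iff_add_eq_0 add.commute)
      have "\<pi> x = (\<Sum>i<n. c' i *\<^sub>R \<pi> (G (K (t i))))"
        using c' linear_on'_sum[OF \<pi>(1) X, of n "\<lambda>i. G (K (t i))" c'] pin by simp
      also have "\<dots> = (\<Sum>i<n. c' i *\<^sub>R (- t i))" by (rule sum.cong) (auto simp: Qt[unfolded Q_def])
      finally have "(\<Sum>i<n. (c i + c' i) *\<^sub>R t i) = 0" using c(2) by (simp add: sum_negf algebra_simps sum.distrib)
      hence s: "(\<Sum>i<n. (c i + c' i) *\<^sub>R t i) \<in> span {}" by simp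
      have "c i + c' i = 0" if "i < n" for i
        by (rule independent_enum[where Bz="{}", OF _ BN(1,2) _ s that]) (use t in auto)
      hence "c' i = - c i" for i using c c' by (cases "i < n") (auto simp: eq_neg_iff_add_eq_0 add.commute)
      thus "c' = (\<lambda>i. - c i)" by (rule ext)
    qed
  qed
  have ran: "(\<forall>i<n. K (d i) \<in> Y) \<and> (\<forall>y\<in>Y. \<exists>!rc. fst rc \<in> A ` X \<and> (\<forall>i\<ge>n. snd rc i = 0) \<and>
      y = fst rc + (\<Sum>i<n. snd rc i *\<^sub>R K (d i)))"
  proof (intro conjI allI impI ballI)
    fix i assume i: "i < n"
    show "K (d i) \<in> Y" using d[OF i] by (intro K)
  next
    fix y assume y: "y \<in> Y"
    have pd: "\<pi> (G (\<Sum>i<n. c i *\<^sub>R K (d i))) = (\<Sum>i<n. c i *\<^sub>R Q (d i))" for c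
    proof -
      have "G (\<Sum>i<n. c i *\<^sub>R K (d i)) = (\<Sum>i<n. c i *\<^sub>R G (K (d i)))"
        by (rule linear_on'_sum[OF G(1) Y]) (auto intro: K d)
      also have "\<pi> \<dots> = (\<Sum>i<n. c i *\<^sub>R \<pi> (G (K (d i))))"
        by (rule linear_on'_sum[OF \<pi>(1) X]) (auto intro: K G d)
      finally show ?thesis by (simp add: Q_def)
    qed
    have inY: "(\<Sum>i<n. c i *\<^sub>R K (d i)) \<in> Y" for c
      by (rule subspace_lincomb[OF Y]) (auto intro: K d)
    have piG: "\<pi> (G (a - b)) = \<pi> (G a) - \<pi> (G b)" if "a \<in> Y" "b \<in> Y" for a b
      using linear_on'D(2)[OF G(1) that] linear_on'D(2)[OF \<pi>(1) G(2)[OF that(1)] G(2)[OF that(2)]] by simp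
    \<comment> \<open>The component of \<open>\<pi> (G y)\<close> in the complement dictates the
      coefficients; once their combination is subtracted from y, \<open>range_iff\<close> puts the
      rest into the range.\<close>
    have "\<pi> (G y) \<in> span ((R1 - R0) \<union> R0)" using R1(3,4) \<pi>(2)[OF G(2)[OF y]] by (simp add: Un_absorb2)
    then obtain a r where ar: "a \<in> span (R1 - R0)" "r \<in> span R0" "\<pi> (G y) = a + r"
      unfolding span_Un by blast
    from span_enum[OF dq ar(1)] obtain c where c: "\<forall>i\<ge>n. c i = 0" "a = (\<Sum>i<n. c i *\<^sub>R Q (d i))" by blast
    define y0 where "y0 = y - (\<Sum>i<n. c i *\<^sub>R K (d i))"
    have y0: "y0 \<in> Y" unfolding y0_def by (rule subspace_diff[OF Y y inY])
    have "\<pi> (G y0) = r" unfolding y0_def piG[OF y inY] pd using ar c by simp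
    hence y0r: "y0 \<in> A ` X" using range_iff[OF y0] ar(2) R1(5) by simp
    show "\<exists>!rc. fst rc \<in> A ` X \<and> (\<forall>i\<ge>n. snd rc i = 0) \<and> y = fst rc + (\<Sum>i<n. snd rc i *\<^sub>R K (d i))"
    proof (rule ex1I[of _ "(y0, c)"])
      show "fst (y0, c) \<in> A ` X \<and> (\<forall>i\<ge>n. snd (y0, c) i = 0) \<and> y = fst (y0, c) + (\<Sum>i<n. snd (y0, c) i *\<^sub>R K (d i))"
        using y0r c by (simp add: y0_def)
      fix rc assume rc': "fst rc \<in> A ` X \<and> (\<forall>i\<ge>n. snd rc i = 0) \<and> y = fst rc + (\<Sum>i<n. snd rc i *\<^sub>R K (d i))"
      define e where "e = snd rc"
      have rc: "fst rc \<in> A ` X" "\<forall>i\<ge>n. e i = 0" "y - fst rc = (\<Sum>i<n. e i *\<^sub>R K (d i))"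
        using conjunct1[OF rc'] conjunct1[OF conjunct2[OF rc']] conjunct2[OF conjunct2[OF rc']]
        by (simp_all only: e_def) (simp add: algebra_simps)
      have rY: "fst rc \<in> Y" using rc(1) A(2) by (metis imageE)
      have "\<pi> (G (y - fst rc)) = (\<Sum>i<n. e i *\<^sub>R Q (d i))"
        unfolding rc(3) by (rule pd)
      hence "(\<Sum>i<n. e i *\<^sub>R Q (d i)) = \<pi> (G y) - \<pi> (G (fst rc))" using piG[OF y rY] by simp
      hence "(\<Sum>i<n. (e i - c i) *\<^sub>R Q (d i)) = r - \<pi> (G (fst rc))"
        using ar(3) c(2) by (simp add: scaleR_diff_left sum_subtractf)
      moreover have "\<pi> (G (fst rc)) \<in> span R0" using range_iff[OF rY] rc(1) R1(5) by simp
      ultimately have s: "(\<Sum>i<n. (e i - c i) *\<^sub>R Q (d i)) \<in> span R0" using ar(2) by (simp add: span_diff)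
      have "e i - c i = 0" if "i < n" for i
        by (rule independent_enum[OF dq R1(2,1,3) s that])
      hence "e i = c i" for i using c(1) rc(2) by (cases "i < n") auto
      hence ec: "e = c" by (rule ext)
      hence "fst rc = y0" using rc(3) by (simp add: y0_def algebra_simps)
      thus "rc = (y0, c)" using ec by (simp add: prod_eq_iff e_def)
    qed
  qed
  show ?thesis
    by (rule exI[of _ n], rule conjI, rule exI, rule ker, rule exI, rule ran)
qed

end

section \<open>Hoelder functions on strips\<close>

definition hb :: "'a::metric_space set \<Rightarrow> real \<Rightarrow> ('a \<Rightarrow> real) \<Rightarrow> bool" where
  "hb S \<alpha> f \<longleftrightarrow> bounded (f ` S) \<and> holder_on S \<alpha> f"

text \<open>A single constant for both the bound and the Hoelder quotient keeps the closure rules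
  below short.\<close>

lemma hb_iff: "hb S \<alpha> f \<longleftrightarrow> (\<exists>N\<ge>0. (\<forall>z\<in>S. \<bar>f z\<bar> \<le> N) \<and> (\<forall>z\<in>S. \<forall>w\<in>S. \<bar>f z - f w\<bar> \<le> N * dist z w powr \<alpha>))"
proof
  assume "hb S \<alpha> f"
  then obtain B C where B: "\<forall>z\<in>S. \<bar>f z\<bar> \<le> B" and C: "\<forall>z\<in>S. \<forall>w\<in>S. \<bar>f z - f w\<bar> \<le> C * dist z w powr \<alpha>"
    unfolding hb_def holder_on_def bounded_iff by auto
  show "\<exists>N\<ge>0. (\<forall>z\<in>S. \<bar>f z\<bar> \<le> N) \<and> (\<forall>z\<in>S. \<forall>w\<in>S. \<bar>f z - f w\<bar> \<le> N * dist z w powr \<alpha>)"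
  proof (intro exI[of _ "\<bar>B\<bar> + \<bar>C\<bar>"] conjI ballI)
    fix z assume z: "z \<in> S"
    show "\<bar>f z\<bar> \<le> \<bar>B\<bar> + \<bar>C\<bar>" using B z by force
  next
    fix z w assume zw: "z \<in> S" "w \<in> S"
    have "C * dist z w powr \<alpha> \<le> (\<bar>B\<bar> + \<bar>C\<bar>) * dist z w powr \<alpha>" by (intro mult_right_mono) auto
    thus "\<bar>f z - f w\<bar> \<le> (\<bar>B\<bar> + \<bar>C\<bar>) * dist z w powr \<alpha>" using C zw by force
  qed auto
next
  assume "\<exists>N\<ge>0. (\<forall>z\<in>S. \<bar>f z\<bar> \<le> N) \<and> (\<forall>z\<in>S. \<forall>w\<in>S. \<bar>f z - f w\<bar> \<le> N * dist z w powr \<alpha>)"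
  thus "hb S \<alpha> f" unfolding hb_def holder_on_def bounded_iff by auto
qed

lemma hb_const [intro]: "hb S \<alpha> (\<lambda>_. c)"
  unfolding hb_iff by (intro exI[of _ "\<bar>c\<bar>"]) auto

lemma hb_add:
  assumes "hb S \<alpha> f" "hb S \<alpha> g" shows "hb S \<alpha> (\<lambda>z. f z + g z)"
proof -
  obtain N where N: "N \<ge> 0" "\<And>z. z \<in> S \<Longrightarrow> \<bar>f z\<bar> \<le> N" "\<And>z w. z \<in> S \<Longrightarrow> w \<in> S \<Longrightarrow> \<bar>f z - f w\<bar> \<le> N * dist z w powr \<alpha>"
    using assms(1) unfolding hb_iff by blast
  obtain N' where N': "N' \<ge> 0" "\<And>z. z \<in> S \<Longrightarrow> \<bar>g z\<bar> \<le> N'" "\<And>z w. z \<in> S \<Longrightarrow> w \<in> S \<Longrightarrow> \<bar>g z - g w\<bar> \<le> N' * dist z w powr \<alpha>"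
    using assms(2) unfolding hb_iff by blast
  show ?thesis unfolding hb_iff
  proof (intro exI[of _ "N + N'"] conjI ballI)
    show "\<bar>f z + g z\<bar> \<le> N + N'" if "z \<in> S" for z using N(2)[OF that] N'(2)[OF that] by linarith
    show "\<bar>f z + g z - (f w + g w)\<bar> \<le> (N + N') * dist z w powr \<alpha>" if "z \<in> S" "w \<in> S" for z w
      using N(3)[OF that] N'(3)[OF that] unfolding distrib_right by linarith
  qed (use N N' in auto)
qed

lemma hb_mult:
  assumes "hb S \<alpha> f" "hb S \<alpha> g" shows "hb S \<alpha> (\<lambda>z. f z * g z)"
proof -
  obtain N where N: "N \<ge> 0" "\<And>z. z \<in> S \<Longrightarrow> \<bar>f z\<bar> \<le> N" "\<And>z w. z \<in> S \<Longrightarrow> w \<in> S \<Longrightarrow> \<bar>f z - f w\<bar> \<le> N * dist z w powr \<alpha>"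
    using assms(1) unfolding hb_iff by blast
  obtain N' where N': "N' \<ge> 0" "\<And>z. z \<in> S \<Longrightarrow> \<bar>g z\<bar> \<le> N'" "\<And>z w. z \<in> S \<Longrightarrow> w \<in> S \<Longrightarrow> \<bar>g z - g w\<bar> \<le> N' * dist z w powr \<alpha>"
    using assms(2) unfolding hb_iff by blast
  have NN: "N * N' \<ge> 0" using N N' by simp
  show ?thesis unfolding hb_iff
  proof (intro exI[of _ "2 * (N * N')"] conjI ballI)
    show "\<bar>f z * g z\<bar> \<le> 2 * (N * N')" if "z \<in> S" for z
    proof -
      have "\<bar>f z * g z\<bar> \<le> N * N'" unfolding abs_mult using N N' that by (intro mult_mono) auto
      thus ?thesis using NN by linarith
    qed
    show "\<bar>f z * g z - f w * g w\<bar> \<le> 2 * (N * N') * dist z w powr \<alpha>" if "z \<in> S" "w \<in> S" for z w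
    proof -
      have "\<bar>f z * (g z - g w)\<bar> \<le> N * (N' * dist z w powr \<alpha>)"
        unfolding abs_mult using N N' that by (intro mult_mono) auto
      moreover have "\<bar>(f z - f w) * g w\<bar> \<le> (N * dist z w powr \<alpha>) * N'"
        unfolding abs_mult using N N' that by (intro mult_mono) auto
      moreover have "f z * g z - f w * g w = f z * (g z - g w) + (f z - f w) * g w" by (simp add: algebra_simps)
      ultimately have "\<bar>f z * g z - f w * g w\<bar> \<le> N * (N' * dist z w powr \<alpha>) + (N * dist z w powr \<alpha>) * N'" by linarith
      thus ?thesis by (simp add: algebra_simps)
    qed
  qed (use NN in auto)
qed

lemma hb_cmult: "hb S \<alpha> f \<Longrightarrow> hb S \<alpha> (\<lambda>z. c * f z)"
  by (rule hb_mult[OF hb_const])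

lemma hb_uminus: "hb S \<alpha> f \<Longrightarrow> hb S \<alpha> (\<lambda>z. - f z)"
  using hb_cmult[of S \<alpha> f "-1"] by simp

lemma hb_diff: "hb S \<alpha> f \<Longrightarrow> hb S \<alpha> g \<Longrightarrow> hb S \<alpha> (\<lambda>z. f z - g z)"
  using hb_add[of S \<alpha> f "\<lambda>z. - g z"] hb_uminus[of S \<alpha> g] by simp

lemmas hb_intros = hb_const hb_add hb_mult hb_uminus hb_diff

lemma hb_cong: "hb S \<alpha> f \<Longrightarrow> (\<And>z. z \<in> S \<Longrightarrow> f z = g z) \<Longrightarrow> hb S \<alpha> g"
  unfolding hb_iff by (smt (verit))

lemma hb_subset: "hb S \<alpha> f \<Longrightarrow> T \<subseteq> S \<Longrightarrow> hb T \<alpha> f"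
  unfolding hb_iff by (meson subsetD)

lemma hb_lipschitz:
  assumes "\<And>z. z \<in> S \<Longrightarrow> \<bar>f z\<bar> \<le> N" "\<And>z w. z \<in> S \<Longrightarrow> w \<in> S \<Longrightarrow> \<bar>f z - f w\<bar> \<le> L * dist z w" "0 < \<alpha>" "\<alpha> \<le> 1"
  shows "hb S \<alpha> f"
  unfolding hb_iff
proof (intro exI[of _ "2 * \<bar>N\<bar> + \<bar>L\<bar>"] conjI ballI)
  show "\<bar>f z\<bar> \<le> 2 * \<bar>N\<bar> + \<bar>L\<bar>" if "z \<in> S" for z using assms(1)[OF that] by linarith
  fix z w assume zw: "z \<in> S" "w \<in> S"
  show "\<bar>f z - f w\<bar> \<le> (2 * \<bar>N\<bar> + \<bar>L\<bar>) * dist z w powr \<alpha>"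
  proof (cases "dist z w \<le> 1")
    case True
    have "\<bar>f z - f w\<bar> \<le> L * dist z w" by (rule assms(2)[OF zw])
    also have "\<dots> \<le> \<bar>L\<bar> * dist z w powr \<alpha>"
    proof (cases "z = w")
      case False
      have "dist z w powr 1 \<le> dist z w powr \<alpha>" using True assms False by (intro powr_mono') auto
      thus ?thesis using False by (intro mult_mono) auto
    qed simp
    also have "\<dots> \<le> (2 * \<bar>N\<bar> + \<bar>L\<bar>) * dist z w powr \<alpha>" by (intro mult_right_mono) auto
    finally show ?thesis .
  next
    case False
    have "1 \<le> dist z w powr \<alpha>" using False assms by (intro ge_one_powr_ge_zero) auto
    hence "(2 * \<bar>N\<bar> + \<bar>L\<bar>) * 1 \<le> (2 * \<bar>N\<bar> + \<bar>L\<bar>) * dist z w powr \<alpha>" by (intro mult_left_mono) auto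
    moreover have "\<bar>f z - f w\<bar> \<le> 2 * \<bar>N\<bar>" using assms(1)[OF zw(1)] assms(1)[OF zw(2)] by linarith
    moreover have "2 * \<bar>N\<bar> \<le> (2 * \<bar>N\<bar> + \<bar>L\<bar>) * 1" by simp
    ultimately show ?thesis by (meson order_trans)
  qed
qed auto

lemma hb_imp_continuous_on: "hb S \<alpha> f \<Longrightarrow> 0 < \<alpha> \<Longrightarrow> continuous_on S f"
  unfolding hb_def by (intro holder_imp_continuous_on) auto

lemma mem_strip: "z \<in> strip a b \<longleftrightarrow> snd z \<in> {a..b}"
  by (auto simp: strip_def mem_Times_iff)

text \<open>The increment is taken first along q and then along p, both segments lying in the strip.
  The first-order terms of \<open>C2_alpha\<close>, whose definition lists them as bounded, become
  Hoelder continuous in this way.\<close>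

lemma hb_strip_partial:
  assumes q: "\<And>q p. p \<in> {a..b} \<Longrightarrow> ((\<lambda>t. f (t, p)) has_vector_derivative fq (q, p)) (at q)"
    and p: "\<And>q p. p \<in> {a..b} \<Longrightarrow> ((\<lambda>t. f (q, t)) has_vector_derivative fp (q, p)) (at p within {a..b})"
    and b: "bounded (f ` strip a b)" "bounded (fq ` strip a b)" "bounded (fp ` strip a b)" and \<alpha>: "0 < \<alpha>" "\<alpha> \<le> 1"
  shows "hb (strip a b) \<alpha> f"
proof -
  obtain N where N: "\<And>z. z \<in> strip a b \<Longrightarrow> \<bar>f z\<bar> \<le> N" using b(1) unfolding bounded_iff by auto
  obtain Nq where Nq: "\<And>z. z \<in> strip a b \<Longrightarrow> \<bar>fq z\<bar> \<le> Nq" using b(2) unfolding bounded_iff by auto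
  obtain Np where Np: "\<And>z. z \<in> strip a b \<Longrightarrow> \<bar>fp z\<bar> \<le> Np" using b(3) unfolding bounded_iff by auto
  show ?thesis
  proof (rule hb_lipschitz[OF N _ \<alpha>])
    fix z w assume zw: "z \<in> strip a b" "w \<in> strip a b"
    obtain q1 p1 q2 p2 where [simp]: "z = (q1, p1)" "w = (q2, p2)" by fastforce
    have p12: "p1 \<in> {a..b}" "p2 \<in> {a..b}" using zw by (auto simp: mem_strip)
    have 1: "norm (f (q1, p1) - f (q2, p1)) \<le> Nq * norm (q1 - q2)"
    proof (rule differentiable_bound[where S = UNIV and f = "\<lambda>t. f (t, p1)" and f' = "\<lambda>t h. h *\<^sub>R fq (t, p1)"])
      fix x show "((\<lambda>t. f (t, p1)) has_derivative (\<lambda>h. h *\<^sub>R fq (x, p1))) (at x within UNIV)"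
        using q[OF p12(1), of x] by (simp add: has_vector_derivative_def)
      have "onorm (\<lambda>h. h *\<^sub>R fq (x, p1)) \<le> \<bar>fq (x, p1)\<bar>" by (rule onorm_le) (simp add: abs_mult mult.commute)
      thus "onorm (\<lambda>h. h *\<^sub>R fq (x, p1)) \<le> Nq" using Nq[of "(x, p1)"] p12 by (simp add: mem_strip)
    qed auto
    have 2: "norm (f (q2, p1) - f (q2, p2)) \<le> Np * norm (p1 - p2)"
    proof (rule differentiable_bound[where S = "{a..b}" and f = "\<lambda>t. f (q2, t)" and f' = "\<lambda>t h. h *\<^sub>R fp (q2, t)"])
      fix x assume x: "x \<in> {a..b}"
      show "((\<lambda>t. f (q2, t)) has_derivative (\<lambda>h. h *\<^sub>R fp (q2, x))) (at x within {a..b})"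
        using p[OF x, of q2] by (simp add: has_vector_derivative_def)
      have "onorm (\<lambda>h. h *\<^sub>R fp (q2, x)) \<le> \<bar>fp (q2, x)\<bar>" by (rule onorm_le) (simp add: abs_mult mult.commute)
      thus "onorm (\<lambda>h. h *\<^sub>R fp (q2, x)) \<le> Np" using Np[of "(q2, x)"] x by (simp add: mem_strip)
    qed (use p12 in auto)
    have d: "norm (q1 - q2) \<le> dist z w" "norm (p1 - p2) \<le> dist z w"
      using dist_fst_le[of z w] dist_snd_le[of z w] by (auto simp: dist_norm)
    have "Nq * norm (q1 - q2) \<le> \<bar>Nq\<bar> * dist z w" "Np * norm (p1 - p2) \<le> \<bar>Np\<bar> * dist z w"
      using d by (auto intro!: mult_mono)
    thus "\<bar>f z - f w\<bar> \<le> (\<bar>Nq\<bar> + \<bar>Np\<bar>) * dist z w" using 1 2 unfolding distrib_right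
      by (simp only: \<open>z = _\<close> \<open>w = _\<close> real_norm_def) linarith
  qed
qed

lemma per_int:
  fixes f :: "real \<Rightarrow> 'a" and n :: int
  assumes "\<And>x. f (x + 2 * pi) = f x" shows "f (x + of_int n * (2 * pi)) = f x"
proof -
  have 1: "f (x + real n * (2 * pi)) = f x" for x n
  proof (induction n)
    case (Suc n) show ?case using assms[of "x + real n * (2 * pi)"] Suc by (simp add: algebra_simps)
  qed simp
  show ?thesis
    using 1[of x "nat n"] 1[of "x + of_int n * (2 * pi)" "nat (- n)"] by (cases "n \<ge> 0") auto
qed

lemma per_reduce:
  obtains n :: int where "q + of_int n * (2 * pi) \<in> {0..2 * pi}"
proof
  show "q + of_int (- \<lfloor>q / (2 * pi)\<rfloor>) * (2 * pi) \<in> {0..2 * pi}"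
    using floor_divide_lower[of "2 * pi" q] floor_divide_upper[of "2 * pi" q] by (auto simp: algebra_simps)
qed

text \<open>The derivatives are listed as arguments, so that they can be given by formulas valid on the strip only.\<close>

definition C2d :: "real \<Rightarrow> real \<Rightarrow> real \<Rightarrow> (real \<times> real \<Rightarrow> real) \<Rightarrow> (real \<times> real \<Rightarrow> real) \<Rightarrow> (real \<times> real \<Rightarrow> real) \<Rightarrow>
    (real \<times> real \<Rightarrow> real) \<Rightarrow> (real \<times> real \<Rightarrow> real) \<Rightarrow> (real \<times> real \<Rightarrow> real) \<Rightarrow> (real \<times> real \<Rightarrow> real) \<Rightarrow> bool" where
  "C2d \<alpha> a b u uq up uqq uqp upq upp \<longleftrightarrow>
     (\<forall>q. \<forall>p\<in>{a..b}.
       ((\<lambda>t. u (t, p)) has_vector_derivative uq (q, p)) (at q) \<and>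
       ((\<lambda>t. u (q, t)) has_vector_derivative up (q, p)) (at p within {a..b}) \<and>
       ((\<lambda>t. uq (t, p)) has_vector_derivative uqq (q, p)) (at q) \<and>
       ((\<lambda>t. uq (q, t)) has_vector_derivative uqp (q, p)) (at p within {a..b}) \<and>
       ((\<lambda>t. up (t, p)) has_vector_derivative upq (q, p)) (at q) \<and>
       ((\<lambda>t. up (q, t)) has_vector_derivative upp (q, p)) (at p within {a..b})) \<and>
     (\<forall>f\<in>{u, uq, up, uqq, uqp, upq, upp}. hb (strip a b) \<alpha> f)"

lemma C2dD:
  assumes "C2d \<alpha> a b u uq up uqq uqp upq upp"
  shows "\<And>q p. p \<in> {a..b} \<Longrightarrow> ((\<lambda>t. u (t, p)) has_vector_derivative uq (q, p)) (at q)"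
    "\<And>q p. p \<in> {a..b} \<Longrightarrow> ((\<lambda>t. u (q, t)) has_vector_derivative up (q, p)) (at p within {a..b})"
    "\<And>q p. p \<in> {a..b} \<Longrightarrow> ((\<lambda>t. uq (t, p)) has_vector_derivative uqq (q, p)) (at q)"
    "\<And>q p. p \<in> {a..b} \<Longrightarrow> ((\<lambda>t. uq (q, t)) has_vector_derivative uqp (q, p)) (at p within {a..b})"
    "\<And>q p. p \<in> {a..b} \<Longrightarrow> ((\<lambda>t. up (t, p)) has_vector_derivative upq (q, p)) (at q)"
    "\<And>q p. p \<in> {a..b} \<Longrightarrow> ((\<lambda>t. up (q, t)) has_vector_derivative upp (q, p)) (at p within {a..b})"
    "hb (strip a b) \<alpha> u" "hb (strip a b) \<alpha> uq" "hb (strip a b) \<alpha> up" "hb (strip a b) \<alpha> uqq"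
    "hb (strip a b) \<alpha> uqp" "hb (strip a b) \<alpha> upq" "hb (strip a b) \<alpha> upp"
  using assms unfolding C2d_def by auto

lemma vderiv_q_eq:
  assumes "\<And>q p. p \<in> {a..b} \<Longrightarrow> ((\<lambda>t. u (t, p)) has_vector_derivative uq (q, p)) (at q)"
  shows "z \<in> strip a b \<Longrightarrow> dq u z = uq z" "z \<in> strip a b \<Longrightarrow> (\<lambda>t. u (t, snd z)) differentiable (at (fst z))"
  using assms[of "snd z" "fst z"] by (auto simp: dq_def mem_strip intro: vector_derivative_at differentiableI_vector)

lemma vderiv_p_eq:
  assumes "a < b" "\<And>q p. p \<in> {a..b} \<Longrightarrow> ((\<lambda>t. u (q, t)) has_vector_derivative up (q, p)) (at p within {a..b})"
  shows "z \<in> strip a b \<Longrightarrow> dp a b u z = up z" "z \<in> strip a b \<Longrightarrow> (\<lambda>t. u (fst z, t)) differentiable (at (snd z) within {a..b})"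
  using assms(2)[of "snd z" "fst z"] assms(1)
  by (auto simp: dp_def mem_strip intro: vector_derivative_within_closed_interval differentiableI_vector)

text \<open>Uniqueness of derivatives identifies \<open>dq\<close> and \<open>dp\<close> with the
  listed functions on the strip. The second derivatives need a transfer first, because
  \<open>dq u\<close> and \<open>uq\<close> may differ off the strip.\<close>

lemma C2d_imp_C2_alpha:
  assumes C: "C2d \<alpha> a b u uq up uqq uqp upq upp" and cyl: "cyl_fun a b u" and ab: "a < b" and \<alpha>: "0 < \<alpha>"
  shows "u \<in> C2_alpha \<alpha> a b"
    and "\<And>z. z \<in> strip a b \<Longrightarrow> dq u z = uq z" "\<And>z. z \<in> strip a b \<Longrightarrow> dp a b u z = up z"
    and "\<And>z. z \<in> strip a b \<Longrightarrow> dq (dq u) z = uqq z" "\<And>z. z \<in> strip a b \<Longrightarrow> dp a b (dq u) z = uqp z"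
    and "\<And>z. z \<in> strip a b \<Longrightarrow> dq (dp a b u) z = upq z" "\<And>z. z \<in> strip a b \<Longrightarrow> dp a b (dp a b u) z = upp z"
proof -
  note D = C2dD[OF C]
  have 1: "dq u z = uq z" "dp a b u z = up z" if "z \<in> strip a b" for z
    using vderiv_q_eq(1)[of a b u uq, OF D(1) that] vderiv_p_eq(1)[of a b u up, OF ab D(2) that] by simp_all
  have tq: "((\<lambda>t. g (t, p)) has_vector_derivative g' (q, p)) (at q)"
    if "\<And>q p. p \<in> {a..b} \<Longrightarrow> ((\<lambda>t. f (t, p)) has_vector_derivative g' (q, p)) (at q)"
      "\<And>z. z \<in> strip a b \<Longrightarrow> g z = f z" "p \<in> {a..b}" for f g g' :: "real \<times> real \<Rightarrow> real" and q p
  proof -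
    have "(\<lambda>t. g (t, p)) = (\<lambda>t. f (t, p))" using that(2,3) by (auto simp: mem_strip)
    thus ?thesis using that(1)[OF that(3)] by simp
  qed
  have tp: "((\<lambda>t. g (q, t)) has_vector_derivative g' (q, p)) (at p within {a..b})"
    if "\<And>q p. p \<in> {a..b} \<Longrightarrow> ((\<lambda>t. f (q, t)) has_vector_derivative g' (q, p)) (at p within {a..b})"
      "\<And>z. z \<in> strip a b \<Longrightarrow> g z = f z" "p \<in> {a..b}" for f g g' :: "real \<times> real \<Rightarrow> real" and q p
    by (rule has_vector_derivative_transform[OF that(3) _ that(1)[OF that(3)]]) (use that(2) in \<open>auto simp: mem_strip\<close>)
  note E = tq[OF D(3) 1(1)] tp[OF D(4) 1(1)] tq[OF D(5) 1(2)] tp[OF D(6) 1(2)]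
  have 2: "dq (dq u) z = uqq z" "dp a b (dq u) z = uqp z" "dq (dp a b u) z = upq z" "dp a b (dp a b u) z = upp z"
    if "z \<in> strip a b" for z
    using vderiv_q_eq(1)[of a b "dq u" uqq, OF E(1) that] vderiv_p_eq(1)[of a b "dq u" uqp, OF ab E(2) that]
      vderiv_q_eq(1)[of a b "dp a b u" upq, OF E(3) that] vderiv_p_eq(1)[of a b "dp a b u" upp, OF ab E(4) that] by simp_all
  show "\<And>z. z \<in> strip a b \<Longrightarrow> dq u z = uq z" "\<And>z. z \<in> strip a b \<Longrightarrow> dp a b u z = up z"
    "\<And>z. z \<in> strip a b \<Longrightarrow> dq (dq u) z = uqq z" "\<And>z. z \<in> strip a b \<Longrightarrow> dp a b (dq u) z = uqp z"
    "\<And>z. z \<in> strip a b \<Longrightarrow> dq (dp a b u) z = upq z" "\<And>z. z \<in> strip a b \<Longrightarrow> dp a b (dp a b u) z = upp z"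
    using 1 2 by auto
  have H: "hb (strip a b) \<alpha> u" "hb (strip a b) \<alpha> (dq u)" "hb (strip a b) \<alpha> (dp a b u)" "hb (strip a b) \<alpha> (dq (dq u))"
    "hb (strip a b) \<alpha> (dp a b (dq u))" "hb (strip a b) \<alpha> (dq (dp a b u))" "hb (strip a b) \<alpha> (dp a b (dp a b u))"
    using D(7) hb_cong[OF D(8)] hb_cong[OF D(9)] hb_cong[OF D(10)] hb_cong[OF D(11)] hb_cong[OF D(12)] hb_cong[OF D(13)] 1 2
    by metis+
  have C1: "C1_strip a b f" if "hb (strip a b) \<alpha> f" "hb (strip a b) \<alpha> (dq f)" "hb (strip a b) \<alpha> (dp a b f)"
     "\<And>z. z \<in> strip a b \<Longrightarrow> (\<lambda>t. f (t, snd z)) differentiable (at (fst z))"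
     "\<And>z. z \<in> strip a b \<Longrightarrow> (\<lambda>t. f (fst z, t)) differentiable (at (snd z) within {a..b})" for f
    unfolding C1_strip_def using that \<alpha> by (auto intro: hb_imp_continuous_on)
  have "C2_strip a b u"
    unfolding C2_strip_def
  proof (intro conjI)
    show "C1_strip a b u" by (rule C1[OF H(1-3) vderiv_q_eq(2)[of a b u, OF D(1)] vderiv_p_eq(2)[of a b u, OF ab D(2)]])
    show "C1_strip a b (dq u)" by (rule C1[OF H(2,4,5) vderiv_q_eq(2)[of a b "dq u", OF E(1)] vderiv_p_eq(2)[of a b "dq u", OF ab E(2)]])
    show "C1_strip a b (dp a b u)" by (rule C1[OF H(3,6,7) vderiv_q_eq(2)[of a b "dp a b u", OF E(3)] vderiv_p_eq(2)[of a b "dp a b u", OF ab E(4)]])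
  qed
  thus "u \<in> C2_alpha \<alpha> a b"
    using cyl H unfolding C2_alpha_def hb_def by auto
qed

lemma C1_stripD:
  assumes "C1_strip a b u" "a < b"
  shows "p \<in> {a..b} \<Longrightarrow> ((\<lambda>t. u (t, p)) has_vector_derivative dq u (q, p)) (at q)"
    "p \<in> {a..b} \<Longrightarrow> ((\<lambda>t. u (q, t)) has_vector_derivative dp a b u (q, p)) (at p within {a..b})"
proof -
  assume p: "p \<in> {a..b}"
  have "(\<lambda>t. u (t, snd (q, p))) differentiable (at (fst (q, p)))" "(\<lambda>t. u (fst (q, p), t)) differentiable (at (snd (q, p)) within {a..b})"
  proof -
    have "(q, p) \<in> strip a b" using p by (simp add: mem_strip)
    thus "(\<lambda>t. u (t, snd (q, p))) differentiable (at (fst (q, p)))" "(\<lambda>t. u (fst (q, p), t)) differentiable (at (snd (q, p)) within {a..b})"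
      using assms unfolding C1_strip_def by blast+
  qed
  thus "((\<lambda>t. u (t, p)) has_vector_derivative dq u (q, p)) (at q)"
    "((\<lambda>t. u (q, t)) has_vector_derivative dp a b u (q, p)) (at p within {a..b})"
    by (simp_all add: dq_def dp_def vector_derivative_works[symmetric])
qed

lemma C2_alpha_imp_C2d:
  assumes u: "u \<in> C2_alpha \<alpha> a b" and ab: "a < b" and \<alpha>: "0 < \<alpha>" "\<alpha> \<le> 1"
  shows "C2d \<alpha> a b u (dq u) (dp a b u) (dq (dq u)) (dp a b (dq u)) (dq (dp a b u)) (dp a b (dp a b u))"
proof -
  have C: "C1_strip a b u" "C1_strip a b (dq u)" "C1_strip a b (dp a b u)"
    using u unfolding C2_alpha_def C2_strip_def by auto
  note D = C1_stripD[OF C(1) ab] C1_stripD[OF C(2) ab] C1_stripD[OF C(3) ab]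
  have B: "bounded (u ` strip a b)" "bounded (dq u ` strip a b)" "bounded (dp a b u ` strip a b)"
    "hb (strip a b) \<alpha> (dq (dq u))" "hb (strip a b) \<alpha> (dp a b (dq u))" "hb (strip a b) \<alpha> (dq (dp a b u))" "hb (strip a b) \<alpha> (dp a b (dp a b u))"
    using u unfolding C2_alpha_def hb_def by auto
  have "hb (strip a b) \<alpha> u" by (rule hb_strip_partial[OF D(1,2) B(1-3) \<alpha>])
  moreover have "hb (strip a b) \<alpha> (dq u)"
    by (rule hb_strip_partial[OF D(3,4) B(2) _ _ \<alpha>]) (use B in \<open>auto simp: hb_def\<close>)
  moreover have "hb (strip a b) \<alpha> (dp a b u)"
    by (rule hb_strip_partial[OF D(5,6) B(3) _ _ \<alpha>]) (use B in \<open>auto simp: hb_def\<close>)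
  ultimately show ?thesis unfolding C2d_def using D B by auto
qed

lemma C2d_lincomb:
  assumes C: "C2d \<alpha> a b u uq up uqq uqp upq upp" and C': "C2d \<alpha> a b v vq vp vqq vqp vpq vpp"
  shows "C2d \<alpha> a b (\<lambda>z. c * u z + d * v z) (\<lambda>z. c * uq z + d * vq z) (\<lambda>z. c * up z + d * vp z)
    (\<lambda>z. c * uqq z + d * vqq z) (\<lambda>z. c * uqp z + d * vqp z) (\<lambda>z. c * upq z + d * vpq z) (\<lambda>z. c * upp z + d * vpp z)"
proof -
  note D = C2dD[OF C] and D' = C2dD[OF C']
  have "((\<lambda>t. c * f t + d * g t) has_vector_derivative c * f' + d * g') F"
    if "(f has_vector_derivative f') F" "(g has_vector_derivative g') F" for f g :: "real \<Rightarrow> real" and f' g' F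
    by (intro has_vector_derivative_add has_vector_derivative_mult_right that)
  thus ?thesis unfolding C2d_def using D(1-6) D'(1-6)
    by (auto intro!: hb_add hb_cmult D D')
qed

text \<open>Periodicity passes to derivatives by their uniqueness, which in the p-direction rests on
  the interval being nondegenerate.\<close>

lemma C2d_per:
  assumes C: "C2d \<alpha> a b u uq up uqq uqp upq upp" and ab: "a < b" and per: "\<And>q p. u (q + 2 * pi, p) = u (q, p)"
    and p: "p \<in> {a..b}"
  shows "uq (q + 2 * pi, p) = uq (q, p)" "up (q + 2 * pi, p) = up (q, p)"
    "uqq (q + 2 * pi, p) = uqq (q, p)" "upp (q + 2 * pi, p) = upp (q, p)"
proof -
  note D = C2dD[OF C]
  have tq: "g (q + 2 * pi, p) = g (q, p)"
    if "\<And>q. ((\<lambda>t. f (t, p)) has_vector_derivative g (q, p)) (at q)" "\<And>q. f (q + 2 * pi, p) = f (q, p)" for f g :: "real \<times> real \<Rightarrow> real" and q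
  proof -
    have "((\<lambda>t. f (t, p)) \<circ> (\<lambda>q. q + 2 * pi) has_vector_derivative 1 *\<^sub>R g (q + 2 * pi, p)) (at q)"
      by (rule vector_diff_chain_at) (auto intro!: derivative_eq_intros that(1))
    hence "((\<lambda>t. f (t, p)) has_vector_derivative g (q + 2 * pi, p)) (at q)" by (simp add: o_def that(2))
    from vector_derivative_unique_at[OF this that(1)] show ?thesis .
  qed
  have tp: "g (q + 2 * pi, p) = g (q, p)"
    if "\<And>q p. p \<in> {a..b} \<Longrightarrow> ((\<lambda>t. f (q, t)) has_vector_derivative g (q, p)) (at p within {a..b})"
       "\<And>q p. p \<in> {a..b} \<Longrightarrow> f (q + 2 * pi, p) = f (q, p)" "p \<in> {a..b}" for f g :: "real \<times> real \<Rightarrow> real" and q p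
  proof -
    have "((\<lambda>t. f (q, t)) has_vector_derivative g (q + 2 * pi, p)) (at p within {a..b})"
      by (rule has_vector_derivative_transform[OF that(3) _ that(1)[OF that(3)]]) (use that(2) in auto)
    from vector_derivative_unique_within_closed_interval[of a b p, OF ab _ this[folded cbox_interval] that(1)[OF that(3), folded cbox_interval]] that(3)
    show ?thesis by simp
  qed
  show 1: "uq (q + 2 * pi, p) = uq (q, p)" for q by (rule tq[of u, OF D(1)[OF p] per])
  show "uqq (q + 2 * pi, p) = uqq (q, p)" by (rule tq[of uq, OF D(3)[OF p] 1])
  have 2: "up (q + 2 * pi, p) = up (q, p)" if "p \<in> {a..b}" for q p by (rule tp[of u, OF D(2) per that])
  show "up (q + 2 * pi, p) = up (q, p)" by (rule 2[OF p])
  show "upp (q + 2 * pi, p) = upp (q, p)" by (rule tp[of up, OF D(6) 2 p])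
qed

lemma C2_alpha_subspace:
  assumes ab: "a < b" and \<alpha>: "0 < \<alpha>" "\<alpha> \<le> 1"
  shows "subspace (C2_alpha \<alpha> a b)"
proof (rule subspaceI)
  have lc: "(\<lambda>z. c * u z + d * v z) \<in> C2_alpha \<alpha> a b" if "u \<in> C2_alpha \<alpha> a b" "v \<in> C2_alpha \<alpha> a b" for u v c d
    by (rule C2d_imp_C2_alpha(1)[OF C2d_lincomb[OF C2_alpha_imp_C2d[OF that(1) ab \<alpha>] C2_alpha_imp_C2d[OF that(2) ab \<alpha>]] _ ab \<alpha>(1)])
      (use that in \<open>auto simp: C2_alpha_def cyl_fun_def\<close>)
  have "C2d \<alpha> a b (\<lambda>_. 0) (\<lambda>_. 0) (\<lambda>_. 0) (\<lambda>_. 0) (\<lambda>_. 0) (\<lambda>_. 0) (\<lambda>_. 0)"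
    unfolding C2d_def by (auto intro!: has_vector_derivative_const)
  from C2d_imp_C2_alpha(1)[OF this _ ab \<alpha>(1)] show "0 \<in> C2_alpha \<alpha> a b" by (simp add: cyl_fun_def zero_fun_def)
  show "x + y \<in> C2_alpha \<alpha> a b" if "x \<in> C2_alpha \<alpha> a b" "y \<in> C2_alpha \<alpha> a b" for x y
    using lc[OF that, of 1 1] by (simp add: plus_fun_def)
  show "c *\<^sub>R x \<in> C2_alpha \<alpha> a b" if "x \<in> C2_alpha \<alpha> a b" for c x
    using lc[OF that that, of c 0] by (simp add: scaleR_fun_def)
qed

section \<open>A maximum principle across the interface\<close>

text \<open>A positive \<open>D\<close> would make \<open>f'\<close> negative just to the left of p,
  so \<open>f\<close> would decrease towards p. Only left neighbours are involved, so p may be the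
  right end of the interval.\<close>

lemma one_sided_max:
  fixes f f' :: "real \<Rightarrow> real"
  assumes p: "a < p" "p \<le> b"
    and f: "\<And>t. t \<in> {a..b} \<Longrightarrow> (f has_vector_derivative f' t) (at t within {a..b})"
    and f'p: "f' p = 0" and f2: "(f' has_vector_derivative D) (at p within {a..b})"
    and mx: "\<And>t. t \<in> {a..b} \<Longrightarrow> f t \<le> f p"
  shows "D \<le> 0"
proof (rule ccontr)
  assume "\<not> D \<le> 0"
  hence D: "D > 0" by simp
  have "(f' has_real_derivative D) (at p within {a..b})"
    using f2 by (simp add: has_real_derivative_iff_has_vector_derivative)
  from has_real_derivative_pos_inc_left[OF this D] obtain d where
    d: "d > 0" "\<And>h. h > 0 \<Longrightarrow> p - h \<in> {a..b} \<Longrightarrow> h < d \<Longrightarrow> f' (p - h) < f' p" by blast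
  define t where "t = max a (p - d / 2)"
  have t: "a \<le> t" "t < p" "p - t < d" using p d by (auto simp: t_def)
  have "\<exists>x\<in>{t<..<p}. f p - f t = (\<lambda>h. h *\<^sub>R f' x) (p - t)"
  proof (rule mvt_simple[OF t(2)])
    fix x assume x: "t \<le> x" "x \<le> p"
    hence "(f has_vector_derivative f' x) (at x within {a..b})" using t p by (intro f) auto
    thus "(f has_derivative (\<lambda>h. h *\<^sub>R f' x)) (at x within {t..p})"
      unfolding has_vector_derivative_def by (rule has_derivative_subset) (use t p in auto)
  qed
  then obtain x where x: "t < x" "x < p" "f p - f t = (p - t) * f' x" by auto
  have "f' (p - (p - x)) < f' p" using x t p by (intro d) auto
  hence "f p - f t < 0" using x f'p t by (simp add: mult_pos_neg)
  moreover have "f t \<le> f p" using t p by (intro mx) auto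
  ultimately show False by simp
qed

lemma interior_max:
  fixes f :: "real \<Rightarrow> real"
  assumes f: "(f has_vector_derivative D) (at x within {a..b})" and x: "a < x" "x < b"
    and mx: "\<And>t. t \<in> {a..b} \<Longrightarrow> f t \<le> f x"
  shows "D = 0"
proof (rule DERIV_local_max)
  have "at x within {a..b} = at x" using x by (simp add: at_within_Icc_at)
  thus "DERIV f x :> D" using f by (simp add: has_real_derivative_iff_has_vector_derivative)
  show "0 < min (x - a) (b - x)" using x by simp
  show "\<forall>y. \<bar>x - y\<bar> < min (x - a) (b - x) \<longrightarrow> f y \<le> f x" using mx x by (auto simp: abs_less_iff)
qed

lemma left_end_max:
  fixes f :: "real \<Rightarrow> real"
  assumes f: "(f has_vector_derivative D) (at a within {a..b})" and x: "a < b"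
    and mx: "\<And>t. t \<in> {a..b} \<Longrightarrow> f t \<le> f a"
  shows "D \<le> 0"
proof (rule ccontr)
  assume "\<not> D \<le> 0"
  with f obtain d where d: "d > 0" "\<And>h. h > 0 \<Longrightarrow> a + h \<in> {a..b} \<Longrightarrow> h < d \<Longrightarrow> f a < f (a + h)"
    using has_real_derivative_pos_inc_right[of f D a "{a..b}"] by (auto simp: has_real_derivative_iff_has_vector_derivative)
  define h where "h = min (d / 2) (b - a)"
  have "h > 0" "h < d" "a + h \<in> {a..b}" using d(1) x by (auto simp: h_def)
  with d(2)[of h] mx[of "a + h"] show False by force
qed

lemma right_end_max:
  fixes f :: "real \<Rightarrow> real"
  assumes f: "(f has_vector_derivative D) (at b within {a..b})" and x: "a < b"
    and mx: "\<And>t. t \<in> {a..b} \<Longrightarrow> f t \<le> f b"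
  shows "D \<ge> 0"
proof (rule ccontr)
  assume "\<not> D \<ge> 0"
  with f obtain d where d: "d > 0" "\<And>h. h > 0 \<Longrightarrow> b - h \<in> {a..b} \<Longrightarrow> h < d \<Longrightarrow> f b < f (b - h)"
    using has_real_derivative_neg_dec_left[of f D b "{a..b}"] by (auto simp: has_real_derivative_iff_has_vector_derivative)
  define h where "h = min (d / 2) (b - a)"
  have "h > 0" "h < d" "b - h \<in> {a..b}" using d(1) x by (auto simp: h_def)
  with d(2)[of h] mx[of "b - h"] show False by force
qed

text \<open>The term \<open>\<epsilon> exp (\<mu> p)\<close> makes the differential inequality at a maximum strict; the maximum may lie on the right end.\<close>

lemma no_max:
  assumes C: "C2d \<alpha> a b u uq up uqq uqp upq upp" and p: "a < p" "p \<le> b"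
    and eq: "upp (q, p) + \<kappa> * uqq (q, p) - \<beta> * up (q, p) = 0" and \<kappa>: "\<kappa> \<ge> 0" and \<beta>: "\<bar>\<beta>\<bar> < \<mu>" and \<epsilon>: "\<epsilon> > 0"
    and mxq: "\<And>t. u (t, p) \<le> u (q, p)"
    and mxp: "\<And>t. t \<in> {a..b} \<Longrightarrow> u (q, t) + \<epsilon> * exp (\<mu> * t) \<le> u (q, p) + \<epsilon> * exp (\<mu> * p)"
    and crit: "up (q, p) + \<epsilon> * (\<mu> * exp (\<mu> * p)) = 0"
  shows False
proof -
  note D = C2dD[OF C]
  have p': "p \<in> {a..b}" using p by auto
  have e1: "((\<lambda>t. \<epsilon> * exp (\<mu> * t)) has_vector_derivative \<epsilon> * (\<mu> * exp (\<mu> * t))) (at t within S)" for t S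
    unfolding has_real_derivative_iff_has_vector_derivative[symmetric] by (auto intro!: derivative_eq_intros)
  have e2: "((\<lambda>t. \<epsilon> * (\<mu> * exp (\<mu> * t))) has_vector_derivative \<epsilon> * (\<mu>\<^sup>2 * exp (\<mu> * t))) (at t within S)" for t S
    unfolding has_real_derivative_iff_has_vector_derivative[symmetric] by (auto intro!: derivative_eq_intros simp: power2_eq_square)
  have 1: "upp (q, p) + \<epsilon> * (\<mu>\<^sup>2 * exp (\<mu> * p)) \<le> 0"
    by (rule one_sided_max[OF p, of "\<lambda>t. u (q, t) + \<epsilon> * exp (\<mu> * t)" "\<lambda>t. up (q, t) + \<epsilon> * (\<mu> * exp (\<mu> * t))"])
      (auto intro!: has_vector_derivative_add D e1 e2 p' crit mxp)
  have uq0: "uq (q, p) = 0"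
    by (rule interior_max[of "\<lambda>t. u (t, p)" _ _ "q - 1" "q + 1"])
      (use mxq in \<open>auto intro!: has_vector_derivative_at_within[OF D(1)] p'\<close>)
  have 2: "uqq (q, p) \<le> 0"
    by (rule one_sided_max[of "q - 1" q "q + 1" "\<lambda>t. u (t, p)" "\<lambda>t. uq (t, p)"])
      (use mxq uq0 in \<open>auto intro!: has_vector_derivative_at_within[OF D(1)] has_vector_derivative_at_within[OF D(3)] p'\<close>)
  have \<mu>: "\<mu> > 0" using \<beta> by linarith
  have "\<kappa> * uqq (q, p) \<le> 0" using 2 \<kappa> by (simp add: mult_nonneg_nonpos)
  moreover have "upp (q, p) \<le> - (\<epsilon> * (\<mu>\<^sup>2 * exp (\<mu> * p)))" using 1 by linarith
  moreover have "up (q, p) = - (\<epsilon> * (\<mu> * exp (\<mu> * p)))" using crit by linarith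
  ultimately have "0 \<le> - (\<epsilon> * (\<mu>\<^sup>2 * exp (\<mu> * p))) + \<beta> * (\<epsilon> * (\<mu> * exp (\<mu> * p)))" using eq by simp
  also have "\<dots> = (\<epsilon> * \<mu> * exp (\<mu> * p)) * (\<beta> - \<mu>)" by (simp add: algebra_simps power2_eq_square)
  also have "\<dots> < 0" using \<beta> \<mu> \<epsilon> by (intro mult_pos_neg) auto
  finally show False by simp
qed

text \<open>At a maximum on the interface the p-derivative is nonnegative seen from below and
  nonpositive seen from above. The transmission condition makes it zero, so the second-order test in
  the lower layer already rules the point out.\<close>

lemma transmission_max_principle:
  assumes C: "C2d \<alpha> p0 p1 v vq vp vqq vqp vpq vpp" and C': "C2d \<alpha> p1 p2 V Vq Vp Vqq Vqp Vpq Vpp"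
    and p: "p0 < p1" "p1 < p2" and \<alpha>: "0 < \<alpha>"
    and per: "\<And>q p. v (q + 2 * pi, p) = v (q, p)" "\<And>q p. V (q + 2 * pi, p) = V (q, p)"
    and tr: "\<And>q. v (q, p1) = V (q, p1)" "\<And>q. vp (q, p1) = Vp (q, p1)"
    and bd: "\<And>q. v (q, p0) \<le> 0" "\<And>q. V (q, p2) \<le> 0"
    and eq: "\<And>q p. p \<in> {p0..p1} \<Longrightarrow> vpp (q, p) + \<kappa> p * vqq (q, p) - \<beta> p * vp (q, p) = 0"
      "\<And>q p. p \<in> {p1..p2} \<Longrightarrow> Vpp (q, p) + \<kappa> p * Vqq (q, p) - \<beta>' p * Vp (q, p) = 0"
    and \<kappa>: "\<And>p. p \<in> {p0..p2} \<Longrightarrow> \<kappa> p \<ge> 0" and \<beta>: "\<And>p. p \<in> {p0..p2} \<Longrightarrow> \<bar>\<beta> p\<bar> < \<mu> \<and> \<bar>\<beta>' p\<bar> < \<mu>"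
  shows "p \<in> {p0..p1} \<Longrightarrow> v (q, p) \<le> 0" "p \<in> {p1..p2} \<Longrightarrow> V (q, p) \<le> 0"
proof -
  define f where "f = (\<lambda>z. if snd z \<le> p1 then v z else V z)"
  have f1: "f (q, p) = v (q, p)" if "p \<le> p1" for q p using that by (simp add: f_def)
  have f2: "f (q, p) = V (q, p)" if "p \<ge> p1" for q p using that tr by (cases "p = p1") (auto simp: f_def)
  have fper: "f (q + 2 * pi, p) = f (q, p)" for q p using per by (simp add: f_def)
  have cf: "continuous_on (strip p0 p2) f"
  proof -
    have "continuous_on (strip p0 p1 \<union> strip p1 p2) f"
    proof (rule continuous_on_closed_Un)
      show "closed (strip p0 p1)" "closed (strip p1 p2)" unfolding strip_def by (auto intro!: closed_Times)
      show "continuous_on (strip p0 p1) f"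
        by (rule continuous_on_eq[OF hb_imp_continuous_on[OF C2dD(7)[OF C] \<alpha>]]) (auto simp: mem_strip f1)
      show "continuous_on (strip p1 p2) f"
        by (rule continuous_on_eq[OF hb_imp_continuous_on[OF C2dD(7)[OF C'] \<alpha>]]) (auto simp: mem_strip f2)
    qed
    moreover have "strip p0 p1 \<union> strip p1 p2 = strip p0 p2" using p by (auto simp: mem_strip)
    ultimately show ?thesis by simp
  qed
  have \<mu>: "\<mu> > 0" using \<beta>[of p0] p by force
  have main: "f (q, p) \<le> \<epsilon> * exp (\<mu> * p2)" if \<epsilon>: "\<epsilon> > 0" and pp: "p \<in> {p0..p2}" for \<epsilon> q p
  proof -
    define F where "F = (\<lambda>z. f z + \<epsilon> * exp (\<mu> * snd z))"
    have "continuous_on ({0..2 * pi} \<times> {p0..p2}) F"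
      unfolding F_def by (intro continuous_intros continuous_on_subset[OF cf]) (auto simp: strip_def)
    moreover have "compact ({0..2 * pi} \<times> {p0..p2})" "{0..2 * pi} \<times> {p0..p2} \<noteq> {}" using p by (auto intro!: compact_Times)
    ultimately obtain z where z: "z \<in> {0..2 * pi} \<times> {p0..p2}" "\<And>w. w \<in> {0..2 * pi} \<times> {p0..p2} \<Longrightarrow> F w \<le> F z"
      using continuous_attains_sup[of "{0..2 * pi} \<times> {p0..p2}" F] by blast
    obtain q0 r where zz: "z = (q0, r)" by fastforce
    have r: "r \<in> {p0..p2}" using z(1) zz by auto
    \<comment> \<open>Periodicity turns the maximum over one period into a maximum over the whole
      strip.\<close>
    have mx: "F (t, x) \<le> F (q0, r)" if "x \<in> {p0..p2}" for t x
    proof -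
      obtain n :: int where n: "t + of_int n * (2 * pi) \<in> {0..2 * pi}" by (rule per_reduce)
      have "F (t + of_int n * (2 * pi), x) = F (t, x)"
        by (rule per_int[of "\<lambda>t. F (t, x)"]) (simp add: F_def fper)
      thus ?thesis using z(2)[of "(t + of_int n * (2 * pi), x)"] n that zz by auto
    qed
    have "F (q0, r) \<le> \<epsilon> * exp (\<mu> * p2)"
    proof -
      have e: "\<epsilon> * exp (\<mu> * r) \<le> \<epsilon> * exp (\<mu> * p2)" using \<epsilon> \<mu> r by (intro mult_left_mono) auto
      consider "r = p0" | "r = p2" | "p0 < r" "r \<le> p1" | "p1 < r" "r < p2" using r by force
      thus ?thesis
      proof cases
        case 1
        thus ?thesis using e bd(1)[of q0] f1[of p0 q0] p by (simp add: F_def)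
      next
        case 2
        thus ?thesis using e bd(2)[of q0] f2[of p2 q0] p by (simp add: F_def)
      next
        case 3
        have Fv: "F (t, x) = v (t, x) + \<epsilon> * exp (\<mu> * x)" if "x \<in> {p0..p1}" for t x
          using that by (simp add: F_def f1)
        have FV: "F (t, x) = V (t, x) + \<epsilon> * exp (\<mu> * x)" if "x \<in> {p1..p2}" for t x
          using that by (simp add: F_def f2)
        have de: "((\<lambda>t. \<epsilon> * exp (\<mu> * t)) has_vector_derivative \<epsilon> * (\<mu> * exp (\<mu> * t))) (at t within S)" for t S
          unfolding has_real_derivative_iff_has_vector_derivative[symmetric] by (auto intro!: derivative_eq_intros)
        have dv: "((\<lambda>t. v (q0, t) + \<epsilon> * exp (\<mu> * t)) has_vector_derivative vp (q0, r) + \<epsilon> * (\<mu> * exp (\<mu> * r))) (at r within {p0..p1})"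
          using 3 by (intro has_vector_derivative_add de C2dD(2)[OF C]) auto
        have mv: "v (q0, t) + \<epsilon> * exp (\<mu> * t) \<le> v (q0, r) + \<epsilon> * exp (\<mu> * r)" if "t \<in> {p0..p1}" for t
          using mx[of t q0] Fv[of t q0] Fv[of r q0] that 3 p by auto
        have crit: "vp (q0, r) + \<epsilon> * (\<mu> * exp (\<mu> * r)) = 0"
        proof (cases "r = p1")
          case False
          show ?thesis by (rule interior_max[OF dv _ _ mv]) (use 3 False in auto)
        next
          case True
          have a: "vp (q0, r) + \<epsilon> * (\<mu> * exp (\<mu> * r)) \<ge> 0"
            by (rule right_end_max[OF dv[unfolded True] p(1), folded True]) (use mv True in auto)
          have "((\<lambda>t. V (q0, t) + \<epsilon> * exp (\<mu> * t)) has_vector_derivative Vp (q0, p1) + \<epsilon> * (\<mu> * exp (\<mu> * p1))) (at p1 within {p1..p2})"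
            using p by (intro has_vector_derivative_add de C2dD(2)[OF C']) auto
          hence "Vp (q0, p1) + \<epsilon> * (\<mu> * exp (\<mu> * p1)) \<le> 0"
          proof (rule left_end_max[OF _ p(2)])
            fix t assume "t \<in> {p1..p2}"
            thus "V (q0, t) + \<epsilon> * exp (\<mu> * t) \<le> V (q0, p1) + \<epsilon> * exp (\<mu> * p1)"
              using mx[of t q0] FV[of t q0] FV[of p1 q0] True p by auto
          qed
          thus ?thesis using a tr(2)[of q0] True by simp
        qed
        have False
        proof (rule no_max[OF C 3 eq(1) _ _ \<epsilon> _ mv crit])
          show "\<kappa> r \<ge> 0" "\<bar>\<beta> r\<bar> < \<mu>" using \<kappa> \<beta> r by auto
          show "v (t, r) \<le> v (q0, r)" for t using mx[of r t] Fv[of r t] Fv[of r q0] 3 r by auto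
        qed (use 3 in auto)
        thus ?thesis ..
      next
        case 4
        have FV: "F (t, x) = V (t, x) + \<epsilon> * exp (\<mu> * x)" if "x \<in> {p1..p2}" for t x
          using that by (simp add: F_def f2)
        have de: "((\<lambda>t. \<epsilon> * exp (\<mu> * t)) has_vector_derivative \<epsilon> * (\<mu> * exp (\<mu> * t))) (at t within S)" for t S
          unfolding has_real_derivative_iff_has_vector_derivative[symmetric] by (auto intro!: derivative_eq_intros)
        have dv: "((\<lambda>t. V (q0, t) + \<epsilon> * exp (\<mu> * t)) has_vector_derivative Vp (q0, r) + \<epsilon> * (\<mu> * exp (\<mu> * r))) (at r within {p1..p2})"
          using 4 by (intro has_vector_derivative_add de C2dD(2)[OF C']) auto
        have mv: "V (q0, t) + \<epsilon> * exp (\<mu> * t) \<le> V (q0, r) + \<epsilon> * exp (\<mu> * r)" if "t \<in> {p1..p2}" for t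
          using mx[of t q0] FV[of t q0] FV[of r q0] that 4 p by auto
        have crit: "Vp (q0, r) + \<epsilon> * (\<mu> * exp (\<mu> * r)) = 0"
          by (rule interior_max[OF dv _ _ mv]) (use 4 in auto)
        have False
        proof (rule no_max[OF C' 4(1) _ eq(2) _ _ \<epsilon> _ mv crit])
          show "\<kappa> r \<ge> 0" "\<bar>\<beta>' r\<bar> < \<mu>" using \<kappa> \<beta> r by auto
          show "V (t, r) \<le> V (q0, r)" for t using mx[of r t] FV[of r t] FV[of r q0] 4 r by auto
        qed (use 4 in auto)
        thus ?thesis ..
      qed
    qed
    moreover have "f (q, p) \<le> F (q, p)" using \<epsilon> by (simp add: F_def)
    ultimately show ?thesis using mx[OF pp, of q] by linarith
  qed
  have f0: "f (q, p) \<le> 0" if "p \<in> {p0..p2}" for q p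
  proof (rule ccontr)
    assume n: "\<not> f (q, p) \<le> 0"
    \<comment> \<open>Chosen to make the upper bound half of the value assumed positive.\<close>
    define \<epsilon> where "\<epsilon> = f (q, p) / (2 * exp (\<mu> * p2))"
    have "f (q, p) \<le> \<epsilon> * exp (\<mu> * p2)" by (rule main[OF _ that]) (use n in \<open>simp add: \<epsilon>_def\<close>)
    also have "\<dots> = f (q, p) / 2" by (simp add: \<epsilon>_def)
    finally show False using n by simp
  qed
  show "p \<in> {p0..p1} \<Longrightarrow> v (q, p) \<le> 0" using f0[of p q] f1[of p q] p by auto
  show "p \<in> {p1..p2} \<Longrightarrow> V (q, p) \<le> 0" using f0[of p q] f2[of p q] p by auto
qed

section \<open>Periodic and cylindrical function spaces\<close>

text \<open>The \<open>2\<pi>\<close>-periodic solution of \<open>w' + \<mu> w = h\<close>, for \<open>\<mu> \<noteq> 0\<close>.\<close>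

definition per1 :: "real \<Rightarrow> (real \<Rightarrow> real) \<Rightarrow> real \<Rightarrow> real" where
  "per1 \<mu> h q = exp (- \<mu> * q) * integral {q - 2 * pi..q} (\<lambda>y. exp (\<mu> * y) * h y) / (1 - exp (- 2 * pi * \<mu>))"

lemma has_vector_derivative_window:
  fixes f :: "real \<Rightarrow> real"
  assumes c: "continuous_on UNIV f" and c0: "c \<ge> 0"
  shows "((\<lambda>q. integral {q - c..q} f) has_vector_derivative (f q - f (q - c))) (at q)"
proof -
  \<comment> \<open>A base point to the left of all windows near q, so that the moving window is a
    difference of two primitives.\<close>
  define N where "N = q - c - 1"
  have int: "f integrable_on {a..b}" for a b
    by (rule integrable_continuous_interval[OF continuous_on_subset[OF c]]) simp
  have G: "((\<lambda>x. integral {N..x} f) has_vector_derivative f x) (at x)" if "x > N" for x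
  proof -
    have "((\<lambda>x. integral {N..x} f) has_vector_derivative f x) (at x within {N..x + 1})"
      by (rule integral_has_vector_derivative[OF continuous_on_subset[OF c]]) (use that in auto)
    thus ?thesis using that by (simp add: at_within_Icc_at)
  qed
  have "((\<lambda>x. integral {N..x} f) \<circ> (\<lambda>q. q - c) has_vector_derivative 1 *\<^sub>R f (q - c)) (at q)"
    by (rule vector_diff_chain_at, (auto intro!: derivative_eq_intros)[1], rule G) (simp add: N_def)
  hence "((\<lambda>q. integral {N..q} f - integral {N..q - c} f) has_vector_derivative (f q - f (q - c))) (at q)"
    using c0 by (intro has_vector_derivative_diff G) (auto simp: o_def N_def)
  thus ?thesis
  proof (rule has_vector_derivative_transform_within_open[where S = "{N + c<..}"])
    fix x assume "x \<in> {N + c<..}"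
    hence "integral {N..x - c} f + integral {x - c..x} f = integral {N..x} f"
      using c0 by (intro Henstock_Kurzweil_Integration.integral_combine int) auto
    thus "integral {N..x} f - integral {N..x - c} f = integral {x - c..x} f" by simp
  qed (auto simp: N_def)
qed

context
  fixes \<mu> :: real assumes \<mu>: "\<mu> \<noteq> 0"
begin

lemma per1_denom: "1 - exp (- 2 * pi * \<mu>) \<noteq> 0"
  using \<mu> by simp

lemma per1_deriv:
  assumes c: "continuous_on UNIV h" and per: "\<And>x. h (x + 2 * pi) = h x"
  shows "(per1 \<mu> h has_vector_derivative (h q - \<mu> * per1 \<mu> h q)) (at q)"
proof -
  let ?f = "\<lambda>y. exp (\<mu> * y) * h y"
  have cf: "continuous_on UNIV ?f" using c by (intro continuous_intros)
  have "h (q - 2 * pi) = h q" using per[of "q - 2 * pi"] by simp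
  \<comment> \<open>The exponential weight changes by a fixed factor over a period, and the
    difference produces exactly the denominator of \<open>per1\<close>.\<close>
  hence w: "?f q - ?f (q - 2 * pi) = exp (\<mu> * q) * h q * (1 - exp (- 2 * pi * \<mu>))"
    by (simp add: algebra_simps exp_diff exp_minus field_simps)
  have 1: "((\<lambda>q. integral {q - 2 * pi..q} ?f) has_real_derivative exp (\<mu> * q) * h q * (1 - exp (- 2 * pi * \<mu>))) (at q)"
    using has_vector_derivative_window[OF cf, of "2 * pi" q] unfolding w has_real_derivative_iff_has_vector_derivative by simp
  have 2: "((\<lambda>q. exp (- \<mu> * q)) has_real_derivative (- \<mu> * exp (- \<mu> * q))) (at q)"
    by (auto intro!: derivative_eq_intros)
  have "(per1 \<mu> h has_real_derivative
     ((- \<mu> * exp (- \<mu> * q)) * integral {q - 2 * pi..q} ?f + exp (\<mu> * q) * h q * (1 - exp (- 2 * pi * \<mu>)) * exp (- \<mu> * q)) / (1 - exp (- 2 * pi * \<mu>))) (at q)"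
    unfolding per1_def[abs_def] by (rule DERIV_cdivide[OF DERIV_mult[OF 2 1]])
  moreover have "((- \<mu> * exp (- \<mu> * q)) * integral {q - 2 * pi..q} ?f + exp (\<mu> * q) * h q * (1 - exp (- 2 * pi * \<mu>)) * exp (- \<mu> * q)) / (1 - exp (- 2 * pi * \<mu>))
     = h q - \<mu> * per1 \<mu> h q"
  proof -
    have e: "exp (\<mu> * q) * exp (- \<mu> * q) = 1" by (simp add: mult_exp_exp)
    have "(- m * E) * I + E' * hh * d * E = d * (hh - m * (E * I / d))" if "E' * E = 1" "d \<noteq> 0" for m E I E' hh d :: real
    proof -
      have "E' * hh * d * E = (E' * E) * hh * d" by simp
      thus ?thesis using that by (simp add: field_simps)
    qed
    from this[OF e per1_denom] show ?thesis using per1_denom by (simp add: per1_def)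
  qed
  ultimately show ?thesis by (simp add: has_real_derivative_iff_has_vector_derivative)
qed

lemma per1_continuous:
  assumes "continuous_on UNIV h" "\<And>x. h (x + 2 * pi) = h x"
  shows "continuous_on S (per1 \<mu> h)"
  by (rule continuous_on_vector_derivative) (rule has_vector_derivative_at_within[OF per1_deriv[OF assms]])

lemma per1_per:
  assumes c: "continuous_on UNIV h" and per: "\<And>x. h (x + 2 * pi) = h x"
  shows "per1 \<mu> h (q + 2 * pi) = per1 \<mu> h q"
proof -
  have "integral {q..q + 2 * pi} (\<lambda>y. exp (\<mu> * y) * h y) = integral {q - 2 * pi..q} (\<lambda>y. exp (\<mu> * (y + 2 * pi)) * h (y + 2 * pi))"
    using integral_shift_Icc_real[of "q - 2 * pi" q "\<lambda>y. exp (\<mu> * y) * h y" "2 * pi"] by (simp add: o_def add.commute)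
  also have "\<dots> = integral {q - 2 * pi..q} (\<lambda>y. exp (2 * pi * \<mu>) * (exp (\<mu> * y) * h y))"
  proof -
    have "exp (\<mu> * (y + 2 * pi)) * h (y + 2 * pi) = exp (2 * pi * \<mu>) * (exp (\<mu> * y) * h y)" for y
      unfolding per distrib_left exp_add by (simp add: mult_ac)
    thus ?thesis by simp
  qed
  finally have "integral {q..q + 2 * pi} (\<lambda>y. exp (\<mu> * y) * h y) = exp (2 * pi * \<mu>) * integral {q - 2 * pi..q} (\<lambda>y. exp (\<mu> * y) * h y)"
    by simp
  moreover have "exp (- \<mu> * (q + 2 * pi)) * (exp (2 * pi * \<mu>) * I) = exp (- \<mu> * q) * I" for I :: real
    unfolding mult.assoc[symmetric] mult_exp_exp by (simp add: algebra_simps)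
  ultimately show ?thesis by (simp add: per1_def)
qed

lemma per1_bound:
  assumes c: "continuous_on UNIV h" and N: "\<And>x. \<bar>h x\<bar> \<le> N"
  shows "\<bar>per1 \<mu> h q\<bar> \<le> exp (2 * pi * \<bar>\<mu>\<bar>) * (2 * pi) / \<bar>1 - exp (- 2 * pi * \<mu>)\<bar> * N"
proof -
  have N0: "N \<ge> 0" using N[of 0] by linarith
  have "norm (integral {q - 2 * pi..q} (\<lambda>y. exp (\<mu> * y) * h y)) \<le> exp (\<mu> * q + 2 * pi * \<bar>\<mu>\<bar>) * N * (q - (q - 2 * pi))"
  proof (rule integral_bound)
    show "continuous_on {q - 2 * pi..q} (\<lambda>y. exp (\<mu> * y) * h y)" by (intro continuous_intros continuous_on_subset[OF c]) auto
    fix t assume t: "t \<in> {q - 2 * pi..q}"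
    have "\<bar>\<mu> * (t - q)\<bar> \<le> \<bar>\<mu>\<bar> * (2 * pi)"
      unfolding abs_mult using t by (intro mult_left_mono) auto
    hence "\<mu> * (t - q) \<le> \<bar>\<mu>\<bar> * (2 * pi)" by linarith
    hence "\<mu> * t \<le> \<mu> * q + 2 * pi * \<bar>\<mu>\<bar>" by (simp add: algebra_simps)
    thus "norm (exp (\<mu> * t) * h t) \<le> exp (\<mu> * q + 2 * pi * \<bar>\<mu>\<bar>) * N"
      using N N0 by (auto simp: abs_mult intro!: mult_mono)
  qed simp
  hence "\<bar>integral {q - 2 * pi..q} (\<lambda>y. exp (\<mu> * y) * h y)\<bar> \<le> exp (\<mu> * q + 2 * pi * \<bar>\<mu>\<bar>) * N * (2 * pi)" by simp
  hence "exp (- \<mu> * q) * \<bar>integral {q - 2 * pi..q} (\<lambda>y. exp (\<mu> * y) * h y)\<bar> \<le> exp (- \<mu> * q) * (exp (\<mu> * q + 2 * pi * \<bar>\<mu>\<bar>) * N * (2 * pi))"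
    by (intro mult_left_mono) auto
  also have "\<dots> = exp (2 * pi * \<bar>\<mu>\<bar>) * (2 * pi) * N"
    unfolding mult.assoc[symmetric] mult_exp_exp by simp
  finally show ?thesis by (simp add: per1_def abs_mult abs_divide divide_right_mono)
qed

lemma per1_lin:
  assumes "continuous_on UNIV h" "continuous_on UNIV k"
  shows "per1 \<mu> (\<lambda>x. c * h x + d * k x) q = c * per1 \<mu> h q + d * per1 \<mu> k q"
proof -
  have int: "(\<lambda>y. exp (\<mu> * y) * f y) integrable_on {q - 2 * pi..q}" if "continuous_on UNIV f" for f :: "real \<Rightarrow> real"
    using that by (intro integrable_continuous_interval continuous_intros continuous_on_subset[OF that]) auto
  have "integral {q - 2 * pi..q} (\<lambda>y. exp (\<mu> * y) * (c * h y + d * k y)) =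
    integral {q - 2 * pi..q} (\<lambda>y. c * (exp (\<mu> * y) * h y) + d * (exp (\<mu> * y) * k y))" by (simp add: algebra_simps)
  also have "\<dots> = c * integral {q - 2 * pi..q} (\<lambda>y. exp (\<mu> * y) * h y) + d * integral {q - 2 * pi..q} (\<lambda>y. exp (\<mu> * y) * k y)"
    using int[OF assms(1)] int[OF assms(2)]
    by (subst Henstock_Kurzweil_Integration.integral_add) (auto intro!: integrable_on_mult_right)
  finally show ?thesis by (simp add: per1_def add_divide_distrib algebra_simps)
qed

end

text \<open>Functions on the closed cylinder, extended constantly in p. In this form they are
  bounded continuous functions on the plane, a complete space in which the contraction principle can
  be applied.\<close>

definition cylC :: "real \<Rightarrow> real \<Rightarrow> (real \<times> real \<Rightarrow> real) set" where
  "cylC lo hi = {w. continuous_on UNIV w \<and> (\<forall>q p. w (q + 2 * pi, p) = w (q, p)) \<and> (\<forall>q p. w (q, p) = w (q, max lo (min p hi)))}"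

lemma cylCD:
  assumes "w \<in> cylC lo hi"
  shows "continuous_on UNIV w" "w (q + 2 * pi, p) = w (q, p)" "w (q, max lo (min p hi)) = w (q, p)"
  using assms unfolding cylC_def mem_Collect_eq by (blast, blast, metis)

lemma cylCI:
  assumes "continuous_on UNIV w" "\<And>q p. w (q + 2 * pi, p) = w (q, p)" "\<And>q p. w (q, max lo (min p hi)) = w (q, p)"
  shows "w \<in> cylC lo hi"
  using assms(1,2) assms(3)[symmetric] unfolding cylC_def mem_Collect_eq by blast

lemma cylC_subspace: "subspace (cylC lo hi)"
proof (rule subspaceI)
  show "0 \<in> cylC lo hi" by (rule cylCI) (auto simp: zero_fun_def)
  fix x y assume xy: "x \<in> cylC lo hi" "y \<in> cylC lo hi"
  show "x + y \<in> cylC lo hi"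
    unfolding plus_fun_def
    by (rule cylCI, rule continuous_on_add[OF cylCD(1)[OF xy(1)] cylCD(1)[OF xy(2)]])
       (simp_all only: cylCD(2,3)[OF xy(1)] cylCD(2,3)[OF xy(2)])
next
  fix c x assume x: "x \<in> cylC lo hi"
  show "c *\<^sub>R x \<in> cylC lo hi"
    unfolding scaleR_fun_def
    by (rule cylCI, rule continuous_on_scaleR[OF continuous_on_const cylCD(1)[OF x]])
       (simp_all only: cylCD(2,3)[OF x])
qed

lemma cylC_bounded:
  assumes "w \<in> cylC lo hi" "lo \<le> hi"
  obtains N where "N \<ge> 0" "\<And>z. \<bar>w z\<bar> \<le> N"
proof -
  have "compact (w ` ({0..2 * pi} \<times> {lo..hi}))"
    using assms(1) by (intro compact_continuous_image compact_Times compact_Icc) (rule continuous_on_subset[OF cylCD(1)[OF assms(1)] subset_UNIV])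
  then obtain N where N: "\<And>z. z \<in> {0..2 * pi} \<times> {lo..hi} \<Longrightarrow> \<bar>w z\<bar> \<le> N"
    using bounded_iff[THEN iffD1, OF compact_imp_bounded] by (metis imageI real_norm_def)
  have "\<bar>w z\<bar> \<le> \<bar>N\<bar>" for z
  proof -
    obtain q p where z: "z = (q, p)" by fastforce
    define p' where "p' = max lo (min p hi)"
    obtain n :: int where n: "q + of_int n * (2 * pi) \<in> {0..2 * pi}" by (rule per_reduce)
    have "w (q + of_int n * (2 * pi), p') = w (q, p')"
      by (rule per_int[of "\<lambda>q. w (q, p')"]) (rule cylCD(2)[OF assms(1)])
    moreover have "w (q, p) = w (q, p')" unfolding p'_def by (rule cylCD(3)[OF assms(1), symmetric])
    moreover have "p' \<in> {lo..hi}" using assms(2) by (auto simp: p'_def)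
    ultimately show ?thesis using N[of "(q + of_int n * (2 * pi), p')"] n z by auto
  qed
  thus ?thesis using that[of "\<bar>N\<bar>"] by simp
qed

text \<open>\<open>E\<close> may fail to be a contraction, but its square is one, so the equation is
  iterated once to \<open>w = r - E r + E (E w)\<close>. If w solves this, then
  \<open>r - E w\<close> solves it too, and uniqueness of the fixed point gives
  \<open>w + E w = r\<close>.\<close>

lemma cylC_neumann:
  assumes lohi: "lo \<le> hi" and E: "linear_on' (cylC lo hi) E" "\<And>w. w \<in> cylC lo hi \<Longrightarrow> E w \<in> cylC lo hi"
    and half: "\<And>w N z. w \<in> cylC lo hi \<Longrightarrow> (\<And>z. \<bar>w z\<bar> \<le> N) \<Longrightarrow> \<bar>E (E w) z\<bar> \<le> N / 2"
    and r: "r \<in> cylC lo hi"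
  shows "\<exists>!w. w \<in> cylC lo hi \<and> w + E w = r"
proof -
  let ?S = "cylC lo hi"
  note sub = cylC_subspace[of lo hi]
  define B where "B = {b :: (real \<times> real) \<Rightarrow>\<^sub>C real. apply_bcontfun b \<in> ?S}"
  have bc: "w \<in> bcontfun" if w: "w \<in> ?S" for w
  proof -
    obtain N where "\<And>z. \<bar>w z\<bar> \<le> N" using cylC_bounded[OF w lohi] by blast
    thus ?thesis using cylCD(1)[OF w] by (auto simp: bcontfun_def bounded_iff)
  qed
  have inv: "apply_bcontfun (Bcontfun w) = w" if "w \<in> ?S" for w by (rule Bcontfun_inverse[OF bc[OF that]])
  define \<Phi> where "\<Phi> = (\<lambda>w. r - E r + E (E w))"
  have \<Phi>S: "\<Phi> w \<in> ?S" if "w \<in> ?S" for w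
    unfolding \<Phi>_def by (intro subspace_add[OF sub] subspace_diff[OF sub] E r that)
  have EE: "E (E w) - E (E w') = E (E (w - w'))" if "w \<in> ?S" "w' \<in> ?S" for w w'
    using linear_on'D(2)[OF E(1) that] linear_on'D(2)[OF E(1) E(2)[OF that(1)] E(2)[OF that(2)]] by simp
  \<comment> \<open>Iterating the halving estimate bounds w by N / 2^n for all n.\<close>
  have zero: "w = 0" if w: "w \<in> ?S" "w = E (E w)" for w
  proof -
    obtain N where N: "N \<ge> 0" "\<And>z. \<bar>w z\<bar> \<le> N" using cylC_bounded[OF w(1) lohi] by blast
    have *: "\<bar>w z\<bar> \<le> N / 2 ^ n" for n z
    proof (induction n arbitrary: z)
      case 0 show ?case using N by simp
    next
      case (Suc n) show ?case using half[OF w(1) Suc, of z] w(2) by simp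
    qed
    have "w z = 0" for z
    proof -
      have "(\<lambda>n. N * (1 / 2) ^ n) \<longlonglongrightarrow> N * 0" by (intro tendsto_intros) auto
      moreover have "\<forall>n\<ge>0. \<bar>w z\<bar> \<le> N * (1 / 2) ^ n" using * by (simp add: power_divide)
      ultimately have "\<bar>w z\<bar> \<le> N * 0" by (intro LIMSEQ_le_const) blast+
      thus ?thesis by simp
    qed
    thus ?thesis by (simp add: fun_eq_iff)
  qed
  have uniq: "w = w'" if "w \<in> ?S" "w' \<in> ?S" "w + E w = r" "w' + E w' = r" for w w'
  proof -
    have d: "w - w' \<in> ?S" by (rule subspace_diff[OF sub that(1,2)])
    have e: "w - w' = - E (w - w')"
    proof -
      have "w = r - E w" "w' = r - E w'"
        by (rule eq_diff_eq[THEN iffD2], rule that)+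
      hence "w - w' = (r - E w) - (r - E w')" by (rule arg_cong2[where f = "(-)"])
      also have "\<dots> = - (E w - E w')" by simp
      finally show ?thesis using linear_on'D(2)[OF E(1) that(1,2)] by simp
    qed
    have "E (w - w') = - E (E (w - w'))"
      using arg_cong[OF e, of E] linear_on'D(5)[OF E(1) E(2)[OF d] d] by simp
    hence "w - w' = - (- E (E (w - w')))" by (subst e) (rule arg_cong[where f = uminus])
    hence "w - w' = E (E (w - w'))" by (simp only: minus_minus)
    from zero[OF d this] show ?thesis by simp
  qed
  have fixu: "w = w'" if "w \<in> ?S" "w' \<in> ?S" "w = \<Phi> w" "w' = \<Phi> w'" for w w'
  proof -
    have "w - w' = \<Phi> w - \<Phi> w'" using that by simp
    also have "\<dots> = E (E (w - w'))" unfolding EE[OF that(1,2), symmetric] by (simp add: \<Phi>_def)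
    finally show ?thesis using zero[OF subspace_diff[OF sub that(1,2)]] by simp
  qed
  have "\<exists>!b\<in>B. Bcontfun (\<Phi> (apply_bcontfun b)) = b"
  proof (rule Banach_fix[where c = "1/2"])
    have "closed B"
      unfolding closed_sequential_limits
    proof (intro allI impI, elim conjE)
      fix x :: "nat \<Rightarrow> (real \<times> real) \<Rightarrow>\<^sub>C real" and b assume x: "\<forall>n. x n \<in> B" and lim: "x \<longlonglongrightarrow> b"
      have pt: "(\<lambda>n. x n z) \<longlonglongrightarrow> b z" for z
      proof (rule metric_LIMSEQ_I)
        fix e :: real assume "e > 0"
        then obtain M where "\<forall>n\<ge>M. dist (x n) b < e" using metric_LIMSEQ_D[OF lim] by blast
        thus "\<exists>no. \<forall>n\<ge>no. dist (x n z) (b z) < e" using dist_bounded[of "x _" z b] by (meson order_le_less_trans)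
      qed
      have "b (q + 2 * pi, p) = b (q, p)" "b (q, max lo (min p hi)) = b (q, p)" for q p
      proof -
        have "(\<lambda>n. x n (q + 2 * pi, p)) = (\<lambda>n. x n (q, p))" "(\<lambda>n. x n (q, max lo (min p hi))) = (\<lambda>n. x n (q, p))"
          using x cylCD(2,3) unfolding B_def mem_Collect_eq by (metis (no_types))+
        thus "b (q + 2 * pi, p) = b (q, p)" "b (q, max lo (min p hi)) = b (q, p)"
          using pt LIMSEQ_unique by metis+
      qed
      thus "b \<in> B" unfolding B_def mem_Collect_eq by (intro cylCI continuous_on_apply_bcontfun)
    qed
    thus "complete B" by (rule complete_eq_closed[THEN iffD2])
    have "Bcontfun r \<in> B" using inv[OF r] r by (simp add: B_def)
    thus "B \<noteq> {}" by blast
    show "(\<lambda>b. Bcontfun (\<Phi> (apply_bcontfun b))) ` B \<subseteq> B" using inv \<Phi>S by (auto simp: B_def)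
    fix x y assume xy: "x \<in> B" "y \<in> B"
    show "dist (Bcontfun (\<Phi> (apply_bcontfun x))) (Bcontfun (\<Phi> (apply_bcontfun y))) \<le> 1 / 2 * dist x y"
    proof (rule dist_bound)
      fix z
      have S: "apply_bcontfun x \<in> ?S" "apply_bcontfun y \<in> ?S" using xy by (auto simp: B_def)
      have "\<Phi> (apply_bcontfun x) - \<Phi> (apply_bcontfun y) = E (E (apply_bcontfun x - apply_bcontfun y))"
        unfolding EE[OF S, symmetric] by (simp add: \<Phi>_def)
      hence eq: "\<Phi> (apply_bcontfun x) z - \<Phi> (apply_bcontfun y) z = E (E (apply_bcontfun x - apply_bcontfun y)) z"
        by (auto dest: fun_cong[of _ _ z] simp del: split_paired_All)
      have "\<bar>E (E (apply_bcontfun x - apply_bcontfun y)) z\<bar> \<le> dist x y / 2"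
      proof (rule half)
        show "apply_bcontfun x - apply_bcontfun y \<in> ?S" by (rule subspace_diff[OF sub S])
        show "\<bar>(apply_bcontfun x - apply_bcontfun y) z\<bar> \<le> dist x y" for z
          using dist_bounded[of x z y] by (simp add: dist_real_def)
      qed
      thus "dist (apply_bcontfun (Bcontfun (\<Phi> (apply_bcontfun x))) z) (apply_bcontfun (Bcontfun (\<Phi> (apply_bcontfun y))) z) \<le> 1 / 2 * dist x y"
        using inv[OF \<Phi>S[OF S(1)]] inv[OF \<Phi>S[OF S(2)]] eq by (simp add: dist_real_def)
    qed
  qed auto
  then obtain b where b: "b \<in> B" "Bcontfun (\<Phi> (apply_bcontfun b)) = b" by blast
  define w where "w = apply_bcontfun b"
  have w: "w \<in> ?S" "w = \<Phi> w" using b inv[OF \<Phi>S, of w] by (auto simp: w_def B_def)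
  define w' where "w' = r - E w"
  have w': "w' \<in> ?S" unfolding w'_def by (intro subspace_diff[OF sub] r E w)
  have Ew': "E w' = r - w"
  proof -
    have "E w' = E r - E (E w)" unfolding w'_def by (rule linear_on'D(2)[OF E(1) r E(2)[OF w(1)]])
    also have "\<dots> = r - (r - E r + E (E w))" by simp
    also have "r - E r + E (E w) = w" using w(2) unfolding \<Phi>_def by (rule sym)
    finally show ?thesis .
  qed
  have "\<Phi> w' = r - E r + E (r - w)" by (simp add: \<Phi>_def Ew')
  also have "E (r - w) = E r - E w" by (rule linear_on'D(2)[OF E(1) r w(1)])
  also have "r - E r + (E r - E w) = w'" unfolding w'_def fun_eq_iff minus_apply plus_fun_apply by simp
  finally have "\<Phi> w' = w'" .
  hence eq: "w' = w" using fixu[OF w(1) w' w(2)] by simp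
  have "w' + E w = r" unfolding w'_def by (rule diff_add_cancel)
  hence "w + E w = r" unfolding eq .
  thus ?thesis using w(1) uniq by blast
qed

section \<open>Hoelder partitions of unity on the cylinder\<close>

lemma hb_inverse:
  assumes "hb S \<alpha> f" "\<And>z. z \<in> S \<Longrightarrow> c \<le> f z" "c > 0"
  shows "hb S \<alpha> (\<lambda>z. 1 / f z)"
proof -
  obtain N where N: "N \<ge> 0" "\<And>z. z \<in> S \<Longrightarrow> \<bar>f z\<bar> \<le> N" "\<And>z w. z \<in> S \<Longrightarrow> w \<in> S \<Longrightarrow> \<bar>f z - f w\<bar> \<le> N * dist z w powr \<alpha>"
    using assms(1) unfolding hb_iff by blast
  show ?thesis unfolding hb_iff
  proof (intro exI[of _ "1 / c + N / c\<^sup>2"] conjI ballI)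
    show "0 \<le> 1 / c + N / c\<^sup>2" using N assms by simp
    show "\<bar>1 / f z\<bar> \<le> 1 / c + N / c\<^sup>2" if "z \<in> S" for z
    proof -
      have "\<bar>1 / f z\<bar> \<le> 1 / c" using assms(2)[OF that] assms(3) by (simp add: frac_le)
      thus ?thesis using N(1) by (simp add: add_increasing2)
    qed
    fix z w assume zw: "z \<in> S" "w \<in> S"
    have fp: "f z > 0" "f w > 0" using assms(2)[OF zw(1)] assms(2)[OF zw(2)] assms(3) by auto
    have "\<bar>1 / f z - 1 / f w\<bar> = \<bar>f z - f w\<bar> / (f z * f w)"
      using fp by (simp add: divide_simps abs_divide abs_mult abs_minus_commute)
    also have "\<dots> \<le> (N * dist z w powr \<alpha>) / (c * c)"
      using N(3)[OF zw] assms(2)[OF zw(1)] assms(2)[OF zw(2)] assms(3) N(1) by (intro frac_le mult_mono) auto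
    also have "\<dots> = N / c\<^sup>2 * dist z w powr \<alpha>" by (simp add: power2_eq_square)
    also have "\<dots> \<le> (1 / c + N / c\<^sup>2) * dist z w powr \<alpha>" using assms(3) by (intro mult_right_mono) auto
    finally show "\<bar>1 / f z - 1 / f w\<bar> \<le> (1 / c + N / c\<^sup>2) * dist z w powr \<alpha>" .
  qed
qed

lemma hb_sum: "finite I \<Longrightarrow> (\<And>i. i \<in> I \<Longrightarrow> hb S \<alpha> (f i)) \<Longrightarrow> hb S \<alpha> (\<lambda>z. \<Sum>i\<in>I. f i z)"
  by (induction I rule: finite_induct) (auto intro!: hb_add)

lemma cos_sin_lipschitz:
  fixes x y :: real
  shows "\<bar>cos x - cos y\<bar> \<le> \<bar>x - y\<bar>" "\<bar>sin x - sin y\<bar> \<le> \<bar>x - y\<bar>"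
proof -
  have "norm (cos x - cos y) \<le> 1 * norm (x - y)"
    by (rule field_differentiable_bound[where S = UNIV and f' = "\<lambda>x. - sin x"]) (auto intro!: derivative_eq_intros)
  thus "\<bar>cos x - cos y\<bar> \<le> \<bar>x - y\<bar>" by simp
  have "norm (sin x - sin y) \<le> 1 * norm (x - y)"
    by (rule field_differentiable_bound[where S = UNIV and f' = "\<lambda>x. cos x"]) (auto intro!: derivative_eq_intros)
  thus "\<bar>sin x - sin y\<bar> \<le> \<bar>x - y\<bar>" by simp
qed

text \<open>For the difference t of the angles, reduced to [-pi, pi], the squared chord is 2 - 2 cos
  t = 4 sin^2 (t/2), and \<open>abs_sin_ge_third\<close> bounds the sine from below.\<close>

lemma circle_close:
  fixes x y \<epsilon> :: real
  assumes "\<bar>cos x - cos y\<bar> \<le> \<epsilon>" "\<bar>sin x - sin y\<bar> \<le> \<epsilon>"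
  obtains n :: int where "\<bar>x + of_int n * (2 * pi) - y\<bar> \<le> 6 * \<epsilon>"
proof -
  obtain n :: int where n: "(x - y + pi) + of_int n * (2 * pi) \<in> {0..2 * pi}" by (rule per_reduce)
  define t where "t = x + of_int n * (2 * pi) - y"
  have t: "\<bar>t\<bar> \<le> pi" using n by (auto simp: t_def abs_le_iff)
  have "cos t = cos (x - y)"
    using per_int[of cos "x - y" n, OF cos_periodic] by (simp add: t_def algebra_simps)
  hence "2 - 2 * cos t = (cos x - cos y)\<^sup>2 + (sin x - sin y)\<^sup>2"
    using sin_cos_squared_add3[of x] sin_cos_squared_add3[of y] by (simp add: cos_diff power2_eq_square algebra_simps)
  also have "\<dots> \<le> \<epsilon>\<^sup>2 + \<epsilon>\<^sup>2"
    using assms by (intro add_mono) (auto simp: abs_le_square_iff[symmetric])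
  finally have "(sin (t / 2))\<^sup>2 \<le> \<epsilon>\<^sup>2"
    using cos_double_sin[of "t / 2"] zero_le_power2[of "sin (t / 2)"] by (simp; linarith)
  hence "\<bar>sin (t / 2)\<bar> \<le> \<epsilon>" using assms(1) by (intro abs_le_square_iff[THEN iffD2, of "sin (t/2)" \<epsilon>, THEN order_trans]) auto
  moreover have "\<bar>t / 2\<bar> / 3 \<le> \<bar>sin (t / 2)\<bar>" using t pi_less_4 by (intro abs_sin_ge_third) auto
  ultimately have "\<bar>t\<bar> \<le> 6 * \<epsilon>" by simp
  thus ?thesis using that[of n] by (simp add: t_def)
qed

text \<open>Tent functions around a finite net, divided by their sum. The distance \<open>D\<close>
  sees the angle through cosine and sine, so periodicity is automatic.\<close>

lemma cyl_partition:
  assumes lohi: "lo \<le> hi" and \<delta>: "\<delta> > 0" and \<alpha>: "0 < \<alpha>" "\<alpha> \<le> 1"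
  obtains m :: nat and zj :: "nat \<Rightarrow> real \<times> real" and \<theta> where
    "\<And>j. j < m \<Longrightarrow> \<theta> j \<in> cylC lo hi" "\<And>j. j < m \<Longrightarrow> hb (strip lo hi) \<alpha> (\<theta> j)"
    "\<And>j z. j < m \<Longrightarrow> 0 \<le> \<theta> j z" "\<And>z. (\<Sum>j<m. \<theta> j z) = 1" "\<And>j. j < m \<Longrightarrow> snd (zj j) \<in> {lo..hi}"
    "\<And>j q p. j < m \<Longrightarrow> p \<in> {lo..hi} \<Longrightarrow> \<theta> j (q, p) \<noteq> 0 \<Longrightarrow> \<exists>n::int. \<bar>q + of_int n * (2 * pi) - fst (zj j)\<bar> + \<bar>p - snd (zj j)\<bar> \<le> \<delta>"
proof -
  \<comment> \<open>The angle costs 6 \<epsilon> by \<open>circle_close\<close>, the height another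
    \<epsilon>.\<close>
  define \<epsilon> where "\<epsilon> = \<delta> / 7"
  have \<epsilon>: "\<epsilon> > 0" using \<delta> by (simp add: \<epsilon>_def)
  define D where "D = (\<lambda>z w :: real \<times> real. \<bar>cos (fst z) - cos (fst w)\<bar> + \<bar>sin (fst z) - sin (fst w)\<bar> + \<bar>snd z - snd w\<bar>)"
  have Ddist: "D z w \<le> 3 * dist z w" for z w
    using cos_sin_lipschitz[of "fst z" "fst w"] dist_fst_le[of z w] dist_snd_le[of z w]
    by (simp add: D_def dist_real_def)
  have Dtri: "\<bar>D z x - D w x\<bar> \<le> D z w" for z w x by (simp add: D_def) linarith
  let ?Q = "{0..2 * pi} \<times> {lo..hi}"
  have "compact ?Q" by (intro compact_Times compact_Icc)
  \<comment> \<open>\<open>D\<close> is at most 3 \<open>dist\<close>, so with mesh \<epsilon> / 6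
    some tent always has height at least \<epsilon> / 2, which keeps the denominator away from
    0.\<close>
  then obtain k where k: "finite k" "k \<subseteq> ?Q" "?Q \<subseteq> (\<Union>x\<in>k. ball x (\<epsilon> / 6))"
    using seq_compact_imp_totally_bounded[OF compact_imp_seq_compact, of ?Q] \<epsilon> by (meson divide_pos_pos zero_less_numeral)
  obtain zj where zj: "bij_betw zj {..<card k} k" using ex_bij_betw_nat_finite[OF k(1)] by (metis atLeast0LessThan)
  define m where "m = card k"
  have zjQ: "zj j \<in> ?Q" if "j < m" for j using zj k(2) that by (auto simp: bij_betw_def m_def)
  define cl where "cl = (\<lambda>z :: real \<times> real. (fst z, max lo (min (snd z) hi)))"
  define \<phi> where "\<phi> = (\<lambda>j z. max 0 (\<epsilon> - D (cl z) (zj j)))"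
  define S where "S = (\<lambda>z. \<Sum>j<m. \<phi> j z)"
  have \<phi>0: "\<phi> j z \<ge> 0" for j z by (simp add: \<phi>_def)
  have S: "S z \<ge> \<epsilon> / 2" for z
  proof -
    obtain n :: int where n: "fst z + of_int n * (2 * pi) \<in> {0..2 * pi}" by (rule per_reduce)
    define z' where "z' = (fst z + of_int n * (2 * pi), snd (cl z))"
    have "z' \<in> ?Q" using n lohi by (auto simp: z'_def cl_def)
    then obtain x where x: "x \<in> k" "dist x z' < \<epsilon> / 6" using k(3) by auto
    obtain j where j: "j < m" "x = zj j" using zj x(1) by (auto simp: bij_betw_def m_def)
    have "cos (fst z') = cos (fst z)" "sin (fst z') = sin (fst z)"
      using per_int[of cos "fst z" n] per_int[of sin "fst z" n] by (simp_all add: z'_def)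
    hence "D (cl z) (zj j) = D z' (zj j)" by (simp add: D_def cl_def z'_def)
    also have "\<dots> \<le> 3 * dist z' (zj j)" by (rule Ddist)
    also have "\<dots> < \<epsilon> / 2" using x j by (simp add: dist_commute)
    finally have "\<phi> j z \<ge> \<epsilon> / 2" by (auto simp: \<phi>_def max_def)
    also have "\<phi> j z \<le> S z" unfolding S_def using j \<phi>0 by (intro member_le_sum) auto
    finally show ?thesis .
  qed
  have c\<phi>: "continuous_on UNIV (\<phi> j)" for j
    unfolding \<phi>_def D_def cl_def by (intro continuous_intros)
  have hb\<phi>: "hb (strip lo hi) \<alpha> (\<phi> j)" for j
  proof (rule hb_lipschitz[of _ _ \<epsilon> 3, OF _ _ \<alpha>])
    show "\<bar>\<phi> j z\<bar> \<le> \<epsilon>" for z using \<epsilon> by (simp add: \<phi>_def D_def)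
    fix z w assume "z \<in> strip lo hi" "w \<in> strip lo hi"
    hence "cl z = z" "cl w = w" by (auto simp: cl_def mem_strip prod_eq_iff)
    hence "\<bar>\<phi> j z - \<phi> j w\<bar> \<le> \<bar>D z (zj j) - D w (zj j)\<bar>" by (simp add: \<phi>_def)
    also have "\<dots> \<le> 3 * dist z w" using Dtri[of z "zj j" w] Ddist[of z w] by linarith
    finally show "\<bar>\<phi> j z - \<phi> j w\<bar> \<le> 3 * dist z w" .
  qed
  define \<theta> where "\<theta> = (\<lambda>j z. \<phi> j z * (1 / S z))"
  have S0: "S z > 0" for z using S[of z] \<epsilon> by linarith
  have cS: "continuous_on UNIV S" unfolding S_def by (intro continuous_intros c\<phi>)
  show ?thesis
  proof (rule that[of m \<theta> zj])
    fix j assume j: "j < m"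
    have p: "\<phi> i (q + 2 * pi, p) = \<phi> i (q, p)" "\<phi> i (q, max lo (min p hi)) = \<phi> i (q, p)" for i q p
      using lohi by (auto simp: \<phi>_def D_def cl_def)
    have S0': "S z \<noteq> 0" for z using S0[of z] by simp
    show "\<theta> j \<in> cylC lo hi"
      by (rule cylCI) (auto simp: \<theta>_def S_def p intro!: continuous_intros c\<phi> simp: S0'[unfolded S_def])
    show "hb (strip lo hi) \<alpha> (\<theta> j)"
      unfolding \<theta>_def
      by (intro hb_mult hb\<phi> hb_inverse[of _ _ _ "\<epsilon> / 2"]) (use S \<epsilon> hb\<phi> in \<open>auto simp: S_def intro!: hb_sum\<close>)
    show "0 \<le> \<theta> j z" for z using \<phi>0 S0[of z] by (simp add: \<theta>_def)
    show "snd (zj j) \<in> {lo..hi}" using zjQ[OF j] by auto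
    fix q p assume p: "p \<in> {lo..hi}" and n: "\<theta> j (q, p) \<noteq> 0"
    have cl: "cl (q, p) = (q, p)" using p by (auto simp: cl_def)
    have "D (q, p) (zj j) \<le> \<epsilon>" using n by (auto simp: \<theta>_def \<phi>_def cl max_def split: if_splits)
    hence a: "\<bar>cos q - cos (fst (zj j))\<bar> \<le> \<epsilon>" "\<bar>sin q - sin (fst (zj j))\<bar> \<le> \<epsilon>" "\<bar>p - snd (zj j)\<bar> \<le> \<epsilon>"
      by (auto simp: D_def)
    obtain n :: int where "\<bar>q + of_int n * (2 * pi) - fst (zj j)\<bar> \<le> 6 * \<epsilon>" by (rule circle_close[OF a(1,2)])
    hence "\<bar>q + of_int n * (2 * pi) - fst (zj j)\<bar> + \<bar>p - snd (zj j)\<bar> \<le> \<delta>" using a(3) by (simp add: \<epsilon>_def)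
    thus "\<exists>n::int. \<bar>q + of_int n * (2 * pi) - fst (zj j)\<bar> + \<bar>p - snd (zj j)\<bar> \<le> \<delta>" by blast
  next
    fix z
    have "(\<Sum>j<m. \<theta> j z) = S z * (1 / S z)" unfolding \<theta>_def S_def sum_distrib_right ..
    thus "(\<Sum>j<m. \<theta> j z) = 1" using S0[of z] by simp
  qed
qed

section \<open>Linear dependence of the potential on its source\<close>

lemma W_lin:
  assumes "continuous_on UNIV h" "continuous_on UNIV k" "Re z > 0"
  shows "W (\<lambda>y. c * h y + d * k y) z = of_real c * W h z + of_real d * W k z"
proof -
  have zc: "z - \<i> * of_real y = Complex (Re z) (Im z - y)" for y by (simp add: complex_eq_iff)
  have "continuous_on {-pi..pi} (\<lambda>y. kap (Complex (Re z) (Im z - y)))"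
    by (rule continuous_on_compose2[OF continuous_on_kap_Complex(1)[OF assms(3), of UNIV]]) (auto intro!: continuous_intros)
  hence ck: "continuous_on {-pi..pi} (\<lambda>y. kap (z - \<i> * of_real y))" unfolding zc .
  have int: "(\<lambda>y. kap (z - \<i> * of_real y) * of_real (f y)) integrable_on {-pi..pi}" if "continuous_on UNIV f" for f
    by (intro integrable_continuous_interval continuous_intros ck continuous_on_subset[OF that]) auto
  have "W (\<lambda>y. c * h y + d * k y) z = integral {-pi..pi} (\<lambda>y. of_real c * (kap (z - \<i> * of_real y) * of_real (h y)) + of_real d * (kap (z - \<i> * of_real y) * of_real (k y)))"
    unfolding W_def by (rule arg_cong[where f = "integral _"]) (auto simp: algebra_simps)
  also have "\<dots> = of_real c * W h z + of_real d * W k z"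
    unfolding W_def using int[OF assms(1)] int[OF assms(2)]
    by (subst Henstock_Kurzweil_Integration.integral_add) (auto intro!: integrable_on_mult_right)
  finally show ?thesis .
qed

lemma mean_lin:
  assumes "continuous_on UNIV h" "continuous_on UNIV k"
  shows "mean (\<lambda>y. c * h y + d * k y) = c * mean h + d * mean k"
proof -
  have int: "f integrable_on {-pi..pi}" if "continuous_on UNIV f" for f :: "real \<Rightarrow> real"
    by (intro integrable_continuous_interval continuous_on_subset[OF that]) auto
  show ?thesis
    unfolding mean_def using int[OF assms(1)] int[OF assms(2)]
    by (subst Henstock_Kurzweil_Integration.integral_add) (auto intro!: integrable_on_mult_right simp: add_divide_distrib)
qed

lemma pW_lin:
  assumes F: "source F M" and G: "source G M'"
  shows "source.pW (\<lambda>t y. c * F t y + d * G t y) q s = c * source.pW F q s + d * source.pW G q s"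
proof -
  interpret F: source F M by (rule F)
  interpret G: source G M' by (rule G)
  interpret FG: source "\<lambda>t y. c * F t y + d * G t y" "\<bar>c\<bar> * M + \<bar>d\<bar> * M'"
  proof
    show "(\<lambda>x. c * F (fst x) (snd x) + d * G (fst x) (snd x)) \<in> borel_measurable borel"
      using F.Fm G.Fm by measurable
    show "continuous_on UNIV (\<lambda>y. c * F t y + d * G t y)" for t by (intro continuous_intros F.Fc G.Fc)
    show "c * F t (y + 2 * pi) + d * G t (y + 2 * pi) = c * F t y + d * G t y" for t y by (simp add: F.Fper G.Fper)
    fix t y
    have "\<bar>c * F t y\<bar> \<le> \<bar>c\<bar> * M" "\<bar>d * G t y\<bar> \<le> \<bar>d\<bar> * M'"
      unfolding abs_mult by (intro mult_left_mono F.Fb G.Fb abs_ge_zero)+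
    thus "\<bar>c * F t y + d * G t y\<bar> \<le> \<bar>c\<bar> * M + \<bar>d\<bar> * M'" by linarith
  qed
  \<comment> \<open>Used for integrability only; the exponent 1/2 is arbitrary.\<close>
  interpret KF: half_kernel "GW F" "32 / (1/2) * M" "1/2" by (rule F.half_kernel_GW) auto
  interpret KG: half_kernel "GW G" "32 / (1/2) * M'" "1/2" by (rule G.half_kernel_GW) auto
  have GW: "GW (\<lambda>t y. c * F t y + d * G t y) z t = c *\<^sub>R GW F z t + d *\<^sub>R GW G z t" for z t
    using W_lin[OF F.Fc G.Fc] by (simp add: GW_def scaleR_conv_of_real)
  have "JJ sgn (GW (\<lambda>t y. c * F t y + d * G t y)) q s =
    (LINT t|lborel. c *\<^sub>R (sgn (s - t) *\<^sub>R GW F (Complex \<bar>s - t\<bar> q) t) + d *\<^sub>R (sgn (s - t) *\<^sub>R GW G (Complex \<bar>s - t\<bar> q) t))"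
    unfolding JJ_def GW by (simp add: scaleR_add_right mult.commute)
  also have "\<dots> = c *\<^sub>R JJ sgn (GW F) q s + d *\<^sub>R JJ sgn (GW G) q s"
    unfolding JJ_def using KF.J_integrable[of sgn s q] KG.J_integrable[of sgn s q]
    by (intro has_bochner_integral_integral_eq has_bochner_integral_add has_bochner_integral_scaleR_right has_bochner_integral_integrable) auto
  finally have 1: "JJ sgn (GW (\<lambda>t y. c * F t y + d * G t y)) q s = c *\<^sub>R JJ sgn (GW F) q s + d *\<^sub>R JJ sgn (GW G) q s" .
  have "Sg (\<lambda>t. mean (\<lambda>y. c * F t y + d * G t y)) s = (LINT t|lborel. c * ((sgn (s - t) + sgn t) * mean (F t)) + d * ((sgn (s - t) + sgn t) * mean (G t)))"
    unfolding Sg_def mean_lin[OF F.Fc G.Fc] by (simp add: algebra_simps)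
  also have "\<dots> = c * Sg (\<lambda>t. mean (F t)) s + d * Sg (\<lambda>t. mean (G t)) s"
    unfolding Sg_def using Sg_integrable[OF F.measurable_mean F.abs_mean_le, of s] Sg_integrable[OF G.measurable_mean G.abs_mean_le, of s]
    by (intro has_bochner_integral_integral_eq has_bochner_integral_add has_bochner_integral_mult_right has_bochner_integral_integrable) auto
  finally have 2: "Sg (\<lambda>t. mean (\<lambda>y. c * F t y + d * G t y)) s = c * Sg (\<lambda>t. mean (F t)) s + d * Sg (\<lambda>t. mean (G t)) s" .
  show ?thesis unfolding FG.pW_def F.pW_def G.pW_def 1 2 by (simp add: algebra_simps add_divide_distrib)
qed

lemma Ws_lin:
  assumes F: "odd_source F M l" and G: "odd_source G M' l" and FG: "odd_source (\<lambda>t y. c * F t y + d * G t y) M'' l"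
  shows "odd_source.Ws (\<lambda>t y. c * F t y + d * G t y) l q s = c * odd_source.Ws F l q s + d * odd_source.Ws G l q s"
proof -
  interpret F: odd_source F M l by (rule F)
  interpret G: odd_source G M' l by (rule G)
  interpret FG: odd_source "\<lambda>t y. c * F t y + d * G t y" M'' l by (rule FG)
  have pW: "FG.pW q s = c * F.pW q s + d * G.pW q s" for q s
    by (rule pW_lin[OF F.source_axioms G.source_axioms])
  have "integral {0..l} (FG.pW 0) = integral {0..l} (\<lambda>s. c * F.pW 0 s + d * G.pW 0 s)"
    by (rule arg_cong[where f = "integral _"]) (rule ext, rule pW)
  also have "\<dots> = c * integral {0..l} (F.pW 0) + d * integral {0..l} (G.pW 0)"
    by (subst Henstock_Kurzweil_Integration.integral_add)
      (auto intro!: integrable_continuous_interval continuous_intros F.pW_continuous_s G.pW_continuous_s)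
  finally have "FG.c0 = c * F.c0 + d * G.c0"
    by (simp add: FG.c0_def F.c0_def G.c0_def add_divide_distrib)
  thus ?thesis by (simp add: FG.Ws_def F.Ws_def G.Ws_def pW algebra_simps)
qed

section \<open>The laminar flow\<close>

locale flow =
  fixes g \<sigma> p0 p1 \<gamma>1 \<gamma>2 \<alpha> lam :: real
  assumes g: "g > 0" and \<sigma>: "\<sigma> > 0" and p01: "p0 < p1" and p1: "p1 < 0" and \<alpha>: "0 < \<alpha>" "\<alpha> < 1"
    and lam_gt: "lam > 2 * (SUP p\<in>{p0..0}. Gam \<gamma>1 \<gamma>2 p1 p)"
begin

abbreviation a :: "real \<Rightarrow> real" where "a \<equiv> aa \<gamma>1 \<gamma>2 p1 lam"

lemma Gam_upper: "p \<in> {p1..0} \<Longrightarrow> Gam \<gamma>1 \<gamma>2 p1 p = \<gamma>2 * p"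
proof -
  assume p: "p \<in> {p1..0}"
  have "integral {p..0} (gam \<gamma>1 \<gamma>2 p1) = integral {p..0} (\<lambda>_. \<gamma>2)"
    by (rule integral_cong) (use p in \<open>auto simp: gam_def\<close>)
  thus ?thesis using p by (cases "p = 0") (auto simp: Gam_def)
qed

lemma Gam_lower: "p \<in> {p0..p1} \<Longrightarrow> Gam \<gamma>1 \<gamma>2 p1 p = \<gamma>2 * p1 + \<gamma>1 * (p - p1)"
proof -
  assume p: "p \<in> {p0..p1}"
  have 1: "(gam \<gamma>1 \<gamma>2 p1 has_integral \<gamma>1 * (p1 - p)) {p..p1}"
  proof (rule has_integral_spike[of "{p1}"])
    show "((\<lambda>_. \<gamma>1) has_integral \<gamma>1 * (p1 - p)) {p..p1}"
      using has_integral_const_real[of \<gamma>1 p p1] p by (simp add: mult.commute)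
  qed (auto simp: gam_def)
  have 2: "(gam \<gamma>1 \<gamma>2 p1 has_integral \<gamma>2 * (0 - p1)) {p1..0}"
  proof (rule has_integral_eq)
    show "((\<lambda>_. \<gamma>2) has_integral \<gamma>2 * (0 - p1)) {p1..0}"
      using has_integral_const_real[of \<gamma>2 p1 0] p1 by (simp add: mult.commute)
  qed (auto simp: gam_def)
  have "integral {p..0} (gam \<gamma>1 \<gamma>2 p1) = \<gamma>1 * (p1 - p) + \<gamma>2 * (0 - p1)"
    by (rule integral_unique, rule has_integral_combine[OF _ _ 1 2]) (use p p1 in auto)
  thus ?thesis using p p1 by (simp add: Gam_def algebra_simps)
qed

text \<open>The gap in the strict inequality for \<open>lam\<close>; its root \<open>am\<close>
  bounds \<open>a\<close> from below.\<close>

definition m0 :: real where "m0 = lam - 2 * (SUP p\<in>{p0..0}. Gam \<gamma>1 \<gamma>2 p1 p)"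

lemma m0: "m0 > 0" using lam_gt by (simp add: m0_def)

lemma bdd: "bdd_above (Gam \<gamma>1 \<gamma>2 p1 ` {p0..0})"
proof (rule bdd_aboveI2)
  fix p assume p: "p \<in> {p0..0}"
  have "\<bar>\<gamma>2 * p\<bar> \<le> \<bar>\<gamma>2\<bar> * \<bar>p0\<bar>" "\<bar>\<gamma>2 * p1\<bar> \<le> \<bar>\<gamma>2\<bar> * \<bar>p0\<bar>" 
    unfolding abs_mult using p p01 p1 by (auto intro!: mult_left_mono)
  moreover have "\<bar>\<gamma>1 * (p - p1)\<bar> \<le> \<bar>\<gamma>1\<bar> * (2 * \<bar>p0\<bar>)"
    unfolding abs_mult using p p01 p1 by (intro mult_left_mono) auto
  moreover have "0 \<le> \<bar>\<gamma>1\<bar> * (2 * \<bar>p0\<bar>)" by simp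
  ultimately show "Gam \<gamma>1 \<gamma>2 p1 p \<le> \<bar>\<gamma>2\<bar> * \<bar>p0\<bar> + \<bar>\<gamma>1\<bar> * (2 * \<bar>p0\<bar>)"
    using Gam_upper[of p] Gam_lower[of p] p by (cases "p \<le> p1") auto
qed

lemma a2_ge: "p \<in> {p0..0} \<Longrightarrow> lam - 2 * Gam \<gamma>1 \<gamma>2 p1 p \<ge> m0"
  using cSUP_upper[OF _ bdd, of p] by (simp add: m0_def)

lemma a_sq: "p \<in> {p0..0} \<Longrightarrow> (a p)\<^sup>2 = lam - 2 * Gam \<gamma>1 \<gamma>2 p1 p"
  using a2_ge[of p] m0 by (simp add: aa_def)

definition am :: real where "am = sqrt m0"

lemma am: "am > 0" using m0 by (simp add: am_def)

lemma a_ge: "p \<in> {p0..0} \<Longrightarrow> a p \<ge> am"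
  using a2_ge[of p] by (simp add: aa_def am_def)

lemma a_pos: "p \<in> {p0..0} \<Longrightarrow> a p > 0"
  using a_ge[of p] am by linarith

lemma lam_pos: "lam > 0"
  using a2_ge[of 0] Gam_upper[of 0] m0 p01 p1 by simp

text \<open>On a layer \<open>Gam\<close> is affine with slope \<open>\<gamma>\<close>, so this is
  the derivative of a root. It is the origin of the first-order term that the change of variable
  creates.\<close>

lemma a_deriv:
  assumes eq: "\<And>x. x \<in> S \<Longrightarrow> Gam \<gamma>1 \<gamma>2 p1 x = c + \<gamma> * x" and S: "S \<subseteq> {p0..0}" "p \<in> S"
  shows "(a has_vector_derivative - \<gamma> / a p) (at p within S)"
proof -
  have pos: "lam - 2 * (c + \<gamma> * p) > 0" using a2_ge[of p] m0 S eq[of p] by force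
  have "((\<lambda>x. sqrt (lam - 2 * (c + \<gamma> * x))) has_real_derivative - \<gamma> / sqrt (lam - 2 * (c + \<gamma> * p))) (at p within S)"
  proof -
    have "((\<lambda>x. lam - 2 * (c + \<gamma> * x)) has_real_derivative - (2 * \<gamma>)) (at p within S)"
      by (auto intro!: derivative_eq_intros)
    note D = DERIV_chain2[where f = sqrt and g = "\<lambda>x. lam - 2 * (c + \<gamma> * x)" and x = p, OF DERIV_real_sqrt[OF pos] this]
    have e: "inverse r / 2 * - (2 * \<gamma>) = - \<gamma> / r" for r :: real by (cases "r = 0") (auto simp: field_simps)
    show ?thesis using D unfolding e .
  qed
  hence "((\<lambda>x. sqrt (lam - 2 * (c + \<gamma> * x))) has_vector_derivative - \<gamma> / a p) (at p within S)"
    using eq[OF S(2)] by (simp add: has_real_derivative_iff_has_vector_derivative aa_def)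
  thus ?thesis by (rule has_vector_derivative_transform[OF S(2), rotated]) (simp add: aa_def eq)
qed

text \<open>Lets every argument about a single layer be given once, with the vorticity belonging to
  that layer.\<close>

definition layer :: "real \<Rightarrow> real \<Rightarrow> real \<Rightarrow> bool" where
  "layer x y \<gamma> \<longleftrightarrow> (x = p0 \<and> y = p1 \<and> \<gamma> = \<gamma>1) \<or> (x = p1 \<and> y = 0 \<and> \<gamma> = \<gamma>2)"

lemma layer_bounds: "layer x y \<gamma> \<Longrightarrow> x < y" "layer x y \<gamma> \<Longrightarrow> p \<in> {x..y} \<Longrightarrow> p \<in> {p0..0}" "layer x y \<gamma> \<Longrightarrow> {x..y} \<subseteq> {p0..0}"
  using p01 p1 by (auto simp: layer_def)

lemma a_deriv_layer:
  assumes "layer x y \<gamma>" "p \<in> {x..y}"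
  shows "(a has_vector_derivative - \<gamma> / a p) (at p within {x..y})"
proof -
  have "\<exists>c. \<forall>x\<in>{x..y}. Gam \<gamma>1 \<gamma>2 p1 x = c + \<gamma> * x"
    using assms(1) unfolding layer_def
  proof (elim disjE conjE)
    assume "x = p0" "y = p1" "\<gamma> = \<gamma>1"
    thus ?thesis using Gam_lower by (intro exI[of _ "\<gamma>2 * p1 - \<gamma>1 * p1"]) (auto simp: algebra_simps)
  next
    assume "x = p1" "y = 0" "\<gamma> = \<gamma>2"
    thus ?thesis using Gam_upper by (intro exI[of _ 0]) auto
  qed
  then obtain c where "\<And>x'. x' \<in> {x..y} \<Longrightarrow> Gam \<gamma>1 \<gamma>2 p1 x' = c + \<gamma> * x'" by blast
  thus ?thesis by (rule a_deriv[OF _ layer_bounds(3)[OF assms(1)] assms(2)])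
qed

lemma layers: "layer p0 p1 \<gamma>1" "layer p1 0 \<gamma>2"
  by (auto simp: layer_def)

lemma a_continuous: "continuous_on {p0..0} a"
proof -
  have "continuous_on ({p0..p1} \<union> {p1..0}) a"
    by (intro continuous_on_closed_Un continuous_on_vector_derivative[OF a_deriv_layer[OF layers(1)]]
        continuous_on_vector_derivative[OF a_deriv_layer[OF layers(2)]]) auto
  moreover have "{p0..p1} \<union> {p1..0} = {p0..0}" using p01 p1 by auto
  ultimately show ?thesis by simp
qed

lemma ia_continuous: "continuous_on {p0..0} (\<lambda>p. 1 / a p)"
  using a_pos by (intro continuous_intros a_continuous) force

text \<open>The variable in which the principal part of each layer operator becomes a multiple of the Laplacian.\<close>

definition s :: "real \<Rightarrow> real" where "s p = integral {p0..p} (\<lambda>x. 1 / a x)"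
definition l :: real where "l = s 0"
definition l1 :: real where "l1 = s p1"

lemma s_deriv: "p \<in> {p0..0} \<Longrightarrow> (s has_vector_derivative 1 / a p) (at p within {p0..0})"
  unfolding s_def by (rule integral_has_vector_derivative[OF ia_continuous])

lemma s_continuous: "continuous_on {p0..0} s"
  by (rule continuous_on_vector_derivative) (rule s_deriv)

lemma s_mono:
  assumes "p \<in> {p0..0}" "p' \<in> {p0..0}" "p < p'"
  shows "s p < s p'"
proof -
  have "\<exists>x\<in>{p<..<p'}. s p' - s p = (\<lambda>h. h *\<^sub>R (1 / a x)) (p' - p)"
  proof (rule mvt_simple[OF assms(3)])
    fix x assume x: "p \<le> x" "x \<le> p'"
    hence "(s has_vector_derivative 1 / a x) (at x within {p0..0})" using assms by (intro s_deriv) auto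
    thus "(s has_derivative (\<lambda>h. h *\<^sub>R (1 / a x))) (at x within {p..p'})"
      unfolding has_vector_derivative_def by (rule has_derivative_subset) (use assms in auto)
  qed
  then obtain x where x: "x \<in> {p<..<p'}" "s p' - s p = (p' - p) * (1 / a x)" by auto
  have "a x > 0" using x assms by (intro a_pos) auto
  hence "(p' - p) * (1 / a x) > 0" using assms by simp
  thus ?thesis using x(2) by linarith
qed

lemma s_lipschitz:
  assumes "p \<in> {p0..0}" "p' \<in> {p0..0}"
  shows "\<bar>s p - s p'\<bar> \<le> (1 / am) * \<bar>p - p'\<bar>"
proof -
  have "norm (s p - s p') \<le> (1 / am) * norm (p - p')"
  proof (rule differentiable_bound[where S = "{p0..0}" and f' = "\<lambda>x h. h *\<^sub>R (1 / a x)"])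
    fix x assume x: "x \<in> {p0..0}"
    show "(s has_derivative (\<lambda>h. h *\<^sub>R (1 / a x))) (at x within {p0..0})"
      using s_deriv[OF x] by (simp add: has_vector_derivative_def)
    have "onorm (\<lambda>h. h *\<^sub>R (1 / a x)) \<le> 1 / a x"
      by (rule onorm_le) (use a_pos[OF x] in \<open>auto simp: abs_divide\<close>)
    also have "\<dots> \<le> 1 / am" using a_ge[OF x] am by (intro divide_left_mono) auto
    finally show "onorm (\<lambda>h. h *\<^sub>R (1 / a x)) \<le> 1 / am" .
  qed (use assms in auto)
  thus ?thesis by simp
qed

lemma s_p0: "s p0 = 0" by (simp add: s_def)

lemma l_pos: "0 < l1" "l1 < l" "0 < l"
  using s_mono[of p0 p1] s_mono[of p1 0] p01 p1 by (auto simp: l_def l1_def s_p0)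

lemma s_le: "p \<in> {p0..0} \<Longrightarrow> p' \<in> {p0..0} \<Longrightarrow> p \<le> p' \<Longrightarrow> s p \<le> s p'"
  using s_mono[of p p'] by (cases "p = p'") auto

lemma s_inj: "inj_on s {p0..0}"
  by (rule inj_onI) (metis s_mono linorder_less_linear less_irrefl)

lemma s_range: "p \<in> {p0..0} \<Longrightarrow> s p \<in> {0..l}"
  using s_le[of p0 p] s_le[of p 0] p01 p1 by (auto simp: s_p0 l_def)

lemma s_image: "s ` {p0..0} = {0..l}"
proof
  show "s ` {p0..0} \<subseteq> {0..l}" using s_range by blast
  show "{0..l} \<subseteq> s ` {p0..0}"
  proof
    fix t assume "t \<in> {0..l}"
    then have "\<exists>x. p0 \<le> x \<and> x \<le> 0 \<and> s x = t"
      using p01 p1 by (intro IVT') (auto simp: s_p0 l_def s_continuous)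
    thus "t \<in> s ` {p0..0}" by force
  qed
qed

definition ps :: "real \<Rightarrow> real" where "ps = inv_into {p0..0} s"

lemma ps_s: "p \<in> {p0..0} \<Longrightarrow> ps (s p) = p"
  unfolding ps_def by (rule inv_into_f_f[OF s_inj])

lemma ps_range: "t \<in> {0..l} \<Longrightarrow> ps t \<in> {p0..0}" and s_ps: "t \<in> {0..l} \<Longrightarrow> s (ps t) = t"
  unfolding ps_def using s_image by (metis inv_into_into, metis f_inv_into_f)

lemma ps_continuous: "continuous_on {0..l} ps"
  using continuous_on_inv[OF s_continuous compact_Icc, of ps] ps_s by (simp add: s_image)

lemma ps_lower: "t \<in> {0..l1} \<Longrightarrow> ps t \<in> {p0..p1}" and ps_upper: "t \<in> {l1..l} \<Longrightarrow> ps t \<in> {p1..0}"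
proof -
  have 0: "p1 \<in> {p0..0}" using p01 p1 by auto
  show "t \<in> {0..l1} \<Longrightarrow> ps t \<in> {p0..p1}"
    using ps_range[of t] s_ps[of t] s_mono[OF 0, of "ps t"] l_pos by (force simp: l1_def)
  show "t \<in> {l1..l} \<Longrightarrow> ps t \<in> {p1..0}"
    using ps_range[of t] s_ps[of t] s_mono[OF _ 0, of "ps t"] l_pos by (force simp: l1_def)
qed

text \<open>\<open>Fs\<close> is the odd \<open>2l\<close>-periodic reflection, in the variable \<open>s\<close>, of the data glued from the two layers.\<close>

definition rho :: "(real \<times> real \<Rightarrow> real) \<Rightarrow> (real \<times> real \<Rightarrow> real) \<Rightarrow> real \<times> real \<Rightarrow> real" where
  "rho r1 r2 z = (if snd z \<le> p1 then r1 (fst z, max p0 (min (snd z) p1)) else r2 (fst z, max p1 (min (snd z) 0)))"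

definition Fs :: "(real \<times> real \<Rightarrow> real) \<Rightarrow> (real \<times> real \<Rightarrow> real) \<Rightarrow> real \<Rightarrow> real \<Rightarrow> real" where
  "Fs r1 r2 t y = sgn (sin (pi * t / l)) * rho r1 r2 (y, ps (l / pi * arccos (cos (pi * t / l))))"

text \<open>Continuous data with a sup bound only: the class on which the smoothing estimate for the
  p-derivative holds.\<close>

definition LD :: "(real \<times> real \<Rightarrow> real) \<Rightarrow> (real \<times> real \<Rightarrow> real) \<Rightarrow> real \<Rightarrow> bool" where
  "LD r1 r2 M \<longleftrightarrow> continuous_on (strip p0 p1) r1 \<and> continuous_on (strip p1 0) r2 \<and>
     (\<forall>q. \<forall>p\<in>{p0..p1}. r1 (q + 2 * pi, p) = r1 (q, p)) \<and> (\<forall>q. \<forall>p\<in>{p1..0}. r2 (q + 2 * pi, p) = r2 (q, p)) \<and>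
     (\<forall>z\<in>strip p0 p1. \<bar>r1 z\<bar> \<le> M) \<and> (\<forall>z\<in>strip p1 0. \<bar>r2 z\<bar> \<le> M)"

lemma odd_source_Fs:
  assumes "LD r1 r2 M"
  shows "odd_source (Fs r1 r2) M l"
proof -
  have c1: "continuous_on (strip p0 p1) r1" and c2: "continuous_on (strip p1 0) r2"
    and per: "\<And>q p. p \<in> {p0..p1} \<Longrightarrow> r1 (q + 2 * pi, p) = r1 (q, p)" "\<And>q p. p \<in> {p1..0} \<Longrightarrow> r2 (q + 2 * pi, p) = r2 (q, p)"
    and M: "\<And>z. z \<in> strip p0 p1 \<Longrightarrow> \<bar>r1 z\<bar> \<le> M" "\<And>z. z \<in> strip p1 0 \<Longrightarrow> \<bar>r2 z\<bar> \<le> M"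
    using assms unfolding LD_def by auto
  have cr1: "continuous_on UNIV (\<lambda>z. r1 (fst z, max p0 (min (snd z) p1)))"
    by (rule continuous_on_compose2[OF c1]) (use p01 in \<open>auto intro!: continuous_intros simp: mem_strip\<close>)
  have cr2: "continuous_on UNIV (\<lambda>z. r2 (fst z, max p1 (min (snd z) 0)))"
    by (rule continuous_on_compose2[OF c2]) (use p1 in \<open>auto intro!: continuous_intros simp: mem_strip\<close>)
  have [measurable]: "fst \<in> borel_measurable (borel :: (real \<times> real) measure)" "snd \<in> borel_measurable (borel :: (real \<times> real) measure)"
    by (intro borel_measurable_continuous_onI continuous_intros)+
  have rm: "rho r1 r2 \<in> borel_measurable borel"
  proof -
    note [measurable] = borel_measurable_continuous_onI[OF cr1] borel_measurable_continuous_onI[OF cr2]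
    show ?thesis unfolding rho_def[abs_def] by measurable
  qed
  have rb: "\<bar>rho r1 r2 z\<bar> \<le> M" for z
    unfolding rho_def using p01 p1 by (auto intro!: M simp: mem_strip)
  have M0: "M \<ge> 0" using rb[of "(0,0)"] by linarith
  \<comment> \<open>This expression is the triangular wave that folds the line onto {0..l}; the sign
    of the sine then makes the folded data odd about both walls.\<close>
  have ac: "l / pi * arccos (cos x) \<in> {0..l}" for x
    using arccos_bounded[of "cos x"] l_pos by (auto simp: field_simps mult_left_mono)
  have psm: "continuous_on UNIV (\<lambda>t. ps (l / pi * arccos (cos (pi * t / l))))"
    by (rule continuous_on_compose2[OF ps_continuous])
      (use ac l_pos in \<open>auto intro!: continuous_intros\<close>)
  have Fm: "(\<lambda>x. Fs r1 r2 (fst x) (snd x)) \<in> borel_measurable borel"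
  proof -
    have "(\<lambda>x::real\<times>real. sgn (sin (pi * fst x / l))) \<in> borel_measurable borel" by measurable
    moreover have "continuous_on UNIV (\<lambda>x::real\<times>real. (snd x, ps (l / pi * arccos (cos (pi * fst x / l)))))"
      by (intro continuous_intros continuous_on_compose2[OF psm, of UNIV fst]) auto
    ultimately show ?thesis unfolding Fs_def
      by (intro borel_measurable_times measurable_compose[OF borel_measurable_continuous_onI rm]) auto
  qed
  show ?thesis
  proof
    show "(\<lambda>x. Fs r1 r2 (fst x) (snd x)) \<in> borel_measurable borel" by (rule Fm)
    fix t
    show "continuous_on UNIV (Fs r1 r2 t)"
    proof -
      define x where "x = ps (l / pi * arccos (cos (pi * t / l)))"
      have "continuous_on UNIV (\<lambda>y. rho r1 r2 (y, x))"
      proof (cases "x \<le> p1")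
        case True
        have "continuous_on UNIV (\<lambda>y. r1 (y, max p0 (min x p1)))"
          by (rule continuous_on_compose2[OF c1]) (use p01 in \<open>auto intro!: continuous_intros simp: mem_strip\<close>)
        thus ?thesis using True by (simp add: rho_def)
      next
        case False
        have "continuous_on UNIV (\<lambda>y. r2 (y, max p1 (min x 0)))"
          by (rule continuous_on_compose2[OF c2]) (use p1 in \<open>auto intro!: continuous_intros simp: mem_strip\<close>)
        thus ?thesis using False by (simp add: rho_def)
      qed
      thus ?thesis unfolding Fs_def x_def by (intro continuous_intros)
    qed
    fix y
    show "Fs r1 r2 t (y + 2 * pi) = Fs r1 r2 t y"
      unfolding Fs_def rho_def using per p01 p1 by auto
    have "\<bar>Fs r1 r2 t y\<bar> \<le> 1 * M"
      unfolding Fs_def abs_mult by (intro mult_mono rb) (auto simp: sgn_if)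
    thus "\<bar>Fs r1 r2 t y\<bar> \<le> M" by simp
    show "Fs r1 r2 (- t) y = - Fs r1 r2 t y" by (simp add: Fs_def sgn_minus)
    have "pi * (2 * l - t) / l = 2 * pi - pi * t / l" using l_pos by (simp add: field_simps)
    thus "Fs r1 r2 (2 * l - t) y = - Fs r1 r2 t y" by (simp add: Fs_def sgn_minus cos_diff sin_diff)
    show "0 < l" by (rule l_pos)
  qed
qed

lemma Fs_val:
  assumes "0 < t" "t < l"
  shows "Fs r1 r2 t y = rho r1 r2 (y, ps t)"
proof -
  have x: "0 < pi * t / l" "pi * t / l < pi" using assms l_pos by (auto simp: field_simps)
  hence "sin (pi * t / l) > 0" by (intro sin_gt_zero) auto
  moreover have "arccos (cos (pi * t / l)) = pi * t / l" using x by (intro arccos_cos) auto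
  ultimately show ?thesis using l_pos by (simp add: Fs_def)
qed

end

section \<open>The Dirichlet problem for the two layers\<close>

context flow begin

lemma Gam_lipschitz:
  assumes "p \<in> {p0..0}" "p' \<in> {p0..0}"
  shows "\<bar>Gam \<gamma>1 \<gamma>2 p1 p - Gam \<gamma>1 \<gamma>2 p1 p'\<bar> \<le> (\<bar>\<gamma>1\<bar> + \<bar>\<gamma>2\<bar>) * \<bar>p - p'\<bar>"
proof -
  have lo: "\<bar>Gam \<gamma>1 \<gamma>2 p1 x - Gam \<gamma>1 \<gamma>2 p1 y\<bar> = \<bar>\<gamma>1\<bar> * \<bar>x - y\<bar>" if "x \<in> {p0..p1}" "y \<in> {p0..p1}" for x y
    using Gam_lower[OF that(1)] Gam_lower[OF that(2)] by (simp add: abs_mult[symmetric] algebra_simps)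
  have up: "\<bar>Gam \<gamma>1 \<gamma>2 p1 x - Gam \<gamma>1 \<gamma>2 p1 y\<bar> = \<bar>\<gamma>2\<bar> * \<bar>x - y\<bar>" if "x \<in> {p1..0}" "y \<in> {p1..0}" for x y
    using Gam_upper[OF that(1)] Gam_upper[OF that(2)] by (simp add: abs_mult[symmetric] algebra_simps)
  have main: "\<bar>Gam \<gamma>1 \<gamma>2 p1 x - Gam \<gamma>1 \<gamma>2 p1 y\<bar> \<le> (\<bar>\<gamma>1\<bar> + \<bar>\<gamma>2\<bar>) * \<bar>x - y\<bar>" if "x \<le> y" "x \<in> {p0..0}" "y \<in> {p0..0}" for x y
  proof -
    consider "y \<le> p1" | "x \<ge> p1" | "x < p1" "p1 < y" by linarith
    thus ?thesis
    proof cases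
      case 1
      have "\<bar>\<gamma>1\<bar> * \<bar>x - y\<bar> \<le> (\<bar>\<gamma>1\<bar> + \<bar>\<gamma>2\<bar>) * \<bar>x - y\<bar>" by (intro mult_right_mono) auto
      thus ?thesis using lo[of x y] 1 that by auto
    next
      case 2
      have "\<bar>\<gamma>2\<bar> * \<bar>x - y\<bar> \<le> (\<bar>\<gamma>1\<bar> + \<bar>\<gamma>2\<bar>) * \<bar>x - y\<bar>" by (intro mult_right_mono) auto
      thus ?thesis using up[of x y] 2 that by auto
    next
      case 3
      have "\<bar>Gam \<gamma>1 \<gamma>2 p1 x - Gam \<gamma>1 \<gamma>2 p1 y\<bar> \<le> \<bar>\<gamma>1\<bar> * \<bar>x - p1\<bar> + \<bar>\<gamma>2\<bar> * \<bar>p1 - y\<bar>"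
        using lo[of x p1] up[of p1 y] 3 that by auto
      also have "\<dots> \<le> \<bar>\<gamma>1\<bar> * \<bar>x - y\<bar> + \<bar>\<gamma>2\<bar> * \<bar>x - y\<bar>" using 3 by (intro add_mono mult_left_mono) auto
      finally show ?thesis by (simp add: algebra_simps)
    qed
  qed
  show ?thesis using main[of p p'] main[of p' p] assms by (cases "p \<le> p'") (auto simp: abs_minus_commute)
qed

text \<open>A difference of squares: a^2 inherits the Lipschitz bound of \<open>Gam\<close>, and
  \<open>a p + a p'\<close> is at least \<open>2 * am\<close>.\<close>

lemma a_lipschitz:
  assumes "p \<in> {p0..0}" "p' \<in> {p0..0}"
  shows "\<bar>a p - a p'\<bar> \<le> (\<bar>\<gamma>1\<bar> + \<bar>\<gamma>2\<bar>) / am * \<bar>p - p'\<bar>"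
proof -
  have s: "a p + a p' \<ge> 2 * am" using a_ge[OF assms(1)] a_ge[OF assms(2)] by simp
  have "(a p - a p') * (a p + a p') = (a p)\<^sup>2 - (a p')\<^sup>2" by (simp add: power2_eq_square algebra_simps)
  also have "\<dots> = 2 * (Gam \<gamma>1 \<gamma>2 p1 p' - Gam \<gamma>1 \<gamma>2 p1 p)" using a_sq[OF assms(1)] a_sq[OF assms(2)] by simp
  finally have "\<bar>a p - a p'\<bar> * \<bar>a p + a p'\<bar> = 2 * \<bar>Gam \<gamma>1 \<gamma>2 p1 p' - Gam \<gamma>1 \<gamma>2 p1 p\<bar>"
    by (metis abs_mult abs_numeral)
  moreover have "\<bar>a p - a p'\<bar> * (2 * am) \<le> \<bar>a p - a p'\<bar> * \<bar>a p + a p'\<bar>" using s by (intro mult_left_mono) auto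
  ultimately have "\<bar>a p - a p'\<bar> * am \<le> (\<bar>\<gamma>1\<bar> + \<bar>\<gamma>2\<bar>) * \<bar>p - p'\<bar>"
    using Gam_lipschitz[OF assms(2,1)] by (simp add: abs_minus_commute)
  thus ?thesis using am by (simp add: field_simps)
qed

lemma hb_a: "hb (strip p0 0) \<beta> (\<lambda>z. a (snd z))" if "0 < \<beta>" "\<beta> \<le> 1"
proof -
  have "bounded (a ` {p0..0})" by (intro compact_imp_bounded compact_continuous_image a_continuous compact_Icc)
  then obtain N where N: "\<And>p. p \<in> {p0..0} \<Longrightarrow> \<bar>a p\<bar> \<le> N" unfolding bounded_iff by (metis imageI real_norm_def)
  show ?thesis
  proof (rule hb_lipschitz[OF _ _ that])
    show "\<bar>a (snd z)\<bar> \<le> N" if "z \<in> strip p0 0" for z using N that by (simp add: mem_strip)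
    fix z w assume zw: "z \<in> strip p0 0" "w \<in> strip p0 0"
    have "\<bar>a (snd z) - a (snd w)\<bar> \<le> (\<bar>\<gamma>1\<bar> + \<bar>\<gamma>2\<bar>) / am * \<bar>snd z - snd w\<bar>"
      using zw by (intro a_lipschitz) (auto simp: mem_strip)
    also have "\<dots> \<le> (\<bar>\<gamma>1\<bar> + \<bar>\<gamma>2\<bar>) / am * dist z w"
      using am dist_snd_le[of z w] by (intro mult_left_mono) (auto simp: dist_real_def)
    finally show "\<bar>a (snd z) - a (snd w)\<bar> \<le> (\<bar>\<gamma>1\<bar> + \<bar>\<gamma>2\<bar>) / am * dist z w" .
  qed
qed

lemma hb_ia: "hb (strip p0 0) \<beta> (\<lambda>z. 1 / a (snd z))" if "0 < \<beta>" "\<beta> \<le> 1"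
  by (rule hb_inverse[OF hb_a[OF that] _ am]) (auto simp: mem_strip intro!: a_ge)

lemma strip_sub: "layer x y \<gamma> \<Longrightarrow> strip x y \<subseteq> strip p0 0"
  using layer_bounds(3) by (force simp: mem_strip)

text \<open>\<open>s\<close> has Lipschitz constant \<open>1 / am\<close>, so \<open>Ls\<close>
  bounds the stretching of |q| + |p| when p is replaced by \<open>s p\<close>.\<close>

definition Ls :: real where "Ls = 1 + 1 / am"

lemma comp_s_holder:
  assumes K: "\<And>q q' s s' d. \<bar>q - q'\<bar> + \<bar>s - s'\<bar> \<le> d \<Longrightarrow> 0 < d \<Longrightarrow> d \<le> 1 \<Longrightarrow> \<bar>f q s - f q' s'\<bar> \<le> K * d powr \<alpha>"
    and N: "\<And>q t. t \<in> {0..l} \<Longrightarrow> \<bar>f q t\<bar> \<le> N" and K0: "K \<ge> 0" and zw: "z \<in> strip p0 0" "w \<in> strip p0 0"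
  shows "\<bar>f (fst z) (s (snd z)) - f (fst w) (s (snd w))\<bar> \<le> (2 * ((K + 2 * N) * Ls) + 4 * N) * dist z w powr \<alpha>"
proof -
  have L1: "Ls \<ge> 1" using am by (simp add: Ls_def)
  have N0: "N \<ge> 0" using N[of 0 0] l_pos by force
  have Lp: "Ls powr \<alpha> \<le> Ls" using powr_mono[of \<alpha> 1 Ls] L1 \<alpha> by simp
  show ?thesis
  proof (rule holder_on_bounded_intro[where S = "strip p0 0" and f = "\<lambda>z. f (fst z) (s (snd z))", OF _ _ _ _ _ zw])
    fix z w :: "real \<times> real" and d :: real
    assume zw: "z \<in> strip p0 0" "w \<in> strip p0 0" and d: "\<bar>fst z - fst w\<bar> + \<bar>snd z - snd w\<bar> \<le> d" "0 < d" "d \<le> 1"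
    have "\<bar>s (snd z) - s (snd w)\<bar> \<le> (1 / am) * \<bar>snd z - snd w\<bar>" using zw by (intro s_lipschitz) (auto simp: mem_strip)
    also have "\<dots> \<le> (1 / am) * d" using d am by (intro mult_left_mono) auto
    finally have ds: "\<bar>fst z - fst w\<bar> + \<bar>s (snd z) - s (snd w)\<bar> \<le> Ls * d" using d by (simp add: Ls_def algebra_simps)
    have pw: "(Ls * d) powr \<alpha> \<le> Ls * d powr \<alpha>" using Lp L1 d by (simp add: powr_mult mult_right_mono)
    show "\<bar>f (fst z) (s (snd z)) - f (fst w) (s (snd w))\<bar> \<le> (K + 2 * N) * Ls * d powr \<alpha>"
    \<comment> \<open>After stretching, an increment may exceed 1, where \<open>K\<close> gives no
      information and the bound \<open>N\<close> takes over.\<close>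
    proof (cases "Ls * d \<le> 1")
      case True
      have "\<bar>f (fst z) (s (snd z)) - f (fst w) (s (snd w))\<bar> \<le> K * (Ls * d) powr \<alpha>"
        using ds True L1 d by (intro K) auto
      also have "\<dots> \<le> (K + 2 * N) * (Ls * d powr \<alpha>)" using pw K0 N0 L1 by (intro mult_mono) auto
      finally show ?thesis by (simp add: mult.assoc)
    next
      case False
      have "\<bar>f (fst z) (s (snd z))\<bar> \<le> N" "\<bar>f (fst w) (s (snd w))\<bar> \<le> N" using zw by (auto intro!: N s_range simp: mem_strip)
      hence "\<bar>f (fst z) (s (snd z)) - f (fst w) (s (snd w))\<bar> \<le> 2 * N * 1" by linarith
      also have "\<dots> \<le> (K + 2 * N) * (Ls * d powr \<alpha>)"
      proof (rule mult_mono)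
        have "1 \<le> (Ls * d) powr \<alpha>" using False \<alpha> by (intro ge_one_powr_ge_zero) auto
        thus "1 \<le> Ls * d powr \<alpha>" using pw by linarith
      qed (use K0 N0 in auto)
      finally show ?thesis by (simp add: mult.assoc)
    qed
  next
    show "\<bar>f (fst z) (s (snd z))\<bar> \<le> N" if "z \<in> strip p0 0" for z using that by (auto intro!: N s_range simp: mem_strip)
    show "(K + 2 * N) * Ls \<ge> 0" using K0 N0 L1 by simp
  qed (use \<alpha> in auto)
qed

lemma hb_comp_s:
  assumes K: "\<And>q q' s s' d. \<bar>q - q'\<bar> + \<bar>s - s'\<bar> \<le> d \<Longrightarrow> 0 < d \<Longrightarrow> d \<le> 1 \<Longrightarrow> \<bar>f q s - f q' s'\<bar> \<le> K * d powr \<alpha>"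
    and N: "\<And>q t. t \<in> {0..l} \<Longrightarrow> \<bar>f q t\<bar> \<le> N"
  shows "hb (strip p0 0) \<alpha> (\<lambda>z. f (fst z) (s (snd z)))"
proof -
  have K': "\<bar>f q s - f q' s'\<bar> \<le> \<bar>K\<bar> * d powr \<alpha>" if "\<bar>q - q'\<bar> + \<bar>s - s'\<bar> \<le> d" "0 < d" "d \<le> 1" for q q' s s' d
  proof -
    have "\<bar>f q s - f q' s'\<bar> \<le> K * d powr \<alpha>" by (rule K[OF that])
    also have "\<dots> \<le> \<bar>K\<bar> * d powr \<alpha>" by (intro mult_right_mono) auto
    finally show ?thesis .
  qed
  have "holder_on (strip p0 0) \<alpha> (\<lambda>z. f (fst z) (s (snd z)))"
    unfolding holder_on_def
    by (intro exI[of _ "2 * ((\<bar>K\<bar> + 2 * N) * Ls) + 4 * N"] ballI comp_s_holder[where f = f] K' N) auto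
  moreover have "bounded ((\<lambda>z. f (fst z) (s (snd z))) ` strip p0 0)"
    unfolding bounded_iff by (intro exI[of _ N]) (auto intro!: N s_range simp: mem_strip)
  ultimately show ?thesis by (simp add: hb_def)
qed

text \<open>The p-derivative of \<open>Ud\<close>, by the chain rule with s' = 1 / a.\<close>

definition Wd :: "(real \<times> real \<Rightarrow> real) \<Rightarrow> (real \<times> real \<Rightarrow> real) \<Rightarrow> real \<times> real \<Rightarrow> real" where
  "Wd r1 r2 z = odd_source.Ws (Fs r1 r2) l (fst z) (s (snd z)) * (1 / a (snd z))"

definition Ud :: "(real \<times> real \<Rightarrow> real) \<Rightarrow> (real \<times> real \<Rightarrow> real) \<Rightarrow> real \<times> real \<Rightarrow> real" where
  "Ud r1 r2 z = odd_source.U (Fs r1 r2) l (fst z) (s (snd z))"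

text \<open>The loss exponent is chosen as b = 1 - \<alpha>, so that \<open>Ws_holder\<close> gives
  exponent \<alpha> from a sup bound. Multiplication by the Hoelder function 1 / a and the
  substitution \<open>s\<close> change only the constant.\<close>

lemma Wd_estimate:
  obtains C where "C \<ge> 0"
    "\<And>r1 r2 M z. LD r1 r2 M \<Longrightarrow> z \<in> strip p0 0 \<Longrightarrow> \<bar>Wd r1 r2 z\<bar> \<le> C * M"
    "\<And>r1 r2 M z w. LD r1 r2 M \<Longrightarrow> z \<in> strip p0 0 \<Longrightarrow> w \<in> strip p0 0 \<Longrightarrow> \<bar>Wd r1 r2 z - Wd r1 r2 w\<bar> \<le> C * M * dist z w powr \<alpha>"
proof -
  define b where "b = 1 - \<alpha>"
  have b: "0 < b" "b < 1" "1 - b = \<alpha>" using \<alpha> by (auto simp: b_def)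
  define cN where "cN = 2 * (32 / b * Cb b + l)"
  define cK where "cK = 128 / b * Cb b + 1"
  have c0: "cN \<ge> 0" "cK \<ge> 0" using b Cb_nonneg[of b] l_pos by (auto simp: cN_def cK_def)
  define cH where "cH = 2 * ((cK + 2 * cN) * Ls) + 4 * cN"
  have L0: "Ls \<ge> 0" using am by (simp add: Ls_def)
  have cH0: "cH \<ge> 0" using c0 L0 by (simp add: cH_def)
  obtain A where A: "A \<ge> 0" "\<And>z. z \<in> strip p0 0 \<Longrightarrow> \<bar>1 / a (snd z)\<bar> \<le> A"
    "\<And>z w. z \<in> strip p0 0 \<Longrightarrow> w \<in> strip p0 0 \<Longrightarrow> \<bar>1 / a (snd z) - 1 / a (snd w)\<bar> \<le> A * dist z w powr \<alpha>"
    using hb_ia[of \<alpha>] \<alpha> unfolding hb_iff by auto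
  show ?thesis
  proof (rule that[of "cN * A + (cN + cH) * A"])
    show "cN * A + (cN + cH) * A \<ge> 0" using c0 cH0 A by simp
    fix r1 r2 M assume LD: "LD r1 r2 M"
    interpret odd_source "Fs r1 r2" M l by (rule odd_source_Fs[OF LD])
    have N: "\<bar>Ws q t\<bar> \<le> cN * M" if "t \<in> {0..l}" for q t
      using Ws_bound[OF b(1,2) that] by (simp add: cN_def)
    have H: "\<bar>Ws (fst z) (s (snd z)) - Ws (fst w) (s (snd w))\<bar> \<le> (cH * M) * dist z w powr \<alpha>"
      if "z \<in> strip p0 0" "w \<in> strip p0 0" for z w
    proof -
      have "\<bar>Ws (fst z) (s (snd z)) - Ws (fst w) (s (snd w))\<bar> \<le> (2 * ((cK * M + 2 * (cN * M)) * Ls) + 4 * (cN * M)) * dist z w powr \<alpha>"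
        by (rule comp_s_holder[OF _ N _ that])
           (use Ws_holder[OF b(1,2)] c0 M_nonneg in \<open>auto simp: b(3) cK_def\<close>)
      also have "2 * ((cK * M + 2 * (cN * M)) * Ls) + 4 * (cN * M) = cH * M" by (simp add: cH_def algebra_simps)
      finally show ?thesis .
    qed
    have Nz: "\<bar>Ws (fst z) (s (snd z))\<bar> \<le> cN * M" if "z \<in> strip p0 0" for z
      using that by (intro N s_range) (simp add: mem_strip)
    have cNM: "0 \<le> cN * M" "0 \<le> cH * M" using c0 cH0 M_nonneg by auto
    fix z assume z: "z \<in> strip p0 0"
    have "\<bar>Wd r1 r2 z\<bar> \<le> (cN * M) * A"
      unfolding Wd_def abs_mult using Nz[OF z] A(2)[OF z] cNM by (intro mult_mono) auto
    also have "\<dots> \<le> (cN * A + (cN + cH) * A) * M" using cNM A(1) M_nonneg c0 cH0 by (simp add: algebra_simps)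
    finally show "\<bar>Wd r1 r2 z\<bar> \<le> (cN * A + (cN + cH) * A) * M" .
    fix w assume w: "w \<in> strip p0 0"
    let ?W = "\<lambda>z. Ws (fst z) (s (snd z))" and ?i = "\<lambda>z. 1 / a (snd z)"
    have "\<bar>?W z * (?i z - ?i w)\<bar> \<le> (cN * M) * (A * dist z w powr \<alpha>)"
      unfolding abs_mult using Nz[OF z] A(3)[OF z w] cNM by (intro mult_mono) auto
    moreover have "\<bar>(?W z - ?W w) * ?i w\<bar> \<le> ((cH * M) * dist z w powr \<alpha>) * A"
      unfolding abs_mult using H[OF z w] A(2)[OF w] cNM by (intro mult_mono) auto
    moreover have "Wd r1 r2 z - Wd r1 r2 w = ?W z * (?i z - ?i w) + (?W z - ?W w) * ?i w"
      by (simp add: Wd_def algebra_simps)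
    ultimately have "\<bar>Wd r1 r2 z - Wd r1 r2 w\<bar> \<le> (cN * M) * (A * dist z w powr \<alpha>) + ((cH * M) * dist z w powr \<alpha>) * A" by linarith
    also have "\<dots> = ((cN + cH) * A) * M * dist z w powr \<alpha>" by (simp add: algebra_simps)
    also have "\<dots> \<le> (cN * A + (cN + cH) * A) * M * dist z w powr \<alpha>"
      using c0 A(1) M_nonneg by (intro mult_right_mono) auto
    finally show "\<bar>Wd r1 r2 z - Wd r1 r2 w\<bar> \<le> (cN * A + (cN + cH) * A) * M * dist z w powr \<alpha>" .
  qed
qed

lemma LD_lincomb:
  assumes "LD r1 r2 M" "LD r1' r2' M'"
  shows "LD (\<lambda>z. c * r1 z + d * r1' z) (\<lambda>z. c * r2 z + d * r2' z) (\<bar>c\<bar> * M + \<bar>d\<bar> * M')"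
proof -
  have ab: "\<bar>c * x + d * y\<bar> \<le> \<bar>c\<bar> * M + \<bar>d\<bar> * M'" if "\<bar>x\<bar> \<le> M" "\<bar>y\<bar> \<le> M'" for x y
  proof -
    have "\<bar>c * x\<bar> \<le> \<bar>c\<bar> * M" "\<bar>d * y\<bar> \<le> \<bar>d\<bar> * M'" unfolding abs_mult using that by (auto intro!: mult_left_mono)
    thus ?thesis by linarith
  qed
  show ?thesis using assms unfolding LD_def by (auto intro!: continuous_intros ab)
qed

lemma Wd_lin:
  assumes "LD r1 r2 M" "LD r1' r2' M'"
  shows "Wd (\<lambda>z. c * r1 z + d * r1' z) (\<lambda>z. c * r2 z + d * r2' z) z = c * Wd r1 r2 z + d * Wd r1' r2' z"
proof -
  have eq: "Fs (\<lambda>z. c * r1 z + d * r1' z) (\<lambda>z. c * r2 z + d * r2' z) = (\<lambda>t y. c * Fs r1 r2 t y + d * Fs r1' r2' t y)"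
    by (auto simp: fun_eq_iff Fs_def rho_def algebra_simps)
  have o: "odd_source (\<lambda>t y. c * Fs r1 r2 t y + d * Fs r1' r2' t y) (\<bar>c\<bar> * M + \<bar>d\<bar> * M') l"
    using odd_source_Fs[OF LD_lincomb[OF assms, of c d]] unfolding eq .
  show ?thesis
    unfolding Wd_def eq Ws_lin[OF odd_source_Fs[OF assms(1)] odd_source_Fs[OF assms(2)] o] by (simp add: algebra_simps)
qed

lemma Wd_per: "LD r1 r2 M \<Longrightarrow> Wd r1 r2 (q + 2 * pi, p) = Wd r1 r2 (q, p)"
  using odd_source.Ws_per[OF odd_source_Fs] by (simp add: Wd_def)

lemma Ud_per: "LD r1 r2 M \<Longrightarrow> Ud r1 r2 (q + 2 * pi, p) = Ud r1 r2 (q, p)"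
  using odd_source.U_per[OF odd_source_Fs] by (simp add: Ud_def)

lemma chain_s:
  assumes xy: "{x..y} \<subseteq> {p0..0}" and p: "p \<in> {x..y}" and f: "(f has_vector_derivative D) (at (s p) within {s x..s y})"
  shows "((\<lambda>p. f (s p)) has_vector_derivative D * (1 / a p)) (at p within {x..y})"
proof -
  have xy': "x \<in> {x..y}" "y \<in> {x..y}" using p by auto
  have "s ` {x..y} \<subseteq> {s x..s y}"
    using xy xy' by (auto intro!: s_le)
  hence f': "(f has_vector_derivative D) (at (s p) within s ` {x..y})" by (rule has_vector_derivative_within_subset[OF f])
  have "(s has_vector_derivative 1 / a p) (at p within {x..y})"
    by (rule has_vector_derivative_within_subset[OF s_deriv xy]) (use xy p in auto)
  from vector_diff_chain_within[OF this f'] show ?thesis by (simp add: o_def mult.commute)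
qed

text \<open>Inside a layer neither the clamping in \<open>rho\<close> nor its choice of the lower
  data at the interface is visible.\<close>

lemma rho_ps:
  assumes "layer x y \<gamma>" "s x < t" "t < s y"
  shows "rho r1 r2 (q, ps t) = (if x = p0 then r1 else r2) (q, ps t)"
proof -
  have p: "p1 \<in> {p0..0}" "p0 \<in> {p0..0}" "0 \<in> {p0..0}" using p01 p1 by auto
  show ?thesis
    using assms(1) unfolding layer_def
  proof (elim disjE conjE)
    assume "x = p0" "y = p1"
    hence "t \<in> {0..l1}" using assms(2,3) by (auto simp: s_p0 l1_def)
    from ps_lower[OF this] show ?thesis using \<open>x = p0\<close> by (auto simp: rho_def)
  next
    assume xy: "x = p1" "y = 0"
    hence t: "t \<in> {l1..l}" "t \<noteq> l1" using assms(2,3) by (auto simp: l_def l1_def)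
    have "ps t \<noteq> p1" using s_ps[of t] t l_pos by (auto simp: l1_def)
    with ps_upper[OF t(1)] show ?thesis using xy p01 by (auto simp: rho_def)
  qed
qed

text \<open>The formula for the second p-derivative comes from u_p = u_s / a, u_ss = r - u_qq and
  (1/a)' = \<gamma> / a^3. \<open>V\<close>, \<open>B\<close> and \<open>A\<close> are common to
  both layers, so a jump at the interface can come only from r and \<gamma> in this last
  derivative.\<close>

lemma dirichlet_C2d:
  assumes LD: "LD r1 r2 M" and hb1: "hb (strip p0 p1) \<alpha> r1" and hb2: "hb (strip p1 0) \<alpha> r2"
  obtains V B A where
    "\<And>x y \<gamma>. layer x y \<gamma> \<Longrightarrow> C2d \<alpha> x y (Ud r1 r2) V (Wd r1 r2) B A A
       (\<lambda>z. ((if x = p0 then r1 else r2) z - B z) * (1 / a (snd z))\<^sup>2 + \<gamma> * (Wd r1 r2 z * (1 / a (snd z))\<^sup>2))"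
    "\<And>q. Ud r1 r2 (q, p0) = 0" "\<And>q. Ud r1 r2 (q, 0) = 0"
proof -
  obtain H where H: "H \<ge> 0" "\<And>z w. z \<in> strip p0 p1 \<Longrightarrow> w \<in> strip p0 p1 \<Longrightarrow> \<bar>r1 z - r1 w\<bar> \<le> H * dist z w powr \<alpha>"
    using hb1 unfolding hb_iff by blast
  obtain H' where H': "H' \<ge> 0" "\<And>z w. z \<in> strip p1 0 \<Longrightarrow> w \<in> strip p1 0 \<Longrightarrow> \<bar>r2 z - r2 w\<bar> \<le> H' * dist z w powr \<alpha>"
    using hb2 unfolding hb_iff by blast
  have rH: "\<bar>rho r1 r2 (x, p) - rho r1 r2 (y, p)\<bar> \<le> (H + H') * \<bar>x - y\<bar> powr \<alpha>" for x y p
  proof -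
    have d: "dist (x, p') (y, p') = \<bar>x - y\<bar>" for p' :: real by (simp add: dist_Pair_Pair dist_real_def)
    have "\<bar>rho r1 r2 (x, p) - rho r1 r2 (y, p)\<bar> \<le> max H H' * \<bar>x - y\<bar> powr \<alpha>"
    proof (cases "p \<le> p1")
      case True
      have "\<bar>rho r1 r2 (x, p) - rho r1 r2 (y, p)\<bar> \<le> H * \<bar>x - y\<bar> powr \<alpha>"
        using H(2)[of "(x, max p0 (min p p1))" "(y, max p0 (min p p1))"] True p01 by (simp add: rho_def d mem_strip)
      also have "\<dots> \<le> max H H' * \<bar>x - y\<bar> powr \<alpha>" by (intro mult_right_mono) auto
      finally show ?thesis .
    next
      case False
      have "\<bar>rho r1 r2 (x, p) - rho r1 r2 (y, p)\<bar> \<le> H' * \<bar>x - y\<bar> powr \<alpha>"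
        using H'(2)[of "(x, max p1 (min p 0))" "(y, max p1 (min p 0))"] False p1 by (simp add: rho_def d mem_strip)
      also have "\<dots> \<le> max H H' * \<bar>x - y\<bar> powr \<alpha>" by (intro mult_right_mono) auto
      finally show ?thesis .
    qed
    also have "\<dots> \<le> (H + H') * \<bar>x - y\<bar> powr \<alpha>" using H H' by (intro mult_right_mono) auto
    finally show ?thesis .
  qed
  interpret odd_source "Fs r1 r2" M l by (rule odd_source_Fs[OF LD])
  interpret odd_holder_source "Fs r1 r2" M l "H + H'" \<alpha>
  proof
    fix t x y
    have "\<bar>Fs r1 r2 t x - Fs r1 r2 t y\<bar> = \<bar>sgn (sin (pi * t / l))\<bar> * \<bar>rho r1 r2 (x, ps (l / pi * arccos (cos (pi * t / l)))) - rho r1 r2 (y, ps (l / pi * arccos (cos (pi * t / l))))\<bar>"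
      unfolding Fs_def abs_mult[symmetric] right_diff_distrib ..
    also have "\<dots> \<le> 1 * ((H + H') * \<bar>x - y\<bar> powr \<alpha>)"
      by (intro mult_mono rH) (auto simp: sgn_if)
    finally show "\<bar>Fs r1 r2 t x - Fs r1 r2 t y\<bar> \<le> (H + H') * \<bar>x - y\<bar> powr \<alpha>" by simp
  qed (use \<alpha> in auto)
  define V where "V = (\<lambda>z. pV (fst z) (s (snd z)))"
  define A where "A = (\<lambda>z. pA (fst z) (s (snd z)) * (1 / a (snd z)))"
  define B where "B = (\<lambda>z. pB (fst z) (s (snd z)))"
  have hia: "hb (strip p0 0) \<alpha> (\<lambda>z. 1 / a (snd z))" using \<alpha> by (intro hb_ia) auto
  have half: "\<bar>- x / 2\<bar> \<le> K / 2" if "\<bar>x\<bar> \<le> K" for x K :: real using that by simp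
  have hV: "hb (strip p0 0) \<alpha> V"
    unfolding V_def
  proof (rule hb_comp_s[OF pAB_holder(3)])
    fix q t show "\<bar>pV q t\<bar> \<le> 32 / (1 - \<alpha>) * M * Cb (1 - \<alpha>) / 2"
      unfolding pV_def by (rule half[OF order_trans[OF abs_Im_le_cmod hk.J_bound]]) simp
  qed
  have hA: "hb (strip p0 0) \<alpha> A"
    unfolding A_def
  proof (intro hb_mult hia hb_comp_s[OF pAB_holder(1)])
    fix q t show "\<bar>pA q t\<bar> \<le> 288 / (1 - \<alpha>) * (H + H') * Cb (1 - \<alpha>) / 2"
      unfolding pA_def by (rule half[OF order_trans[OF abs_Im_le_cmod hk.D.J_bound]]) simp
  qed
  have hB: "hb (strip p0 0) \<alpha> B"
    unfolding B_def
  proof (intro hb_comp_s[OF pAB_holder(2)])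
    fix q t show "\<bar>pB q t\<bar> \<le> 288 / (1 - \<alpha>) * (H + H') * Cb (1 - \<alpha>) / 2"
      unfolding pB_def by (rule half[OF order_trans[OF abs_Re_le_cmod hk.D.J_bound]]) simp
  qed
  have hW: "hb (strip p0 0) \<alpha> (Wd r1 r2)"
  proof -
    obtain C where C: "C \<ge> 0" "\<And>z. z \<in> strip p0 0 \<Longrightarrow> \<bar>Wd r1 r2 z\<bar> \<le> C * M"
      "\<And>z w. z \<in> strip p0 0 \<Longrightarrow> w \<in> strip p0 0 \<Longrightarrow> \<bar>Wd r1 r2 z - Wd r1 r2 w\<bar> \<le> C * M * dist z w powr \<alpha>"
      using Wd_estimate[of thesis] LD by metis
    thus ?thesis unfolding hb_iff using M_nonneg by (intro exI[of _ "C * M"]) auto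
  qed
  show ?thesis
  proof (rule that[of V B A])
    show "Ud r1 r2 (q, p0) = 0" for q by (simp add: Ud_def s_p0 U_0)
    show "Ud r1 r2 (q, 0) = 0" for q using U_l by (simp add: Ud_def l_def)
    fix x y \<gamma> assume lay: "layer x y \<gamma>"
    define r where "r = (if x = p0 then r1 else r2)"
    have hr: "hb (strip x y) \<alpha> r" using lay hb1 hb2 p01 by (auto simp: layer_def r_def)
    have cr: "continuous_on (strip x y) r" by (rule hb_imp_continuous_on[OF hr \<alpha>(1)])
    note sub = strip_sub[OF lay] and lb = layer_bounds(2)[OF lay]
    have dq: "((\<lambda>t. Ud r1 r2 (t, p)) has_vector_derivative V (q, p)) (at q)"
      "((\<lambda>t. V (t, p)) has_vector_derivative B (q, p)) (at q)"
      "((\<lambda>t. Wd r1 r2 (t, p)) has_vector_derivative A (q, p)) (at q)" if "p \<in> {x..y}" for q p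
    proof -
      have sp: "s p \<in> {0..l}" by (rule s_range[OF lb[OF that]])
      show "((\<lambda>t. Ud r1 r2 (t, p)) has_vector_derivative V (q, p)) (at q)"
        using U_q[OF sp, of q] by (simp add: Ud_def V_def)
      show "((\<lambda>t. V (t, p)) has_vector_derivative B (q, p)) (at q)"
        using pV_q[of "s p" q UNIV] by (simp add: V_def B_def)
      show "((\<lambda>t. Wd r1 r2 (t, p)) has_vector_derivative A (q, p)) (at q)"
        using has_vector_derivative_mult_left[OF Ws_q[of "s p" q UNIV], of "1 / a p"] by (simp add: Wd_def A_def)
    qed
    have xy: "{x..y} \<subseteq> {p0..0}" by (rule layer_bounds(3)[OF lay])
    have sxy: "{s x..s y} \<subseteq> {0..l}"
    proof -
      have "x \<in> {p0..0}" "y \<in> {p0..0}" using xy layer_bounds(1)[OF lay] by auto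
      from s_range[OF this(1)] s_range[OF this(2)] show ?thesis by auto
    qed
    have ps_xy: "ps t \<in> {x..y}" if "t \<in> {s x..s y}" for t
      using lay that ps_lower[of t] ps_upper[of t] by (auto simp: layer_def s_p0 l_def l1_def)
    have dp1: "((\<lambda>t. Ud r1 r2 (q, t)) has_vector_derivative Wd r1 r2 (q, p)) (at p within {x..y})" if "p \<in> {x..y}" for q p
      using chain_s[OF xy that has_vector_derivative_within_subset[OF U_s[OF s_range[OF lb[OF that]]] sxy]]
      by (simp add: Ud_def Wd_def)
    have dp2: "((\<lambda>t. V (q, t)) has_vector_derivative A (q, p)) (at p within {x..y})" if "p \<in> {x..y}" for q p
      using chain_s[OF xy that pV_s] by (simp add: V_def A_def)
    have dp3: "((\<lambda>t. Wd r1 r2 (q, t)) has_vector_derivative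
        (r (q, p) - B (q, p)) * (1 / a p)\<^sup>2 + \<gamma> * (Wd r1 r2 (q, p) * (1 / a p)\<^sup>2)) (at p within {x..y})" if p: "p \<in> {x..y}" for q p
    proof -
      have "((\<lambda>t. Ws q t) has_vector_derivative r (q, ps (s p)) - pB q (s p)) (at (s p) within {s x..s y})"
      proof (rule Ws_s)
        show "continuous_on {s x..s y} (\<lambda>t. r (q, ps t))"
          by (rule continuous_on_compose2[OF cr])
            (use ps_xy sxy in \<open>auto intro!: continuous_intros continuous_on_subset[OF ps_continuous] simp: mem_strip\<close>)
        show "Fs r1 r2 t q = r (q, ps t)" if "s x < t" "t < s y" for t
        proof -
          have "0 < t" "t < l" using that sxy by auto
          thus ?thesis using Fs_val rho_ps[OF lay that] by (simp add: r_def)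
        qed
        show "s p \<in> {s x..s y}" using p xy by (auto intro!: s_le)
      qed
      from chain_s[OF xy p this]
      have 1: "((\<lambda>p. Ws q (s p)) has_vector_derivative (r (q, p) - B (q, p)) * (1 / a p)) (at p within {x..y})"
        using ps_s[OF lb[OF p]] by (simp add: B_def)
      have ap: "a p \<noteq> 0" using a_pos[OF lb[OF p]] by simp
      have 2: "((\<lambda>p. 1 / a p) has_vector_derivative \<gamma> * (1 / a p) ^ 3) (at p within {x..y})"
      proof -
        have "(a has_real_derivative - \<gamma> / a p) (at p within {x..y})"
          using a_deriv_layer[OF lay p] by (simp add: has_real_derivative_iff_has_vector_derivative)
        from DERIV_inverse_fun[OF this ap]
        have "((\<lambda>p. inverse (a p)) has_real_derivative \<gamma> * (1 / a p) ^ 3) (at p within {x..y})"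
          by (rule DERIV_cong) (simp add: field_simps power2_eq_square power3_eq_cube)
        thus ?thesis by (simp add: has_real_derivative_iff_has_vector_derivative inverse_eq_divide)
      qed
      have "((\<lambda>p. Ws q (s p) * (1 / a p)) has_vector_derivative
         Ws q (s p) * (\<gamma> * (1 / a p) ^ 3) + (r (q, p) - B (q, p)) * (1 / a p) * (1 / a p)) (at p within {x..y})"
        by (rule has_vector_derivative_mult[OF 1 2])
      moreover have "Ws q (s p) * (\<gamma> * (1 / a p) ^ 3) + (r (q, p) - B (q, p)) * (1 / a p) * (1 / a p)
         = (r (q, p) - B (q, p)) * (1 / a p)\<^sup>2 + \<gamma> * (Wd r1 r2 (q, p) * (1 / a p)\<^sup>2)"
        by (simp add: Wd_def power2_eq_square power3_eq_cube mult_ac)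
      ultimately show ?thesis by (simp add: Wd_def[abs_def])
    qed
    note hs = hb_subset[OF _ sub]
    have hU: "hb (strip x y) \<alpha> (Ud r1 r2)"
    proof (rule hb_strip_partial[OF dq(1) dp1])
      have "\<bar>U q t\<bar> \<le> 2 * (32 / (1/2) * Cb (1/2) + l) * M * l" if "t \<in> {0..l}" for q t
      proof -
        have B0: "0 \<le> 2 * (32 / (1/2) * Cb (1/2) + l) * M" using Cb_nonneg[of "1/2"] l_pos M_nonneg by simp
        have "norm (U q t) \<le> 2 * (32 / (1/2) * Cb (1/2) + l) * M * (t - 0)"
          unfolding U_def
        proof (rule integral_bound[OF _ Ws_continuous_s])
          fix u assume "u \<in> {0..t}"
          thus "norm (Ws q u) \<le> 2 * (32 / (1/2) * Cb (1/2) + l) * M"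
            using Ws_bound[of "1/2" u q] that by simp
        qed (use that in auto)
        also have "\<dots> \<le> 2 * (32 / (1/2) * Cb (1/2) + l) * M * l" using that B0 by (intro mult_left_mono) auto
        finally show ?thesis by simp
      qed
      thus "bounded (Ud r1 r2 ` strip x y)"
        unfolding bounded_iff Ud_def using s_range lb
        by (intro exI[of _ "2 * (32 / (1/2) * Cb (1/2) + l) * M * l"]) (auto simp: mem_strip)
    qed (use hs[OF hV] hs[OF hW] \<alpha> in \<open>auto simp: hb_def\<close>)
    have "hb (strip x y) \<alpha> (\<lambda>z. (r z - B z) * (1 / a (snd z))\<^sup>2 + \<gamma> * (Wd r1 r2 z * (1 / a (snd z))\<^sup>2))"
      unfolding power2_eq_square by (intro hb_intros hr hs[OF hB] hs[OF hW] hs[OF hia])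
    thus "C2d \<alpha> x y (Ud r1 r2) V (Wd r1 r2) B A A
       (\<lambda>z. ((if x = p0 then r1 else r2) z - B z) * (1 / a (snd z))\<^sup>2 + \<gamma> * (Wd r1 r2 z * (1 / a (snd z))\<^sup>2))"
      unfolding C2d_def r_def[symmetric] using dq dp1 dp2 dp3 hU hs[OF hV] hs[OF hW] hs[OF hB] hs[OF hA] by auto
  qed
qed

end

lemma abs_lincomb: "\<bar>x\<bar> \<le> M \<Longrightarrow> \<bar>y\<bar> \<le> M' \<Longrightarrow> \<bar>c * x + d * y\<bar> \<le> \<bar>c\<bar> * M + \<bar>d\<bar> * M'" for x y c d M M' :: real
proof -
  assume "\<bar>x\<bar> \<le> M" "\<bar>y\<bar> \<le> M'"
  hence "\<bar>c * x\<bar> \<le> \<bar>c\<bar> * M" "\<bar>d * y\<bar> \<le> \<bar>d\<bar> * M'" unfolding abs_mult by (auto intro!: mult_left_mono)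
  thus ?thesis by linarith
qed

section \<open>Lifting of the top condition and the p-derivative of the inverse\<close>

context flow begin

definition pdata :: "(real \<Rightarrow> real) \<Rightarrow> real \<Rightarrow> bool" where
  "pdata h N \<longleftrightarrow> continuous_on UNIV h \<and> (\<forall>x. h (x + 2 * pi) = h x) \<and> (\<forall>x. \<bar>h x\<bar> \<le> N)"

lemma pdataD: "pdata h N \<Longrightarrow> continuous_on UNIV h" "pdata h N \<Longrightarrow> h (x + 2 * pi) = h x" "pdata h N \<Longrightarrow> \<bar>h x\<bar> \<le> N"
  by (auto simp: pdata_def)

lemma pdata_nonneg: "pdata h N \<Longrightarrow> N \<ge> 0"
  using pdataD(3)[of h N 0] by linarith

lemma pdata_lincomb: "pdata h N \<Longrightarrow> pdata k N' \<Longrightarrow> pdata (\<lambda>q. c * h q + d * k q) (\<bar>c\<bar> * N + \<bar>d\<bar> * N')"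
  unfolding pdata_def by (auto intro!: continuous_intros abs_lincomb)

text \<open>The top condition for the boundary values is phi'' - (g / \<sigma>) phi = - (lam / (2
  \<sigma>)) h; with this root the left side factors as (D - \<mu>)(D + \<mu>) phi, D being
  d/dq.\<close>

definition \<mu> :: real where "\<mu> = sqrt (g / \<sigma>)"

lemma \<mu>: "\<mu> > 0" "\<mu>\<^sup>2 = g / \<sigma>"
  using g \<sigma> by (auto simp: \<mu>_def)

lemma pdata_per1:
  assumes "m \<noteq> 0"
  obtains C where "C \<ge> 0" "\<And>h N. pdata h N \<Longrightarrow> pdata (per1 m h) (C * N)"
proof
  let ?C = "exp (2 * pi * \<bar>m\<bar>) * (2 * pi) / \<bar>1 - exp (- 2 * pi * m)\<bar>"
  show "?C \<ge> 0" by simp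
  show "pdata (per1 m h) (?C * N)" if "pdata h N" for h N
    unfolding pdata_def
    using per1_continuous[OF assms pdataD(1)[OF that] pdataD(2)[OF that]] per1_per[OF assms pdataD(1)[OF that] pdataD(2)[OF that]]
      per1_bound[OF assms pdataD(1)[OF that] pdataD(3)[OF that]] by blast
qed

definition rr :: "(real \<Rightarrow> real) \<Rightarrow> real \<Rightarrow> real" where "rr h = (\<lambda>q. - (lam / (2 * \<sigma>)) * h q)"
text \<open>Inverts the factor D - \<mu>; \<open>phi\<close> then inverts D + \<mu>.
  \<open>phi1\<close> and \<open>phi2\<close> are the first two derivatives of \<open>phi\<close>,
  expressed without differentiation.\<close>

definition xi :: "(real \<Rightarrow> real) \<Rightarrow> real \<Rightarrow> real" where "xi h = per1 (- \<mu>) (rr h)"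
definition phi :: "(real \<Rightarrow> real) \<Rightarrow> real \<Rightarrow> real" where "phi h = per1 \<mu> (xi h)"
definition phi1 :: "(real \<Rightarrow> real) \<Rightarrow> real \<Rightarrow> real" where "phi1 h = (\<lambda>q. xi h q - \<mu> * phi h q)"
definition phi2 :: "(real \<Rightarrow> real) \<Rightarrow> real \<Rightarrow> real" where "phi2 h = (\<lambda>q. (g / \<sigma>) * phi h q - (lam / (2 * \<sigma>)) * h q)"

lemma pdata_rr: "pdata h N \<Longrightarrow> pdata (rr h) (\<bar>lam / (2 * \<sigma>)\<bar> * N)"
proof -
  assume h: "pdata h N"
  have b: "\<bar>- k * h x\<bar> \<le> \<bar>k\<bar> * N" for k x
    using pdataD(3)[OF h, of x] by (simp add: abs_mult mult_left_mono)
  show ?thesis unfolding pdata_def rr_def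
  proof (intro conjI allI)
    show "continuous_on UNIV (\<lambda>q. - (lam / (2 * \<sigma>)) * h q)" by (intro continuous_on_mult continuous_on_const pdataD(1)[OF h])
  qed (simp_all only: pdataD(2)[OF h] b)
qed

lemma phi_pdata:
  obtains C where "C \<ge> 0" "\<And>h N. pdata h N \<Longrightarrow> pdata (xi h) (C * N)" "\<And>h N. pdata h N \<Longrightarrow> pdata (phi h) (C * N)"
    "\<And>h N. pdata h N \<Longrightarrow> pdata (phi1 h) (C * N)" "\<And>h N. pdata h N \<Longrightarrow> pdata (phi2 h) (C * N)"
proof -
  have m: "\<mu> \<noteq> 0" "- \<mu> \<noteq> 0" using \<mu> by auto
  obtain C1 where C1: "C1 \<ge> 0" "\<And>h N. pdata h N \<Longrightarrow> pdata (per1 (- \<mu>) h) (C1 * N)" using pdata_per1[OF m(2)] by blast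
  obtain C2 where C2: "C2 \<ge> 0" "\<And>h N. pdata h N \<Longrightarrow> pdata (per1 \<mu> h) (C2 * N)" using pdata_per1[OF m(1)] by blast
  define k where "k = \<bar>lam / (2 * \<sigma>)\<bar>"
  define c1 where "c1 = C1 * k"
  define c2 where "c2 = C2 * c1"
  have c: "c1 \<ge> 0" "c2 \<ge> 0" "k \<ge> 0" using C1 C2 by (auto simp: c1_def c2_def k_def)
  have x: "pdata (xi h) (c1 * N)" if "pdata h N" for h N
    using C1(2)[OF pdata_rr[OF that]] by (simp add: xi_def c1_def k_def mult.assoc)
  have p: "pdata (phi h) (c2 * N)" if "pdata h N" for h N
    using C2(2)[OF x[OF that]] by (simp add: phi_def c2_def mult.assoc)
  have mono: "pdata h N'" if "pdata h N" "N \<le> N'" for h N N' using that unfolding pdata_def by (meson order_trans)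
  define C where "C = c1 + c2 + \<mu> * c2 + \<bar>g / \<sigma>\<bar> * c2 + k"
  have nn: "\<mu> * c2 \<ge> 0" "\<bar>g / \<sigma>\<bar> * c2 \<ge> 0" using c \<mu> by auto
  show ?thesis
  proof (rule that[of C])
    show "C \<ge> 0" using c nn by (simp add: C_def)
    fix h N assume h: "pdata h N"
    have N: "N \<ge> 0" by (rule pdata_nonneg[OF h])
    have le: "z * N \<le> C * N" if "z \<le> C" for z using that N by (rule mult_right_mono)
    show "pdata (xi h) (C * N)" by (rule mono[OF x[OF h] le]) (use c nn in \<open>simp add: C_def\<close>)
    show "pdata (phi h) (C * N)" by (rule mono[OF p[OF h] le]) (use c nn in \<open>simp add: C_def\<close>)
    have "pdata (phi1 h) ((c1 + \<mu> * c2) * N)"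
      using pdata_lincomb[OF x[OF h] p[OF h], of 1 "- \<mu>"] \<mu> by (simp add: phi1_def algebra_simps)
    thus "pdata (phi1 h) (C * N)" by (rule mono[OF _ le]) (use c nn in \<open>simp add: C_def\<close>)
    have "pdata (phi2 h) ((\<bar>g / \<sigma>\<bar> * c2 + k) * N)"
      using pdata_lincomb[OF p[OF h] h, of "g / \<sigma>" "- (lam / (2 * \<sigma>))"] by (simp add: phi2_def k_def algebra_simps)
    thus "pdata (phi2 h) (C * N)" by (rule mono[OF _ le]) (use c nn in \<open>simp add: C_def\<close>)
  qed
qed

text \<open>With xi' = rr + \<mu> xi and phi' = xi - \<mu> phi one gets phi'' = rr + \<mu> (xi -
  phi') = rr + \<mu>^2 phi.\<close>

lemma phi_deriv:
  assumes h: "pdata h N"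
  shows "(phi h has_vector_derivative phi1 h q) (at q)" "(phi1 h has_vector_derivative phi2 h q) (at q)"
proof -
  have m: "\<mu> \<noteq> 0" "- \<mu> \<noteq> 0" using \<mu> by auto
  obtain C where C: "pdata (xi h) (C * N)" using phi_pdata h by metis
  show 1: "(phi h has_vector_derivative phi1 h q) (at q)" for q
    using per1_deriv[OF m(1) pdataD(1)[OF C] pdataD(2)[OF C], of q] by (simp add: phi_def phi1_def)
  note r = pdata_rr[OF h]
  have "(xi h has_vector_derivative (rr h q + \<mu> * xi h q)) (at q)"
    using per1_deriv[OF m(2) pdataD(1)[OF r] pdataD(2)[OF r], of q] by (simp add: xi_def)
  from has_vector_derivative_diff[OF this has_vector_derivative_mult_right[OF 1[of q], of \<mu>]]
  have "(phi1 h has_vector_derivative rr h q + \<mu> * xi h q - \<mu> * phi1 h q) (at q)" by (simp add: phi1_def[abs_def])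
  moreover have "rr h q + \<mu> * xi h q - \<mu> * phi1 h q = phi2 h q"
  proof -
    have "\<mu> * (\<mu> * x) = g / \<sigma> * x" for x
      using \<mu>(2) by (metis mult.assoc power2_eq_square)
    thus ?thesis by (simp add: phi1_def phi2_def rr_def right_diff_distrib)
  qed
  ultimately show "(phi1 h has_vector_derivative phi2 h q) (at q)" by simp
qed

lemma phi_lin:
  assumes "pdata h N" "pdata k N'"
  shows "phi (\<lambda>q. c * h q + d * k q) q = c * phi h q + d * phi k q"
    "phi2 (\<lambda>q. c * h q + d * k q) q = c * phi2 h q + d * phi2 k q"
proof -
  have m: "\<mu> \<noteq> 0" "- \<mu> \<noteq> 0" using \<mu> by auto
  have rr: "rr (\<lambda>q. c * h q + d * k q) = (\<lambda>q. c * rr h q + d * rr k q)" by (simp add: rr_def algebra_simps)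
  have "xi (\<lambda>q. c * h q + d * k q) = (\<lambda>q. c * xi h q + d * xi k q)"
    unfolding xi_def rr
    by (rule ext) (rule per1_lin[OF m(2) pdataD(1)[OF pdata_rr[OF assms(1)]] pdataD(1)[OF pdata_rr[OF assms(2)]]])
  moreover obtain C where "pdata (xi h) (C * N)" "pdata (xi k) (C * N')" using phi_pdata assms by metis
  ultimately show 1: "phi (\<lambda>q. c * h q + d * k q) q = c * phi h q + d * phi k q"
    using per1_lin[OF m(1) pdataD(1) pdataD(1)] by (simp add: phi_def)
  show "phi2 (\<lambda>q. c * h q + d * k q) q = c * phi2 h q + d * phi2 k q"
    by (simp add: phi2_def 1 algebra_simps add_divide_distrib)
qed

definition kx :: real where "kx = 1 / (- p0)"
text \<open>An affine cutoff: the lifting has no second p-derivative and satisfies the transmission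
  conditions by itself.\<close>

definition chi :: "real \<Rightarrow> real" where "chi p = (p - p0) * kx"

lemma kx: "kx > 0" using p01 p1 by (simp add: kx_def)

lemma chi: "chi p0 = 0" "chi 0 = 1" "p \<in> {p0..0} \<Longrightarrow> 0 \<le> chi p \<and> chi p \<le> 1"
  using p01 p1 kx by (auto simp: chi_def kx_def field_simps)

text \<open>Interior data left over after subtracting the lifting \<open>phi h q * chi p\<close> of the boundary values on top, in the normalisation \<open>u\<^sub>s\<^sub>s + u\<^sub>q\<^sub>q\<close>.\<close>

definition Rr :: "real \<Rightarrow> (real \<times> real \<Rightarrow> real) \<Rightarrow> (real \<Rightarrow> real) \<Rightarrow> real \<times> real \<Rightarrow> real" where
  "Rr \<gamma> f h z = (a (snd z))\<^sup>2 * f z - phi2 h (fst z) * chi (snd z) + \<gamma> * (phi h (fst z) * kx)"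

text \<open>Sup-norm control of all three data. \<open>Kop\<close> of a merely continuous function
  belongs to this class, though not in general to \<open>YZ\<close>.\<close>

definition Y0 :: "yzelt \<Rightarrow> real \<Rightarrow> bool" where
  "Y0 y N \<longleftrightarrow> LD (fst y) (fst (snd y)) N \<and> pdata (snd (snd y)) N"

lemma Y0_D: "Y0 (f1, f2, h) N \<Longrightarrow> LD f1 f2 N" "Y0 (f1, f2, h) N \<Longrightarrow> pdata h N"
  by (auto simp: Y0_def)

lemma Rr_LD:
  obtains C where "C \<ge> 0" "\<And>f1 f2 h N. Y0 (f1, f2, h) N \<Longrightarrow> LD (Rr \<gamma>1 f1 h) (Rr \<gamma>2 f2 h) (C * N)"
proof -
  obtain C where C: "C \<ge> 0" "\<And>h N. pdata h N \<Longrightarrow> pdata (phi h) (C * N)" "\<And>h N. pdata h N \<Longrightarrow> pdata (phi2 h) (C * N)"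
    using phi_pdata by metis
  obtain A where A: "A \<ge> 0" "\<And>z. z \<in> strip p0 0 \<Longrightarrow> \<bar>a (snd z)\<bar> \<le> A"
    using hb_a[of 1] unfolding hb_iff by auto
  have ca: "continuous_on (strip x y) (\<lambda>z. a (snd z))" if "layer x y \<gamma>" for x y \<gamma>
    by (rule continuous_on_subset[OF hb_imp_continuous_on[OF hb_a[of 1]] strip_sub[OF that]]) auto
  define k where "k = A\<^sup>2 + C + (\<bar>\<gamma>1\<bar> + \<bar>\<gamma>2\<bar>) * (C * kx)"
  have main: "continuous_on (strip x y) (Rr \<gamma> f h) \<and> (\<forall>q. \<forall>p\<in>{x..y}. Rr \<gamma> f h (q + 2 * pi, p) = Rr \<gamma> f h (q, p))
       \<and> (\<forall>z\<in>strip x y. \<bar>Rr \<gamma> f h z\<bar> \<le> k * N)"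
    if lay: "layer x y \<gamma>" and f: "continuous_on (strip x y) f" "\<And>q p. p \<in> {x..y} \<Longrightarrow> f (q + 2 * pi, p) = f (q, p)" "\<And>z. z \<in> strip x y \<Longrightarrow> \<bar>f z\<bar> \<le> N"
      and h: "pdata h N" for x y \<gamma> f h N
  proof (intro conjI allI ballI)
    note P = C(2)[OF h] C(3)[OF h]
    have N: "N \<ge> 0" by (rule pdata_nonneg[OF h])
    show "continuous_on (strip x y) (Rr \<gamma> f h)"
      unfolding Rr_def[abs_def] chi_def
      by (intro continuous_intros ca[OF lay] f(1) continuous_on_compose2[OF pdataD(1)[OF P(1)]] continuous_on_compose2[OF pdataD(1)[OF P(2)]]) auto
    show "Rr \<gamma> f h (q + 2 * pi, p) = Rr \<gamma> f h (q, p)" if "p \<in> {x..y}" for q p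
      using f(2)[OF that] pdataD(2)[OF P(1)] pdataD(2)[OF P(2)] by (simp add: Rr_def)
    fix z assume z: "z \<in> strip x y"
    hence z0: "z \<in> strip p0 0" "snd z \<in> {p0..0}" using strip_sub[OF lay] by (auto simp: mem_strip)
    have "(a (snd z))\<^sup>2 \<le> A\<^sup>2" using A(2)[OF z0(1)] A(1) by (simp add: abs_le_square_iff[symmetric])
    hence 1: "\<bar>(a (snd z))\<^sup>2 * f z\<bar> \<le> A\<^sup>2 * N" unfolding abs_mult using f(3)[OF z] N by (intro mult_mono) auto
    have 2: "\<bar>phi2 h (fst z) * chi (snd z)\<bar> \<le> (C * N) * 1"
      unfolding abs_mult using pdataD(3)[OF P(2), of "fst z"] chi(3)[OF z0(2)] C(1) N by (intro mult_mono) auto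
    have g: "\<bar>\<gamma>\<bar> \<le> \<bar>\<gamma>1\<bar> + \<bar>\<gamma>2\<bar>" using lay by (auto simp: layer_def)
    have 3: "\<bar>\<gamma> * (phi h (fst z) * kx)\<bar> \<le> (\<bar>\<gamma>1\<bar> + \<bar>\<gamma>2\<bar>) * ((C * N) * kx)"
      unfolding abs_mult using pdataD(3)[OF P(1), of "fst z"] g kx C(1) N by (intro mult_mono) auto
    have "\<bar>Rr \<gamma> f h z\<bar> \<le> A\<^sup>2 * N + (C * N) * 1 + (\<bar>\<gamma>1\<bar> + \<bar>\<gamma>2\<bar>) * ((C * N) * kx)"
      unfolding Rr_def using 1 2 3 by linarith
    also have "\<dots> = k * N" by (simp add: k_def algebra_simps)
    finally show "\<bar>Rr \<gamma> f h z\<bar> \<le> k * N" .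
  qed
  show ?thesis
  proof (rule that[of k])
    show "k \<ge> 0" using C kx by (simp add: k_def)
    fix f1 f2 h N assume Y: "Y0 (f1, f2, h) N"
    note h = Y0_D(2)[OF Y]
    have L: "continuous_on (strip p0 p1) f1" "continuous_on (strip p1 0) f2" "\<And>q p. p \<in> {p0..p1} \<Longrightarrow> f1 (q + 2 * pi, p) = f1 (q, p)"
      "\<And>q p. p \<in> {p1..0} \<Longrightarrow> f2 (q + 2 * pi, p) = f2 (q, p)" "\<And>z. z \<in> strip p0 p1 \<Longrightarrow> \<bar>f1 z\<bar> \<le> N" "\<And>z. z \<in> strip p1 0 \<Longrightarrow> \<bar>f2 z\<bar> \<le> N"
      using Y0_D(1)[OF Y] unfolding LD_def by auto
    show "LD (Rr \<gamma>1 f1 h) (Rr \<gamma>2 f2 h) (k * N)"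
      using main[OF layers(1) L(1,3,5) h] main[OF layers(2) L(2,4,6) h] unfolding LD_def by blast
  qed
qed

text \<open>The \<open>p\<close>-derivative of \<open>PP\<inverse> y\<close>; unlike \<open>PP\<inverse>\<close> it makes sense for merely continuous data.\<close>

definition DR :: "yzelt \<Rightarrow> real \<times> real \<Rightarrow> real" where
  "DR y z = Wd (Rr \<gamma>1 (fst y) (snd (snd y))) (Rr \<gamma>2 (fst (snd y)) (snd (snd y))) (fst z, max p0 (min (snd z) 0))
     + phi (snd (snd y)) (fst z) * kx"

lemma clamp_in: "max p0 (min p 0) \<in> {p0..0}" "p \<in> {p0..0} \<Longrightarrow> max p0 (min p 0) = p"
  using p01 p1 by auto

lemma dist_clamp: "dist (q, max p0 (min p 0)) (q', max p0 (min p' 0)) \<le> dist (q, p) (q', p')"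
  unfolding dist_Pair_Pair dist_real_def by (intro real_sqrt_le_mono add_mono power_mono) auto

text \<open>Bounded data go to Hoelder functions, with a constant linear in the bound. The interior
  part is \<open>Wd_estimate\<close>; the lifting part is Lipschitz in q, and distances above 1 are
  covered by its bound.\<close>

lemma DR_estimate:
  obtains C where "C \<ge> 0" "\<And>y N z. Y0 y N \<Longrightarrow> \<bar>DR y z\<bar> \<le> C * N"
    "\<And>y N z w. Y0 y N \<Longrightarrow> \<bar>DR y z - DR y w\<bar> \<le> C * N * dist z w powr \<alpha>"
proof -
  obtain CW where CW: "CW \<ge> 0" "\<And>r1 r2 M z. LD r1 r2 M \<Longrightarrow> z \<in> strip p0 0 \<Longrightarrow> \<bar>Wd r1 r2 z\<bar> \<le> CW * M"
    "\<And>r1 r2 M z w. LD r1 r2 M \<Longrightarrow> z \<in> strip p0 0 \<Longrightarrow> w \<in> strip p0 0 \<Longrightarrow> \<bar>Wd r1 r2 z - Wd r1 r2 w\<bar> \<le> CW * M * dist z w powr \<alpha>"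
    using Wd_estimate by blast
  obtain CR where CR: "CR \<ge> 0" "\<And>f1 f2 h N. Y0 (f1, f2, h) N \<Longrightarrow> LD (Rr \<gamma>1 f1 h) (Rr \<gamma>2 f2 h) (CR * N)" using Rr_LD by blast
  obtain C where C: "C \<ge> 0" "\<And>h N. pdata h N \<Longrightarrow> pdata (phi h) (C * N)" "\<And>h N. pdata h N \<Longrightarrow> pdata (phi1 h) (C * N)"
    using phi_pdata by metis
  show ?thesis
  proof (rule that[of "CW * CR + 3 * (C * kx)"])
    show "CW * CR + 3 * (C * kx) \<ge> 0" using CW CR C kx by simp
    fix y N assume Y: "Y0 y N"
    obtain f1 f2 h where y: "y = (f1, f2, h)" by (cases y) auto
    note L = CR(2)[OF Y[unfolded y]] and h = Y0_D(2)[OF Y[unfolded y]]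
    have N: "N \<ge> 0" by (rule pdata_nonneg[OF h])
    have CkN: "0 \<le> C * kx * N" using C kx N by simp
    let ?W = "Wd (Rr \<gamma>1 f1 h) (Rr \<gamma>2 f2 h)"
    have ph: "\<bar>phi h q * kx\<bar> \<le> C * kx * N" for q
      unfolding abs_mult using pdataD(3)[OF C(2)[OF h], of q] kx by (simp add: mult_right_mono mult.assoc mult.left_commute)
    {
      fix z
      have "\<bar>?W (fst z, max p0 (min (snd z) 0))\<bar> \<le> CW * (CR * N)" using clamp_in(1)[of "snd z"] by (intro CW(2)[OF L]) (simp add: mem_strip)
      hence "\<bar>DR y z\<bar> \<le> CW * (CR * N) + C * kx * N" using ph[of "fst z"] unfolding DR_def y fst_conv snd_conv by linarith
      also have "\<dots> \<le> (CW * CR + 3 * (C * kx)) * N" using CkN by (simp add: algebra_simps)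
      finally show "\<bar>DR y z\<bar> \<le> (CW * CR + 3 * (C * kx)) * N" .
    }
    fix z w
    have "\<bar>?W (fst z, max p0 (min (snd z) 0)) - ?W (fst w, max p0 (min (snd w) 0))\<bar>
        \<le> CW * (CR * N) * dist (fst z, max p0 (min (snd z) 0)) (fst w, max p0 (min (snd w) 0)) powr \<alpha>"
      using clamp_in(1)[of "snd z"] clamp_in(1)[of "snd w"] by (intro CW(3)[OF L]) (simp_all add: mem_strip)
    also have "\<dots> \<le> CW * (CR * N) * dist z w powr \<alpha>"
      using dist_clamp[of "fst z" "snd z" "fst w" "snd w"] \<alpha> CW CR N by (intro mult_left_mono powr_mono2) auto
    finally have 1: "\<bar>?W (fst z, max p0 (min (snd z) 0)) - ?W (fst w, max p0 (min (snd w) 0))\<bar> \<le> CW * (CR * N) * dist z w powr \<alpha>" .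
    have lip: "\<bar>phi h (fst z) - phi h (fst w)\<bar> \<le> C * N * dist z w"
    proof -
      have "norm (phi h (fst z) - phi h (fst w)) \<le> (C * N) * norm (fst z - fst w)"
      proof (rule differentiable_bound[where S = UNIV and f' = "\<lambda>x t. t *\<^sub>R phi1 h x"])
        fix x
        show "(phi h has_derivative (\<lambda>t. t *\<^sub>R phi1 h x)) (at x within UNIV)"
          using phi_deriv(1)[OF h, of x] by (simp add: has_vector_derivative_def)
        have "onorm (\<lambda>t. t *\<^sub>R phi1 h x) \<le> \<bar>phi1 h x\<bar>" by (rule onorm_le) (simp add: abs_mult mult.commute)
        thus "onorm (\<lambda>t. t *\<^sub>R phi1 h x) \<le> C * N" using pdataD(3)[OF C(3)[OF h], of x] by linarith
      qed auto
      also have "\<dots> \<le> (C * N) * dist z w" using dist_fst_le[of z w] C(1) N by (intro mult_left_mono) (auto simp: dist_norm)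
      finally show ?thesis by simp
    qed
    have "\<bar>phi h (fst z) * kx - phi h (fst w) * kx\<bar> \<le> 2 * (C * kx * N) * dist z w powr \<alpha>"
    proof (cases "dist z w \<le> 1")
      case True
      have "dist z w \<le> dist z w powr \<alpha>"
      proof (cases "z = w")
        case False
        have "dist z w powr 1 \<le> dist z w powr \<alpha>" using True False \<alpha> by (intro powr_mono') auto
        thus ?thesis using False by simp
      qed simp
      hence "C * N * dist z w \<le> C * N * dist z w powr \<alpha>" using C N by (intro mult_left_mono) auto
      hence "\<bar>phi h (fst z) - phi h (fst w)\<bar> * kx \<le> C * N * dist z w powr \<alpha> * kx" using lip kx by (intro mult_right_mono) auto
      moreover have "\<bar>phi h (fst z) * kx - phi h (fst w) * kx\<bar> = \<bar>phi h (fst z) - phi h (fst w)\<bar> * kx"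
        using kx by (simp add: left_diff_distrib[symmetric] abs_mult)
      moreover have "0 \<le> (C * kx * N) * dist z w powr \<alpha>" using CkN by simp
      ultimately show ?thesis by (simp add: algebra_simps)
    next
      case False
      have "1 \<le> dist z w powr \<alpha>" using False \<alpha> by (intro ge_one_powr_ge_zero) auto
      hence "2 * (C * kx * N) * 1 \<le> 2 * (C * kx * N) * dist z w powr \<alpha>" using CkN by (intro mult_left_mono) auto
      moreover have "\<bar>phi h (fst z) * kx - phi h (fst w) * kx\<bar> \<le> 2 * (C * kx * N)" using ph[of "fst z"] ph[of "fst w"] by linarith
      ultimately show ?thesis by linarith
    qed
    with 1 have "\<bar>DR y z - DR y w\<bar> \<le> CW * (CR * N) * dist z w powr \<alpha> + 2 * (C * kx * N) * dist z w powr \<alpha>"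
      unfolding DR_def y fst_conv snd_conv by linarith
    also have "\<dots> = (CW * CR + 2 * (C * kx)) * N * dist z w powr \<alpha>" by (simp add: algebra_simps)
    also have "\<dots> \<le> (CW * CR + 3 * (C * kx)) * N * dist z w powr \<alpha>"
      using C kx N by (intro mult_right_mono) auto
    finally show "\<bar>DR y z - DR y w\<bar> \<le> (CW * CR + 3 * (C * kx)) * N * dist z w powr \<alpha>" .
  qed
qed

lemma DR_hb: "Y0 y N \<Longrightarrow> hb S \<alpha> (DR y)"
proof -
  assume Y: "Y0 y N"
  obtain C where C: "C \<ge> 0" "\<And>z. \<bar>DR y z\<bar> \<le> C * N" "\<And>z w. \<bar>DR y z - DR y w\<bar> \<le> C * N * dist z w powr \<alpha>"
    using DR_estimate Y by metis
  have "N \<ge> 0" using Y pdata_nonneg by (auto simp: Y0_def)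
  thus ?thesis unfolding hb_iff using C by (intro exI[of _ "C * N"]) auto
qed

lemma DR_cylC: "Y0 y N \<Longrightarrow> DR y \<in> cylC p0 0"
proof (rule cylCI)
  assume Y: "Y0 y N"
  obtain f1 f2 h where y: "y = (f1, f2, h)" by (cases y) auto
  show "continuous_on UNIV (DR y)" by (rule hb_imp_continuous_on[OF DR_hb[OF Y] \<alpha>(1)])
  obtain CR where L: "LD (Rr \<gamma>1 f1 h) (Rr \<gamma>2 f2 h) (CR * N)" using Rr_LD Y unfolding y by metis
  obtain C where "pdata (phi h) (C * N)" using phi_pdata Y0_D(2)[OF Y[unfolded y]] by metis
  thus "DR y (q + 2 * pi, p) = DR y (q, p)" for q p
    using Wd_per[OF L] pdataD(2) by (simp add: DR_def y)
  show "DR y (q, max p0 (min p 0)) = DR y (q, p)" for q p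
    using clamp_in(2)[OF clamp_in(1), of p] by (simp add: DR_def)
qed

lemma DR_lin:
  assumes "Y0 y N" "Y0 y' N'"
  shows "DR (c *\<^sub>R y + d *\<^sub>R y') = c *\<^sub>R DR y + d *\<^sub>R DR y'"
proof -
  obtain f1 f2 h where y: "y = (f1, f2, h)" by (cases y) auto
  obtain f1' f2' h' where y': "y' = (f1', f2', h')" by (cases y') auto
  note h = Y0_D(2)[OF assms(1)[unfolded y]] Y0_D(2)[OF assms(2)[unfolded y']]
  obtain CR where L: "LD (Rr \<gamma>1 f1 h) (Rr \<gamma>2 f2 h) (CR * N)" "LD (Rr \<gamma>1 f1' h') (Rr \<gamma>2 f2' h') (CR * N')"
    using Rr_LD assms unfolding y y' by metis
  have R: "Rr \<gamma> (\<lambda>z. c * f z + d * f' z) (\<lambda>q. c * h q + d * h' q) = (\<lambda>z. c * Rr \<gamma> f h z + d * Rr \<gamma> f' h' z)" for \<gamma> f f'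
    unfolding Rr_def[abs_def] phi_lin[OF h] by (simp add: algebra_simps)
  have "DR (c *\<^sub>R y + d *\<^sub>R y') z = c * DR y z + d * DR y' z" for z
    unfolding DR_def y y' using Wd_lin[OF L, of c d] phi_lin(1)[OF h, of c d]
    by (simp add: plus_fun_def scaleR_fun_def R algebra_simps)
  thus ?thesis by (simp add: fun_eq_iff scaleR_fun_def)
qed

end

lemma C2d_cong:
  assumes C: "C2d \<alpha> a b u uq up uqq uqp upq upp" and e: "\<And>z. z \<in> strip a b \<Longrightarrow> u' z = u z"
  shows "C2d \<alpha> a b u' uq up uqq uqp upq upp"
proof -
  note D = C2dD[OF C]
  have 1: "((\<lambda>t. u' (t, p)) has_vector_derivative uq (q, p)) (at q)" if "p \<in> {a..b}" for q p
  proof -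
    have "(\<lambda>t. u' (t, p)) = (\<lambda>t. u (t, p))" using e that by (auto simp: mem_strip)
    thus ?thesis using D(1)[OF that] by simp
  qed
  have 2: "((\<lambda>t. u' (q, t)) has_vector_derivative up (q, p)) (at p within {a..b})" if "p \<in> {a..b}" for q p
    by (rule has_vector_derivative_transform[OF that _ D(2)[OF that]]) (use e in \<open>auto simp: mem_strip\<close>)
  have 3: "hb (strip a b) \<alpha> u'" by (rule hb_cong[OF D(7)]) (simp add: e)
  show ?thesis unfolding C2d_def using 1 2 3 D by auto
qed

lemma hb_fst:
  fixes S :: "(real \<times> real) set" and k :: "real \<Rightarrow> real"
  assumes k: "hb UNIV \<alpha> k" and \<alpha>: "0 < \<alpha>" shows "hb S \<alpha> (\<lambda>z. k (fst z))"
proof -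
  obtain N where N: "N \<ge> 0" "\<And>z. \<bar>k z\<bar> \<le> N" "\<And>z w. \<bar>k z - k w\<bar> \<le> N * dist z w powr \<alpha>"
    using k unfolding hb_iff by auto
  show ?thesis unfolding hb_iff
  proof (intro exI[of _ N] conjI ballI N)
    fix z w :: "real \<times> real"
    have "\<bar>k (fst z) - k (fst w)\<bar> \<le> N * dist (fst z) (fst w) powr \<alpha>" by (rule N)
    also have "\<dots> \<le> N * dist z w powr \<alpha>" using N(1) \<alpha> by (intro mult_left_mono powr_mono2 dist_fst_le) auto
    finally show "\<bar>k (fst z) - k (fst w)\<bar> \<le> N * dist z w powr \<alpha>" .
  qed
qed

lemma hb_real_deriv:
  fixes k k' :: "real \<Rightarrow> real"
  assumes "\<And>q. (k has_vector_derivative k' q) (at q)" "\<And>q. \<bar>k q\<bar> \<le> N" "\<And>q. \<bar>k' q\<bar> \<le> N'" "0 < \<alpha>" "\<alpha> \<le> 1"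
  shows "hb UNIV \<alpha> k"
proof (rule hb_lipschitz[OF assms(2) _ assms(4,5)])
  fix z w :: real
  have "norm (k z - k w) \<le> N' * norm (z - w)"
  proof (rule differentiable_bound[where S = UNIV and f' = "\<lambda>x t. t *\<^sub>R k' x"])
    fix x
    show "(k has_derivative (\<lambda>t. t *\<^sub>R k' x)) (at x within UNIV)"
      using assms(1)[of x] by (simp add: has_vector_derivative_def)
    have "onorm (\<lambda>t. t *\<^sub>R k' x) \<le> \<bar>k' x\<bar>" by (rule onorm_le) (simp add: abs_mult mult.commute)
    thus "onorm (\<lambda>t. t *\<^sub>R k' x) \<le> N'" using assms(3)[of x] by linarith
  qed auto
  thus "\<bar>k z - k w\<bar> \<le> N' * dist z w" by (simp add: dist_real_def)
qed

text \<open>For points on different sides the increment is split at the interface point with the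
  q-coordinate of the first point; it is no farther from either of them than they are from each
  other.\<close>

lemma hb_glue:
  assumes "hb (strip x y) \<alpha> f" "hb (strip y t) \<alpha> f" "x \<le> y" "y \<le> t" "0 < \<alpha>"
  shows "hb (strip x t) \<alpha> f"
proof -
  obtain N where N: "N \<ge> 0" "\<And>z. z \<in> strip x y \<Longrightarrow> \<bar>f z\<bar> \<le> N" "\<And>z w. z \<in> strip x y \<Longrightarrow> w \<in> strip x y \<Longrightarrow> \<bar>f z - f w\<bar> \<le> N * dist z w powr \<alpha>"
    using assms(1) unfolding hb_iff by blast
  obtain M where M: "M \<ge> 0" "\<And>z. z \<in> strip y t \<Longrightarrow> \<bar>f z\<bar> \<le> M" "\<And>z w. z \<in> strip y t \<Longrightarrow> w \<in> strip y t \<Longrightarrow> \<bar>f z - f w\<bar> \<le> M * dist z w powr \<alpha>"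
    using assms(2) unfolding hb_iff by blast
  have cross: "\<bar>f z - f w\<bar> \<le> (N + M) * dist z w powr \<alpha>" if "z \<in> strip x y" "w \<in> strip y t" for z w
  proof -
    define v where "v = (fst z, y)"
    have d: "dist z v \<le> dist z w" "dist v w \<le> dist z w"
    proof -
      have "dist z v = \<bar>snd z - y\<bar>" by (cases z) (simp add: v_def dist_Pair_Pair dist_real_def)
      also have "\<dots> \<le> dist (snd z) (snd w)" using that by (auto simp: mem_strip dist_real_def)
      also have "\<dots> \<le> dist z w" by (rule dist_snd_le)
      finally show "dist z v \<le> dist z w" .
      show "dist v w \<le> dist z w"
        using that by (cases z, cases w) (auto simp: v_def dist_Pair_Pair dist_real_def mem_strip intro!: real_sqrt_le_mono add_mono abs_le_square_iff[THEN iffD1])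
    qed
    have v: "v \<in> strip x y" "v \<in> strip y t" using assms(3,4) by (auto simp: v_def mem_strip)
    have "\<bar>f z - f v\<bar> \<le> N * dist z w powr \<alpha>"
      using N(3)[OF that(1) v(1)] powr_mono2[of \<alpha> "dist z v" "dist z w"] d assms(5) N(1)
      by (auto intro: order_trans mult_left_mono)
    moreover have "\<bar>f v - f w\<bar> \<le> M * dist z w powr \<alpha>"
      using M(3)[OF v(2) that(2)] powr_mono2[of \<alpha> "dist v w" "dist z w"] d assms(5) M(1)
      by (auto intro: order_trans mult_left_mono)
    ultimately show ?thesis unfolding distrib_right by linarith
  qed
  have mem: "z \<in> strip x y \<or> z \<in> strip y t" if "z \<in> strip x t" for z using that by (auto simp: mem_strip)
  show ?thesis unfolding hb_iff
  proof (intro exI[of _ "N + M"] conjI ballI)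
    show "0 \<le> N + M" using N M by simp
    show "\<bar>f z\<bar> \<le> N + M" if "z \<in> strip x t" for z using mem[OF that] N(1) N(2)[of z] M(1) M(2)[of z] by fastforce
    fix z w assume zw: "z \<in> strip x t" "w \<in> strip x t"
    have le: "N * dist z w powr \<alpha> \<le> (N + M) * dist z w powr \<alpha>" "M * dist z w powr \<alpha> \<le> (N + M) * dist z w powr \<alpha>"
      using N(1) M(1) by (auto intro!: mult_right_mono)
    show "\<bar>f z - f w\<bar> \<le> (N + M) * dist z w powr \<alpha>"
      using mem[OF zw(1)] mem[OF zw(2)] N(3)[of z w] M(3)[of z w] cross[of z w] cross[of w z] le
      by (elim disjE) (auto simp: dist_commute abs_minus_commute)
  qed
qed

lemma C_alpha_iff: "f \<in> C_alpha \<alpha> a b \<longleftrightarrow> cyl_fun a b f \<and> hb (strip a b) \<alpha> f"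
  by (auto simp: C_alpha_def hb_def)

lemma C_alpha_S_iff: "h \<in> C_alpha_S \<alpha> \<longleftrightarrow> (\<forall>q. h (q + 2 * pi) = h q) \<and> hb UNIV \<alpha> h"
  by (auto simp: C_alpha_S_def hb_def)

lemma C_alpha_subspace: "subspace (C_alpha \<alpha> a b)" "subspace (C_alpha_S \<alpha>)"
  by (rule subspaceI; auto simp: C_alpha_iff C_alpha_S_iff cyl_fun_def plus_fun_def scaleR_fun_def zero_fun_def intro!: hb_add hb_cmult)+

lemma YZ_subspace: "subspace (YZsp \<alpha> p0 p1)"
  unfolding YZsp_def by (intro subspace_Times C_alpha_subspace)

lemma sup_norm_ge:
  assumes "bounded (f ` S)" "z \<in> S" shows "\<bar>f z\<bar> \<le> sup_norm S f" "0 \<le> sup_norm S f"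
proof -
  obtain N where "\<forall>x\<in>S. \<bar>f x\<bar> \<le> N" using assms(1) unfolding bounded_iff by auto
  hence "bdd_above ((\<lambda>z. \<bar>f z\<bar>) ` S)" by (auto intro: bdd_aboveI2)
  from cSUP_upper[OF assms(2) this] show "\<bar>f z\<bar> \<le> sup_norm S f" by (simp add: sup_norm_def)
  thus "0 \<le> sup_norm S f" by linarith
qed

lemma holder_semi_nonneg:
  assumes "holder_on S \<alpha> f" "z \<in> S" "w \<in> S" "z \<noteq> w"
  shows "0 \<le> holder_semi S \<alpha> f"
proof -
  obtain C where C: "\<And>z w. z \<in> S \<Longrightarrow> w \<in> S \<Longrightarrow> \<bar>f z - f w\<bar> \<le> C * dist z w powr \<alpha>"
    using assms(1) unfolding holder_on_def by blast
  let ?A = "{(z, w). z \<in> S \<and> w \<in> S \<and> z \<noteq> w}" and ?g = "\<lambda>zw. \<bar>f (fst zw) - f (snd zw)\<bar> / dist (fst zw) (snd zw) powr \<alpha>"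
  have "bdd_above (?g ` ?A)"
    by (rule bdd_aboveI2[where M = C]) (use C in \<open>auto simp: divide_le_eq\<close>)
  moreover have "(z, w) \<in> ?A" using assms by simp
  ultimately have "?g (z, w) \<le> holder_semi S \<alpha> f" unfolding holder_semi_def by (intro cSUP_upper)
  moreover have "0 \<le> ?g (z, w)" by simp
  ultimately show ?thesis by linarith
qed

lemma periodic_max:
  fixes f :: "real \<Rightarrow> real"
  assumes "continuous_on UNIV f" "\<And>q. f (q + 2 * pi) = f q"
  obtains q0 where "\<And>q. f q \<le> f q0"
proof -
  have "\<exists>q0\<in>{0..2 * pi}. \<forall>q\<in>{0..2 * pi}. f q \<le> f q0"
    by (rule continuous_attains_sup) (auto intro: continuous_on_subset[OF assms(1)])
  then obtain q0 where q0: "\<And>q. q \<in> {0..2 * pi} \<Longrightarrow> f q \<le> f q0" by blast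
  show ?thesis
  proof (rule that[of q0])
    fix q
    obtain n :: int where n: "q + of_int n * (2 * pi) \<in> {0..2 * pi}" by (rule per_reduce)
    show "f q \<le> f q0" using q0[OF n] per_int[of f q n] assms(2) by simp
  qed
qed

section \<open>The splitting of the operator and its mapping properties\<close>

context flow begin

abbreviation X where "X \<equiv> Xsp \<alpha> p0 p1"
abbreviation YZ where "YZ \<equiv> YZsp \<alpha> p0 p1"
abbreviation LT where "LT \<equiv> LTop g \<sigma> p0 p1 \<gamma>1 \<gamma>2 lam"

lemma \<alpha>1: "\<alpha> \<le> 1" using \<alpha> by simp

text \<open>The clamp places the derivative in \<open>cylC p0 0\<close>. At the interface the lower
  layer is taken, which agrees with the upper one by the transmission condition.\<close>

definition Dx :: "xelt \<Rightarrow> real \<times> real \<Rightarrow> real" where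
  "Dx x z = (if max p0 (min (snd z) 0) \<le> p1 then dp p0 p1 (fst x) (fst z, max p0 (min (snd z) 0))
     else dp p1 0 (snd x) (fst z, max p0 (min (snd z) 0)))"

definition PL :: "real \<Rightarrow> real \<Rightarrow> real \<Rightarrow> (real \<times> real \<Rightarrow> real) \<Rightarrow> real \<times> real \<Rightarrow> real" where
  "PL \<gamma> x y v z = (if snd z \<in> {x..y} then dp x y (dp x y v) z + dq (dq v) z * (1 / a (snd z))\<^sup>2 - \<gamma> * (dp x y v z * (1 / a (snd z))\<^sup>2) else 0)"

definition PP :: "xelt \<Rightarrow> yzelt" where
  "PP x = (PL \<gamma>1 p0 p1 (fst x), PL \<gamma>2 p1 0 (snd x), \<lambda>q. (2 / lam) * (g * snd x (q, 0) - \<sigma> * dq (dq (snd x)) (q, 0)))"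

text \<open>What is left of the coefficient - 3 \<gamma> after \<open>PL\<close> has taken -
  \<gamma>.\<close>

definition KL :: "real \<Rightarrow> real \<Rightarrow> real \<Rightarrow> (real \<times> real \<Rightarrow> real) \<Rightarrow> real \<times> real \<Rightarrow> real" where
  "KL \<gamma> x y w z = (if snd z \<in> {x..y} then - (2 * \<gamma>) * (w z * (1 / a (snd z))\<^sup>2) else 0)"

definition Kop :: "(real \<times> real \<Rightarrow> real) \<Rightarrow> yzelt" where
  "Kop w = (KL \<gamma>1 p0 p1 w, KL \<gamma>2 p1 0 w, \<lambda>q. - (2 / lam * lam powr (3/2)) * w (q, 0))"

lemma XD:
  assumes "x \<in> X"
  shows "fst x \<in> C2_alpha \<alpha> p0 p1" "snd x \<in> C2_alpha \<alpha> p1 0" "fst x (q, p1) = snd x (q, p1)"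
    "dp p0 p1 (fst x) (q, p1) = dp p1 0 (snd x) (q, p1)" "fst x (q, p0) = 0"
  using assms by (auto simp: Xsp_def split: prod.splits)

lemma C2_alpha_per: "u \<in> C2_alpha \<alpha> x y \<Longrightarrow> u (q + 2 * pi, p) = u (q, p)" "u \<in> C2_alpha \<alpha> x y \<Longrightarrow> p \<notin> {x..y} \<Longrightarrow> u (q, p) = 0"
  by (auto simp: C2_alpha_def cyl_fun_def)

lemma Dx_lower: "x \<in> X \<Longrightarrow> z \<in> strip p0 p1 \<Longrightarrow> Dx x z = dp p0 p1 (fst x) z"
  using p1 by (auto simp: Dx_def mem_strip)

lemma Dx_upper:
  assumes x: "x \<in> X" and z: "z \<in> strip p1 0" shows "Dx x z = dp p1 0 (snd x) z"
proof (cases "snd z = p1")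
  case True
  hence "z = (fst z, p1)" by (metis prod.collapse)
  thus ?thesis using Dx_lower[OF x, of z] XD(4)[OF x, of "fst z"] p01 True by (metis atLeastAtMost_iff less_imp_le mem_strip order_refl)
next
  case False
  thus ?thesis using z p01 by (auto simp: Dx_def mem_strip)
qed

lemma LT_eq:
  assumes x: "x \<in> X" shows "LT x = PP x + Kop (Dx x)"
proof -
  have 1: "Lop \<gamma>1 \<gamma>1 \<gamma>2 p1 lam p0 p1 (fst x) z = PL \<gamma>1 p0 p1 (fst x) z + KL \<gamma>1 p0 p1 (Dx x) z" for z
    using Dx_lower[OF x, of z] by (simp add: Lop_def PL_def KL_def mem_strip power_divide algebra_simps)
  have 2: "Lop \<gamma>2 \<gamma>1 \<gamma>2 p1 lam p1 0 (snd x) z = PL \<gamma>2 p1 0 (snd x) z + KL \<gamma>2 p1 0 (Dx x) z" for z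
    using Dx_upper[OF x, of z] by (simp add: Lop_def PL_def KL_def mem_strip power_divide algebra_simps)
  have 3: "Top g \<sigma> p1 lam (snd x) q = (2 / lam) * (g * snd x (q, 0) - \<sigma> * dq (dq (snd x)) (q, 0)) + - (2 / lam * lam powr (3/2)) * Dx x (q, 0)" for q
    using Dx_upper[OF x, of "(q, 0)"] p1 by (simp add: Top_def mem_strip algebra_simps diff_divide_distrib)
  show ?thesis
    unfolding LTop_def PP_def Kop_def case_prod_beta using 1 2 3 by (simp add: fun_eq_iff plus_fun_def)
qed

lemma C2d_x: "u \<in> C2_alpha \<alpha> x y \<Longrightarrow> x < y \<Longrightarrow>
   C2d \<alpha> x y u (dq u) (dp x y u) (dq (dq u)) (dp x y (dq u)) (dq (dp x y u)) (dp x y (dp x y u))"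
  by (rule C2_alpha_imp_C2d[OF _ _ \<alpha>(1) \<alpha>1])

lemma deriv_lin:
  assumes "u \<in> C2_alpha \<alpha> x y" "v \<in> C2_alpha \<alpha> x y" "x < y" "z \<in> strip x y"
  shows "dp x y (c *\<^sub>R u + d *\<^sub>R v) z = c * dp x y u z + d * dp x y v z"
    "dq (dq (c *\<^sub>R u + d *\<^sub>R v)) z = c * dq (dq u) z + d * dq (dq v) z"
    "dp x y (dp x y (c *\<^sub>R u + d *\<^sub>R v)) z = c * dp x y (dp x y u) z + d * dp x y (dp x y v) z"
proof -
  have e: "c *\<^sub>R u + d *\<^sub>R v = (\<lambda>z. c * u z + d * v z)" by (simp add: plus_fun_def scaleR_fun_def)
  have cyl: "cyl_fun x y (\<lambda>z. c * u z + d * v z)" using assms(1,2) by (auto simp: C2_alpha_def cyl_fun_def)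
  note C = C2d_imp_C2_alpha[OF C2d_lincomb[OF C2d_x[OF assms(1,3)] C2d_x[OF assms(2,3)]] cyl assms(3) \<alpha>(1)]
  show "dp x y (c *\<^sub>R u + d *\<^sub>R v) z = c * dp x y u z + d * dp x y v z"
    "dq (dq (c *\<^sub>R u + d *\<^sub>R v)) z = c * dq (dq u) z + d * dq (dq v) z"
    "dp x y (dp x y (c *\<^sub>R u + d *\<^sub>R v)) z = c * dp x y (dp x y u) z + d * dp x y (dp x y v) z"
    unfolding e using C(3,4,7)[OF assms(4)] by simp_all
qed

lemma X_lincomb:
  assumes x: "x \<in> X" and x': "x' \<in> X" shows "c *\<^sub>R x + d *\<^sub>R x' \<in> X"
proof -
  have 1: "c *\<^sub>R fst x + d *\<^sub>R fst x' \<in> C2_alpha \<alpha> p0 p1"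
    using C2_alpha_subspace[OF p01 \<alpha>(1) \<alpha>1] XD(1)[OF x] XD(1)[OF x'] by (intro subspace_add subspace_scale)
  have 2: "c *\<^sub>R snd x + d *\<^sub>R snd x' \<in> C2_alpha \<alpha> p1 0"
    using C2_alpha_subspace[OF p1 \<alpha>(1) \<alpha>1] XD(2)[OF x] XD(2)[OF x'] by (intro subspace_add subspace_scale)
  have 3: "dp p0 p1 (c *\<^sub>R fst x + d *\<^sub>R fst x') (q, p1) = dp p1 0 (c *\<^sub>R snd x + d *\<^sub>R snd x') (q, p1)" for q
    using deriv_lin(1)[OF XD(1)[OF x] XD(1)[OF x'] p01, of "(q, p1)"] deriv_lin(1)[OF XD(2)[OF x] XD(2)[OF x'] p1, of "(q, p1)"]
      XD(4)[OF x] XD(4)[OF x'] p01 p1 by (simp add: mem_strip)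
  have 4: "(c *\<^sub>R fst x + d *\<^sub>R fst x') (q, p1) = (c *\<^sub>R snd x + d *\<^sub>R snd x') (q, p1)" "(c *\<^sub>R fst x + d *\<^sub>R fst x') (q, p0) = 0" for q
    using XD(3,5)[OF x] XD(3,5)[OF x'] by (simp_all add: scaleR_fun_def)
  show ?thesis using 1 2 3 4 by (simp add: Xsp_def case_prod_beta)
qed

lemma X_zero: "0 \<in> X"
proof -
  have 0: "(0::real\<times>real\<Rightarrow>real) \<in> C2_alpha \<alpha> p0 p1" "(0::real\<times>real\<Rightarrow>real) \<in> C2_alpha \<alpha> p1 0"
    using C2_alpha_subspace[OF p01 \<alpha>(1) \<alpha>1] C2_alpha_subspace[OF p1 \<alpha>(1) \<alpha>1] subspace_0 by auto
  have "dp p0 p1 0 (q, p1) = 0" "dp p1 0 0 (q, p1) = 0" for q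
    using deriv_lin(1)[OF 0(1) 0(1) p01, of "(q,p1)" 0 0] deriv_lin(1)[OF 0(2) 0(2) p1, of "(q,p1)" 0 0] p01 p1 by (auto simp: mem_strip)
  thus ?thesis using 0 by (simp add: Xsp_def zero_prod_def)
qed

lemma X_subspace: "subspace X"
proof (rule subspaceI[OF X_zero])
  show "x + y \<in> X" if "x \<in> X" "y \<in> X" for x y using X_lincomb[OF that, of 1 1] by simp
  show "c *\<^sub>R x \<in> X" if "x \<in> X" for c x using X_lincomb[OF that X_zero, of c 0] by simp
qed

lemma Dx_lin: "linear_on' X Dx"
  unfolding linear_on'_def
proof (intro ballI allI)
  fix x x' c d assume x: "x \<in> X" "x' \<in> X"
  have "Dx (c *\<^sub>R x + d *\<^sub>R x') z = c * Dx x z + d * Dx x' z" for z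
  proof -
    define p' where "p' = max p0 (min (snd z) 0)"
    have z: "p' \<in> {p0..0}" unfolding p'_def by (rule clamp_in)
    show ?thesis
      using z deriv_lin(1)[OF XD(1)[OF x(1)] XD(1)[OF x(2)] p01, of "(fst z, p')" c d] deriv_lin(1)[OF XD(2)[OF x(1)] XD(2)[OF x(2)] p1, of "(fst z, p')" c d]
      unfolding Dx_def p'_def[symmetric] by (auto simp: mem_strip)
  qed
  thus "Dx (c *\<^sub>R x + d *\<^sub>R x') = c *\<^sub>R Dx x + d *\<^sub>R Dx x'" by (simp add: fun_eq_iff scaleR_fun_def)
qed

lemma PP_lin: "linear_on' X PP"
  unfolding linear_on'_def
proof (intro ballI allI)
  fix x x' c d assume x: "x \<in> X" "x' \<in> X"
  have PL: "PL \<gamma> r t (c *\<^sub>R u + d *\<^sub>R v) z = c * PL \<gamma> r t u z + d * PL \<gamma> r t v z"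
    if "u \<in> C2_alpha \<alpha> r t" "v \<in> C2_alpha \<alpha> r t" "r < t" for \<gamma> r t u v z
    using deriv_lin[OF that, of z] by (simp add: PL_def mem_strip algebra_simps)
  have "dq (dq (c *\<^sub>R snd x + d *\<^sub>R snd x')) (q, 0) = c * dq (dq (snd x)) (q, 0) + d * dq (dq (snd x')) (q, 0)" for q
    using deriv_lin(2)[OF XD(2)[OF x(1)] XD(2)[OF x(2)] p1, of "(q,0)"] p1 by (simp add: mem_strip)
  thus "PP (c *\<^sub>R x + d *\<^sub>R x') = c *\<^sub>R PP x + d *\<^sub>R PP x'"
    using PL[OF XD(1)[OF x(1)] XD(1)[OF x(2)] p01] PL[OF XD(2)[OF x(1)] XD(2)[OF x(2)] p1]
    by (simp add: PP_def fun_eq_iff scaleR_fun_def algebra_simps)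
qed

lemma Kop_lin: "Kop (c *\<^sub>R w + d *\<^sub>R w') = c *\<^sub>R Kop w + d *\<^sub>R Kop w'"
  by (simp add: Kop_def KL_def fun_eq_iff scaleR_fun_def algebra_simps add_divide_distrib)

lemma hb_top:
  assumes "hb (strip x 0) \<alpha> f" "x \<le> 0" shows "hb UNIV \<alpha> (\<lambda>q. f (q, 0::real))"
proof -
  obtain N where N: "N \<ge> 0" "\<And>z. z \<in> strip x 0 \<Longrightarrow> \<bar>f z\<bar> \<le> N" "\<And>z w. z \<in> strip x 0 \<Longrightarrow> w \<in> strip x 0 \<Longrightarrow> \<bar>f z - f w\<bar> \<le> N * dist z w powr \<alpha>"
    using assms(1) unfolding hb_iff by blast
  have m: "(q, 0) \<in> strip x 0" for q using assms(2) by (simp add: mem_strip)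
  show ?thesis unfolding hb_iff using N(1) N(2)[OF m] N(3)[OF m m] by (intro exI[of _ N]) (simp add: dist_Pair_Pair)
qed

lemma hb_ia_layer: "layer x y \<gamma> \<Longrightarrow> hb (strip x y) \<alpha> (\<lambda>z. 1 / a (snd z))"
  by (rule hb_subset[OF hb_ia[OF \<alpha>(1) \<alpha>1] strip_sub])

lemma Dx_hb: "x \<in> X \<Longrightarrow> hb (strip p0 0) \<alpha> (Dx x)"
proof (rule hb_glue[of _ p1])
  assume x: "x \<in> X"
  show "hb (strip p0 p1) \<alpha> (Dx x)"
    by (rule hb_cong[OF C2dD(9)[OF C2d_x[OF XD(1)[OF x] p01]]]) (simp add: Dx_lower[OF x])
  show "hb (strip p1 0) \<alpha> (Dx x)"
    by (rule hb_cong[OF C2dD(9)[OF C2d_x[OF XD(2)[OF x] p1]]]) (simp add: Dx_upper[OF x])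
qed (use p01 p1 \<alpha> in auto)

lemma Dx_clamp: "Dx x (q, max p0 (min p 0)) = Dx x (q, p)"
  using clamp_in(2)[OF clamp_in(1), of p] by (simp add: Dx_def)

lemma Dx_cylC: assumes x: "x \<in> X" shows "Dx x \<in> cylC p0 0"
proof (rule cylCI)
  have "continuous_on UNIV (\<lambda>z. Dx x (fst z, max p0 (min (snd z) 0)))"
    by (rule continuous_on_compose2[OF hb_imp_continuous_on[OF Dx_hb[OF x] \<alpha>(1)]])
      (use p01 p1 in \<open>auto intro!: continuous_intros simp: mem_strip\<close>)
  thus "continuous_on UNIV (Dx x)" by (simp add: Dx_clamp)
  show "Dx x (q, max p0 (min p 0)) = Dx x (q, p)" for q p by (rule Dx_clamp)
  show "Dx x (q + 2 * pi, p) = Dx x (q, p)" for q p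
  proof -
    define p' where "p' = max p0 (min p 0)"
    have z: "p' \<in> {p0..0}" unfolding p'_def by (rule clamp_in)
    show ?thesis using z
      C2d_per(2)[OF C2d_x[OF XD(1)[OF x] p01] p01 C2_alpha_per(1)[OF XD(1)[OF x]], of "p'" q]
      C2d_per(2)[OF C2d_x[OF XD(2)[OF x] p1] p1 C2_alpha_per(1)[OF XD(2)[OF x]], of "p'" q]
      unfolding Dx_def fst_conv snd_conv p'_def[symmetric] by auto
  qed
qed

lemma PP_in: assumes x: "x \<in> X" shows "PP x \<in> YZ"
proof -
  have L: "PL \<gamma> r t u \<in> C_alpha \<alpha> r t" if lay: "layer r t \<gamma>" and u: "u \<in> C2_alpha \<alpha> r t" for r t \<gamma> u
  proof -
    have rt: "r < t" by (rule layer_bounds(1)[OF lay])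
    note C = C2d_x[OF u rt]
    have "hb (strip r t) \<alpha> (\<lambda>z. dp r t (dp r t u) z + dq (dq u) z * (1 / a (snd z))\<^sup>2 - \<gamma> * (dp r t u z * (1 / a (snd z))\<^sup>2))"
      unfolding power2_eq_square by (intro hb_intros C2dD[OF C] hb_ia_layer[OF lay])
    hence "hb (strip r t) \<alpha> (PL \<gamma> r t u)" by (rule hb_cong) (simp add: PL_def mem_strip)
    moreover have "cyl_fun r t (PL \<gamma> r t u)"
      using C2d_per[OF C rt C2_alpha_per(1)[OF u]] by (auto simp: cyl_fun_def PL_def)
    ultimately show ?thesis by (simp add: C_alpha_iff)
  qed
  note C = C2d_x[OF XD(2)[OF x] p1]
  have "hb UNIV \<alpha> (\<lambda>q. (2 / lam) * (g * snd x (q, 0) - \<sigma> * dq (dq (snd x)) (q, 0)))"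
    by (intro hb_intros hb_top[OF C2dD(7)[OF C]] hb_top[OF C2dD(10)[OF C]]) (use p1 in auto)
  moreover have "0 \<in> {p1..0}" using p1 by simp
  ultimately have "(\<lambda>q. (2 / lam) * (g * snd x (q, 0) - \<sigma> * dq (dq (snd x)) (q, 0))) \<in> C_alpha_S \<alpha>"
    using C2d_per(3)[OF C p1 C2_alpha_per(1)[OF XD(2)[OF x]]] C2_alpha_per(1)[OF XD(2)[OF x]] by (simp add: C_alpha_S_iff)
  thus ?thesis using L[OF layers(1) XD(1)[OF x]] L[OF layers(2) XD(2)[OF x]] by (simp add: PP_def YZsp_def)
qed

lemma Kop_in:
  assumes w: "w \<in> cylC p0 0" and h: "hb (strip p0 0) \<alpha> w" shows "Kop w \<in> YZ"
proof -
  have L: "KL \<gamma> r t w \<in> C_alpha \<alpha> r t" if lay: "layer r t \<gamma>" for r t \<gamma>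
  proof -
    have "hb (strip r t) \<alpha> (\<lambda>z. - (2 * \<gamma>) * (w z * (1 / a (snd z))\<^sup>2))"
      unfolding power2_eq_square by (intro hb_intros hb_subset[OF h strip_sub[OF lay]] hb_ia_layer[OF lay])
    hence "hb (strip r t) \<alpha> (KL \<gamma> r t w)" by (rule hb_cong) (simp add: KL_def mem_strip)
    moreover have "cyl_fun r t (KL \<gamma> r t w)" using cylCD(2)[OF w] by (auto simp: cyl_fun_def KL_def)
    ultimately show ?thesis by (simp add: C_alpha_iff)
  qed
  have "hb UNIV \<alpha> (\<lambda>q. w (q, 0))" by (rule hb_top[OF h]) (use p01 p1 in simp)
  note hb_cmult[OF this, of "- (2 / lam * lam powr (3/2))"]
  hence "(\<lambda>q. - (2 / lam * lam powr (3/2)) * w (q, 0)) \<in> C_alpha_S \<alpha>"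
    unfolding C_alpha_S_iff cylCD(2)[OF w] by blast
  thus ?thesis using L[OF layers(1)] L[OF layers(2)] by (simp add: Kop_def YZsp_def)
qed

text \<open>The sup norm of w alone is used; combined with \<open>DR_estimate\<close> this makes
  \<open>DR \<circ> Kop\<close> a map from continuous to Hoelder functions.\<close>

lemma Kop_Y0:
  obtains C where "C \<ge> 0" "\<And>w N. w \<in> cylC p0 0 \<Longrightarrow> (\<And>z. \<bar>w z\<bar> \<le> N) \<Longrightarrow> Y0 (Kop w) (C * N)"
proof -
  obtain A where A: "A \<ge> 0" "\<And>z. z \<in> strip p0 0 \<Longrightarrow> \<bar>1 / a (snd z)\<bar> \<le> A" using hb_ia[OF \<alpha>(1) \<alpha>1] unfolding hb_iff by blast
  define k where "k = \<bar>2 / lam * lam powr (3/2)\<bar>"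
  define G where "G = 2 * (\<bar>\<gamma>1\<bar> + \<bar>\<gamma>2\<bar>) * A\<^sup>2"
  have G: "G \<ge> 0" "k \<ge> 0" by (auto simp: G_def k_def)
  show ?thesis
  proof (rule that[of "G + k"])
    show "G + k \<ge> 0" using G by simp
    fix w N assume w: "w \<in> cylC p0 0" and N: "\<And>z. \<bar>w z\<bar> \<le> N"
    have N0: "N \<ge> 0" using N[of undefined] by linarith
    have L: "continuous_on (strip r t) (KL \<gamma> r t w) \<and> (\<forall>q. \<forall>p\<in>{r..t}. KL \<gamma> r t w (q + 2 * pi, p) = KL \<gamma> r t w (q, p)) \<and> (\<forall>z\<in>strip r t. \<bar>KL \<gamma> r t w z\<bar> \<le> (G + k) * N)"
      if lay: "layer r t \<gamma>" for r t \<gamma>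
    proof (intro conjI allI ballI)
      have "continuous_on (strip r t) (\<lambda>z. - (2 * \<gamma>) * (w z * (1 / a (snd z))\<^sup>2))"
        by (intro continuous_on_mult continuous_on_const continuous_on_power hb_imp_continuous_on[OF hb_ia_layer[OF lay] \<alpha>(1)] continuous_on_subset[OF cylCD(1)[OF w]]) auto
      thus "continuous_on (strip r t) (KL \<gamma> r t w)" by (rule continuous_on_eq) (simp add: KL_def mem_strip)
      show "KL \<gamma> r t w (q + 2 * pi, p) = KL \<gamma> r t w (q, p)" for q p using cylCD(2)[OF w] by (simp add: KL_def)
      fix z assume z: "z \<in> strip r t"
      have "\<bar>1 / a (snd z)\<bar>\<^sup>2 \<le> A\<^sup>2" using A(2)[of z] strip_sub[OF lay] z by (intro power_mono) auto
      hence "\<bar>(1 / a (snd z))\<^sup>2\<bar> \<le> A\<^sup>2" by (simp only: power2_abs abs_power2)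
      hence 1: "\<bar>w z * (1 / a (snd z))\<^sup>2\<bar> \<le> N * A\<^sup>2" unfolding abs_mult using N[of z] N0 by (intro mult_mono) auto
      have "\<bar>- (2 * \<gamma>) * (w z * (1 / a (snd z))\<^sup>2)\<bar> \<le> (2 * (\<bar>\<gamma>1\<bar> + \<bar>\<gamma>2\<bar>)) * (N * A\<^sup>2)"
        unfolding abs_mult[of "- (2 * \<gamma>)"] using lay 1 by (intro mult_mono) (auto simp: layer_def)
      also have "\<dots> = G * N" by (simp add: G_def)
      also have "\<dots> \<le> (G + k) * N" using N0 G by (intro mult_right_mono) auto
      finally show "\<bar>KL \<gamma> r t w z\<bar> \<le> (G + k) * N" using z by (simp add: KL_def mem_strip)
    qed
    have "pdata (\<lambda>q. - (2 / lam * lam powr (3/2)) * w (q, 0)) ((G + k) * N)"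
      unfolding pdata_def
    proof (intro conjI allI)
      show "continuous_on UNIV (\<lambda>q. - (2 / lam * lam powr (3/2)) * w (q, 0))"
        by (intro continuous_on_mult continuous_on_const continuous_on_compose2[OF cylCD(1)[OF w]] continuous_on_Pair continuous_on_id) auto
      fix q
      show "- (2 / lam * lam powr (3/2)) * w (q + 2 * pi, 0) = - (2 / lam * lam powr (3/2)) * w (q, 0)" by (simp add: cylCD(2)[OF w])
      have "\<bar>- (2 / lam * lam powr (3/2)) * w (q, 0)\<bar> \<le> k * N"
        unfolding abs_mult[of "- (2 / lam * lam powr (3/2))"] abs_minus_cancel k_def using N by (intro mult_left_mono) auto
      also have "\<dots> \<le> (G + k) * N" using N0 G by (intro mult_right_mono) auto
      finally show "\<bar>- (2 / lam * lam powr (3/2)) * w (q, 0)\<bar> \<le> (G + k) * N" .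
    qed
    thus "Y0 (Kop w) ((G + k) * N)"
      using L[OF layers(1)] L[OF layers(2)] unfolding Y0_def LD_def Kop_def fst_conv snd_conv by blast
  qed
qed

text \<open>The sup norms are summands of \<open>YZnorm\<close>. The other summands are nonnegative
  because each domain contains two distinct points, so that no supremum runs over an empty
  set.\<close>

lemma YZ_Y0:
  assumes y: "y \<in> YZ" shows "Y0 y (YZnorm \<alpha> p0 p1 y)"
proof -
  obtain f1 f2 h where e: "y = (f1, f2, h)" by (cases y) auto
  have f1: "cyl_fun p0 p1 f1" "hb (strip p0 p1) \<alpha> f1" and f2: "cyl_fun p1 0 f2" "hb (strip p1 0) \<alpha> f2"
    and h: "\<And>q. h (q + 2 * pi) = h q" "hb UNIV \<alpha> h"
    using y unfolding e YZsp_def by (auto simp: C_alpha_iff C_alpha_S_iff)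
  have in1: "(0, p0) \<in> strip p0 p1" "(1, p0) \<in> strip p0 p1" "(0, p1) \<in> strip p1 0" "(1, p1) \<in> strip p1 0"
    using p01 p1 by (auto simp: mem_strip)
  have nn: "0 \<le> holder_semi (strip p0 p1) \<alpha> f1" "0 \<le> holder_semi (strip p1 0) \<alpha> f2" "0 \<le> holder_semi UNIV \<alpha> h"
    using holder_semi_nonneg[OF _ in1(1,2), of \<alpha> f1] holder_semi_nonneg[OF _ in1(3,4), of \<alpha> f2] holder_semi_nonneg[of UNIV \<alpha> h 0 1] f1(2) f2(2) h(2)
    by (auto simp: hb_def)
  have s: "0 \<le> sup_norm (strip p0 p1) f1" "0 \<le> sup_norm (strip p1 0) f2" "0 \<le> sup_norm UNIV h"
    using sup_norm_ge(2)[OF _ in1(1), of f1] sup_norm_ge(2)[OF _ in1(3), of f2] sup_norm_ge(2)[of h UNIV 0] f1(2) f2(2) h(2)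
    by (auto simp: hb_def)
  have le: "sup_norm (strip p0 p1) f1 \<le> YZnorm \<alpha> p0 p1 y" "sup_norm (strip p1 0) f2 \<le> YZnorm \<alpha> p0 p1 y" "sup_norm UNIV h \<le> YZnorm \<alpha> p0 p1 y"
    using nn s by (auto simp: YZnorm_def e)
  have b: "\<bar>f1 z\<bar> \<le> YZnorm \<alpha> p0 p1 y" if "z \<in> strip p0 p1" for z using sup_norm_ge(1)[OF _ that, of f1] f1(2) le by (force simp: hb_def)
  have b2: "\<bar>f2 z\<bar> \<le> YZnorm \<alpha> p0 p1 y" if "z \<in> strip p1 0" for z using sup_norm_ge(1)[OF _ that, of f2] f2(2) le by (force simp: hb_def)
  have b3: "\<bar>h z\<bar> \<le> YZnorm \<alpha> p0 p1 y" for z using sup_norm_ge(1)[of h UNIV z] h(2) le by (force simp: hb_def)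
  note c = hb_imp_continuous_on[OF f1(2) \<alpha>(1)] hb_imp_continuous_on[OF f2(2) \<alpha>(1)] hb_imp_continuous_on[OF h(2) \<alpha>(1)]
  have per: "f1 (q + 2 * pi, p) = f1 (q, p)" "f2 (q + 2 * pi, p) = f2 (q, p)" for q p using f1(1) f2(1) by (auto simp: cyl_fun_def)
  have f: "fst y = f1" "fst (snd y) = f2" "snd (snd y) = h" by (simp_all add: e)
  show ?thesis
    unfolding Y0_def f LD_def pdata_def using c per h(1) b b2 b3 by blast
qed

end

lemma C2d_cong_up:
  assumes C: "C2d \<alpha> x y u uq up uqq uqp upq upp"
    and e: "\<And>z. z \<in> strip x y \<Longrightarrow> up' z = up z" "\<And>z. z \<in> strip x y \<Longrightarrow> upp' z = upp z"
  shows "C2d \<alpha> x y u uq up' uqq uqp upq upp'"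
proof -
  note D = C2dD[OF C]
  have e': "up' (q, p) = up (q, p)" "upp' (q, p) = upp (q, p)" if "p \<in> {x..y}" for q p using e[of "(q, p)"] that by (auto simp: mem_strip)
  have 1: "((\<lambda>t. u (q, t)) has_vector_derivative up' (q, p)) (at p within {x..y})" if "p \<in> {x..y}" for q p
    using D(2)[OF that, of q] e'(1)[OF that, of q] by simp
  have 2: "((\<lambda>t. up' (t, p)) has_vector_derivative upq (q, p)) (at q)" if "p \<in> {x..y}" for q p
    using D(5)[OF that, of q] by (simp add: e'(1)[OF that])
  have 3: "((\<lambda>t. up' (q, t)) has_vector_derivative upp' (q, p)) (at p within {x..y})" if p: "p \<in> {x..y}" for q p
    unfolding e'(2)[OF p] by (rule has_vector_derivative_transform[OF p _ D(6)[OF p]]) (simp add: e')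
  have 4: "hb (strip x y) \<alpha> up'" "hb (strip x y) \<alpha> upp'"
    by (rule hb_cong[OF D(9)], simp add: e, rule hb_cong[OF D(13)], simp add: e)
  show ?thesis unfolding C2d_def using D(1,3,4,7,8,10,11,12) 1 2 3 4 by auto
qed

section \<open>Bijectivity of the principal part\<close>

context flow begin

definition UU :: "yzelt \<Rightarrow> real \<times> real \<Rightarrow> real" where
  "UU y z = Ud (Rr \<gamma>1 (fst y) (snd (snd y))) (Rr \<gamma>2 (fst (snd y)) (snd (snd y))) z + phi (snd (snd y)) (fst z) * chi (snd z)"

text \<open>The single function \<open>UU y\<close> is cut along the layers and set to 0 outside
  them, as \<open>cyl_fun\<close> requires.\<close>

definition UR :: "yzelt \<Rightarrow> xelt" where
  "UR y = (\<lambda>z. if snd z \<in> {p0..p1} then UU y z else 0, \<lambda>z. if snd z \<in> {p1..0} then UU y z else 0)"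

lemma hb_chi: "hb (strip p0 0) \<alpha> (\<lambda>z. chi (snd z))"
proof (rule hb_lipschitz[where N = 1 and L = kx])
  show "\<bar>chi (snd z)\<bar> \<le> 1" if "z \<in> strip p0 0" for z using chi(3)[of "snd z"] that by (auto simp: mem_strip)
  fix z w :: "real \<times> real"
  have "\<bar>chi (snd z) - chi (snd w)\<bar> = kx * dist (snd z) (snd w)"
    using kx by (simp add: chi_def dist_real_def abs_mult left_diff_distrib[symmetric])
  also have "\<dots> \<le> kx * dist z w" using kx dist_snd_le[of z w] by simp
  finally show "\<bar>chi (snd z) - chi (snd w)\<bar> \<le> kx * dist z w" .
qed (use \<alpha> in auto)

lemma lifting_C2d:
  assumes h: "h \<in> C_alpha_S \<alpha>" and lay: "layer x y \<gamma>"
  shows "C2d \<alpha> x y (\<lambda>z. phi h (fst z) * chi (snd z)) (\<lambda>z. phi1 h (fst z) * chi (snd z)) (\<lambda>z. phi h (fst z) * kx)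
     (\<lambda>z. phi2 h (fst z) * chi (snd z)) (\<lambda>z. phi1 h (fst z) * kx) (\<lambda>z. phi1 h (fst z) * kx) (\<lambda>z. 0)"
    and "hb UNIV \<alpha> (phi h)" "hb UNIV \<alpha> (phi2 h)"
proof -
  have hh: "hb UNIV \<alpha> h" "\<And>q. h (q + 2 * pi) = h q" using h by (auto simp: C_alpha_S_iff)
  obtain N where "\<And>z. \<bar>h z\<bar> \<le> N" using hh(1) unfolding hb_iff by auto
  hence pd: "pdata h N" unfolding pdata_def using hh hb_imp_continuous_on[OF hh(1) \<alpha>(1)] by blast
  obtain C where C: "pdata (phi h) (C * N)" "pdata (phi1 h) (C * N)" "pdata (phi2 h) (C * N)"
    using phi_pdata pd by metis
  note d = phi_deriv[OF pd]
  show p0: "hb UNIV \<alpha> (phi h)" by (rule hb_real_deriv[OF d(1) pdataD(3)[OF C(1)] pdataD(3)[OF C(2)] \<alpha>(1) \<alpha>1])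
  have p1: "hb UNIV \<alpha> (phi1 h)" by (rule hb_real_deriv[OF d(2) pdataD(3)[OF C(2)] pdataD(3)[OF C(3)] \<alpha>(1) \<alpha>1])
  show p2: "hb UNIV \<alpha> (phi2 h)" unfolding phi2_def by (intro hb_diff hb_cmult p0 hh(1))
  have hc: "hb (strip x y) \<alpha> (\<lambda>z. chi (snd z))" by (rule hb_subset[OF hb_chi strip_sub[OF lay]])
  have c: "((\<lambda>t. k * chi t) has_vector_derivative k * kx) (at p within S)" for k p S
    unfolding chi_def has_real_derivative_iff_has_vector_derivative[symmetric] by (auto intro!: derivative_eq_intros)
  have c': "((\<lambda>t. k * kx) has_vector_derivative 0) F" for k :: real and F by (rule has_vector_derivative_const)
  show "C2d \<alpha> x y (\<lambda>z. phi h (fst z) * chi (snd z)) (\<lambda>z. phi1 h (fst z) * chi (snd z)) (\<lambda>z. phi h (fst z) * kx)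
     (\<lambda>z. phi2 h (fst z) * chi (snd z)) (\<lambda>z. phi1 h (fst z) * kx) (\<lambda>z. phi1 h (fst z) * kx) (\<lambda>z. 0)"
    unfolding C2d_def fst_conv snd_conv ball_simps
    by (intro conjI allI ballI impI TrueI hb_mult hb_const hc hb_fst[OF p0 \<alpha>(1)] hb_fst[OF p1 \<alpha>(1)] hb_fst[OF p2 \<alpha>(1)]
        has_vector_derivative_mult_left d c c')
qed

lemma Rr_hb:
  assumes lay: "layer x y \<gamma>" and f: "hb (strip x y) \<alpha> f" and h: "h \<in> C_alpha_S \<alpha>"
  shows "hb (strip x y) \<alpha> (Rr \<gamma> f h)"
proof -
  note p = lifting_C2d(2,3)[OF h lay]
  have a: "hb (strip x y) \<alpha> (\<lambda>z. a (snd z))" "hb (strip x y) \<alpha> (\<lambda>z. chi (snd z))"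
    by (rule hb_subset[OF hb_a[OF \<alpha>(1) \<alpha>1] strip_sub[OF lay]], rule hb_subset[OF hb_chi strip_sub[OF lay]])
  show ?thesis unfolding Rr_def[abs_def] power2_eq_square
    by (intro hb_add hb_diff hb_mult hb_const a f hb_fst[OF p(1) \<alpha>(1)] hb_fst[OF p(2) \<alpha>(1)])
qed

text \<open>The data \<open>Rr\<close> are arranged so that the lifting terms, which reappear in
  \<open>B\<close> and \<open>DR\<close>, cancel and \<open>f1\<close>, \<open>f2\<close> remain. On
  top \<open>Ud\<close> vanishes together with its q-derivatives, so \<open>B\<close> reduces to
  \<open>phi2\<close>.\<close>

lemma UU_C2d:
  assumes y: "(f1, f2, h) \<in> YZ"
  obtains V B A where
    "\<And>x y \<gamma>. layer x y \<gamma> \<Longrightarrow> C2d \<alpha> x y (UU (f1, f2, h)) V (DR (f1, f2, h)) B A A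
       (\<lambda>z. (if x = p0 then f1 else f2) z - B z * (1 / a (snd z))\<^sup>2 + \<gamma> * (DR (f1, f2, h) z * (1 / a (snd z))\<^sup>2))"
    "\<And>q. UU (f1, f2, h) (q, p0) = 0" "\<And>q. UU (f1, f2, h) (q, 0) = phi h q" "\<And>q. B (q, 0) = phi2 h q"
    "\<And>q p. UU (f1, f2, h) (q + 2 * pi, p) = UU (f1, f2, h) (q, p)"
proof -
  define r1 r2 where "r1 = Rr \<gamma>1 f1 h" and "r2 = Rr \<gamma>2 f2 h"
  have f: "hb (strip p0 p1) \<alpha> f1" "hb (strip p1 0) \<alpha> f2" and h: "h \<in> C_alpha_S \<alpha>" using y by (auto simp: YZsp_def C_alpha_iff)
  have hb: "hb (strip p0 p1) \<alpha> r1" "hb (strip p1 0) \<alpha> r2"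
    unfolding r1_def r2_def by (rule Rr_hb[OF layers(1) f(1) h], rule Rr_hb[OF layers(2) f(2) h])
  define N where "N = YZnorm \<alpha> p0 p1 (f1, f2, h)"
  have Y: "Y0 (f1, f2, h) N" unfolding N_def by (rule YZ_Y0[OF y])
  note pd = Y0_D(2)[OF Y]
  obtain CR where LD: "LD r1 r2 (CR * N)" unfolding r1_def r2_def using Rr_LD Y by metis
  obtain V B A where C: "\<And>x y \<gamma>. layer x y \<gamma> \<Longrightarrow> C2d \<alpha> x y (Ud r1 r2) V (Wd r1 r2) B A A
       (\<lambda>z. ((if x = p0 then r1 else r2) z - B z) * (1 / a (snd z))\<^sup>2 + \<gamma> * (Wd r1 r2 z * (1 / a (snd z))\<^sup>2))"
    and b: "\<And>q. Ud r1 r2 (q, p0) = 0" "\<And>q. Ud r1 r2 (q, 0) = 0"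
    by (rule dirichlet_C2d[OF LD hb]) (rule that, (assumption | simp only:)+)
  obtain Cp where php: "pdata (phi h) (Cp * N)" using phi_pdata pd by metis
  have U: "UU (f1, f2, h) z = Ud r1 r2 z + phi h (fst z) * chi (snd z)" for z by (simp add: UU_def r1_def r2_def)
  have D: "DR (f1, f2, h) z = Wd r1 r2 z + phi h (fst z) * kx" if "z \<in> strip p0 0" for z
    using clamp_in(2)[of "snd z"] that by (simp add: DR_def r1_def r2_def mem_strip)
  have V0: "V (q, 0) = 0" for q
  proof -
    have "((\<lambda>t. Ud r1 r2 (t, 0)) has_vector_derivative V (q, 0)) (at q)"
      using C2dD(1)[OF C[OF layers(2)], of 0 q] p1 by simp
    moreover have "((\<lambda>t. Ud r1 r2 (t, 0)) has_vector_derivative 0) (at q)" unfolding b(2) by (rule has_vector_derivative_const)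
    ultimately show ?thesis by (rule vector_derivative_unique_at)
  qed
  have Bz: "B (q, 0) = 0" for q
  proof -
    have "((\<lambda>t. V (t, 0)) has_vector_derivative B (q, 0)) (at q)"
      using C2dD(3)[OF C[OF layers(2)], of 0 q] p1 by simp
    moreover have "((\<lambda>t. V (t, 0)) has_vector_derivative 0) (at q)" unfolding V0 by (rule has_vector_derivative_const)
    ultimately show ?thesis by (rule vector_derivative_unique_at)
  qed
  define V' A' B' where "V' = (\<lambda>z. V z + phi1 h (fst z) * chi (snd z))" and "A' = (\<lambda>z. A z + phi1 h (fst z) * kx)"
    and "B' = (\<lambda>z. B z + phi2 h (fst z) * chi (snd z))"
  show ?thesis
  proof (rule that[of V' B' A'])
    fix x y \<gamma> assume lay: "layer x y \<gamma>"
    have u: "UU (f1, f2, h) = (\<lambda>z. Ud r1 r2 z + phi h (fst z) * chi (snd z))" by (rule ext) (rule U)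
    note L = C2d_lincomb[OF C[OF lay] lifting_C2d(1)[OF h lay], of 1 1, unfolded mult_1 u[symmetric] V'_def[symmetric] A'_def[symmetric] B'_def[symmetric]]
    have e: "DR (f1, f2, h) z = Wd r1 r2 z + phi h (fst z) * kx" if "z \<in> strip x y" for z using D strip_sub[OF lay] that by blast
    have e2: "(if x = p0 then f1 else f2) z - B' z * (1 / a (snd z))\<^sup>2 + \<gamma> * (DR (f1, f2, h) z * (1 / a (snd z))\<^sup>2)
       = ((if x = p0 then r1 else r2) z - B z) * (1 / a (snd z))\<^sup>2 + \<gamma> * (Wd r1 r2 z * (1 / a (snd z))\<^sup>2) + 0" if z: "z \<in> strip x y" for z
    proof -
      define k where "k = (1 / a (snd z))\<^sup>2"
      have "a (snd z) > 0" using a_pos layer_bounds(2)[OF lay] z by (auto simp: mem_strip)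
      hence k: "(a (snd z))\<^sup>2 * k = 1" by (simp add: k_def power_divide)
      have r: "(if x = p0 then r1 else r2) z = (a (snd z))\<^sup>2 * (if x = p0 then f1 else f2) z - phi2 h (fst z) * chi (snd z) + \<gamma> * (phi h (fst z) * kx)"
        using lay p01 by (auto simp: layer_def r1_def r2_def Rr_def)
      have "(if x = p0 then r1 else r2) z * k = (if x = p0 then f1 else f2) z * ((a (snd z))\<^sup>2 * k) - phi2 h (fst z) * chi (snd z) * k + \<gamma> * (phi h (fst z) * kx) * k"
        unfolding r by (simp add: algebra_simps)
      thus ?thesis unfolding e[OF z] B'_def k k_def[symmetric] by (simp add: algebra_simps)
    qed
    note D = C2dD[OF L]
    show "C2d \<alpha> x y (UU (f1, f2, h)) V' (DR (f1, f2, h)) B' A' A'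
       (\<lambda>z. (if x = p0 then f1 else f2) z - B' z * (1 / a (snd z))\<^sup>2 + \<gamma> * (DR (f1, f2, h) z * (1 / a (snd z))\<^sup>2))"
      by (rule C2d_cong_up[OF L e e2])
  next
    show "UU (f1, f2, h) (q, p0) = 0" for q by (simp add: U b chi)
    show "UU (f1, f2, h) (q, 0) = phi h q" for q by (simp add: U b chi)
    show "B' (q, 0) = phi2 h q" for q by (simp add: B'_def Bz chi)
    show "UU (f1, f2, h) (q + 2 * pi, p) = UU (f1, f2, h) (q, p)" for q p
      by (simp add: U Ud_per[OF LD] pdataD(2)[OF php])
  qed
qed

text \<open>Both components are cut from one function with one p-derivative \<open>DR y\<close>, so
  the transmission conditions hold by construction; the top condition is the differential equation
  solved by \<open>phi\<close>.\<close>

lemma UR: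
  assumes y: "y \<in> YZ"
  shows "UR y \<in> X" "PP (UR y) = y" "Dx (UR y) = DR y"
proof -
  obtain f1 f2 h where e: "y = (f1, f2, h)" by (cases y) auto
  obtain V B A where C: "\<And>x t \<gamma>. layer x t \<gamma> \<Longrightarrow> C2d \<alpha> x t (UU y) V (DR y) B A A
       (\<lambda>z. (if x = p0 then f1 else f2) z - B z * (1 / a (snd z))\<^sup>2 + \<gamma> * (DR y z * (1 / a (snd z))\<^sup>2))"
    and b: "\<And>q. UU y (q, p0) = 0" "\<And>q. UU y (q, 0) = phi h q" "\<And>q. B (q, 0) = phi2 h q"
    and per: "\<And>q p. UU y (q + 2 * pi, p) = UU y (q, p)"
    by (rule UU_C2d[OF y[unfolded e], folded e]) (rule that, (assumption | simp only:)+)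
  define cut where "cut x t = (\<lambda>z. if snd z \<in> {x..t} then UU y z else 0)" for x t :: real
  have UR: "UR y = (cut p0 p1, cut p1 0)" by (simp add: UR_def cut_def)
  have Cc: "C2d \<alpha> x t (cut x t) V (DR y) B A A
       (\<lambda>z. (if x = p0 then f1 else f2) z - B z * (1 / a (snd z))\<^sup>2 + \<gamma> * (DR y z * (1 / a (snd z))\<^sup>2))" if "layer x t \<gamma>" for x t \<gamma>
    by (rule C2d_cong[OF C[OF that]]) (simp add: cut_def mem_strip)
  have cyl: "cyl_fun x t (cut x t)" for x t by (auto simp: cyl_fun_def cut_def per)
  note I1 = C2d_imp_C2_alpha[OF Cc[OF layers(1)] cyl p01 \<alpha>(1)]
  note I2 = C2d_imp_C2_alpha[OF Cc[OF layers(2)] cyl p1 \<alpha>(1)]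
  show X: "UR y \<in> X"
    using I1(1) I2(1) I1(3)[of "(_, p1)"] I2(3)[of "(_, p1)"] p01 p1 b(1) by (simp add: UR Xsp_def mem_strip cut_def)
  have D12: "Dx (UR y) z = DR y z" if z: "z \<in> strip p0 0" for z
  proof (cases "z \<in> strip p0 p1")
    case True
    thus ?thesis using Dx_lower[OF X True] I1(3)[OF True] by (simp add: UR)
  next
    case False
    hence t: "z \<in> strip p1 0" using z by (auto simp: mem_strip)
    thus ?thesis using Dx_upper[OF X t] I2(3)[OF t] by (simp add: UR)
  qed
  show "Dx (UR y) = DR y"
  proof
    fix z :: "real \<times> real"
    have "(fst z, max p0 (min (snd z) 0)) \<in> strip p0 0" using clamp_in(1) by (simp add: mem_strip)
    from D12[OF this] have "Dx (UR y) (fst z, snd z) = DR y (fst z, snd z)"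
      unfolding Dx_clamp cylCD(3)[OF DR_cylC[OF YZ_Y0[OF y]]] .
    thus "Dx (UR y) z = DR y z" by simp
  qed
  have f0: "f1 z = 0" if "snd z \<notin> {p0..p1}" for z using y that by (cases z) (auto simp: e YZsp_def C_alpha_def cyl_fun_def)
  have f0': "f2 z = 0" if "snd z \<notin> {p1..0}" for z using y that by (cases z) (auto simp: e YZsp_def C_alpha_def cyl_fun_def)
  have 1: "PL \<gamma>1 p0 p1 (cut p0 p1) z = f1 z" for z
    using I1(3,4,7)[of z] f0[of z] by (auto simp: PL_def mem_strip)
  have 2: "PL \<gamma>2 p1 0 (cut p1 0) z = f2 z" for z
    using I2(3,4,7)[of z] f0'[of z] p01 by (auto simp: PL_def mem_strip)
  have 3: "(2 / lam) * (g * cut p1 0 (q, 0) - \<sigma> * dq (dq (cut p1 0)) (q, 0)) = h q" for q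
  proof -
    have "\<sigma> * dq (dq (cut p1 0)) (q, 0) = \<sigma> * phi2 h q" using I2(4)[of "(q, 0)"] p1 b(3) by (simp add: mem_strip)
    also have "\<dots> = g * phi h q - lam / 2 * h q" using \<sigma> by (simp add: phi2_def field_simps)
    finally show ?thesis using p1 lam_pos by (simp add: cut_def b)
  qed
  have "PP (UR y) = (f1, f2, h)" unfolding PP_def UR fst_conv snd_conv 3 using 1 2 by (simp add: fun_eq_iff)
  thus "PP (UR y) = y" by (simp add: e)
qed

text \<open>The top part of \<open>PP\<close> contains no p-derivative: where the top values are
  maximal, u_qq <= 0, and g u = \<sigma> u_qq makes the maximum nonpositive. The boundary values are
  then in order for \<open>transmission_max_principle\<close>.\<close>

lemma PP_max:
  assumes x: "x \<in> X" and PP: "PP x = 0"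
  shows "p \<in> {p0..p1} \<Longrightarrow> fst x (q, p) \<le> 0" "p \<in> {p1..0} \<Longrightarrow> snd x (q, p) \<le> 0"
proof -
  note C = C2d_x[OF XD(1)[OF x] p01] and C' = C2d_x[OF XD(2)[OF x] p1]
  have PL: "PL \<gamma>1 p0 p1 (fst x) = 0" "PL \<gamma>2 p1 0 (snd x) = 0" and top: "\<And>q. (2 / lam) * (g * snd x (q, 0) - \<sigma> * dq (dq (snd x)) (q, 0)) = 0"
    using PP unfolding PP_def zero_prod_def zero_fun_def prod.inject by (auto simp: fun_eq_iff)
  note D = C2dD[OF C']
  have z0: "0 \<in> {p1..0}" using p1 by simp
  have cont: "continuous_on UNIV (\<lambda>t. snd x (t, 0))"
    by (rule hb_imp_continuous_on[OF hb_top[OF D(7)] \<alpha>(1)]) (use p1 in simp)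
  obtain q0 where q0: "\<And>q. snd x (q, 0) \<le> snd x (q0, 0)" using periodic_max[OF cont] C2_alpha_per(1)[OF XD(2)[OF x]] by metis
  have "dq (snd x) (q0, 0) = 0"
    by (rule interior_max[where f = "\<lambda>t. snd x (t, 0)" and a = "q0 - 1" and b = "q0 + 1" and x = q0, OF has_vector_derivative_at_within[OF D(1)[OF z0]]]) (use q0 in auto)
  hence "dq (dq (snd x)) (q0, 0) \<le> 0"
    by (intro one_sided_max[where f = "\<lambda>t. snd x (t, 0)" and f' = "\<lambda>t. dq (snd x) (t, 0)" and a = "q0 - 1" and b = "q0 + 1" and p = q0])
      (use q0 has_vector_derivative_at_within[OF D(1)[OF z0]] has_vector_derivative_at_within[OF D(3)[OF z0]] in auto)
  moreover have "g * snd x (q0, 0) = \<sigma> * dq (dq (snd x)) (q0, 0)" using top[of q0] lam_pos by simp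
  ultimately have "g * snd x (q0, 0) \<le> 0" using \<sigma> by (simp add: mult_le_0_iff)
  hence "snd x (q0, 0) \<le> 0" using g by (simp add: mult_le_0_iff)
  hence t0: "snd x (q, 0) \<le> 0" for q using q0[of q] by linarith
  obtain A where A: "\<And>z. z \<in> strip p0 0 \<Longrightarrow> \<bar>1 / a (snd z)\<bar> \<le> A" using hb_ia[OF \<alpha>(1) \<alpha>1] unfolding hb_iff by blast
  \<comment> \<open>The + 1 makes \<open>m\<close> strictly larger than the first-order
    coefficients, as the maximum principle demands.\<close>
  define m where "m = (\<bar>\<gamma>1\<bar> + \<bar>\<gamma>2\<bar>) * A\<^sup>2 + 1"
  have \<beta>: "\<bar>\<gamma>1 * (1 / a p)\<^sup>2\<bar> < m \<and> \<bar>\<gamma>2 * (1 / a p)\<^sup>2\<bar> < m" if "p \<in> {p0..0}" for p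
  proof -
    have "\<bar>1 / a p\<bar>\<^sup>2 \<le> A\<^sup>2" using A[of "(0, p)"] that by (intro power_mono) (auto simp: mem_strip)
    hence k: "(1 / a p)\<^sup>2 \<le> A\<^sup>2" by (simp only: power2_abs)
    have "\<bar>\<gamma>\<bar> * (1 / a p)\<^sup>2 \<le> (\<bar>\<gamma>1\<bar> + \<bar>\<gamma>2\<bar>) * A\<^sup>2" if "\<gamma> = \<gamma>1 \<or> \<gamma> = \<gamma>2" for \<gamma>
      by (intro mult_mono k) (use that in auto)
    from this[of \<gamma>1] this[of \<gamma>2] show ?thesis unfolding m_def abs_mult abs_power2 by linarith
  qed
  have e1: "dp p0 p1 (dp p0 p1 (fst x)) (q, p) + (1 / a p)\<^sup>2 * dq (dq (fst x)) (q, p) - \<gamma>1 * (1 / a p)\<^sup>2 * dp p0 p1 (fst x) (q, p) = 0"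
    if "p \<in> {p0..p1}" for q p using fun_cong[OF PL(1), of "(q, p)"] that by (simp add: PL_def mult.commute mult.left_commute)
  have e2: "dp p1 0 (dp p1 0 (snd x)) (q, p) + (1 / a p)\<^sup>2 * dq (dq (snd x)) (q, p) - \<gamma>2 * (1 / a p)\<^sup>2 * dp p1 0 (snd x) (q, p) = 0"
    if "p \<in> {p1..0}" for q p using fun_cong[OF PL(2), of "(q, p)"] that by (simp add: PL_def mult.commute mult.left_commute)
  have lb: "fst x (q, p0) \<le> 0" for q using XD(5)[OF x, of q] by simp
  note M = transmission_max_principle[where \<kappa> = "\<lambda>p. (1 / a p)\<^sup>2" and \<beta> = "\<lambda>p. \<gamma>1 * (1 / a p)\<^sup>2" and \<beta>' = "\<lambda>p. \<gamma>2 * (1 / a p)\<^sup>2" and \<mu> = m,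
      OF C C' p01 p1 \<alpha>(1) C2_alpha_per(1)[OF XD(1)[OF x]] C2_alpha_per(1)[OF XD(2)[OF x]] XD(3)[OF x] XD(4)[OF x] lb t0 e1 e2 zero_le_power2 \<beta>]
  show "p \<in> {p0..p1} \<Longrightarrow> fst x (q, p) \<le> 0" "p \<in> {p1..0} \<Longrightarrow> snd x (q, p) \<le> 0"
    using M(1)[of p q] M(2)[of p q] by blast+
qed

lemma PP_inj:
  assumes x: "x \<in> X" and PP: "PP x = 0" shows "x = 0"
proof -
  have mx: "- x \<in> X" using subspace_neg[OF X_subspace x] .
  have "PP (- x) = 0" using linear_on'D(5)[OF PP_lin x x] PP by simp
  note M = PP_max[OF mx this] PP_max[OF x PP]
  have 1: "fst x (q, p) = 0" for q p
    using M(1)[of p q] M(3)[of p q] C2_alpha_per(2)[OF XD(1)[OF x], of p q] by (cases "p \<in> {p0..p1}") (auto simp: uminus_prod_def)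
  have 2: "snd x (q, p) = 0" for q p
    using M(2)[of p q] M(4)[of p q] C2_alpha_per(2)[OF XD(2)[OF x], of p q] by (cases "p \<in> {p1..0}") (auto simp: uminus_prod_def)
  show ?thesis using 1 2 by (intro prod_eqI) (auto simp: fun_eq_iff)
qed

lemma UR_PP:
  assumes x: "x \<in> X" shows "UR (PP x) = x" "DR (PP x) = Dx x"
proof -
  note U = UR[OF PP_in[OF x]]
  have "PP (UR (PP x) - x) = 0" using linear_on'D(2)[OF PP_lin U(1) x] U(2) by simp
  from PP_inj[OF subspace_diff[OF X_subspace U(1) x] this] show "UR (PP x) = x" by simp
  thus "DR (PP x) = Dx x" using U(3) by simp
qed

end

text \<open>Induction on the spanning set. Were the coefficients of the new vector unbounded,
  division by them would exhibit that vector as a pointwise limit from the old span. So they are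
  bounded, and a subsequence of them converges.\<close>

lemma span_pointwise_closed:
  fixes f :: "nat \<Rightarrow> 'a \<Rightarrow> real"
  assumes "finite S" "\<And>n. f n \<in> span S" "\<And>z. (\<lambda>n. f n z) \<longlonglongrightarrow> h z"
  shows "h \<in> span S"
  using assms
proof (induction S arbitrary: f h rule: finite_induct)
  case empty
  have "f n z = 0" for n z using empty(1)[of n] by simp
  hence "(\<lambda>n. 0) \<longlonglongrightarrow> h z" for z using empty(2)[of z] by simp
  hence "h z = 0" for z by (metis LIMSEQ_unique tendsto_const)
  hence "h = 0" by (simp add: fun_eq_iff)
  thus ?case by (simp only: span_zero)
next
  case (insert s S)
  show ?case
  proof (cases "s \<in> span S")
    case True
    hence "span (insert s S) = span S" by (rule span_redundant)
    thus ?thesis using insert.IH[OF _ insert.prems(2)] insert.prems(1) by simp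
  next
    case False
    have "\<exists>c. f n - c *\<^sub>R s \<in> span S" for n using insert.prems(1)[of n] unfolding span_insert by blast
    then obtain c where c: "\<And>n. f n - c n *\<^sub>R s \<in> span S" by metis
    have "\<exists>b. \<forall>n. \<bar>c n\<bar> \<le> b"
    proof (rule ccontr)
      assume "\<nexists>b. \<forall>n. \<bar>c n\<bar> \<le> b"
      hence "\<forall>k::nat. \<exists>n. \<bar>c n\<bar> > real k + 1" by (meson not_le)
      then obtain r where r: "\<And>k::nat. \<bar>c (r k)\<bar> > real k + 1" by metis
      have nz: "c (r k) \<noteq> 0" for k using r[of k] by auto
      have "s \<in> span S"
      proof (rule insert.IH[of "\<lambda>k. (- 1 / c (r k)) *\<^sub>R (f (r k) - c (r k) *\<^sub>R s)"])
        show "(- 1 / c (r k)) *\<^sub>R (f (r k) - c (r k) *\<^sub>R s) \<in> span S" for k by (intro span_scale c)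
        fix z
        have "bounded (range (\<lambda>n. f n z))" using insert.prems(2)[of z] by (rule convergent_imp_bounded)
        then obtain b where b: "\<And>n. \<bar>f n z\<bar> \<le> b" unfolding bounded_iff by auto
        have "(\<lambda>k. f (r k) z / c (r k)) \<longlonglongrightarrow> 0"
        proof (rule Lim_null_comparison)
          show "\<forall>\<^sub>F k in sequentially. norm (f (r k) z / c (r k)) \<le> b * (1 / (real k + 1))"
          proof (intro always_eventually allI)
            fix k
            have "\<bar>f (r k) z\<bar> * (1 / \<bar>c (r k)\<bar>) \<le> b * (1 / (real k + 1))"
              using b[of "r k"] r[of k] by (intro mult_mono divide_left_mono mult_pos_pos) auto
            thus "norm (f (r k) z / c (r k)) \<le> b * (1 / (real k + 1))" by (simp add: abs_divide)
          qed
          show "(\<lambda>k. b * (1 / (real k + 1))) \<longlonglongrightarrow> 0"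
            using tendsto_mult_right_zero[OF LIMSEQ_inverse_real_of_nat, of b] by (simp add: inverse_eq_divide add.commute)
        qed
        hence "(\<lambda>k. s z - f (r k) z / c (r k)) \<longlonglongrightarrow> s z - 0" by (intro tendsto_intros)
        moreover have "((- 1 / c (r k)) *\<^sub>R (f (r k) - c (r k) *\<^sub>R s)) z = s z - f (r k) z / c (r k)" for k
          using nz[of k] by (simp add: scaleR_fun_def field_simps)
        ultimately show "(\<lambda>k. ((- 1 / c (r k)) *\<^sub>R (f (r k) - c (r k) *\<^sub>R s)) z) \<longlonglongrightarrow> s z" by simp
      qed
      thus False using False by contradiction
    qed
    hence "bounded (range c)" unfolding bounded_iff by auto
    then obtain l r where r: "strict_mono r" "(c \<circ> r) \<longlonglongrightarrow> l" using bounded_imp_convergent_subsequence by blast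
    have "h - l *\<^sub>R s \<in> span S"
    proof (rule insert.IH[of "\<lambda>k. f (r k) - c (r k) *\<^sub>R s"])
      show "f (r k) - c (r k) *\<^sub>R s \<in> span S" for k by (rule c)
      fix z
      have "(\<lambda>k. f (r k) z) \<longlonglongrightarrow> h z" using LIMSEQ_subseq_LIMSEQ[OF insert.prems(2)[of z] r(1)] by (simp add: o_def)
      moreover have "(\<lambda>k. c (r k)) \<longlonglongrightarrow> l" using r(2) by (simp add: o_def)
      ultimately show "(\<lambda>k. (f (r k) - c (r k) *\<^sub>R s) z) \<longlonglongrightarrow> (h - l *\<^sub>R s) z"
        by (auto simp: scaleR_fun_def intro!: tendsto_intros)
    qed
    thus ?thesis unfolding span_insert by blast
  qed
qed

section \<open>Inversion up to finite rank\<close>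

lemma xcomb_eq: "xcomb n c ks = (\<Sum>i<n. c i *\<^sub>R ks i)"
proof (induction n)
  case (Suc n)
  have "xcomb (Suc n) c ks = xcomb n c ks + c n *\<^sub>R ks n" by (simp add: xcomb_def prod_eq_iff fun_eq_iff scaleR_fun_def)
  thus ?case using Suc by simp
qed (simp add: xcomb_def zero_prod_def zero_fun_def)

lemma yzcomb_eq: "yzcomb n c ks = (\<Sum>i<n. c i *\<^sub>R ks i)"
proof (induction n)
  case (Suc n)
  have "yzcomb (Suc n) c ks = yzcomb n c ks + c n *\<^sub>R ks n" by (simp add: yzcomb_def prod_eq_iff fun_eq_iff scaleR_fun_def)
  thus ?case using Suc by simp
qed (simp add: yzcomb_def zero_prod_def zero_fun_def)

lemma yz_ops: "yzadd y y' = y + y'" "yzdiff y y' = y - y'" "yzzero = 0"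
  by (auto simp: yzadd_def yzdiff_def yzzero_def prod_eq_iff fun_eq_iff)

text \<open>The hypothesis \<open>small\<close> makes \<open>E \<circ> E\<close> halve sup norms:
  each \<open>E\<close> costs a factor \<open>CD * CK\<close>, the first \<open>w - PI w\<close> a
  factor 2, and interpolating the Hoelder function \<open>E w\<close> gains
  \<open>\<delta> powr \<alpha>\<close>.\<close>

locale flow_interpolation = flow +
  fixes m :: nat and zj :: "nat \<Rightarrow> real \<times> real" and \<theta> :: "nat \<Rightarrow> real \<times> real \<Rightarrow> real" and \<delta> CD CK :: real
  assumes \<theta>: "\<And>j. j < m \<Longrightarrow> \<theta> j \<in> cylC p0 0" "\<And>j. j < m \<Longrightarrow> hb (strip p0 0) \<alpha> (\<theta> j)"
      "\<And>j z. j < m \<Longrightarrow> 0 \<le> \<theta> j z" "\<And>z. (\<Sum>j<m. \<theta> j z) = 1" "\<And>j. j < m \<Longrightarrow> snd (zj j) \<in> {p0..0}"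
      "\<And>j q p. j < m \<Longrightarrow> p \<in> {p0..0} \<Longrightarrow> \<theta> j (q, p) \<noteq> 0 \<Longrightarrow> \<exists>n::int. \<bar>q + of_int n * (2 * pi) - fst (zj j)\<bar> + \<bar>p - snd (zj j)\<bar> \<le> \<delta>"
    and CD: "CD \<ge> 0" "\<And>y N z. Y0 y N \<Longrightarrow> \<bar>DR y z\<bar> \<le> CD * N"
      "\<And>y N z w. Y0 y N \<Longrightarrow> \<bar>DR y z - DR y w\<bar> \<le> CD * N * dist z w powr \<alpha>"
    and CK: "CK \<ge> 0" "\<And>w N. w \<in> cylC p0 0 \<Longrightarrow> (\<And>z. \<bar>w z\<bar> \<le> N) \<Longrightarrow> Y0 (Kop w) (CK * N)"
    and small: "\<delta> > 0" "(CD * CK)\<^sup>2 * \<delta> powr \<alpha> \<le> 1 / 4"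
begin

definition PI :: "(real \<times> real \<Rightarrow> real) \<Rightarrow> real \<times> real \<Rightarrow> real" where
  "PI w = (\<Sum>j<m. w (zj j) *\<^sub>R \<theta> j)"

lemma PI_apply: "PI w z = (\<Sum>j<m. w (zj j) * \<theta> j z)"
proof -
  have "(\<Sum>j<k. w (zj j) *\<^sub>R \<theta> j) z = (\<Sum>j<k. w (zj j) * \<theta> j z)" for k by (induction k) (auto simp: scaleR_fun_def)
  thus ?thesis by (simp add: PI_def)
qed

abbreviation Th where "Th \<equiv> span (\<theta> ` {..<m})"

lemma PI_in: "PI w \<in> Th"
  unfolding PI_def by (intro span_sum span_scale span_base) auto

lemma PI_lin: "PI (c *\<^sub>R w + d *\<^sub>R w') = c *\<^sub>R PI w + d *\<^sub>R PI w'"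
  by (simp add: PI_apply fun_eq_iff scaleR_fun_def sum.distrib sum_distrib_left algebra_simps)

definition CH where "CH = {w \<in> cylC p0 0. hb (strip p0 0) \<alpha> w}"

lemma CH_subspace: "subspace CH"
proof (rule subspaceI)
  note s = cylC_subspace[of p0 0]
  show "0 \<in> CH" using subspace_0[OF s] hb_const[of "strip p0 0" \<alpha> 0] by (simp add: CH_def zero_fun_def)
  show "x + y \<in> CH" if "x \<in> CH" "y \<in> CH" for x y
    using that subspace_add[OF s] hb_add[of "strip p0 0" \<alpha> x y] by (simp add: CH_def plus_fun_def)
  show "c *\<^sub>R x \<in> CH" if "x \<in> CH" for c x
    using that subspace_scale[OF s] hb_cmult[of "strip p0 0" \<alpha> x c] by (simp add: CH_def scaleR_fun_def)
qed

lemma Th_CH: "Th \<subseteq> CH"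
  by (rule span_minimal[OF _ CH_subspace]) (use \<theta> in \<open>auto simp: CH_def\<close>)

lemma cyl_PI: "w \<in> cylC p0 0 \<Longrightarrow> w - PI w \<in> cylC p0 0"
  by (rule subspace_diff[OF cylC_subspace]) (use PI_in Th_CH in \<open>auto simp: CH_def\<close>)

lemma PI_bound: assumes "\<And>z. \<bar>w z\<bar> \<le> N" shows "\<bar>PI w z\<bar> \<le> N"
proof -
  have "\<bar>PI w z\<bar> \<le> (\<Sum>j<m. \<bar>w (zj j) * \<theta> j z\<bar>)" unfolding PI_apply by (rule sum_abs)
  also have "\<dots> \<le> (\<Sum>j<m. N * \<theta> j z)" using assms \<theta>(3) by (intro sum_mono) (simp add: abs_mult mult_right_mono del: split_paired_All split_paired_all)
  also have "\<dots> = N" unfolding sum_distrib_left[symmetric] \<theta>(4) by simp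
  finally show ?thesis .
qed

lemma PI_bound': assumes "\<And>z. \<bar>w z\<bar> \<le> N" shows "\<bar>(w - PI w) z\<bar> \<le> 2 * N"
  using assms[of z] PI_bound[of w N z, OF assms] by simp

text \<open>Where \<open>\<theta> j\<close> is nonzero, a translate of the point by whole periods
  lies within \<delta> of the node \<open>zj j\<close>; the weights are nonnegative and sum to
  1.\<close>

lemma PI_approx:
  assumes v: "v \<in> cylC p0 0" and H: "\<And>z w. \<bar>v z - v w\<bar> \<le> H * dist z w powr \<alpha>" "H \<ge> 0"
  shows "\<bar>(v - PI v) z\<bar> \<le> H * \<delta> powr \<alpha>"
proof -
  have main: "\<bar>v (q, p) - PI v (q, p)\<bar> \<le> H * \<delta> powr \<alpha>" if p: "p \<in> {p0..0}" for q p
  proof -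
    have "v (q, p) - PI v (q, p) = (\<Sum>j<m. (v (q, p) - v (zj j)) * \<theta> j (q, p))"
      unfolding PI_apply left_diff_distrib sum_subtractf sum_distrib_left[symmetric] \<theta>(4) by simp
    also have "\<bar>\<dots>\<bar> \<le> (\<Sum>j<m. \<bar>(v (q, p) - v (zj j)) * \<theta> j (q, p)\<bar>)" by (rule sum_abs)
    also have "\<dots> \<le> (\<Sum>j<m. H * \<delta> powr \<alpha> * \<theta> j (q, p))"
    proof (rule sum_mono)
      fix j assume "j \<in> {..<m}"
      hence j: "j < m" by simp
      show "\<bar>(v (q, p) - v (zj j)) * \<theta> j (q, p)\<bar> \<le> H * \<delta> powr \<alpha> * \<theta> j (q, p)"
      proof (cases "\<theta> j (q, p) = 0")
        case False
        obtain n :: int where n: "\<bar>q + of_int n * (2 * pi) - fst (zj j)\<bar> + \<bar>p - snd (zj j)\<bar> \<le> \<delta>"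
          using \<theta>(6)[OF j p False] by blast
        have "v (q + of_int n * (2 * pi), p) = v (q, p)" by (rule per_int[of "\<lambda>q. v (q, p)"]) (rule cylCD(2)[OF v])
        hence "\<bar>v (q, p) - v (zj j)\<bar> \<le> H * dist (q + of_int n * (2 * pi), p) (zj j) powr \<alpha>" using H(1)[of "(q + of_int n * (2 * pi), p)" "zj j"] by simp
        also have "dist (q + of_int n * (2 * pi), p) (zj j) \<le> \<delta>"
          using n sqrt_sum_squares_le_sum_abs[of "q + of_int n * (2 * pi) - fst (zj j)" "p - snd (zj j)"]
          by (cases "zj j") (simp add: dist_Pair_Pair dist_real_def)
        hence "H * dist (q + of_int n * (2 * pi), p) (zj j) powr \<alpha> \<le> H * \<delta> powr \<alpha>"
          using H(2) \<alpha> by (intro mult_left_mono powr_mono2) auto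
        finally show ?thesis using \<theta>(3)[OF j, of "(q, p)"] by (simp add: abs_mult mult_right_mono)
      qed simp
    qed
    also have "\<dots> = H * \<delta> powr \<alpha>" unfolding sum_distrib_left[symmetric] \<theta>(4) by simp
    finally show ?thesis .
  qed
  have "(v - PI v) (fst z, snd z) = (v - PI v) (fst z, max p0 (min (snd z) 0))"
    by (rule cylCD(3)[OF cyl_PI[OF v], symmetric])
  thus ?thesis using main[OF clamp_in(1), of "fst z" "snd z"] by simp
qed

text \<open>For the modified operator \<open>LT\<close> minus \<open>Kop (PI (Dx x))\<close> the
  equation reads \<open>PP x = y - Kop (w - PI w)\<close> with \<open>w = Dx x\<close>. Applying
  \<open>DR\<close> yields \<open>w + E w = DR y\<close>, an equation for w alone.\<close>

definition E where "E w = DR (Kop (w - PI w))"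

lemma E_Y0: assumes "w \<in> cylC p0 0" "\<And>z. \<bar>w z\<bar> \<le> N" shows "Y0 (Kop (w - PI w)) (CK * (2 * N))"
  by (rule CK(2)[OF cyl_PI[OF assms(1)] PI_bound'[OF assms(2)]])

lemma lohi: "p0 \<le> 0" using p01 p1 by simp

lemma E_Y0': assumes "w \<in> cylC p0 0" obtains N where "Y0 (Kop (w - PI w)) N"
  using E_Y0[OF assms] cylC_bounded[OF assms lohi] by metis

lemma E_in: "w \<in> cylC p0 0 \<Longrightarrow> E w \<in> cylC p0 0" "w \<in> cylC p0 0 \<Longrightarrow> E w \<in> CH"
proof -
  assume w: "w \<in> cylC p0 0"
  obtain N where N: "Y0 (Kop (w - PI w)) N" by (rule E_Y0'[OF w])
  show "E w \<in> cylC p0 0" "E w \<in> CH" unfolding CH_def E_def using DR_cylC[OF N] DR_hb[OF N] by auto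
qed

lemma E_lin: "linear_on' (cylC p0 0) E"
  unfolding linear_on'_def
proof (intro ballI allI)
  fix w w' c d assume w: "w \<in> cylC p0 0" "w' \<in> cylC p0 0"
  obtain N where N: "Y0 (Kop (w - PI w)) N" by (rule E_Y0'[OF w(1)])
  obtain N' where N': "Y0 (Kop (w' - PI w')) N'" by (rule E_Y0'[OF w(2)])
  have "(c *\<^sub>R w + d *\<^sub>R w') - PI (c *\<^sub>R w + d *\<^sub>R w') = c *\<^sub>R (w - PI w) + d *\<^sub>R (w' - PI w')"
    unfolding PI_lin by (simp add: algebra_simps)
  thus "E (c *\<^sub>R w + d *\<^sub>R w') = c *\<^sub>R E w + d *\<^sub>R E w'" unfolding E_def using Kop_lin DR_lin[OF N N'] by simp
qed

lemma E_bound: "w \<in> cylC p0 0 \<Longrightarrow> (\<And>z. \<bar>w z\<bar> \<le> N) \<Longrightarrow> \<bar>E w z\<bar> \<le> 2 * (CD * CK) * N"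
  using CD(2)[OF E_Y0, of w N z] by (simp add: E_def mult_ac)

text \<open>\<open>DR\<close> makes \<open>E w\<close> Hoelder with constant \<open>H\<close>, so
  its interpolation error is at most \<open>H * \<delta> powr \<alpha>\<close>; the second
  \<open>DR \<circ> Kop\<close> multiplies this by \<open>CD * CK\<close>.\<close>

lemma E_half:
  assumes w: "w \<in> cylC p0 0" and N: "\<And>z. \<bar>w z\<bar> \<le> N" shows "\<bar>E (E w) z\<bar> \<le> N / 2"
proof -
  have N0: "N \<ge> 0" using N[of undefined] by linarith
  define H where "H = CD * (CK * (2 * N))"
  have H: "H \<ge> 0" using CD(1) CK(1) N0 by (simp add: H_def)
  have "\<bar>(E w - PI (E w)) z\<bar> \<le> H * \<delta> powr \<alpha>" for z
    by (rule PI_approx[OF E_in(1)[OF w] _ H]) (use CD(3)[OF E_Y0[OF w N]] in \<open>simp add: E_def H_def\<close>)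
  from CD(2)[OF CK(2)[OF cyl_PI[OF E_in(1)[OF w]] this], of z]
  have "\<bar>E (E w) z\<bar> \<le> CD * (CK * (H * \<delta> powr \<alpha>))" unfolding E_def[of "E w"] .
  also have "\<dots> = 2 * N * ((CD * CK)\<^sup>2 * \<delta> powr \<alpha>)" by (simp add: H_def power2_eq_square mult_ac)
  also have "\<dots> \<le> 2 * N * (1 / 4)" using small(2) N0 by (intro mult_left_mono) auto
  finally show ?thesis by simp
qed

text \<open>With r = w + E w one has \<open>w = r - E r + E (E w)\<close>. Passing to the supremum,
  the last term is at most half of it and is absorbed on the left.\<close>

lemma sol_bound:
  assumes w: "w \<in> cylC p0 0" and r: "w + E w \<in> cylC p0 0" "\<And>z. \<bar>(w + E w) z\<bar> \<le> R"
  shows "\<bar>w z\<bar> \<le> 2 * (1 + 2 * (CD * CK)) * R"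
proof -
  obtain N where N: "\<And>z. \<bar>w z\<bar> \<le> N" using cylC_bounded[OF w lohi] by blast
  define M where "M = (SUP z. \<bar>w z\<bar>)"
  have bdd: "bdd_above (range (\<lambda>z. \<bar>w z\<bar>))" using N by (intro bdd_aboveI2[where M = N]) auto
  have M: "\<bar>w z\<bar> \<le> M" for z unfolding M_def by (rule cSUP_upper[OF UNIV_I bdd])
  have e: "w = (w + E w) - E (w + E w) + E (E w)"
    using linear_on'D(1)[OF E_lin w E_in(1)[OF w]] by simp
  have "\<bar>w z\<bar> \<le> R + 2 * (CD * CK) * R + M / 2" for z
  proof -
    have "w z = (w + E w) z - E (w + E w) z + E (E w) z" by (subst e) (simp only: plus_fun_apply fun_diff_def)
    thus ?thesis using r(2)[of z] E_bound[OF r, of z] E_half[OF w M, of z] by linarith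
  qed
  hence "M \<le> R + 2 * (CD * CK) * R + M / 2" unfolding M_def by (intro cSUP_least) auto
  hence "M \<le> 2 * (1 + 2 * (CD * CK)) * R" by (simp add: algebra_simps)
  thus ?thesis using M[of z] by linarith
qed

definition sol where "sol y = (THE w. w \<in> cylC p0 0 \<and> w + E w = DR y)"

lemma sol_ex1: "y \<in> YZ \<Longrightarrow> \<exists>!w. w \<in> cylC p0 0 \<and> w + E w = DR y"
  by (rule cylC_neumann[OF lohi E_lin E_in(1) E_half DR_cylC[OF YZ_Y0]])

lemma sol:
  assumes y: "y \<in> YZ"
  shows "sol y \<in> CH" "sol y + E (sol y) = DR y" "\<bar>sol y z\<bar> \<le> 2 * (1 + 2 * (CD * CK)) * (CD * YZnorm \<alpha> p0 p1 y)"
    "w \<in> cylC p0 0 \<Longrightarrow> w + E w = DR y \<Longrightarrow> sol y = w"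
proof -
  note Y = YZ_Y0[OF y]
  have s: "sol y \<in> cylC p0 0 \<and> sol y + E (sol y) = DR y" unfolding sol_def by (rule theI'[OF sol_ex1[OF y]])
  show "sol y + E (sol y) = DR y" using s by blast
  have "sol y = DR y - E (sol y)" using s by (simp add: eq_diff_eq)
  moreover have "DR y - E (sol y) \<in> CH"
    using subspace_diff[OF CH_subspace _ E_in(2)] DR_cylC[OF Y] DR_hb[OF Y] s by (simp add: CH_def)
  ultimately show "sol y \<in> CH" by simp
  show "\<bar>sol y z\<bar> \<le> 2 * (1 + 2 * (CD * CK)) * (CD * YZnorm \<alpha> p0 p1 y)"
    by (rule sol_bound) (use s DR_cylC[OF Y] CD(2)[OF Y] in auto)
  show "w \<in> cylC p0 0 \<Longrightarrow> w + E w = DR y \<Longrightarrow> sol y = w" using sol_ex1[OF y] s by blast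
qed

text \<open>The inverse of the modified operator: once the p-derivative \<open>sol y\<close> is
  known, only \<open>PP\<close> remains to be inverted.\<close>

definition G where "G y = UR (y - Kop (sol y - PI (sol y)))"

lemma Kop_PI: "w \<in> CH \<Longrightarrow> Kop (w - PI w) \<in> YZ"
proof -
  assume "w \<in> CH"
  hence "w - PI w \<in> CH" using subspace_diff[OF CH_subspace] PI_in Th_CH by blast
  thus ?thesis using Kop_in by (simp add: CH_def)
qed

lemma G_facts:
  assumes y: "y \<in> YZ" shows "G y \<in> X" "Dx (G y) = sol y" "PP (G y) = y - Kop (sol y - PI (sol y))"
proof -
  have K: "Kop (sol y - PI (sol y)) \<in> YZ" by (rule Kop_PI[OF sol(1)[OF y]])
  note U = UR[OF subspace_diff[OF YZ_subspace y K], folded G_def]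
  show "G y \<in> X" "PP (G y) = y - Kop (sol y - PI (sol y))" by (rule U)+
  have "DR (y - Kop (sol y - PI (sol y))) = DR y - E (sol y)"
    using DR_lin[OF YZ_Y0[OF y] YZ_Y0[OF K], of 1 "-1"] by (simp add: E_def)
  also have "\<dots> = sol y" using sol(2)[OF y] by (simp add: algebra_simps)
  finally show "Dx (G y) = sol y" using U(3) by simp
qed

lemma Kop_linear_on: "linear_on' S Kop" by (simp add: linear_on'_def Kop_lin)

lemma LT_lin: "linear_on' X LT"
  unfolding linear_on'_def
proof (intro ballI allI)
  fix x x' c d assume x: "x \<in> X" "x' \<in> X"
  have "PP (c *\<^sub>R x + d *\<^sub>R x') = c *\<^sub>R PP x + d *\<^sub>R PP x'" "Dx (c *\<^sub>R x + d *\<^sub>R x') = c *\<^sub>R Dx x + d *\<^sub>R Dx x'"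
    using PP_lin Dx_lin x unfolding linear_on'_def by blast+
  thus "LT (c *\<^sub>R x + d *\<^sub>R x') = c *\<^sub>R LT x + d *\<^sub>R LT x'"
    unfolding LT_eq[OF X_lincomb[OF x]] LT_eq[OF x(1)] LT_eq[OF x(2)] by (simp add: Kop_lin algebra_simps)
qed

lemma LT_in: "x \<in> X \<Longrightarrow> LT x \<in> YZ"
  unfolding LT_eq by (intro subspace_add[OF YZ_subspace] PP_in Kop_in Dx_cylC Dx_hb)

lemma B_eq:
  assumes x: "x \<in> X" shows "LT x - Kop (PI (Dx x)) = PP x + Kop (Dx x - PI (Dx x))"
  using linear_on'D(2)[OF Kop_linear_on[of UNIV], of "Dx x" "PI (Dx x)"] by (simp add: LT_eq[OF x])

lemma GB: assumes x: "x \<in> X" shows "G (LT x - Kop (PI (Dx x))) = x"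
proof -
  define y where "y = PP x + Kop (Dx x - PI (Dx x))"
  have w: "Dx x \<in> CH" "Dx x \<in> cylC p0 0" using Dx_cylC[OF x] Dx_hb[OF x] by (auto simp: CH_def)
  note K = Kop_PI[OF w(1)]
  have y: "y \<in> YZ" unfolding y_def by (rule subspace_add[OF YZ_subspace PP_in[OF x] K])
  have "DR y = DR (PP x) + E (Dx x)"
    using DR_lin[OF YZ_Y0[OF PP_in[OF x]] YZ_Y0[OF K], of 1 1] by (simp add: E_def y_def)
  hence "Dx x + E (Dx x) = DR y" using UR_PP(2)[OF x] by simp
  from sol(4)[OF y w(2) this] have "G y = UR (PP x)" by (simp add: G_def y_def)
  thus ?thesis unfolding B_eq[OF x] y_def[symmetric] using UR_PP(1)[OF x] by simp
qed

lemma BG: assumes y: "y \<in> YZ" shows "LT (G y) - Kop (PI (Dx (G y))) = y"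
  using B_eq[OF G_facts(1)[OF y]] unfolding G_facts(2,3)[OF y] by simp

text \<open>\<open>sol\<close> is given by a description, so linearity is obtained indirectly:
  \<open>G\<close> inverts a linear map.\<close>

lemma G_lin: "linear_on' YZ G"
  unfolding linear_on'_def
proof (intro ballI allI)
  fix y y' c d assume y: "y \<in> YZ" "y' \<in> YZ"
  note x = G_facts(1)[OF y(1)] G_facts(1)[OF y(2)]
  have "Dx (c *\<^sub>R G y + d *\<^sub>R G y') = c *\<^sub>R Dx (G y) + d *\<^sub>R Dx (G y')" "LT (c *\<^sub>R G y + d *\<^sub>R G y') = c *\<^sub>R LT (G y) + d *\<^sub>R LT (G y')"
    using LT_lin Dx_lin x unfolding linear_on'_def by blast+
  hence "LT (c *\<^sub>R G y + d *\<^sub>R G y') - Kop (PI (Dx (c *\<^sub>R G y + d *\<^sub>R G y')))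
      = c *\<^sub>R (LT (G y) - Kop (PI (Dx (G y)))) + d *\<^sub>R (LT (G y') - Kop (PI (Dx (G y'))))"
    by (simp add: PI_lin Kop_lin algebra_simps)
  also have "\<dots> = c *\<^sub>R y + d *\<^sub>R y'" by (simp only: BG[OF y(1)] BG[OF y(2)])
  finally show "G (c *\<^sub>R y + d *\<^sub>R y') = c *\<^sub>R G y + d *\<^sub>R G y'" using GB[OF X_lincomb[OF x], of c d] by simp
qed

sublocale fin: finite_rank_perturbation X YZ Th LT G "\<lambda>x. PI (Dx x)" Kop "\<theta> ` {..<m}"
proof
  show "subspace X" "subspace YZ" by (rule X_subspace, rule YZ_subspace)
  show "linear_on' X (\<lambda>x. PI (Dx x))" using Dx_lin by (simp add: linear_on'_def PI_lin)
  show "Kop t \<in> YZ" if "t \<in> Th" for t using Kop_in Th_CH that by (auto simp: CH_def)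
qed (use LT_lin LT_in G_lin G_facts(1) PI_in GB BG Kop_linear_on in auto)

text \<open>By \<open>range_iff\<close>, y lies in the range exactly when
  \<open>PI (Dx (G y))\<close> lies in a fixed finite-dimensional span. This function depends
  continuously on y, in the sup norm against \<open>YZnorm\<close>, and the span is closed under
  pointwise limits.\<close>

lemma LT_closed_range: "closed_range X YZ (YZnorm \<alpha> p0 p1) LT"
  unfolding closed_range_def
proof (intro allI impI, elim conjE)
  fix xs y assume xs: "\<forall>k. xs k \<in> X" and y: "y \<in> YZ" and lim: "(\<lambda>k. YZnorm \<alpha> p0 p1 (yzdiff (LT (xs k)) y)) \<longlonglongrightarrow> 0"
  have yk: "LT (xs k) \<in> YZ" for k using LT_in xs by simp
  obtain S where S: "finite S" "span S = fin.T ` Th"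
    using fin.index_bases finite_subset by metis
  define f where "f = (\<lambda>k. PI (Dx (G (LT (xs k)))))"
  have f: "f k \<in> span S" for k unfolding S(2) f_def using fin.range_iff[OF yk[of k]] xs by blast
  have "(\<lambda>k. f k z) \<longlonglongrightarrow> PI (Dx (G y)) z" for z
  proof (rule Lim_transform[OF tendsto_const])
    \<comment> \<open>The constant of the a priori bound for \<open>sol\<close>; \<open>PI\<close>
      does not increase the sup norm.\<close>
    define c where "c = 2 * (1 + 2 * (CD * CK)) * CD"
    show "(\<lambda>k. f k z - PI (Dx (G y)) z) \<longlonglongrightarrow> 0"
    proof (rule Lim_null_comparison)
      show "(\<lambda>k. c * YZnorm \<alpha> p0 p1 (yzdiff (LT (xs k)) y)) \<longlonglongrightarrow> 0" using tendsto_mult_right_zero[OF lim] by simp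
      show "\<forall>\<^sub>F k in sequentially. norm (f k z - PI (Dx (G y)) z) \<le> c * YZnorm \<alpha> p0 p1 (yzdiff (LT (xs k)) y)"
      proof (intro always_eventually allI)
        fix k
        have d: "LT (xs k) - y \<in> YZ" by (rule subspace_diff[OF YZ_subspace yk y])
        have "G (LT (xs k) - y) = G (LT (xs k)) - G y" by (rule linear_on'D(2)[OF G_lin yk y])
        hence "PI (Dx (G (LT (xs k) - y))) = f k - PI (Dx (G y))"
          using linear_on'D(2)[OF fin.\<pi>(1) G_facts(1)[OF yk] G_facts(1)[OF y], of k] by (simp add: f_def)
        moreover have "\<bar>PI (Dx (G (LT (xs k) - y))) z\<bar> \<le> c * YZnorm \<alpha> p0 p1 (LT (xs k) - y)"
          unfolding G_facts(2)[OF d] by (rule PI_bound) (use sol(3)[OF d] in \<open>simp add: c_def mult_ac\<close>)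
        ultimately show "norm (f k z - PI (Dx (G y)) z) \<le> c * YZnorm \<alpha> p0 p1 (yzdiff (LT (xs k)) y)"
          by (simp add: yz_ops)
      qed
    qed
  qed
  from span_pointwise_closed[OF S(1) f this] show "y \<in> LT ` X" using fin.range_iff[OF y] S(2) by blast
qed

lemma LT_fredholm: "fredholm_index_zero X YZ (YZnorm \<alpha> p0 p1) LT"
  unfolding fredholm_index_zero_def kernel_dim_def range_codim_def xcomb_eq yzcomb_eq yz_ops
  using LT_in LT_closed_range fin.index_zero by blast

end

lemma (in flow) LT_fredholm: "fredholm_index_zero X YZ (YZnorm \<alpha> p0 p1) LT"
proof -
  obtain CD where CD: "CD \<ge> 0" "\<And>y N z. Y0 y N \<Longrightarrow> \<bar>DR y z\<bar> \<le> CD * N"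
      "\<And>y N z w. Y0 y N \<Longrightarrow> \<bar>DR y z - DR y w\<bar> \<le> CD * N * dist z w powr \<alpha>" using DR_estimate by blast
  obtain CK where CK: "CK \<ge> 0" "\<And>w N. w \<in> cylC p0 0 \<Longrightarrow> (\<And>z. \<bar>w z\<bar> \<le> N) \<Longrightarrow> Y0 (Kop w) (CK * N)" using Kop_Y0 by blast
  \<comment> \<open>Then \<open>\<delta> powr \<alpha> = 1 / k\<close>, which gives the factor 1/4
    in \<open>small\<close>; the + 1 keeps k positive if the product vanishes.\<close>
  define k where "k = 4 * (CD * CK)\<^sup>2 + 1"
  define \<delta> where "\<delta> = k powr (- 1 / \<alpha>)"
  have k: "k > 0" by (simp add: k_def add_nonneg_pos)
  have \<delta>: "\<delta> > 0" using k by (simp add: \<delta>_def)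
  have "\<delta> powr \<alpha> = 1 / k" using \<alpha> k unfolding \<delta>_def powr_powr by (simp add: powr_minus inverse_eq_divide)
  hence small: "(CD * CK)\<^sup>2 * \<delta> powr \<alpha> \<le> 1 / 4" using k by (simp add: k_def divide_le_eq)
  have p: "p0 \<le> 0" using p01 p1 by simp
  obtain m :: nat and zj \<theta> where \<theta>: "\<And>j. j < m \<Longrightarrow> \<theta> j \<in> cylC p0 0" "\<And>j. j < m \<Longrightarrow> hb (strip p0 0) \<alpha> (\<theta> j)"
      "\<And>j z. j < m \<Longrightarrow> 0 \<le> \<theta> j z" "\<And>z. (\<Sum>j<m. \<theta> j z) = 1" "\<And>j. j < m \<Longrightarrow> snd (zj j) \<in> {p0..0}"
      "\<And>j q p. j < m \<Longrightarrow> p \<in> {p0..0} \<Longrightarrow> \<theta> j (q, p) \<noteq> 0 \<Longrightarrow> \<exists>n::int. \<bar>q + of_int n * (2 * pi) - fst (zj j)\<bar> + \<bar>p - snd (zj j)\<bar> \<le> \<delta>"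
    by (rule cyl_partition[OF p \<delta> \<alpha>(1) \<alpha>1]) (rule that, (assumption | simp only:)+)
  interpret flow_interpolation g \<sigma> p0 p1 \<gamma>1 \<gamma>2 \<alpha> lam m zj \<theta> \<delta> CD CK
    by unfold_locales (fact \<theta> CD CK \<delta> small)+
  show ?thesis by (rule LT_fredholm)
qed

theorem theorem3p3:
  fixes g \<sigma> p0 p1 \<gamma>1 \<gamma>2 \<alpha> lam :: real
  assumes "g > 0" and "\<sigma> > 0"
    and "p0 < p1" and "p1 < 0"
    and "0 < \<alpha>" and "\<alpha> < 1"
    and "\<gamma>1 \<noteq> \<gamma>2"
    and "lam > 2 * (SUP p\<in>{p0..0}. Gam \<gamma>1 \<gamma>2 p1 p)"
  shows "fredholm_index_zero (Xsp \<alpha> p0 p1) (YZsp \<alpha> p0 p1) (YZnorm \<alpha> p0 p1)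
           (LTop g \<sigma> p0 p1 \<gamma>1 \<gamma>2 lam)"
proof -
  interpret flow g \<sigma> p0 p1 \<gamma>1 \<gamma>2 \<alpha> lam using assms by unfold_locales
  show ?thesis by (rule LT_fredholm)
qed

end
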